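(* Let $A$ be a unital $C^*$-algebra, $\delta:A\to A$ a (not necessarily unital) $*$-endomorphism, $E=\delta(1)A$ the $C^*$-dynamical system Hilbert bimodule of $(A,\delta)$, and $J$ an ideal in $A$ such that $\ker\delta\cap J=\{0\}$. Then the relative Cuntz-Pimsner algebra $\mathcal O(J,E)$ and the crossed product $C^*(A,\delta,J)$ are canonically isomorphic, i.e. there is a $*$-isomorphism $\mathcal O(J,E)\to C^*(A,\delta,J)$ sending $k_A(a)$ to $a$ for every $a\in A$ and $k_E(\delta(1))^*$ to $u$.
   Context: Ideals are closed and two-sided. Dynamical system bimodule: $E=\delta(1)A$ with right action $x\cdot a=xa$, inner product $\langle x,y\rangle_A=x^*y$ and left action $a\cdot x=\phi(a)x:=\delta(a)x$; here $J(E):=\phi^{-1}(\mathcal K(E))=A$ and $\ker\phi=\ker\delta$. Covariant representation of $(A,\delta)$ in a unital $C^*$-algebra $B$: a pair $(\pi,U)$ with $\pi:A\to B$ a unital $*$-homomorphism and $U\in B$ such that $U\pi(a)U^*=\pi(\delta(a))$ for all $a\in A$ and $U^*U\in\pi(A)'$; it is associated with the ideal $\{a\in A:U^*U\pi(a)=\pi(a)\}$. Crossed product $C^*(A,\delta,J)$ (for $J\cap\ker\delta=\{0\}$): the universal $C^*$-algebra generated by a copy of $A$ (as a unital subalgebra) and a partial isometry $u$ subject to $uau^*=\delta(a)$, $u^*ua=au^*u$ for $a\in A$, and $J=\{a\in A:u^*ua=a\}$; universality means that for each covariant representation $(\pi,U)$ of $(A,\delta)$ associated with $J$ there is a $*$-homomorphism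 on $C^*(A,\delta,J)$ extending $\pi$ and sending $u$ to $U$. Relative Cuntz-Pimsner algebra: on the Fock module $\mathcal F(E)=\bigoplus_{n\ge0}E^{\otimes n}$ ($E^{\otimes0}=A$, internal tensor powers over $A$) let $\phi_\infty$ be the diagonal left action of $A$ and $T(x)$ the creation operators ($T(x)y=x\cdot y$ for $y\in A$, $T(x)y=x\otimes y$ for $y\in E^{\otimes n}$, $n\ge1$); $\mathcal T(E)$ is the $C^*$-subalgebra of $\mathcal L(\mathcal F(E))$ generated by $T(E)\cup\phi_\infty(A)$; $P_0$ is the projection onto $E^{\otimes0}=A$. For an ideal $J\subset J(E)$, $\mathcal O(J,E)=\mathcal T(E)/\mathcal J(J)$, where $\mathcal J(J)$ is the ideal of $\mathcal T(E)$ generated by $\phi_\infty(J)P_0\subset\mathcal T(E)$; $k_E=q\circ T$ and $k_A=q\circ\phi_\infty$ with $q$ the quotient map. *)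

theory Defs
  imports Complex_Main "HOL-Algebra.QuotRing"
begin

section \<open>Unital $C^*$-algebras\<close>

text \<open>
  $C^*$-algebras are carrier based, so that subalgebras and quotients are again of this form.
  The zero algebra is allowed.
\<close>

record 'a cstar_algebra = "'a ring" +
  scal :: "complex \<Rightarrow> 'a \<Rightarrow> 'a"
  star :: "'a \<Rightarrow> 'a"
  nrm :: "'a \<Rightarrow> real"

definition nrm_lim :: "('a, 'm) cstar_algebra_scheme \<Rightarrow> (nat \<Rightarrow> 'a) \<Rightarrow> 'a \<Rightarrow> bool" where
  "nrm_lim A s l \<longleftrightarrow> l \<in> carrier A \<and> (\<lambda>n. nrm A (s n \<ominus>\<^bsub>A\<^esub> l)) \<longlonglongrightarrow> 0"

locale unital_cstar_algebra = ring A for A (structure) +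
  assumes scal_closed: "a \<in> carrier A \<Longrightarrow> scal A c a \<in> carrier A"
    and scal_add_right:
      "\<lbrakk>a \<in> carrier A; b \<in> carrier A\<rbrakk> \<Longrightarrow> scal A c (a \<oplus> b) = scal A c a \<oplus> scal A c b"
    and scal_add_left: "a \<in> carrier A \<Longrightarrow> scal A (c + d) a = scal A c a \<oplus> scal A d a"
    and scal_scal: "a \<in> carrier A \<Longrightarrow> scal A c (scal A d a) = scal A (c * d) a"
    and scal_one: "a \<in> carrier A \<Longrightarrow> scal A 1 a = a"
    and scal_mult_left:
      "\<lbrakk>a \<in> carrier A; b \<in> carrier A\<rbrakk> \<Longrightarrow> scal A c a \<otimes> b = scal A c (a \<otimes> b)"
    and scal_mult_right:
      "\<lbrakk>a \<in> carrier A; b \<in> carrier A\<rbrakk> \<Longrightarrow> a \<otimes> scal A c b = scal A c (a \<otimes> b)"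
    and star_closed: "a \<in> carrier A \<Longrightarrow> star A a \<in> carrier A"
    and star_star: "a \<in> carrier A \<Longrightarrow> star A (star A a) = a"
    and star_add:
      "\<lbrakk>a \<in> carrier A; b \<in> carrier A\<rbrakk> \<Longrightarrow> star A (a \<oplus> b) = star A a \<oplus> star A b"
    and star_scal: "a \<in> carrier A \<Longrightarrow> star A (scal A c a) = scal A (cnj c) (star A a)"
    and star_mult:
      "\<lbrakk>a \<in> carrier A; b \<in> carrier A\<rbrakk> \<Longrightarrow> star A (a \<otimes> b) = star A b \<otimes> star A a"
    and nrm_nonneg: "a \<in> carrier A \<Longrightarrow> 0 \<le> nrm A a"
    and nrm_eq_zero: "a \<in> carrier A \<Longrightarrow> nrm A a = 0 \<longleftrightarrow> a = \<zero>"
    and nrm_scal: "a \<in> carrier A \<Longrightarrow> nrm A (scal A c a) = cmod c * nrm A a"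
    and nrm_add:
      "\<lbrakk>a \<in> carrier A; b \<in> carrier A\<rbrakk> \<Longrightarrow> nrm A (a \<oplus> b) \<le> nrm A a + nrm A b"
    and nrm_mult:
      "\<lbrakk>a \<in> carrier A; b \<in> carrier A\<rbrakk> \<Longrightarrow> nrm A (a \<otimes> b) \<le> nrm A a * nrm A b"
    and cstar_identity: "a \<in> carrier A \<Longrightarrow> nrm A (star A a \<otimes> a) = (nrm A a)\<^sup>2"
    and complete:
      "\<lbrakk>\<And>n. s n \<in> carrier A; \<forall>e>0. \<exists>N. \<forall>m\<ge>N. \<forall>n\<ge>N. nrm A (s m \<ominus> s n) < e\<rbrakk>
        \<Longrightarrow> \<exists>l. nrm_lim A s l"

text \<open>Homomorphisms need not be unital.\<close>

definition star_hom ::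
    "('a, 'm) cstar_algebra_scheme \<Rightarrow> ('b, 'n) cstar_algebra_scheme \<Rightarrow> ('a \<Rightarrow> 'b) \<Rightarrow> bool" where
  "star_hom A B f \<longleftrightarrow>
     f \<in> carrier A \<rightarrow> carrier B \<and>
     (\<forall>a\<in>carrier A. \<forall>b\<in>carrier A. f (a \<oplus>\<^bsub>A\<^esub> b) = f a \<oplus>\<^bsub>B\<^esub> f b) \<and>
     (\<forall>a\<in>carrier A. \<forall>b\<in>carrier A. f (a \<otimes>\<^bsub>A\<^esub> b) = f a \<otimes>\<^bsub>B\<^esub> f b) \<and>
     (\<forall>c. \<forall>a\<in>carrier A. f (scal A c a) = scal B c (f a)) \<and>
     (\<forall>a\<in>carrier A. f (star A a) = star B (f a))"

definition star_iso ::
    "('a, 'm) cstar_algebra_scheme \<Rightarrow> ('b, 'n) cstar_algebra_scheme \<Rightarrow> ('a \<Rightarrow> 'b) \<Rightarrow> bool" where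
  "star_iso A B f \<longleftrightarrow> star_hom A B f \<and> bij_betw f (carrier A) (carrier B)"

definition nrm_closed :: "('a, 'm) cstar_algebra_scheme \<Rightarrow> 'a set \<Rightarrow> bool" where
  "nrm_closed A S \<longleftrightarrow> (\<forall>s l. (\<forall>n. s n \<in> S) \<and> nrm_lim A s l \<longrightarrow> l \<in> S)"

definition closed_ideal :: "('a, 'm) cstar_algebra_scheme \<Rightarrow> 'a set \<Rightarrow> bool" where
  "closed_ideal A I \<longleftrightarrow> ideal I A \<and> nrm_closed A I"

definition closed_ideal_gen :: "('a, 'm) cstar_algebra_scheme \<Rightarrow> 'a set \<Rightarrow> 'a set" where
  "closed_ideal_gen A G = \<Inter>{I. closed_ideal A I \<and> G \<subseteq> I}"

definition cstar_subalgebra :: "('a, 'm) cstar_algebra_scheme \<Rightarrow> 'a set \<Rightarrow> bool" where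
  "cstar_subalgebra A S \<longleftrightarrow>
     S \<subseteq> carrier A \<and> \<zero>\<^bsub>A\<^esub> \<in> S \<and>
     (\<forall>a\<in>S. \<forall>b\<in>S. a \<oplus>\<^bsub>A\<^esub> b \<in> S \<and> a \<otimes>\<^bsub>A\<^esub> b \<in> S) \<and>
     (\<forall>a\<in>S. star A a \<in> S \<and> (\<forall>c. scal A c a \<in> S)) \<and>
     nrm_closed A S"

definition cstar_gen :: "('a, 'm) cstar_algebra_scheme \<Rightarrow> 'a set \<Rightarrow> 'a set" where
  "cstar_gen A G = \<Inter>{S. cstar_subalgebra A S \<and> G \<subseteq> S}"

text \<open>
  The quotient by a closed ideal: the ring \<^const>\<open>FactRing\<close> of cosets with the induced
  scalar multiplication and involution and the quotient norm.
\<close>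

definition cstar_quotient ::
    "('a, 'm) cstar_algebra_scheme \<Rightarrow> 'a set \<Rightarrow> 'a set cstar_algebra" where
  "cstar_quotient A I = ring.extend (A Quot I)
     (cstar_algebra.fields
        (\<lambda>c X. \<Union>a\<in>X. I +>\<^bsub>A\<^esub> scal A c a)
        (\<lambda>X. \<Union>a\<in>X. I +>\<^bsub>A\<^esub> star A a)
        (\<lambda>X. INF a\<in>X. nrm A a))"


section \<open>Hilbert bimodules\<close>

text \<open>
  The data (no axioms) of a Hilbert bimodule over $A$: a right Hilbert $A$-module whose inner product is
  conjugate linear in the first variable, with a left action of $A$ by adjointable operators.
  As $A$ is unital, multiplication by a scalar $c$ is the right action of $c1$ and has no field
  of its own.
\<close>

record ('a, 'x) hilbert_bimodule = "'x partial_object" +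
  hadd :: "'x \<Rightarrow> 'x \<Rightarrow> 'x"
  hzero :: "'x"
  ract :: "'x \<Rightarrow> 'a \<Rightarrow> 'x"
  lact :: "'a \<Rightarrow> 'x \<Rightarrow> 'x"
  ip :: "'x \<Rightarrow> 'x \<Rightarrow> 'a"

definition hscal ::
    "'a cstar_algebra \<Rightarrow> ('a, 'x) hilbert_bimodule \<Rightarrow> complex \<Rightarrow> 'x \<Rightarrow> 'x" where
  "hscal A X c x = ract X x (scal A c \<one>\<^bsub>A\<^esub>)"

definition hnorm :: "'a cstar_algebra \<Rightarrow> ('a, 'x) hilbert_bimodule \<Rightarrow> 'x \<Rightarrow> real" where
  "hnorm A X x = sqrt (nrm A (ip X x x))"

definition hdist :: "'a cstar_algebra \<Rightarrow> ('a, 'x) hilbert_bimodule \<Rightarrow> 'x \<Rightarrow> 'x \<Rightarrow> real" where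
  "hdist A X x y = hnorm A X (hadd X x (hscal A X (- 1) y))"

definition dyn_bimodule :: "'a cstar_algebra \<Rightarrow> ('a \<Rightarrow> 'a) \<Rightarrow> ('a, 'a) hilbert_bimodule" where
  "dyn_bimodule A \<delta> =
     \<lparr>carrier = {\<delta> \<one>\<^bsub>A\<^esub> \<otimes>\<^bsub>A\<^esub> a | a. a \<in> carrier A},
      hadd = (\<lambda>x y. x \<oplus>\<^bsub>A\<^esub> y),
      hzero = \<zero>\<^bsub>A\<^esub>,
      ract = (\<lambda>x a. x \<otimes>\<^bsub>A\<^esub> a),
      lact = (\<lambda>a x. \<delta> a \<otimes>\<^bsub>A\<^esub> x),
      ip = (\<lambda>x y. star A x \<otimes>\<^bsub>A\<^esub> y)\<rparr>"


subsection \<open>Completion of a semi-inner product bimodule\<close>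

definition hcauchy :: "'a cstar_algebra \<Rightarrow> ('a, 'p) hilbert_bimodule \<Rightarrow> (nat \<Rightarrow> 'p) set" where
  "hcauchy A P = {s. (\<forall>k. s k \<in> carrier P) \<and>
     (\<forall>e>0. \<exists>N. \<forall>m\<ge>N. \<forall>n\<ge>N. hdist A P (s m) (s n) < e)}"

definition hequiv ::
    "'a cstar_algebra \<Rightarrow> ('a, 'p) hilbert_bimodule \<Rightarrow> ((nat \<Rightarrow> 'p) \<times> (nat \<Rightarrow> 'p)) set" where
  "hequiv A P = {(s, t). s \<in> hcauchy A P \<and> t \<in> hcauchy A P \<and>
     (\<lambda>k. hdist A P (s k) (t k)) \<longlonglongrightarrow> 0}"

text \<open>
  Cauchy sequences modulo null sequences. This divides out the vectors of length zero, so that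
  the equality on the carrier of the argument plays no role.
\<close>

definition hcompletion ::
    "'a cstar_algebra \<Rightarrow> ('a, 'p) hilbert_bimodule \<Rightarrow> ('a, (nat \<Rightarrow> 'p) set) hilbert_bimodule" where
  "hcompletion A P =
     \<lparr>carrier = hcauchy A P // hequiv A P,
      hadd = (\<lambda>X Y. \<Union>s\<in>X. \<Union>t\<in>Y. hequiv A P `` {\<lambda>k. hadd P (s k) (t k)}),
      hzero = hequiv A P `` {\<lambda>k. hzero P},
      ract = (\<lambda>X a. \<Union>s\<in>X. hequiv A P `` {\<lambda>k. ract P (s k) a}),
      lact = (\<lambda>a X. \<Union>s\<in>X. hequiv A P `` {\<lambda>k. lact P a (s k)}),
      ip = (\<lambda>X Y. THE l. \<forall>s\<in>X. \<forall>t\<in>Y. nrm_lim A (\<lambda>k. ip P (s k) (t k)) l)\<rparr>"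


subsection \<open>Internal tensor powers\<close>

text \<open>
  A nonempty word $[x_1,\dots,x_n]$ over $E$ stands for the elementary tensor
  $x_1\otimes\dots\otimes x_n$. Iterating
  $\langle x\otimes\xi, y\otimes\eta\rangle = \langle \xi, \langle x,y\rangle\cdot\eta\rangle$
  gives
  $\langle x_1\otimes\dots\otimes x_n, y_1\otimes\dots\otimes y_n\rangle
    = \langle x_n, \langle x_{n-1}, \dots \langle x_1,y_1\rangle\cdot y_2 \dots\rangle
       \cdot y_n\rangle$.
\<close>

definition word_ip :: "('a, 'x) hilbert_bimodule \<Rightarrow> 'x list \<Rightarrow> 'x list \<Rightarrow> 'a" where
  "word_ip E v w =
     foldl (\<lambda>a (x, y). ip E x (lact E a y)) (ip E (hd v) (hd w)) (zip (tl v) (tl w))"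

text \<open>
  The algebraic tensor power, for \<open>n \<ge> 1\<close>: a list of words is the formal sum of its entries.
  The relations of the balanced tensor product over $A$ hold up to vectors of length zero, hence
  hold in the completion.
\<close>

definition alg_tensor_power ::
    "'a cstar_algebra \<Rightarrow> ('a, 'x) hilbert_bimodule \<Rightarrow> nat
      \<Rightarrow> ('a, 'x list list) hilbert_bimodule" where
  "alg_tensor_power A E n =
     \<lparr>carrier = {s. \<forall>w\<in>set s. length w = n \<and> set w \<subseteq> carrier E},
      hadd = (\<lambda>s t. s @ t),
      hzero = [],
      ract = (\<lambda>s a. map (\<lambda>w. butlast w @ [ract E (last w) a]) s),
      lact = (\<lambda>a s. map (\<lambda>w. lact E a (hd w) # tl w) s),
      ip = (\<lambda>s t. foldr (\<lambda>(v, w) b. word_ip E v w \<oplus>\<^bsub>A\<^esub> b) (List.product s t) \<zero>\<^bsub>A\<^esub>)\<rparr>"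

type_synonym 'x tensor = "(nat \<Rightarrow> 'x list list) set"

definition tensor_power ::
    "'a cstar_algebra \<Rightarrow> ('a, 'x) hilbert_bimodule \<Rightarrow> nat \<Rightarrow> ('a, 'x tensor) hilbert_bimodule" where
  "tensor_power A E n = hcompletion A (alg_tensor_power A E n)"

definition tensor_embed ::
    "'a cstar_algebra \<Rightarrow> ('a, 'x) hilbert_bimodule \<Rightarrow> 'x \<Rightarrow> 'x tensor" where
  "tensor_embed A E x = hequiv A (alg_tensor_power A E 1) `` {\<lambda>k. [[x]]}"

text \<open>The map $\xi\mapsto x\otimes\xi$ from $E^{\otimes n}$ to $E^{\otimes(n+1)}$.\<close>

definition tensor_cons ::
    "'a cstar_algebra \<Rightarrow> ('a, 'x) hilbert_bimodule \<Rightarrow> nat \<Rightarrow> 'x \<Rightarrow> 'x tensor \<Rightarrow> 'x tensor" where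
  "tensor_cons A E n x \<xi> =
     (\<Union>s\<in>\<xi>. hequiv A (alg_tensor_power A E (Suc n)) `` {\<lambda>k. map (\<lambda>w. x # w) (s k)})"


subsection \<open>The Fock module\<close>

text \<open>
  A Fock vector \<open>(b, \<xi>)\<close> has the component \<open>b\<close> in $E^{\otimes 0} = A$ and the component \<open>\<xi> n\<close>
  in $E^{\otimes(n+1)}$.
\<close>

type_synonym ('a, 'x) fock = "'a \<times> (nat \<Rightarrow> 'x tensor)"

definition fock_partial_ip ::
    "'a cstar_algebra \<Rightarrow> ('a, 'x) hilbert_bimodule
      \<Rightarrow> ('a, 'x) fock \<Rightarrow> ('a, 'x) fock \<Rightarrow> nat \<Rightarrow> 'a" where
  "fock_partial_ip A E v w N =
     (star A (fst v) \<otimes>\<^bsub>A\<^esub> fst w) \<oplus>\<^bsub>A\<^esub>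
     finsum A (\<lambda>n. ip (tensor_power A E (Suc n)) (snd v n) (snd w n)) {..<N}"

definition fock_module ::
    "'a cstar_algebra \<Rightarrow> ('a, 'x) hilbert_bimodule \<Rightarrow> ('a, ('a, 'x) fock) hilbert_bimodule" where
  "fock_module A E =
     \<lparr>carrier = {v. fst v \<in> carrier A \<and>
         (\<forall>n. snd v n \<in> carrier (tensor_power A E (Suc n))) \<and>
         (\<exists>l. nrm_lim A (fock_partial_ip A E v v) l)},
      hadd = (\<lambda>v w. (fst v \<oplus>\<^bsub>A\<^esub> fst w,
         \<lambda>n. hadd (tensor_power A E (Suc n)) (snd v n) (snd w n))),
      hzero = (\<zero>\<^bsub>A\<^esub>, \<lambda>n. hzero (tensor_power A E (Suc n))),
      ract = (\<lambda>v a. (fst v \<otimes>\<^bsub>A\<^esub> a, \<lambda>n. ract (tensor_power A E (Suc n)) (snd v n) a)),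
      lact = (\<lambda>a v. (a \<otimes>\<^bsub>A\<^esub> fst v, \<lambda>n. lact (tensor_power A E (Suc n)) a (snd v n))),
      ip = (\<lambda>v w. THE l. nrm_lim A (fock_partial_ip A E v w) l)\<rparr>"


subsection \<open>Adjointable operators\<close>

definition is_adjoint ::
    "('a, 'x) hilbert_bimodule \<Rightarrow> ('x \<Rightarrow> 'x) \<Rightarrow> ('x \<Rightarrow> 'x) \<Rightarrow> bool" where
  "is_adjoint X T S \<longleftrightarrow>
     T \<in> carrier X \<rightarrow>\<^sub>E carrier X \<and> S \<in> carrier X \<rightarrow>\<^sub>E carrier X \<and>
     (\<forall>x\<in>carrier X. \<forall>y\<in>carrier X. ip X (T x) y = ip X x (S y))"

definition adjointable ::
    "'a cstar_algebra \<Rightarrow> ('a, 'x) hilbert_bimodule \<Rightarrow> ('x \<Rightarrow> 'x) cstar_algebra" where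
  "adjointable A X =
     \<lparr>carrier = {T. \<exists>S. is_adjoint X T S},
      mult = compose (carrier X),
      one = (\<lambda>x\<in>carrier X. x),
      zero = (\<lambda>x\<in>carrier X. hzero X),
      add = (\<lambda>S T. \<lambda>x\<in>carrier X. hadd X (S x) (T x)),
      scal = (\<lambda>c T. \<lambda>x\<in>carrier X. hscal A X c (T x)),
      star = (\<lambda>T. THE S. is_adjoint X T S),
      nrm = (\<lambda>T. SUP x\<in>{x \<in> carrier X. hnorm A X x \<le> 1}. hnorm A X (T x))\<rparr>"


section \<open>Relative Cuntz-Pimsner algebras\<close>

type_synonym ('a, 'x) fock_op = "('a, 'x) fock \<Rightarrow> ('a, 'x) fock"

definition fock_phi ::
    "'a cstar_algebra \<Rightarrow> ('a, 'x) hilbert_bimodule \<Rightarrow> 'a \<Rightarrow> ('a, 'x) fock_op" where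
  "fock_phi A E a = (\<lambda>v\<in>carrier (fock_module A E). lact (fock_module A E) a v)"

definition fock_creation ::
    "'a cstar_algebra \<Rightarrow> ('a, 'x) hilbert_bimodule \<Rightarrow> 'x \<Rightarrow> ('a, 'x) fock_op" where
  "fock_creation A E x = (\<lambda>v\<in>carrier (fock_module A E).
     (\<zero>\<^bsub>A\<^esub>, \<lambda>n. case n of
        0 \<Rightarrow> tensor_embed A E (ract E x (fst v))
      | Suc m \<Rightarrow> tensor_cons A E (Suc m) x (snd v m)))"

definition fock_P0 ::
    "'a cstar_algebra \<Rightarrow> ('a, 'x) hilbert_bimodule \<Rightarrow> ('a, 'x) fock_op" where
  "fock_P0 A E = (\<lambda>v\<in>carrier (fock_module A E). (fst v, snd (hzero (fock_module A E))))"

text \<open>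
  The unit of the Toeplitz algebra is that of the algebra of adjointable operators. It belongs to
  the carrier whenever the left action on \<open>E\<close> is unital, as for \<^const>\<open>dyn_bimodule\<close>, where it
  is \<open>fock_phi A E \<one>\<close>.
\<close>

definition toeplitz_algebra ::
    "'a cstar_algebra \<Rightarrow> ('a, 'x) hilbert_bimodule \<Rightarrow> ('a, 'x) fock_op cstar_algebra" where
  "toeplitz_algebra A E =
     (adjointable A (fock_module A E))
       \<lparr>carrier := cstar_gen (adjointable A (fock_module A E))
          (fock_creation A E ` carrier E \<union> fock_phi A E ` carrier A)\<rparr>"

definition rel_ideal ::
    "'a cstar_algebra \<Rightarrow> 'a set \<Rightarrow> ('a, 'x) hilbert_bimodule \<Rightarrow> ('a, 'x) fock_op set" where
  "rel_ideal A J E = closed_ideal_gen (toeplitz_algebra A E)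
     {fock_phi A E a \<otimes>\<^bsub>toeplitz_algebra A E\<^esub> fock_P0 A E | a. a \<in> J}"

definition cuntz_pimsner ::
    "'a cstar_algebra \<Rightarrow> 'a set \<Rightarrow> ('a, 'x) hilbert_bimodule
      \<Rightarrow> ('a, 'x) fock_op set cstar_algebra" where
  "cuntz_pimsner A J E = cstar_quotient (toeplitz_algebra A E) (rel_ideal A J E)"

definition cp_kA ::
    "'a cstar_algebra \<Rightarrow> 'a set \<Rightarrow> ('a, 'x) hilbert_bimodule \<Rightarrow> 'a \<Rightarrow> ('a, 'x) fock_op set" where
  "cp_kA A J E a = rel_ideal A J E +>\<^bsub>toeplitz_algebra A E\<^esub> fock_phi A E a"

definition cp_kE ::
    "'a cstar_algebra \<Rightarrow> 'a set \<Rightarrow> ('a, 'x) hilbert_bimodule \<Rightarrow> 'x \<Rightarrow> ('a, 'x) fock_op set" where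
  "cp_kE A J E x = rel_ideal A J E +>\<^bsub>toeplitz_algebra A E\<^esub> fock_creation A E x"


section \<open>Crossed products by endomorphisms\<close>

definition covariant_rep ::
    "'a cstar_algebra \<Rightarrow> ('a \<Rightarrow> 'a) \<Rightarrow> 'b cstar_algebra \<Rightarrow> ('a \<Rightarrow> 'b) \<Rightarrow> 'b \<Rightarrow> bool" where
  "covariant_rep A \<delta> B \<pi> U \<longleftrightarrow>
     unital_cstar_algebra B \<and> star_hom A B \<pi> \<and> \<pi> \<one>\<^bsub>A\<^esub> = \<one>\<^bsub>B\<^esub> \<and> U \<in> carrier B \<and>
     (\<forall>a\<in>carrier A. U \<otimes>\<^bsub>B\<^esub> \<pi> a \<otimes>\<^bsub>B\<^esub> star B U = \<pi> (\<delta> a)) \<and>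
     (\<forall>a\<in>carrier A. star B U \<otimes>\<^bsub>B\<^esub> U \<otimes>\<^bsub>B\<^esub> \<pi> a = \<pi> a \<otimes>\<^bsub>B\<^esub> (star B U \<otimes>\<^bsub>B\<^esub> U))"

definition associated_ideal ::
    "'a cstar_algebra \<Rightarrow> 'b cstar_algebra \<Rightarrow> ('a \<Rightarrow> 'b) \<Rightarrow> 'b \<Rightarrow> 'a set" where
  "associated_ideal A B \<pi> U = {a \<in> carrier A. star B U \<otimes>\<^bsub>B\<^esub> U \<otimes>\<^bsub>B\<^esub> \<pi> a = \<pi> a}"

text \<open>
  \<open>(C, \<iota>, u)\<close> is the crossed product of \<open>A\<close> by \<open>\<delta>\<close> relative to \<open>J\<close>, where \<open>\<iota>\<close> is the
  inclusion of the copy of \<open>A\<close>. HOL cannot quantify over all types at once, so the universal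
  property is tested on the algebras over the type given by the first argument.
\<close>

definition crossed_product ::
    "'b itself \<Rightarrow> 'a cstar_algebra \<Rightarrow> ('a \<Rightarrow> 'a) \<Rightarrow> 'a set
      \<Rightarrow> 'c cstar_algebra \<Rightarrow> ('a \<Rightarrow> 'c) \<Rightarrow> 'c \<Rightarrow> bool" where
  "crossed_product _ A \<delta> J C \<iota> u \<longleftrightarrow>
     covariant_rep A \<delta> C \<iota> u \<and> inj_on \<iota> (carrier A) \<and>
     u \<otimes>\<^bsub>C\<^esub> star C u \<otimes>\<^bsub>C\<^esub> u = u \<and>
     associated_ideal A C \<iota> u = J \<and>
     cstar_gen C (\<iota> ` carrier A \<union> {u}) = carrier C \<and>
     (\<forall>(B :: 'b cstar_algebra) \<pi> U.
        covariant_rep A \<delta> B \<pi> U \<and> associated_ideal A B \<pi> U = J \<longrightarrow>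
        (\<exists>\<Psi>. star_hom C B \<Psi> \<and> (\<forall>a\<in>carrier A. \<Psi> (\<iota> a) = \<pi> a) \<and> \<Psi> u = U))"

end

theory Submission
  imports Defs
begin

text \<open>
  The module $E^{\otimes n}$ is $\delta^n(1)A$, so the Fock module consists of square summable sequences
  in $A$, operators on it have matrices with entries in $A$, and $u^* = T(\delta(1))$ is a weighted shift
  with $T(\delta(1)a) = u^*\phi_\infty(a)$ and $P_0 = 1 - u^*u$. Hence $(\phi_\infty, u)$ is a
  covariant representation.

  It is universal: let $(\pi, U)$ be covariant and $q = 1 - U^*U$. A polynomial $T$ in
  $\phi_\infty(A)$, $u$, $u^*$ has a banded matrix, which $\pi$ turns into a matrix acting on the columns
  $(U^j)_j$ and $(qU^j)_j$, up to finitely many rows as multiplication by the corresponding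
  polynomial $X$ in $\pi(A)$, $U$, $U^*$. Positivity of $\|T\|^2 - T^*T$ survives under $\pi$, and
  telescoping $U^{*j}qU^j = U^{*j}U^j - U^{*(j+1)}U^{j+1}$ over long stretches of $j$ yields
  $\|X\| \le \|T\|$, so $T \mapsto X$ extends to the Toeplitz algebra. It kills
  $\phi_\infty(J)P_0$ as soon as $J$ is contained in the associated ideal.

  Conversely, the operators whose entries lie in $J$ and tend to $0$ along each diagonal contain the
  ideal generated by $\phi_\infty(J)P_0$. As $\delta$ is isometric on $J$, no $\phi_\infty(a)$ with
  $a \ne 0$ is among them, and the entry at $(0,0)$ shows that the associated ideal of
  $(k_A, q(u))$ is exactly $J$. So $\mathcal O(J,E)$ itself has the universal property
  of the crossed product.
\<close>

text \<open>One convergent iteration for square roots takes the place of functional calculus: it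
  yields positivity, contractivity of homomorphisms, approximate units and quotients. The universal
  property is tested over one type at a time, so maps out of the quotient are built into targets of
  arbitrary type, by an estimate inside the target and not through a faithful representation of it.
  Both columns are needed in that estimate. The column of \<open>q U^j\<close> satisfies the matrix
  relations in every row but may vanish, for instance if \<open>U\<close> is an isometry; the column
  of \<open>U^j\<close> already fails in row 0 of the shift. Their squares are complementary: what
  p_j lacks to 1 is supplied by the second column. Only entries and finite sums of entries are
  transported by \<pi>; infinite sums over rows follow by continuity. That \<delta> preserves norms
  on J, although on A it may be neither injective nor unital, is obtained from the quotient by J and
  from the corner at \<delta>(1).\<close>

section \<open>Sequences behind square roots, and the notion of positivity\<close>

primrec psum :: "('a, 'm) ring_scheme \<Rightarrow> (nat \<Rightarrow> 'a) \<Rightarrow> nat \<Rightarrow> 'a" where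
  "psum R f 0 = \<zero>\<^bsub>R\<^esub>"
| "psum R f (Suc n) = psum R f n \<oplus>\<^bsub>R\<^esub> f n"

text \<open>The limit \<open>y\<close> of the iteration satisfies $(1 - y)^2 = 1 - x$; the increments are dominated by those
  of the scalar iteration at $1$, which is \<open>sqrt_bnd\<close>.\<close>

primrec sqrt_iter :: "('a, 'm) cstar_algebra_scheme \<Rightarrow> 'a \<Rightarrow> nat \<Rightarrow> 'a" where
  "sqrt_iter A x 0 = \<zero>\<^bsub>A\<^esub>"
| "sqrt_iter A x (Suc n) = scal A (1/2) (x \<oplus>\<^bsub>A\<^esub> (sqrt_iter A x n \<otimes>\<^bsub>A\<^esub> sqrt_iter A x n))"

primrec sqrt_bnd :: "nat \<Rightarrow> real" where
  "sqrt_bnd 0 = 0"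
| "sqrt_bnd (Suc n) = (1 + (sqrt_bnd n)\<^sup>2) / 2"

lemma sqrt_bnd_bounds: "0 \<le> sqrt_bnd n \<and> sqrt_bnd n \<le> 1"
proof (induction n)
  case (Suc n)
  then have "(sqrt_bnd n)\<^sup>2 \<le> 1"
    by (simp add: power_le_one)
  with Suc show ?case by simp
qed simp

lemma sqrt_bnd_mono: "incseq sqrt_bnd"
proof (rule incseq_SucI)
  fix n
  have "0 \<le> (1 - sqrt_bnd n)\<^sup>2" by simp
  then show "sqrt_bnd n \<le> sqrt_bnd (Suc n)" by (simp add: power2_diff)
qed

lemma sqrt_bnd_convergent: "convergent sqrt_bnd"
  using sqrt_bnd_mono sqrt_bnd_bounds
  by (metis convergent_def incseq_convergent)

definition alg_sqrt :: "('a, 'm) cstar_algebra_scheme \<Rightarrow> 'a \<Rightarrow> 'a" where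
  "alg_sqrt A h = \<one>\<^bsub>A\<^esub> \<ominus>\<^bsub>A\<^esub> (THE l. nrm_lim A (sqrt_iter A (\<one>\<^bsub>A\<^esub> \<ominus>\<^bsub>A\<^esub> h)) l)"

abbreviation real_elt :: "('a, 'm) cstar_algebra_scheme \<Rightarrow> real \<Rightarrow> 'a" where
  "real_elt A t \<equiv> scal A (complex_of_real t) \<one>\<^bsub>A\<^esub>"

definition self_adj :: "('a, 'm) cstar_algebra_scheme \<Rightarrow> 'a \<Rightarrow> bool" where
  "self_adj A h \<longleftrightarrow> h \<in> carrier A \<and> star A h = h"

text \<open>For self-adjoint \<open>h\<close>, the condition says that the spectrum of \<open>h\<close> lies in $[0, 2t]$.\<close>

definition pos :: "('a, 'm) cstar_algebra_scheme \<Rightarrow> 'a \<Rightarrow> bool" where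
  "pos A h \<longleftrightarrow> self_adj A h \<and> (\<exists>t\<ge>0. nrm A (real_elt A t \<ominus>\<^bsub>A\<^esub> h) \<le> t)"

section \<open>Elementary consequences of the axioms\<close>

context unital_cstar_algebra
begin

lemma nrm_zero [simp]: "nrm A \<zero> = 0"
  using nrm_eq_zero by simp

lemma scal_zero_left: "a \<in> carrier A \<Longrightarrow> scal A 0 a = \<zero>"
  using nrm_eq_zero[OF scal_closed, of a 0] nrm_scal[of a 0] by simp

lemma scal_zero_right [simp]: "scal A c \<zero> = \<zero>"
  using nrm_eq_zero[OF scal_closed, of \<zero> c] nrm_scal[of \<zero> c] by simp

lemma scal_minus: "a \<in> carrier A \<Longrightarrow> scal A c (\<ominus> a) = \<ominus> scal A c a"
  by (metis a_inv_closed l_neg minus_equality scal_add_right scal_closed scal_zero_right)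

lemma scal_minus_left: "a \<in> carrier A \<Longrightarrow> scal A (- c) a = \<ominus> scal A c a"
  by (metis add.left_inverse minus_equality scal_add_left scal_closed scal_zero_left)

lemma scal_minus_one: "a \<in> carrier A \<Longrightarrow> scal A (- 1) a = \<ominus> a"
  by (simp add: scal_minus_left scal_one)

lemma star_zero [simp]: "star A \<zero> = \<zero>"
  using star_scal[of \<zero> 0] by (simp add: scal_zero_left star_closed)

lemma star_minus: "a \<in> carrier A \<Longrightarrow> star A (\<ominus> a) = \<ominus> star A a"
  using star_scal[of a "-1"] by (simp add: scal_minus_one star_closed)

lemma star_one [simp]: "star A \<one> = \<one>"
  by (metis l_one one_closed r_one star_closed star_mult star_star)

lemmas cstar_simprules
  [algebra add: ring "zero A" "add A" "a_inv A" "a_minus A" "one A" "mult A"] =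
  star_closed star_star star_add star_mult star_scal star_minus star_zero star_one
  scal_closed scal_add_right scal_minus scal_zero_right scal_mult_left scal_mult_right scal_scal
  scal_one r_one

lemma star_diff: "\<lbrakk>a \<in> carrier A; b \<in> carrier A\<rbrakk> \<Longrightarrow> star A (a \<ominus> b) = star A a \<ominus> star A b"
  by algebra

lemma nrm_minus: "a \<in> carrier A \<Longrightarrow> nrm A (\<ominus> a) = nrm A a"
  by (metis nrm_scal scal_minus_one norm_minus_cancel norm_one mult_1)

lemma nrm_diff: "\<lbrakk>a \<in> carrier A; b \<in> carrier A\<rbrakk> \<Longrightarrow> nrm A (a \<ominus> b) \<le> nrm A a + nrm A b"
  using nrm_add[of a "\<ominus> b"] by (simp add: minus_eq nrm_minus)

lemma nrm_diff_commute: "\<lbrakk>a \<in> carrier A; b \<in> carrier A\<rbrakk> \<Longrightarrow> nrm A (a \<ominus> b) = nrm A (b \<ominus> a)"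
proof -
  assume ab: "a \<in> carrier A" "b \<in> carrier A"
  then have "a \<ominus> b = \<ominus> (b \<ominus> a)" by algebra
  with ab show ?thesis by (simp add: nrm_minus)
qed

lemma nrm_triangle:
  assumes "a \<in> carrier A" "b \<in> carrier A" "c \<in> carrier A"
  shows "nrm A (a \<ominus> c) \<le> nrm A (a \<ominus> b) + nrm A (b \<ominus> c)"
proof -
  have "a \<ominus> c = (a \<ominus> b) \<oplus> (b \<ominus> c)" using assms by algebra
  with assms show ?thesis by (simp add: nrm_add)
qed

lemma nrm_le_diff:
  assumes "a \<in> carrier A" "b \<in> carrier A"
  shows "nrm A a \<le> nrm A b + nrm A (a \<ominus> b)"
proof -
  have "a = b \<oplus> (a \<ominus> b)" using assms by algebra
  with assms show ?thesis by (metis minus_closed nrm_add)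
qed

lemma abs_nrm_diff:
  assumes "a \<in> carrier A" "b \<in> carrier A"
  shows "\<bar>nrm A a - nrm A b\<bar> \<le> nrm A (a \<ominus> b)"
  using nrm_le_diff[OF assms] nrm_le_diff[OF assms(2,1)] nrm_diff_commute[OF assms] by linarith

lemma diff_self [simp]: "a \<in> carrier A \<Longrightarrow> a \<ominus> a = \<zero>"
  by algebra

lemma diff_eq_zeroD: "\<lbrakk>a \<in> carrier A; b \<in> carrier A; a \<ominus> b = \<zero>\<rbrakk> \<Longrightarrow> a = b"
  using minus_equality[of a "\<ominus> b"] by (simp add: minus_eq)

lemma nrm_diff_eq_zero: "\<lbrakk>a \<in> carrier A; b \<in> carrier A; nrm A (a \<ominus> b) = 0\<rbrakk> \<Longrightarrow> a = b"
  using nrm_eq_zero diff_eq_zeroD minus_closed by blast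

lemma nrm_star: "a \<in> carrier A \<Longrightarrow> nrm A (star A a) = nrm A a"
proof -
  have le: "nrm A b \<le> nrm A (star A b)" if b: "b \<in> carrier A" for b
  proof (cases "nrm A b = 0")
    case False
    have "(nrm A b)\<^sup>2 \<le> nrm A (star A b) * nrm A b"
      using b nrm_mult[of "star A b" b] by (simp add: cstar_identity star_closed)
    with False nrm_nonneg[OF b] show ?thesis by (simp add: power2_eq_square)
  qed (use b nrm_nonneg star_closed in simp)
  assume "a \<in> carrier A"
  with le[of a] le[of "star A a"] show ?thesis by (simp add: star_closed star_star)
qed

lemma cstar_identity': "a \<in> carrier A \<Longrightarrow> nrm A (a \<otimes> star A a) = (nrm A a)\<^sup>2"
  using cstar_identity[of "star A a"] by (simp add: star_closed star_star nrm_star)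

lemma star_mult_eq_zero: "\<lbrakk>a \<in> carrier A; star A a \<otimes> a = \<zero>\<rbrakk> \<Longrightarrow> a = \<zero>"
  using cstar_identity[of a] nrm_eq_zero[of a] by simp

text \<open>Only an inequality holds, since the unit of the zero algebra has norm 0.\<close>

lemma nrm_one_le: "nrm A \<one> \<le> 1"
proof -
  have "(nrm A \<one>)\<^sup>2 = nrm A \<one>" using cstar_identity[of \<one>] by simp
  then have "nrm A \<one> = 0 \<or> nrm A \<one> = 1" by (simp add: power2_eq_square)
  then show ?thesis by auto
qed

lemma nrm_real_elt_le: "0 \<le> t \<Longrightarrow> nrm A (real_elt A t) \<le> t"
  using nrm_one_le by (simp add: nrm_scal mult_left_le)

lemma nrm_mult_le:
  assumes "a \<in> carrier A" "b \<in> carrier A" "nrm A a \<le> s" "nrm A b \<le> t"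
  shows "nrm A (a \<otimes> b) \<le> s * t"
  using assms nrm_mult[of a b] mult_mono[of "nrm A a" s "nrm A b" t] nrm_nonneg[of a] nrm_nonneg[of b]
  by linarith

lemma scal_sum_half: "a \<in> carrier A \<Longrightarrow> scal A (1/2) (a \<oplus> a) = a"
  using scal_add_left[of a "1/2" "1/2"] by (simp add: scal_add_right scal_one)

lemma scal_cancel: "\<lbrakk>a \<in> carrier A; b \<in> carrier A; c \<noteq> 0; scal A c a = scal A c b\<rbrakk> \<Longrightarrow> a = b"
  by (metis left_inverse scal_one scal_scal)

lemma psum_closed: "(\<And>n. f n \<in> carrier A) \<Longrightarrow> psum A f n \<in> carrier A"
  by (induction n) auto

text \<open>Links the recursive sums, which serve as sequences and unfold without side conditions,
  to the \<open>finsum\<close> in the definition of the Fock module.\<close>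

lemma psum_eq_finsum: "(\<And>n. f n \<in> carrier A) \<Longrightarrow> psum A f n = finsum A f {..<n}"
  by (induction n) (auto simp: lessThan_Suc finsum_insert a_comm psum_closed Pi_def)

section \<open>Limits\<close>

lemma nrm_limD: "nrm_lim A s l \<Longrightarrow> l \<in> carrier A"
  "nrm_lim A s l \<Longrightarrow> (\<lambda>n. nrm A (s n \<ominus> l)) \<longlonglongrightarrow> 0"
  by (auto simp: nrm_lim_def)

lemma nrm_limI_bound:
  assumes "l \<in> carrier A" "\<And>n. s n \<in> carrier A"
    "\<forall>\<^sub>F n in sequentially. nrm A (s n \<ominus> l) \<le> c n" "c \<longlonglongrightarrow> 0"
  shows "nrm_lim A s l"
  unfolding nrm_lim_def
  using assms(1,2) by (intro conjI tendsto_sandwich[OF _ assms(3) tendsto_const assms(4)])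
    (auto simp: nrm_nonneg)

lemma nrm_lim_unique:
  assumes "nrm_lim A s l" "nrm_lim A s m" "\<And>n. s n \<in> carrier A"
  shows "l = m"
proof -
  note lm = nrm_limD(1)[OF assms(1)] nrm_limD(1)[OF assms(2)]
  have "(\<lambda>n. nrm A (s n \<ominus> l) + nrm A (s n \<ominus> m)) \<longlonglongrightarrow> 0 + 0"
    by (intro tendsto_add nrm_limD(2) assms)
  moreover have "nrm A (l \<ominus> m) \<le> nrm A (s n \<ominus> l) + nrm A (s n \<ominus> m)" for n
    using nrm_triangle[OF lm(1) assms(3) lm(2), of n] nrm_diff_commute[OF lm(1) assms(3)[of n]]
    by simp
  ultimately have "nrm A (l \<ominus> m) \<le> 0 + 0"
    by (intro LIMSEQ_le_const) auto
  with lm show ?thesis using nrm_nonneg[of "l \<ominus> m"] nrm_diff_eq_zero[of l m] by simp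
qed

lemma nrm_lim_const: "a \<in> carrier A \<Longrightarrow> nrm_lim A (\<lambda>_. a) a"
  by (simp add: nrm_lim_def)

lemma nrm_lim_add:
  assumes "nrm_lim A s l" "nrm_lim A t m" "\<And>n. s n \<in> carrier A" "\<And>n. t n \<in> carrier A"
  shows "nrm_lim A (\<lambda>n. s n \<oplus> t n) (l \<oplus> m)"
proof (rule nrm_limI_bound)
  note lm = nrm_limD(1)[OF assms(1)] nrm_limD(1)[OF assms(2)]
  have "(s n \<oplus> t n) \<ominus> (l \<oplus> m) = (s n \<ominus> l) \<oplus> (t n \<ominus> m)" for n
    using lm assms(3)[of n] assms(4)[of n] by algebra
  then show "\<forall>\<^sub>F n in sequentially. nrm A ((s n \<oplus> t n) \<ominus> (l \<oplus> m))
      \<le> nrm A (s n \<ominus> l) + nrm A (t n \<ominus> m)"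
    using lm assms(3,4) by (simp add: nrm_add)
  show "(\<lambda>n. nrm A (s n \<ominus> l) + nrm A (t n \<ominus> m)) \<longlonglongrightarrow> 0"
    using tendsto_add[OF nrm_limD(2)[OF assms(1)] nrm_limD(2)[OF assms(2)]] by simp
qed (use assms nrm_limD in auto)

lemma nrm_lim_mult:
  assumes "nrm_lim A s l" "nrm_lim A t m" "\<And>n. s n \<in> carrier A" "\<And>n. t n \<in> carrier A"
  shows "nrm_lim A (\<lambda>n. s n \<otimes> t n) (l \<otimes> m)"
proof (rule nrm_limI_bound)
  note lm = nrm_limD(1)[OF assms(1)] nrm_limD(1)[OF assms(2)]
  let ?c = "\<lambda>n. nrm A (s n \<ominus> l) * (nrm A m + nrm A (t n \<ominus> m)) + nrm A l * nrm A (t n \<ominus> m)"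
  have "nrm A ((s n \<otimes> t n) \<ominus> (l \<otimes> m)) \<le> ?c n" for n
  proof -
    have "(s n \<otimes> t n) \<ominus> (l \<otimes> m) = (s n \<ominus> l) \<otimes> t n \<oplus> l \<otimes> (t n \<ominus> m)"
      using lm assms(3)[of n] assms(4)[of n] by algebra
    then have "nrm A ((s n \<otimes> t n) \<ominus> (l \<otimes> m))
        \<le> nrm A ((s n \<ominus> l) \<otimes> t n) + nrm A (l \<otimes> (t n \<ominus> m))"
      using lm assms(3,4) by (simp add: nrm_add)
    also have "\<dots> \<le> ?c n"
      using lm assms(3,4) nrm_le_diff[OF assms(4) lm(2)]
      by (intro add_mono nrm_mult_le nrm_mult) auto
    finally show ?thesis .
  qed
  then show "\<forall>\<^sub>F n in sequentially. nrm A ((s n \<otimes> t n) \<ominus> (l \<otimes> m)) \<le> ?c n" by simp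
  show "?c \<longlonglongrightarrow> 0"
    using nrm_limD(2)[OF assms(1)] nrm_limD(2)[OF assms(2)] by (auto intro!: tendsto_eq_intros)
qed (use assms nrm_limD in auto)

lemma nrm_lim_scal:
  assumes "nrm_lim A s l" "\<And>n. s n \<in> carrier A"
  shows "nrm_lim A (\<lambda>n. scal A c (s n)) (scal A c l)"
proof -
  have l: "l \<in> carrier A" using assms nrm_limD by blast
  have "scal A c \<one> \<otimes> a = scal A c a" if "a \<in> carrier A" for a using that by algebra
  then show ?thesis
    using nrm_lim_mult[OF nrm_lim_const assms(1), of "scal A c \<one>"] assms(2) l
    by (simp add: scal_closed)
qed

lemma nrm_lim_minus:
  assumes "nrm_lim A s l" "\<And>n. s n \<in> carrier A"
  shows "nrm_lim A (\<lambda>n. \<ominus> s n) (\<ominus> l)"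
  using nrm_lim_scal[OF assms, of "-1"] assms nrm_limD(1)[OF assms(1)] by (simp add: scal_minus_one)

lemma nrm_lim_diff:
  assumes "nrm_lim A s l" "nrm_lim A t m" "\<And>n. s n \<in> carrier A" "\<And>n. t n \<in> carrier A"
  shows "nrm_lim A (\<lambda>n. s n \<ominus> t n) (l \<ominus> m)"
  using nrm_lim_add[OF assms(1) nrm_lim_minus[OF assms(2,4)] assms(3)] assms(4)
  by (simp add: minus_eq)

lemma nrm_lim_star:
  assumes "nrm_lim A s l" "\<And>n. s n \<in> carrier A"
  shows "nrm_lim A (\<lambda>n. star A (s n)) (star A l)"
proof (rule nrm_limI_bound)
  have l: "l \<in> carrier A" using assms nrm_limD by blast
  then show "\<forall>\<^sub>F n in sequentially. nrm A (star A (s n) \<ominus> star A l) \<le> nrm A (s n \<ominus> l)"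
    using assms by (simp add: star_diff[symmetric] nrm_star)
qed (use assms nrm_limD star_closed in auto)

lemma nrm_lim_nrm:
  assumes "nrm_lim A s l" "\<And>n. s n \<in> carrier A"
  shows "(\<lambda>n. nrm A (s n)) \<longlonglongrightarrow> nrm A l"
proof (rule LIM_zero_cancel, rule tendsto_rabs_zero_cancel,
    rule tendsto_sandwich[OF _ _ tendsto_const nrm_limD(2)[OF assms(1)]])
  show "\<forall>\<^sub>F n in sequentially. \<bar>nrm A (s n) - nrm A l\<bar> \<le> nrm A (s n \<ominus> l)"
    using assms nrm_limD(1)[OF assms(1)] by (simp add: abs_nrm_diff)
qed simp

lemma nrm_lim_le:
  assumes "nrm_lim A s l" "\<And>n. s n \<in> carrier A" "\<And>n. N \<le> n \<Longrightarrow> nrm A (s n) \<le> c"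
  shows "nrm A l \<le> c"
  using nrm_lim_nrm[OF assms(1,2)] assms(3) by (meson LIMSEQ_le_const2)

lemma nrm_lim_subseq: "nrm_lim A s l \<Longrightarrow> strict_mono r \<Longrightarrow> nrm_lim A (\<lambda>n. s (r n)) l"
  by (auto simp: nrm_lim_def dest: LIMSEQ_subseq_LIMSEQ simp: o_def)

lemma nrm_lim_Suc: "nrm_lim A s l \<Longrightarrow> nrm_lim A (\<lambda>n. s (Suc n)) l"
  by (rule nrm_lim_subseq) (auto simp: strict_mono_def)

lemma nrm_lim_epsilon:
  assumes "l \<in> carrier A"
  shows "nrm_lim A s l \<longleftrightarrow> (\<forall>e>0. \<exists>N. \<forall>n\<ge>N. \<bar>nrm A (s n \<ominus> l)\<bar> < e)"
  using assms by (simp add: nrm_lim_def LIMSEQ_iff)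

lemma nrm_lim_cong:
  "nrm_lim A s l \<Longrightarrow> \<forall>\<^sub>F n in sequentially. t n = s n \<Longrightarrow> nrm_lim A t l"
  unfolding nrm_lim_def
  by (auto elim!: Lim_transform_eventually eventually_mono)

text \<open>A telescoping majorant: \<open>c\<close> is the scalar iteration \<open>sqrt_bnd\<close>
  for square roots and a geometric sequence for the completeness of quotients.\<close>

lemma convergent_if_increments_le:
  assumes "\<And>n. s n \<in> carrier A" "\<And>n. nrm A (s (Suc n) \<ominus> s n) \<le> c (Suc n) - c n" "convergent c"
  shows "\<exists>l. nrm_lim A s l"
proof (rule complete)
  have mono: "nrm A (s (m + k) \<ominus> s m) \<le> c (m + k) - c m" for m k
  proof (induction k)
    case 0
    show ?case using assms(1)[of m] by simp
  next
    case (Suc k)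
    then show ?case
      using nrm_triangle[of "s (m + Suc k)" "s (m + k)" "s m"] assms(1) assms(2)[of "m + k"]
      by simp
  qed
  show "\<forall>e>0. \<exists>N. \<forall>m\<ge>N. \<forall>n\<ge>N. nrm A (s m \<ominus> s n) < e"
  proof (intro allI impI)
    fix e :: real assume "e > 0"
    with assms(3) obtain N where N: "\<bar>c m - c n\<bar> < e" if "m \<ge> N" "n \<ge> N" for m n
      unfolding Cauchy_convergent_iff[symmetric] Cauchy_def dist_real_def by blast
    have "nrm A (s m \<ominus> s n) < e" if mn: "m \<ge> N" "n \<ge> N" for m n
    proof (cases "n \<le> m")
      case True
      then show ?thesis using mono[of n "m - n"] N[OF mn] by simp
    next
      case False
      then show ?thesis using mono[of m "n - m"] N[OF mn] nrm_diff_commute[OF assms(1) assms(1)]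
        by simp
    qed
    then show "\<exists>N. \<forall>m\<ge>N. \<forall>n\<ge>N. nrm A (s m \<ominus> s n) < e" by blast
  qed
qed (rule assms(1))

lemma nrm_closedD: "nrm_closed A S \<Longrightarrow> (\<And>n. s n \<in> S) \<Longrightarrow> nrm_lim A s l \<Longrightarrow> l \<in> S"
  unfolding nrm_closed_def by blast

section \<open>Square roots\<close>

lemma sqrt_iter_closed: "x \<in> carrier A \<Longrightarrow> sqrt_iter A x n \<in> carrier A"
  by (induction n) (auto simp: scal_closed)

text \<open>The iterates are one and the same polynomial evaluated at \<open>x\<close> and at
  \<open>y\<close>. For \<open>y = x\<close> this is commutation.\<close>

lemma sqrt_iter_intertwine:
  assumes "x \<in> carrier A" "y \<in> carrier A" "z \<in> carrier A" "z \<otimes> x = y \<otimes> z"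
  shows "z \<otimes> sqrt_iter A x n = sqrt_iter A y n \<otimes> z"
proof (induction n)
  case (Suc n)
  note cl = sqrt_iter_closed[OF assms(1), of n] sqrt_iter_closed[OF assms(2), of n]
  have "z \<otimes> (sqrt_iter A x n \<otimes> sqrt_iter A x n) = sqrt_iter A y n \<otimes> sqrt_iter A y n \<otimes> z"
    using assms cl Suc by (metis m_assoc)
  then show ?case using assms cl by (simp add: scal_mult_left scal_mult_right l_distr r_distr)
qed (use assms in simp)

lemma sqrt_iter_self_adj:
  "x \<in> carrier A \<Longrightarrow> star A x = x \<Longrightarrow> star A (sqrt_iter A x n) = sqrt_iter A x n"
  by (induction n) (auto simp: star_scal star_add star_mult sqrt_iter_closed)

lemma sqrt_iter_nrm: "x \<in> carrier A \<Longrightarrow> nrm A x \<le> 1 \<Longrightarrow> nrm A (sqrt_iter A x n) \<le> sqrt_bnd n"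
proof (induction n)
  case (Suc n)
  let ?y = "sqrt_iter A x n"
  have y: "?y \<in> carrier A" using Suc sqrt_iter_closed by blast
  have "nrm A (x \<oplus> ?y \<otimes> ?y) \<le> nrm A x + nrm A (?y \<otimes> ?y)" using Suc y by (simp add: nrm_add)
  also have "\<dots> \<le> 1 + sqrt_bnd n * sqrt_bnd n" using Suc y by (intro add_mono nrm_mult_le) auto
  finally show ?case using Suc y by (simp add: nrm_scal power2_eq_square)
qed simp

text \<open>Iterates commute, so the difference of their squares factors. As \<open>sqrt_bnd\<close>
  is the same recursion at the number 1, the bounds on iterates and increments multiply to exactly
  the next bound.\<close>

lemma sqrt_iter_step:
  assumes "x \<in> carrier A" "nrm A x \<le> 1"
  shows "nrm A (sqrt_iter A x (Suc n) \<ominus> sqrt_iter A x n) \<le> sqrt_bnd (Suc n) - sqrt_bnd n"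
proof (induction n)
  case 0
  show ?case using assms by (simp add: minus_eq nrm_scal scal_closed)
next
  case (Suc n)
  let ?y = "sqrt_iter A x n" and ?z = "sqrt_iter A x (Suc n)"
  have cl: "?y \<in> carrier A" "?z \<in> carrier A" using assms sqrt_iter_closed by blast+
  have "?y \<otimes> x = x \<otimes> ?y" using sqrt_iter_intertwine[of x x x n] assms by simp
  then have comm: "?y \<otimes> ?z = ?z \<otimes> ?y" using sqrt_iter_intertwine[of x x ?y "Suc n"] assms cl by metis
  have "sqrt_iter A x (Suc (Suc n)) \<ominus> ?z
      = scal A (1/2) (x \<oplus> ?z \<otimes> ?z) \<ominus> scal A (1/2) (x \<oplus> ?y \<otimes> ?y)" by simp
  also have "\<dots> = scal A (1/2) ((?z \<ominus> ?y) \<otimes> (?z \<oplus> ?y))"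
  proof -
    have "(?z \<ominus> ?y) \<otimes> (?z \<oplus> ?y) = ?z \<otimes> ?z \<ominus> ?y \<otimes> ?y \<oplus> (?z \<otimes> ?y \<ominus> ?y \<otimes> ?z)"
      using cl by algebra
    also have "\<dots> = (x \<oplus> ?z \<otimes> ?z) \<ominus> (x \<oplus> ?y \<otimes> ?y)"
      unfolding comm using cl assms(1) by algebra
    finally show ?thesis
      using assms(1) cl by (simp add: minus_eq scal_add_right scal_minus scal_closed minus_add)
  qed
  finally have eq: "sqrt_iter A x (Suc (Suc n)) \<ominus> ?z = scal A (1/2) ((?z \<ominus> ?y) \<otimes> (?z \<oplus> ?y))" .
  have "nrm A ((?z \<ominus> ?y) \<otimes> (?z \<oplus> ?y))
      \<le> (sqrt_bnd (Suc n) - sqrt_bnd n) * (sqrt_bnd (Suc n) + sqrt_bnd n)"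
    using cl Suc order_trans[OF nrm_add add_mono[OF sqrt_iter_nrm sqrt_iter_nrm], of x "Suc n" x n]
      assms by (intro nrm_mult_le) auto
  also have "\<dots> = (sqrt_bnd (Suc n))\<^sup>2 - (sqrt_bnd n)\<^sup>2"
    by (simp only: power2_eq_square square_diff_square_factored mult.commute)
  finally show ?case unfolding eq using cl by (simp add: nrm_scal field_simps)
qed

lemma sqrt_iter_lim:
  assumes "x \<in> carrier A" "nrm A x \<le> 1"
  shows "nrm_lim A (sqrt_iter A x) (THE l. nrm_lim A (sqrt_iter A x) l)"
proof -
  obtain l where "nrm_lim A (sqrt_iter A x) l"
    using convergent_if_increments_le[OF sqrt_iter_closed[OF assms(1)] sqrt_iter_step[OF assms]
        sqrt_bnd_convergent] by blast
  then show ?thesis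
    using nrm_lim_unique sqrt_iter_closed[OF assms(1)] by (metis theI)
qed

context
  fixes h assumes h: "h \<in> carrier A" "nrm A (\<one> \<ominus> h) \<le> 1"
begin

lemma alg_sqrt_closed: "alg_sqrt A h \<in> carrier A"
  unfolding alg_sqrt_def using nrm_limD(1)[OF sqrt_iter_lim] h by simp

lemma alg_sqrt_lim: "nrm_lim A (sqrt_iter A (\<one> \<ominus> h)) (\<one> \<ominus> alg_sqrt A h)"
proof -
  have "\<one> \<ominus> (\<one> \<ominus> l) = l" if "l \<in> carrier A" for l using that by algebra
  then show ?thesis
    unfolding alg_sqrt_def using sqrt_iter_lim[of "\<one> \<ominus> h"] h nrm_limD(1)[OF sqrt_iter_lim] by simp
qed

text \<open>The limit y is a fixed point, y = (x + y^2)/2 with x = 1 - h, which rearranges to (1 -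
  y)^2 = h.\<close>

lemma alg_sqrt_square: "alg_sqrt A h \<otimes> alg_sqrt A h = h"
proof -
  let ?y = "\<one> \<ominus> alg_sqrt A h"
  have y: "?y \<in> carrier A" "\<one> \<ominus> h \<in> carrier A" using alg_sqrt_closed h by auto
  have "nrm_lim A (\<lambda>n. sqrt_iter A (\<one> \<ominus> h) (Suc n)) (scal A (1/2) ((\<one> \<ominus> h) \<oplus> ?y \<otimes> ?y))"
    unfolding sqrt_iter.simps using y sqrt_iter_closed alg_sqrt_lim
    by (intro nrm_lim_scal nrm_lim_add nrm_lim_mult nrm_lim_const) auto
  moreover have "nrm_lim A (\<lambda>n. sqrt_iter A (\<one> \<ominus> h) (Suc n)) ?y" by (rule nrm_lim_Suc[OF alg_sqrt_lim])
  ultimately have "scal A (1/2) ((\<one> \<ominus> h) \<oplus> ?y \<otimes> ?y) = ?y"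
    using nrm_lim_unique sqrt_iter_closed[OF y(2)] by blast
  also have "?y = scal A (1/2) (?y \<oplus> ?y)" using scal_sum_half y by metis
  finally have "(\<one> \<ominus> h) \<oplus> ?y \<otimes> ?y = ?y \<oplus> ?y" using y by (auto dest!: scal_cancel[rotated 3])
  then have "h \<oplus> ((\<one> \<ominus> h) \<oplus> ?y \<otimes> ?y) \<ominus> (?y \<oplus> ?y) = h" using y h by algebra
  moreover have "h \<oplus> ((\<one> \<ominus> h) \<oplus> ?y \<otimes> ?y) \<ominus> (?y \<oplus> ?y) = alg_sqrt A h \<otimes> alg_sqrt A h"
    using h alg_sqrt_closed by algebra
  ultimately show ?thesis by simp
qed

lemma nrm_one_minus_alg_sqrt: "nrm A (\<one> \<ominus> alg_sqrt A h) \<le> 1"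
  using nrm_lim_le[OF alg_sqrt_lim sqrt_iter_closed] order_trans[OF sqrt_iter_nrm] sqrt_bnd_bounds h
  by auto

lemma alg_sqrt_self_adj: "star A h = h \<Longrightarrow> star A (alg_sqrt A h) = alg_sqrt A h"
proof -
  assume *: "star A h = h"
  have "nrm_lim A (sqrt_iter A (\<one> \<ominus> h)) (star A (\<one> \<ominus> alg_sqrt A h))"
    using nrm_lim_star[OF alg_sqrt_lim] sqrt_iter_closed sqrt_iter_self_adj h * by (simp add: star_diff)
  then have "star A (\<one> \<ominus> alg_sqrt A h) = \<one> \<ominus> alg_sqrt A h"
    by (rule nrm_lim_unique[OF _ alg_sqrt_lim]) (use h sqrt_iter_closed in auto)
  then have "\<one> \<ominus> star A (\<one> \<ominus> alg_sqrt A h) = \<one> \<ominus> (\<one> \<ominus> alg_sqrt A h)" by simp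
  moreover have "\<one> \<ominus> star A (\<one> \<ominus> alg_sqrt A h) = star A (alg_sqrt A h)" "\<one> \<ominus> (\<one> \<ominus> alg_sqrt A h) = alg_sqrt A h"
    using alg_sqrt_closed by algebra+
  ultimately show ?thesis by simp
qed

text \<open>All iterates are polynomials in 1 - h without constant term.\<close>

lemma alg_sqrt_ideal: "closed_ideal A I \<Longrightarrow> \<one> \<ominus> h \<in> I \<Longrightarrow> \<one> \<ominus> alg_sqrt A h \<in> I"
proof -
  assume I: "closed_ideal A I" "\<one> \<ominus> h \<in> I"
  then interpret I: ideal I A by (simp add: closed_ideal_def)
  have scal: "scal A c a \<in> I" if "a \<in> I" for c a
    using I.I_l_closed[OF that, of "scal A c \<one>"] I.Icarr[OF that]
    by (simp add: scal_closed scal_mult_left)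
  have "sqrt_iter A (\<one> \<ominus> h) n \<in> I" for n
  proof (induction n)
    case (Suc n)
    then show ?case using I I.Icarr by (auto intro!: scal I.a_closed I.I_l_closed)
  qed simp
  then show ?thesis using I alg_sqrt_lim unfolding closed_ideal_def by (blast intro: nrm_closedD)
qed

end

text \<open>Beyond commutation: \<open>z\<close> may carry the root of one element to the root of
  another, as is needed for the two products of an element with its adjoint.\<close>

lemma alg_sqrt_intertwine:
  assumes h: "h \<in> carrier A" "nrm A (\<one> \<ominus> h) \<le> 1"
    and k: "k \<in> carrier A" "nrm A (\<one> \<ominus> k) \<le> 1" "z \<in> carrier A" "z \<otimes> h = k \<otimes> z"
  shows "z \<otimes> alg_sqrt A h = alg_sqrt A k \<otimes> z"
proof -
  note cl = alg_sqrt_closed[OF h] alg_sqrt_closed[OF k(1,2)]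
  have eq: "z \<otimes> (\<one> \<ominus> h) = (\<one> \<ominus> k) \<otimes> z"
    using h k by (simp add: minus_eq l_distr r_distr l_minus r_minus)
  have "nrm_lim A (\<lambda>n. z \<otimes> sqrt_iter A (\<one> \<ominus> h) n) (z \<otimes> (\<one> \<ominus> alg_sqrt A h))"
    using h k sqrt_iter_closed by (intro nrm_lim_mult nrm_lim_const alg_sqrt_lim) auto
  moreover have "nrm_lim A (\<lambda>n. sqrt_iter A (\<one> \<ominus> k) n \<otimes> z) ((\<one> \<ominus> alg_sqrt A k) \<otimes> z)"
    using h k sqrt_iter_closed by (intro nrm_lim_mult nrm_lim_const alg_sqrt_lim) auto
  ultimately have "z \<otimes> (\<one> \<ominus> alg_sqrt A h) = (\<one> \<ominus> alg_sqrt A k) \<otimes> z"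
    unfolding sqrt_iter_intertwine[OF minus_closed[OF one_closed h(1)]
        minus_closed[OF one_closed k(1)] k(3) eq]
    by (rule nrm_lim_unique) (use h k sqrt_iter_closed in auto)
  then have "z \<ominus> z \<otimes> (\<one> \<ominus> alg_sqrt A h) = z \<ominus> (\<one> \<ominus> alg_sqrt A k) \<otimes> z" by simp
  moreover have "z \<ominus> z \<otimes> (\<one> \<ominus> alg_sqrt A h) = z \<otimes> alg_sqrt A h"
    "z \<ominus> (\<one> \<ominus> alg_sqrt A k) \<otimes> z = alg_sqrt A k \<otimes> z"
    using cl k by algebra+
  ultimately show ?thesis by simp
qed

section \<open>Positive elements\<close>

lemma self_adjD: "self_adj A h \<Longrightarrow> h \<in> carrier A" "self_adj A h \<Longrightarrow> star A h = h"
  by (auto simp: self_adj_def)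

lemma real_elt_closed: "real_elt A t \<in> carrier A"
  by (simp add: scal_closed)

lemma real_elt_mult:
  "a \<in> carrier A \<Longrightarrow> real_elt A t \<otimes> a = scal A (complex_of_real t) a"
  "a \<in> carrier A \<Longrightarrow> a \<otimes> real_elt A t = scal A (complex_of_real t) a"
  by (simp_all add: scal_mult_left scal_mult_right)

lemma real_elt_add: "real_elt A s \<oplus> real_elt A t = real_elt A (s + t)"
  by (simp add: scal_add_left)

lemma real_elt_1: "real_elt A 1 = \<one>"
  by (simp add: scal_one)

lemma nrm_scal_real: "a \<in> carrier A \<Longrightarrow> nrm A (scal A (complex_of_real t) a) = \<bar>t\<bar> * nrm A a"
  by (simp add: nrm_scal)

lemma scal_diff:
  "\<lbrakk>a \<in> carrier A; b \<in> carrier A\<rbrakk> \<Longrightarrow> scal A c (a \<ominus> b) = scal A c a \<ominus> scal A c b"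
  by algebra

lemma self_adj_real_elt: "self_adj A (real_elt A t)"
  by (simp add: self_adj_def scal_closed star_scal)

lemma self_adj_scal: "self_adj A h \<Longrightarrow> self_adj A (scal A (complex_of_real t) h)"
  by (simp add: self_adj_def scal_closed star_scal)

lemma self_adj_add: "self_adj A h \<Longrightarrow> self_adj A k \<Longrightarrow> self_adj A (h \<oplus> k)"
  by (simp add: self_adj_def star_add)

lemma self_adj_diff: "self_adj A h \<Longrightarrow> self_adj A k \<Longrightarrow> self_adj A (h \<ominus> k)"
  by (simp add: self_adj_def star_diff)

lemma self_adj_mult: "self_adj A h \<Longrightarrow> self_adj A k \<Longrightarrow> h \<otimes> k = k \<otimes> h \<Longrightarrow> self_adj A (h \<otimes> k)"
  by (simp add: self_adj_def star_mult)

lemma self_adj_square: "self_adj A h \<Longrightarrow> self_adj A (h \<otimes> h)"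
  by (rule self_adj_mult) auto

lemma self_adj_star_mult: "x \<in> carrier A \<Longrightarrow> self_adj A (star A x \<otimes> x)"
  by (simp add: self_adj_def star_mult star_closed star_star)

lemma nrm_square: "self_adj A h \<Longrightarrow> nrm A (h \<otimes> h) = (nrm A h)\<^sup>2"
  by (metis self_adj_def cstar_identity)

lemma square_eq_zero: "self_adj A h \<Longrightarrow> h \<otimes> h = \<zero> \<Longrightarrow> h = \<zero>"
  by (metis self_adj_def star_mult_eq_zero)

text \<open>The element \<open>a + \<i>b\<close> is a multiple of a unitary, and \<open>a\<close> is its real part.\<close>

lemma nrm_le_sum_squares:
  assumes a: "self_adj A a" and b: "self_adj A b" and ab: "a \<otimes> b = b \<otimes> a"
    and sum: "a \<otimes> a \<oplus> b \<otimes> b = real_elt A t" and t: "0 \<le> t"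
  shows "nrm A a \<le> sqrt t"
proof -
  note cl = self_adjD(1)[OF a] self_adjD(1)[OF b]
  define d where "d = scal A \<i> b"
  define u where "u = a \<oplus> d"
  have d: "d \<in> carrier A" "star A d = \<ominus> d" "a \<otimes> d = d \<otimes> a" "d \<otimes> d = \<ominus> (b \<otimes> b)"
    using cl b ab scal_minus_left[of b \<i>] scal_minus_one
    by (auto simp: d_def scal_closed star_scal self_adj_def scal_mult_left scal_mult_right scal_scal)
  have u: "u \<in> carrier A" "star A u = a \<ominus> d"
    using cl a d by (simp_all add: u_def star_add minus_eq self_adj_def)
  have "star A u \<otimes> u = a \<otimes> a \<ominus> d \<otimes> d \<oplus> (a \<otimes> d \<ominus> d \<otimes> a)"
    unfolding u(2) unfolding u_def using cl d(1) by algebra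
  also have "\<dots> = a \<otimes> a \<oplus> b \<otimes> b" unfolding d(3,4) using cl d(1) by algebra
  finally have "(nrm A u)\<^sup>2 \<le> t" using u sum nrm_real_elt_le[OF t] by (simp flip: cstar_identity)
  then have nu: "nrm A u \<le> sqrt t" by (simp add: real_le_rsqrt)
  have "u \<oplus> star A u = a \<oplus> a" unfolding u(2) unfolding u_def using cl d(1) by algebra
  then have "a = scal A (1/2) (u \<oplus> star A u)" using scal_sum_half cl by metis
  moreover have "nrm A (u \<oplus> star A u) \<le> sqrt t + sqrt t"
    using nrm_add[of u "star A u"] nu u(1) by (simp add: star_closed nrm_star)
  ultimately show ?thesis
    using u(1) nrm_scal[of "u \<oplus> star A u" "1/2"] by (simp add: star_closed)
qed

text \<open>Stands in for the spectral fact that t - g^2 lies between 0 and t. Rescaling gives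
  \<open>a\<close> of norm at most 1 and a root \<open>r\<close> of 1 - a^2 commuting with
  \<open>a\<close>; from a^2 + r^2 = 1 the norm of \<open>r\<close>, hence of 1 - a^2, is at most
  1.\<close>

lemma real_elt_minus_square_le:
  assumes g: "self_adj A g" and t: "(nrm A g)\<^sup>2 \<le> t"
  shows "nrm A (real_elt A t \<ominus> g \<otimes> g) \<le> t"
proof (cases "t = 0")
  case True
  then have "g = \<zero>" using assms self_adjD(1) nrm_eq_zero by simp
  with True show ?thesis by (simp add: scal_zero_left)
next
  case False
  then have t0: "t > 0" using t zero_le_power2[of "nrm A g"] by linarith
  note gc = self_adjD(1)[OF g]
  define a where "a = scal A (complex_of_real (1 / sqrt t)) g"
  have a: "self_adj A a" "a \<in> carrier A" using self_adj_scal[OF g, of "1 / sqrt t"] self_adjD by (auto simp: a_def)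
  have aa: "a \<otimes> a = scal A (complex_of_real (1 / t)) (g \<otimes> g)"
    using t0 gc by (simp add: a_def scal_mult_left scal_mult_right scal_scal scal_closed
        flip: of_real_mult)
  define h where "h = \<one> \<ominus> a \<otimes> a"
  have h: "h \<in> carrier A" "self_adj A h"
    using a self_adj_diff[OF self_adj_real_elt[of 1] self_adj_square[OF a(1)]]
    by (auto simp: h_def scal_one)
  have 1: "\<one> \<ominus> h = a \<otimes> a" unfolding h_def using a by algebra
  have "nrm A (a \<otimes> a) = nrm A (g \<otimes> g) / t" using t0 gc by (simp add: aa nrm_scal norm_divide)
  then have nh: "nrm A (\<one> \<ominus> h) \<le> 1" using t0 t by (simp add: 1 nrm_square g)
  define r where "r = alg_sqrt A h"
  have r: "self_adj A r" "r \<otimes> r = h"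
    using h nh by (auto simp: r_def self_adj_def alg_sqrt_closed alg_sqrt_square alg_sqrt_self_adj)
  have "a \<otimes> h = h \<otimes> a" unfolding h_def using a by algebra
  then have ra: "r \<otimes> a = a \<otimes> r" using alg_sqrt_intertwine[OF h(1) nh h(1) nh a(2)] by (simp add: r_def)
  have "r \<otimes> r \<oplus> a \<otimes> a = real_elt A 1"
    unfolding r(2) h_def real_elt_1 using a by algebra
  from nrm_le_sum_squares[OF r(1) a(1) ra this]
  have "nrm A h \<le> 1" using r by (simp flip: r(2) add: nrm_square self_adjD nrm_nonneg power_le_one)
  moreover have "real_elt A t \<ominus> g \<otimes> g = scal A (complex_of_real t) h"
    using t0 gc by (simp add: h_def scal_diff aa scal_closed scal_scal scal_one flip: of_real_mult)
  ultimately show ?thesis using t0 h by (simp add: nrm_scal)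
qed

lemma posD: "pos A h \<Longrightarrow> self_adj A h" "pos A h \<Longrightarrow> h \<in> carrier A" "pos A h \<Longrightarrow> star A h = h"
  by (auto simp: pos_def self_adj_def)

lemma posI: "self_adj A h \<Longrightarrow> 0 \<le> t \<Longrightarrow> nrm A (real_elt A t \<ominus> h) \<le> t \<Longrightarrow> pos A h"
  by (auto simp: pos_def)

lemma pos_square: "self_adj A g \<Longrightarrow> pos A (g \<otimes> g)"
  using posI[OF self_adj_square _ real_elt_minus_square_le[OF _ order_refl]] by simp

lemma pos_scal:
  assumes "pos A h" "0 \<le> s"
  shows "pos A (scal A (complex_of_real s) h)"
proof -
  obtain t where t: "t \<ge> 0" "nrm A (real_elt A t \<ominus> h) \<le> t" using assms unfolding pos_def by blast
  have "real_elt A (s * t) \<ominus> scal A (complex_of_real s) h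
      = scal A (complex_of_real s) (real_elt A t \<ominus> h)"
    using posD(2)[OF assms(1)] by (simp add: scal_diff scal_closed scal_scal)
  then show ?thesis
    using assms t posD[OF assms(1)] nrm_scal_real[of "real_elt A t \<ominus> h" s]
    by (intro posI[of _ "s * t"]) (auto simp: self_adj_scal real_elt_closed mult_left_mono)
qed

text \<open>With positivity expressed by a norm, the witnesses add up and the triangle inequality
  suffices.\<close>

lemma pos_add:
  assumes "pos A h" "pos A k"
  shows "pos A (h \<oplus> k)"
proof -
  obtain s t where st: "s \<ge> 0" "nrm A (real_elt A s \<ominus> h) \<le> s" "t \<ge> 0" "nrm A (real_elt A t \<ominus> k) \<le> t"
    using assms unfolding pos_def by blast
  have "real_elt A (s + t) \<ominus> (h \<oplus> k) = (real_elt A s \<ominus> h) \<oplus> (real_elt A t \<ominus> k)"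
    unfolding real_elt_add[symmetric] using posD(2) assms real_elt_closed by algebra
  then have "nrm A (real_elt A (s + t) \<ominus> (h \<oplus> k)) \<le> s + t"
    using st nrm_add[of "real_elt A s \<ominus> h" "real_elt A t \<ominus> k"] posD(2) assms real_elt_closed by simp
  then show ?thesis using st assms posD self_adj_add by (intro posI[of _ "s + t"]) auto
qed

lemma pos_zero: "pos A \<zero>"
  using pos_square[of \<zero>] by (simp add: self_adj_def)

lemma pos_one: "pos A \<one>"
  using pos_square[of \<one>] by (simp add: self_adj_def)

text \<open>The last clause makes roots usable together: a root is a limit of polynomials in
  \<open>h\<close>, so it commutes with whatever commutes with \<open>h\<close>.\<close>

lemma pos_sqrt:
  assumes "pos A h"
  obtains g where "pos A g" "g \<otimes> g = h"
    "\<And>z. z \<in> carrier A \<Longrightarrow> z \<otimes> h = h \<otimes> z \<Longrightarrow> z \<otimes> g = g \<otimes> z"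
proof -
  note hc = posD[OF assms]
  obtain s where s: "s \<ge> 0" "nrm A (real_elt A s \<ominus> h) \<le> s" using assms unfolding pos_def by blast
  \<comment> \<open>\<open>s\<close> may be 0, and \<open>h\<close> is about to be divided by
    \<open>t\<close>; adding 1 keeps the norm condition because the unit has norm at most 1.\<close>
  define t where "t = s + 1"
  have t: "t > 0" using s by (simp add: t_def)
  have "real_elt A t \<ominus> h = (real_elt A s \<ominus> h) \<oplus> \<one>"
    unfolding t_def real_elt_add[symmetric] real_elt_1 using hc real_elt_closed by algebra
  then have nt: "nrm A (real_elt A t \<ominus> h) \<le> t"
    using s nrm_add[of "real_elt A s \<ominus> h" \<one>] hc real_elt_closed nrm_one_le by (simp add: t_def)
  define k where "k = scal A (complex_of_real (1 / t)) h"
  have k: "k \<in> carrier A" "star A k = k" using hc by (auto simp: k_def scal_closed star_scal)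
  have "\<one> \<ominus> k = scal A (complex_of_real (1 / t)) (real_elt A t \<ominus> h)"
    using t hc by (simp add: k_def scal_diff scal_closed scal_scal scal_one flip: of_real_mult)
  then have nk: "nrm A (\<one> \<ominus> k) \<le> 1" using t nt hc by (simp add: nrm_scal real_elt_closed norm_divide)
  define r where "r = alg_sqrt A k"
  have r: "r \<in> carrier A" "r \<otimes> r = k" "pos A r"
    using k nk alg_sqrt_closed alg_sqrt_square alg_sqrt_self_adj nrm_one_minus_alg_sqrt
    by (auto simp: r_def self_adj_def scal_one intro!: posI[of _ 1])
  show thesis
  proof
    let ?g = "scal A (complex_of_real (sqrt t)) r"
    show "pos A ?g" using t r by (simp add: pos_scal)
    show "?g \<otimes> ?g = h"
      using t r hc by (simp add: scal_mult_left scal_mult_right scal_scal scal_closed k_def scal_one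
          flip: of_real_mult)
    fix z assume z: "z \<in> carrier A" "z \<otimes> h = h \<otimes> z"
    then have "z \<otimes> k = k \<otimes> z" using hc by (simp add: k_def scal_mult_left scal_mult_right)
    then have "z \<otimes> r = r \<otimes> z" using alg_sqrt_intertwine k nk z by (simp add: r_def)
    then show "z \<otimes> ?g = ?g \<otimes> z" using z r by (simp add: scal_mult_left scal_mult_right)
  qed
qed

text \<open>Frees the witness: the definition of \<open>pos\<close> provides some \<open>t\<close>,
  here every bound of the norm serves. Limits of positive elements rely on this.\<close>

lemma pos_nrm_diff:
  assumes "pos A h" "nrm A h \<le> t"
  shows "nrm A (real_elt A t \<ominus> h) \<le> t"
proof -
  obtain g where g: "pos A g" "g \<otimes> g = h" using pos_sqrt assms(1) by blast
  then show ?thesis using real_elt_minus_square_le[of g t] nrm_square[of g] posD assms(2) by auto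
qed

lemma pos_real_elt_diff:
  assumes "self_adj A h" "nrm A h \<le> t"
  shows "pos A (real_elt A t \<ominus> h)"
proof (rule posI)
  have "real_elt A t \<ominus> (real_elt A t \<ominus> h) = h" using self_adjD(1)[OF assms(1)] real_elt_closed by algebra
  then show "nrm A (real_elt A t \<ominus> (real_elt A t \<ominus> h)) \<le> t" using assms by simp
qed (use assms self_adj_diff self_adj_real_elt self_adjD nrm_nonneg order_trans in blast)+

text \<open>Commuting roots \<open>g\<close> of h and \<open>m\<close> of - h satisfy g^2 + m^2 = 0,
  and \<open>nrm_le_sum_squares\<close> at 0 kills \<open>g\<close>.\<close>

lemma pos_antisym:
  assumes "pos A h" "pos A (\<ominus> h)"
  shows "h = \<zero>"
proof -
  note hc = posD[OF assms(1)]
  obtain g where g: "pos A g" "g \<otimes> g = h" using pos_sqrt[OF assms(1)] by metis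
  note gc = posD[OF g(1)]
  obtain m where m: "pos A m" "m \<otimes> m = \<ominus> h"
    and mc: "\<And>z. z \<in> carrier A \<Longrightarrow> z \<otimes> (\<ominus> h) = (\<ominus> h) \<otimes> z \<Longrightarrow> z \<otimes> m = m \<otimes> z"
    using pos_sqrt[OF assms(2)] by metis
  have "g \<otimes> (\<ominus> h) = (\<ominus> h) \<otimes> g" unfolding g(2)[symmetric] using gc by algebra
  then have "g \<otimes> m = m \<otimes> g" using mc gc by blast
  moreover have "g \<otimes> g \<oplus> m \<otimes> m = real_elt A 0" using hc by (simp add: g m scal_zero_left r_neg)
  ultimately have "nrm A g \<le> 0" using nrm_le_sum_squares[of g m 0] g m posD by simp
  then have "g = \<zero>" using nrm_nonneg[of g] nrm_eq_zero[of g] gc by simp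
  then show ?thesis using g(2) by simp
qed

lemma pos_add_eq_zero:
  assumes "pos A h" "pos A k" "h \<oplus> k = \<zero>"
  shows "h = \<zero>"
proof -
  have "k = \<ominus> h" using assms posD(2) by (metis a_comm minus_equality)
  then show ?thesis using pos_antisym assms by blast
qed

text \<open>Again a pair of commuting roots, now with squares adding up to \<open>t\<close>.\<close>

lemma nrm_le_if_pos_diff:
  assumes "pos A p" "pos A (real_elt A t \<ominus> p)" "0 \<le> t"
  shows "nrm A p \<le> t"
proof -
  note pc = posD[OF assms(1)]
  obtain g where g: "pos A g" "g \<otimes> g = p" using pos_sqrt[OF assms(1)] by metis
  note gc = posD[OF g(1)]
  obtain m where m: "pos A m" "m \<otimes> m = real_elt A t \<ominus> p"
    and mc: "\<And>z. z \<in> carrier A \<Longrightarrow> z \<otimes> (real_elt A t \<ominus> p) = (real_elt A t \<ominus> p) \<otimes> z \<Longrightarrow> z \<otimes> m = m \<otimes> z"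
    using pos_sqrt[OF assms(2)] by metis
  have "g \<otimes> (real_elt A t \<ominus> p) = (real_elt A t \<ominus> p) \<otimes> g"
    unfolding g(2)[symmetric] using gc by algebra
  then have "g \<otimes> m = m \<otimes> g" using mc gc by blast
  moreover have "g \<otimes> g \<oplus> m \<otimes> m = real_elt A t" unfolding g m using pc real_elt_closed by algebra
  ultimately have "nrm A g \<le> sqrt t" using nrm_le_sum_squares[of g m t] g m posD assms(3) by simp
  then have "(nrm A g)\<^sup>2 \<le> (sqrt t)\<^sup>2" using nrm_nonneg gc by (intro power_mono) auto
  then show ?thesis using nrm_square[of g] posD g assms(3) by simp
qed

lemma nrm_mono:
  assumes "pos A p" "pos A (q \<ominus> p)" "q \<in> carrier A"
  shows "nrm A p \<le> nrm A q"
proof (rule nrm_le_if_pos_diff[OF assms(1)])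
  have "q = (q \<ominus> p) \<oplus> p" using assms(3) posD(2)[OF assms(1)] by algebra
  then have "pos A q" using pos_add assms by metis
  then have "pos A (real_elt A (nrm A q) \<ominus> q)" using pos_real_elt_diff posD by blast
  then have "pos A ((real_elt A (nrm A q) \<ominus> q) \<oplus> (q \<ominus> p))" using pos_add assms by blast
  moreover have "(real_elt A (nrm A q) \<ominus> q) \<oplus> (q \<ominus> p) = real_elt A (nrm A q) \<ominus> p"
    using assms(3) posD(2)[OF assms(1)] real_elt_closed by algebra
  ultimately show "pos A (real_elt A (nrm A q) \<ominus> p)" by simp
qed (use assms nrm_nonneg in simp)

text \<open>The product of the commuting roots is a self-adjoint root of the product.\<close>

lemma pos_mult:
  assumes "pos A p" "pos A q" "p \<otimes> q = q \<otimes> p"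
  shows "pos A (p \<otimes> q)"
proof -
  note pq = posD(2)[OF assms(1)] posD(2)[OF assms(2)]
  obtain g where g: "pos A g" "g \<otimes> g = p"
    and gc: "\<And>z. z \<in> carrier A \<Longrightarrow> z \<otimes> p = p \<otimes> z \<Longrightarrow> z \<otimes> g = g \<otimes> z"
    using pos_sqrt[OF assms(1)] by metis
  obtain m where m: "pos A m" "m \<otimes> m = q"
    and mc: "\<And>z. z \<in> carrier A \<Longrightarrow> z \<otimes> q = q \<otimes> z \<Longrightarrow> z \<otimes> m = m \<otimes> z"
    using pos_sqrt[OF assms(2)] by metis
  note cl = posD(2)[OF g(1)] posD(2)[OF m(1)]
  have "g \<otimes> q = q \<otimes> g" using gc[of q] pq assms(3) by simp
  then have gm: "g \<otimes> m = m \<otimes> g" using mc[of g] cl by simp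
  have "(g \<otimes> m) \<otimes> (g \<otimes> m) = (g \<otimes> m) \<otimes> (m \<otimes> g)" using gm by simp
  also have "\<dots> = (g \<otimes> q) \<otimes> g" using cl by (simp add: m_assoc flip: m(2))
  also have "\<dots> = p \<otimes> q"
    using cl pq \<open>g \<otimes> q = q \<otimes> g\<close> assms(3) by (simp add: m_assoc g(2))
  finally show ?thesis using pos_square[of "g \<otimes> m"] self_adj_mult posD g m gm by metis
qed

lemma nrm_lim_bounded:
  assumes "nrm_lim A s l" "\<And>n. s n \<in> carrier A"
  obtains b where "b \<ge> 0" "\<And>n. nrm A (s n) \<le> b"
proof -
  have "Bseq (\<lambda>n. nrm A (s n))" using nrm_lim_nrm[OF assms] convergent_def convergent_imp_Bseq by blast
  then obtain b where "b > 0" "\<And>n. norm (nrm A (s n)) \<le> b" unfolding Bseq_def by blast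
  then show thesis using that[of b] by (auto intro: order_trans[OF abs_ge_self])
qed

lemma self_adj_lim:
  assumes "nrm_lim A s l" "\<And>n. self_adj A (s n)"
  shows "self_adj A l"
proof -
  have "nrm_lim A s (star A l)" using nrm_lim_star[OF assms(1)] assms(2) by (simp add: self_adj_def)
  then have "star A l = l" using nrm_lim_unique assms by (metis self_adjD(1))
  then show ?thesis using nrm_limD(1)[OF assms(1)] by (simp add: self_adj_def)
qed

text \<open>A convergent sequence is bounded, so one witness \<open>b\<close> serves all its terms
  and passes to the limit.\<close>

lemma pos_lim:
  assumes "nrm_lim A s l" "\<And>n. pos A (s n)"
  shows "pos A l"
proof -
  have cl: "s n \<in> carrier A" for n using assms(2) posD by blast
  obtain b where b: "b \<ge> 0" "\<And>n. nrm A (s n) \<le> b" using nrm_lim_bounded assms(1) cl by blast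
  have "nrm A (real_elt A b \<ominus> l) \<le> b"
    using pos_nrm_diff[OF assms(2) b(2)] cl real_elt_closed
    by (intro nrm_lim_le[OF nrm_lim_diff[OF nrm_lim_const assms(1)]]) auto
  then show ?thesis using posI[OF self_adj_lim] assms posD b by blast
qed

text \<open>For c = g - k one has (g + k) c = 0, so the positive elements g c^2 and k c^2 add up to
  0 and both vanish. Then c^3 = 0, hence c^4 = 0, and self-adjointness gives c = 0.\<close>

lemma pos_sqrt_unique:
  assumes "pos A g" "pos A k" "g \<otimes> k = k \<otimes> g" "g \<otimes> g = k \<otimes> k"
  shows "g = k"
proof -
  note cl = posD(2)[OF assms(1)] posD(2)[OF assms(2)]
  define c where "c = g \<ominus> k"
  have c: "self_adj A c" "c \<in> carrier A" using assms cl self_adj_diff posD by (auto simp: c_def)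
  have gc: "g \<otimes> c = c \<otimes> g" and kc: "k \<otimes> c = c \<otimes> k"
    using cl assms(3) by (simp_all add: c_def minus_eq l_distr r_distr l_minus r_minus)
  have "g \<otimes> (c \<otimes> c) = (c \<otimes> c) \<otimes> g" "k \<otimes> (c \<otimes> c) = (c \<otimes> c) \<otimes> k"
    using gc kc c cl by (metis m_assoc)+
  then have pos: "pos A (g \<otimes> (c \<otimes> c))" "pos A (k \<otimes> (c \<otimes> c))"
    using pos_mult[OF assms(1) pos_square[OF c(1)]] pos_mult[OF assms(2) pos_square[OF c(1)]]
    by auto
  have "(g \<oplus> k) \<otimes> c = (g \<otimes> g \<ominus> k \<otimes> k) \<oplus> (k \<otimes> g \<ominus> g \<otimes> k)"
    unfolding c_def using cl by algebra
  also have "\<dots> = \<zero>" unfolding assms(3,4) using cl by algebra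
  finally have gk: "(g \<oplus> k) \<otimes> c = \<zero>" .
  have "g \<otimes> (c \<otimes> c) \<oplus> k \<otimes> (c \<otimes> c) = (g \<oplus> k) \<otimes> c \<otimes> c" using c cl by algebra
  then have "g \<otimes> (c \<otimes> c) \<oplus> k \<otimes> (c \<otimes> c) = \<zero>" using gk c by simp
  then have "g \<otimes> (c \<otimes> c) = \<zero>" "k \<otimes> (c \<otimes> c) = \<zero>"
    using pos_add_eq_zero[OF pos] pos_add_eq_zero[OF pos(2,1)] a_comm posD pos by auto
  moreover have "c \<otimes> (c \<otimes> c) = g \<otimes> (c \<otimes> c) \<ominus> k \<otimes> (c \<otimes> c)"
  proof -
    have "(g \<ominus> k) \<otimes> (c \<otimes> c) = g \<otimes> (c \<otimes> c) \<ominus> k \<otimes> (c \<otimes> c)" using c(2) cl by algebra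
    then show ?thesis by (simp add: c_def)
  qed
  ultimately have "c \<otimes> (c \<otimes> c) = \<zero>" by simp
  then have "(c \<otimes> c) \<otimes> (c \<otimes> c) = \<zero>" using c by (simp add: m_assoc)
  then have "c = \<zero>" using c square_eq_zero self_adj_square by blast
  then show ?thesis using cl diff_eq_zeroD by (simp add: c_def)
qed

text \<open>\<open>alg_sqrt_intertwine\<close> speaks of the iterated root only; this identifies the
  iterated root of a square with the given positive element.\<close>

lemma alg_sqrt_square_pos:
  assumes "pos A k" "nrm A k \<le> 1"
  shows "nrm A (\<one> \<ominus> k \<otimes> k) \<le> 1" "alg_sqrt A (k \<otimes> k) = k"
proof -
  note k = posD[OF assms(1)]
  show n: "nrm A (\<one> \<ominus> k \<otimes> k) \<le> 1"
    using real_elt_minus_square_le[OF k(1), of 1] assms k nrm_nonneg[of k]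
    by (simp add: scal_one power_le_one)
  have kk: "k \<otimes> k \<in> carrier A" "star A (k \<otimes> k) = k \<otimes> k" using k by (auto simp: star_mult)
  have "self_adj A (alg_sqrt A (k \<otimes> k))"
    using n kk alg_sqrt_closed alg_sqrt_self_adj by (auto simp: self_adj_def)
  then have "pos A (alg_sqrt A (k \<otimes> k))"
    using posI[of _ 1] nrm_one_minus_alg_sqrt[OF kk(1) n] by (simp add: scal_one)
  moreover have "k \<otimes> (k \<otimes> k) = (k \<otimes> k) \<otimes> k" using k by (simp add: m_assoc)
  then have "k \<otimes> alg_sqrt A (k \<otimes> k) = alg_sqrt A (k \<otimes> k) \<otimes> k"
    using alg_sqrt_intertwine[OF kk(1) n kk(1) n k(2)] by simp
  ultimately show "alg_sqrt A (k \<otimes> k) = k"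
    using pos_sqrt_unique[OF _ assms(1)] alg_sqrt_square[OF kk(1) n] by metis
qed

text \<open>One factor for both elements, so that a relation between them survives the
  rescaling.\<close>

lemma nrm_scale_le_one:
  assumes "a \<in> carrier A" "b \<in> carrier A"
  obtains s where "s > 0" "nrm A (scal A (complex_of_real s) a) \<le> 1"
    "nrm A (scal A (complex_of_real s) b) \<le> 1"
proof
  let ?s = "1 / (1 + nrm A a + nrm A b)"
  note n = nrm_nonneg[OF assms(1)] nrm_nonneg[OF assms(2)]
  show "?s > 0" using n by simp
  show "nrm A (scal A (complex_of_real ?s) a) \<le> 1" "nrm A (scal A (complex_of_real ?s) b) \<le> 1"
    unfolding nrm_scal_real[OF assms(1)] nrm_scal_real[OF assms(2)] using n by auto
qed

text \<open>If \<open>y\<^sup>*y\<close> is negative and \<open>yy\<^sup>*\<close> is positive, then \<open>y\<close> intertwines the square roots of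
  \<open>(y\<^sup>*y)\<^sup>2\<close> and \<open>(yy\<^sup>*)\<^sup>2\<close>, which are \<open>- y\<^sup>*y\<close> and \<open>yy\<^sup>*\<close>.\<close>

lemma eq_zero_if_star_mult_neg:
  assumes y: "y \<in> carrier A" and k: "pos A (\<ominus> (star A y \<otimes> y))" and h: "pos A (y \<otimes> star A y)"
  shows "y = \<zero>"
proof -
  define k where "k = \<ominus> (star A y \<otimes> y)"
  define h where "h = y \<otimes> star A y"
  have cl: "k \<in> carrier A" "h \<in> carrier A" and star: "star A y \<in> carrier A"
    using y star_closed by (auto simp: k_def h_def)
  obtain s where s: "s > 0" "nrm A (scal A (complex_of_real s) k) \<le> 1"
    "nrm A (scal A (complex_of_real s) h) \<le> 1"
    using nrm_scale_le_one[OF cl] by blast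
  define k1 where "k1 = scal A (complex_of_real s) k"
  define h1 where "h1 = scal A (complex_of_real s) h"
  have c1: "k1 \<in> carrier A" "h1 \<in> carrier A" using cl by (auto simp: k1_def h1_def scal_closed)
  have p: "pos A k1" "pos A h1" using s k h by (auto simp: k1_def h1_def k_def h_def intro!: pos_scal)
  have n: "nrm A k1 \<le> 1" "nrm A h1 \<le> 1" using s by (auto simp: k1_def h1_def)
  have "y \<otimes> k = \<ominus> (h \<otimes> y)" unfolding k_def h_def using y star by algebra
  then have yk: "y \<otimes> k1 = \<ominus> (h1 \<otimes> y)"
    using y cl by (simp add: k1_def h1_def scal_mult_left scal_mult_right scal_minus)
  have "y \<otimes> (k1 \<otimes> k1) = \<ominus> (h1 \<otimes> y) \<otimes> k1" using y c1 yk by (metis m_assoc)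
  also have "\<dots> = \<ominus> (h1 \<otimes> (y \<otimes> k1))" using y c1 by algebra
  also have "\<dots> = (h1 \<otimes> h1) \<otimes> y" unfolding yk using y c1 by algebra
  finally have "y \<otimes> alg_sqrt A (k1 \<otimes> k1) = alg_sqrt A (h1 \<otimes> h1) \<otimes> y"
    using alg_sqrt_square_pos(1)[OF p(1) n(1)] alg_sqrt_square_pos(1)[OF p(2) n(2)] c1 y
    by (intro alg_sqrt_intertwine) auto
  then have "y \<otimes> k1 = h1 \<otimes> y"
    using alg_sqrt_square_pos(2)[OF p(1) n(1)] alg_sqrt_square_pos(2)[OF p(2) n(2)] by simp
  then have "y \<otimes> k1 \<oplus> y \<otimes> k1 = \<ominus> (h1 \<otimes> y) \<oplus> h1 \<otimes> y" using yk by simp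
  also have "\<dots> = \<zero>" using y c1 by algebra
  finally have "y \<otimes> k1 = \<zero>" using scal_sum_half[of "y \<otimes> k1"] y c1 by simp
  then have "star A y \<otimes> (y \<otimes> k1) = \<zero>" using star by simp
  then have "scal A (complex_of_real s) (k \<otimes> k) = \<zero>"
    using y star cl by (simp add: k1_def k_def scal_mult_left scal_mult_right l_minus r_minus m_assoc
        scal_minus scal_closed)
  then have "k \<otimes> k = \<zero>"
    using scal_cancel[of "k \<otimes> k" \<zero> "complex_of_real s"] cl s(1) by simp
  then have "k = \<zero>" using square_eq_zero k posD(1) by (simp add: k_def)
  then have "\<ominus> k = \<zero>" by simp
  then have "star A y \<otimes> y = \<zero>" using y star by (simp add: k_def)
  then show ?thesis using star_mult_eq_zero y by blast
qed

text \<open>Twice this element is a^2 + b^2 for the self-adjoint elements a = y + star y and b = i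
  (y - star y).\<close>

lemma pos_star_mult_add:
  assumes y: "y \<in> carrier A"
  shows "pos A (star A y \<otimes> y \<oplus> y \<otimes> star A y)"
proof -
  define z where "z = star A y"
  have z: "z \<in> carrier A" "star A y = z" "star A z = y" using y by (auto simp: z_def star_closed star_star)
  define a where "a = y \<oplus> z"
  define b where "b = scal A \<i> (y \<ominus> z)"
  have sa: "self_adj A a" "self_adj A b"
  proof -
    show "self_adj A a" using y z by (simp add: self_adj_def a_def star_add a_comm)
    have "star A b = scal A (- \<i>) (z \<ominus> y)" using y z by (simp add: b_def star_scal star_diff)
    also have "\<dots> = scal A \<i> (\<ominus> (z \<ominus> y))" using y z by (simp add: scal_minus scal_minus_left)
    also have "\<ominus> (z \<ominus> y) = y \<ominus> z" using y z by algebra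
    finally show "self_adj A b" using y z by (simp add: self_adj_def b_def scal_closed)
  qed
  have "b \<otimes> b = \<ominus> ((y \<ominus> z) \<otimes> (y \<ominus> z))"
    using y z by (simp add: b_def scal_mult_left scal_mult_right scal_scal scal_minus_one scal_closed)
  then have "a \<otimes> a \<oplus> b \<otimes> b = (z \<otimes> y \<oplus> y \<otimes> z) \<oplus> (z \<otimes> y \<oplus> y \<otimes> z)"
    unfolding a_def using y z by algebra
  then have "scal A (complex_of_real (1/2)) (a \<otimes> a \<oplus> b \<otimes> b) = z \<otimes> y \<oplus> y \<otimes> z"
    using scal_sum_half y z by simp
  then show ?thesis
    using pos_scal[OF pos_add[OF pos_square[OF sa(1)] pos_square[OF sa(2)]], of "1/2"]
    by (simp add: z_def)
qed

text \<open>With \<open>h = x\<^sup>*x\<close> and \<open>g = \<bar>h\<bar>\<close>, twice the negative part of \<open>h\<close> is \<open>n = g - h\<close>, and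
  \<open>(xn)\<^sup>*(xn) = - n g n\<close> is negative.\<close>

theorem pos_star_mult:
  assumes x: "x \<in> carrier A"
  shows "pos A (star A x \<otimes> x)"
proof -
  define h where "h = star A x \<otimes> x"
  have h: "self_adj A h" "h \<in> carrier A" using self_adj_star_mult x self_adjD by (auto simp: h_def)
  obtain g where g: "pos A g" "g \<otimes> g = h \<otimes> h"
    and gc: "\<And>z. z \<in> carrier A \<Longrightarrow> z \<otimes> (h \<otimes> h) = (h \<otimes> h) \<otimes> z \<Longrightarrow> z \<otimes> g = g \<otimes> z"
    using pos_sqrt[OF pos_square[OF h(1)]] by metis
  note gcl = posD[OF g(1)]
  have hg: "h \<otimes> g = g \<otimes> h" using gc[of h] h by (simp add: m_assoc)
  obtain r where r: "pos A r" "r \<otimes> r = g"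
    and rc: "\<And>z. z \<in> carrier A \<Longrightarrow> z \<otimes> g = g \<otimes> z \<Longrightarrow> z \<otimes> r = r \<otimes> z"
    using pos_sqrt[OF g(1)] by metis
  note rcl = posD[OF r(1)]
  define n where "n = g \<ominus> h"
  have n: "self_adj A n" "n \<in> carrier A" using self_adj_diff gcl h by (auto simp: n_def)
  have ng: "n \<otimes> g = g \<otimes> n"
    using h gcl hg by (simp add: n_def minus_eq l_distr r_distr l_minus r_minus)
  have nr: "n \<otimes> r = r \<otimes> n" using rc n ng by blast
  have hn: "h \<otimes> n = \<ominus> (g \<otimes> n)"
    using h gcl hg g(2) by (simp add: n_def minus_eq r_distr r_minus minus_add a_comm)
  define y where "y = x \<otimes> n"
  have y: "y \<in> carrier A" using x n by (simp add: y_def)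
  have "star A y \<otimes> y = n \<otimes> (h \<otimes> n)"
    using x n(2) self_adjD(2)[OF n(1)] star_closed by (simp add: y_def star_mult h_def m_assoc)
  then have yy: "\<ominus> (star A y \<otimes> y) = n \<otimes> (g \<otimes> n)" using n gcl by (simp add: hn r_minus)
  also have "\<dots> = (n \<otimes> r) \<otimes> (r \<otimes> n)" using n rcl by (simp add: m_assoc flip: r(2))
  also have "\<dots> = (n \<otimes> r) \<otimes> (n \<otimes> r)" by (simp add: nr)
  finally have neg: "pos A (\<ominus> (star A y \<otimes> y))"
    using pos_square[OF self_adj_mult[OF n(1) posD(1)[OF r(1)] nr]] by simp
  have star: "star A y \<in> carrier A" using y star_closed by blast
  have "(star A y \<otimes> y \<oplus> y \<otimes> star A y) \<oplus> \<ominus> (star A y \<otimes> y) = y \<otimes> star A y"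
    using y star by algebra
  then have "pos A (y \<otimes> star A y)" using pos_add[OF pos_star_mult_add[OF y] neg] by simp
  then have "y = \<zero>" using eq_zero_if_star_mult_neg y neg by blast
  \<comment> \<open>From x n = 0 follow h n = 0 and g n = - h n = 0, so n^2 = g n - h n
    vanishes.\<close>
  then have "h \<otimes> n = \<zero>" using x n star_closed by (simp add: y_def h_def m_assoc)
  then have "g \<otimes> n = \<zero>" using hn n gcl by (metis m_closed minus_minus minus_zero)
  with \<open>h \<otimes> n = \<zero>\<close> have "n \<otimes> n = \<zero>"
    using h gcl n by (simp add: n_def[of] minus_eq l_distr l_minus)
  then have "n = \<zero>" using square_eq_zero n by blast
  then have "g = h" using diff_eq_zeroD gcl h by (simp add: n_def)
  then show ?thesis using g(1) by (simp add: h_def)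
qed

lemma pos_conj:
  assumes "pos A p" "c \<in> carrier A"
  shows "pos A (star A c \<otimes> p \<otimes> c)"
proof -
  obtain g where g: "pos A g" "g \<otimes> g = p" using pos_sqrt assms by metis
  note gc = posD[OF g(1)]
  have "star A (g \<otimes> c) \<otimes> (g \<otimes> c) = star A c \<otimes> p \<otimes> c"
    using gc assms star_closed by (simp add: star_mult m_assoc flip: g(2))
  then show ?thesis using pos_star_mult[of "g \<otimes> c"] gc assms by simp
qed

lemma pos_conj_diff:
  assumes "pos A (q \<ominus> p)" "p \<in> carrier A" "q \<in> carrier A" "c \<in> carrier A"
  shows "pos A (star A c \<otimes> q \<otimes> c \<ominus> star A c \<otimes> p \<otimes> c)"
proof -
  have "star A c \<in> carrier A" using assms star_closed by blast
  then have "star A c \<otimes> (q \<ominus> p) \<otimes> c = star A c \<otimes> q \<otimes> c \<ominus> star A c \<otimes> p \<otimes> c"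
    using assms(2-) by algebra
  then show ?thesis using pos_conj[OF assms(1,4)] by simp
qed

lemma pos_psum: "(\<And>i. pos A (f i)) \<Longrightarrow> pos A (psum A f n)"
  by (induction n) (auto intro: pos_zero pos_add)

text \<open>\<open>P\<close>, \<open>R\<close>, \<open>Q\<close> stand for the inner products of x
  with x, x with y and y with y; the hypothesis is positivity of the square of y + x c. In this form
  it serves Hilbert modules and finite columns alike. The choice c = - R / t, with t at least the
  norm of \<open>P\<close>, is the usual minimizer.\<close>

lemma cauchy_schwarz:
  assumes P: "pos A P" and Q: "Q \<in> carrier A" and R: "R \<in> carrier A"
    and pos: "\<And>c. c \<in> carrier A \<Longrightarrow> pos A (Q \<oplus> star A c \<otimes> R \<oplus> star A R \<otimes> c \<oplus> star A c \<otimes> P \<otimes> c)"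
  shows "(nrm A R)\<^sup>2 \<le> nrm A P * nrm A Q"
proof -
  have main: "(nrm A R)\<^sup>2 \<le> t * nrm A Q" if t: "t > 0" "nrm A P \<le> t" for t
  proof -
    let ?s = "complex_of_real (1 / t)"
    define c where "c = \<ominus> scal A ?s R"
    define w where "w = scal A ?s (star A R \<otimes> R)"
    define v where "v = scal A ?s (scal A ?s (star A R \<otimes> P \<otimes> R))"
    have cl: "P \<in> carrier A" "star A R \<in> carrier A" "c \<in> carrier A" "w \<in> carrier A" "v \<in> carrier A"
      using P R posD star_closed scal_closed by (auto simp: c_def w_def v_def)
    have c: "star A c \<otimes> R = \<ominus> w" "star A R \<otimes> c = \<ominus> w" "star A c \<otimes> P \<otimes> c = v"
      using cl R by (simp_all add: c_def w_def v_def star_minus star_scal scal_closed scal_minus l_minus r_minus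
          scal_mult_left scal_mult_right)
    have "pos A (real_elt A t \<ominus> P)" using pos_real_elt_diff posD P t by blast
    then have "pos A (star A R \<otimes> (real_elt A t \<ominus> P) \<otimes> R)" using pos_conj R by blast
    then have "pos A (scal A (complex_of_real (1/t * (1/t))) (star A R \<otimes> (real_elt A t \<ominus> P) \<otimes> R))"
      using t by (intro pos_scal) auto
    also have "star A R \<otimes> (real_elt A t \<ominus> P) \<otimes> R
        = scal A (complex_of_real t) (star A R \<otimes> R) \<ominus> star A R \<otimes> P \<otimes> R"
      using cl R by (simp add: minus_eq r_distr l_distr l_minus r_minus scal_closed real_elt_mult
          scal_mult_left scal_mult_right)
    also have "scal A (complex_of_real (1/t * (1/t))) \<dots> = w \<ominus> v"
      using cl R t by (simp add: scal_diff w_def v_def scal_scal scal_closed)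
    finally have "pos A (w \<ominus> v)" .
    moreover have "pos A (Q \<oplus> \<ominus> w \<oplus> \<ominus> w \<oplus> v)" using pos[OF cl(3)] unfolding c .
    ultimately have "pos A ((Q \<oplus> \<ominus> w \<oplus> \<ominus> w \<oplus> v) \<oplus> (w \<ominus> v))" using pos_add by blast
    also have "(Q \<oplus> \<ominus> w \<oplus> \<ominus> w \<oplus> v) \<oplus> (w \<ominus> v) = Q \<ominus> w" using cl Q by algebra
    finally have "nrm A w \<le> nrm A Q"
      using nrm_mono[of w Q] pos_scal[OF pos_star_mult[OF R], of "1/t"] Q t by (simp add: w_def)
    then have "(1/t) * (nrm A R)\<^sup>2 \<le> nrm A Q"
      using R cl t nrm_scal_real[of "star A R \<otimes> R" "1/t"] by (simp add: w_def cstar_identity)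
    then show ?thesis using t by (simp add: field_simps)
  qed
  show ?thesis
  proof (cases "nrm A P = 0")
    case False
    then show ?thesis using main[of "nrm A P"] nrm_nonneg posD P by (simp add: less_le)
  next
    \<comment> \<open>Now every t > 0 is admissible, and the value chosen below makes the right-hand
      side smaller than the left.\<close>
    case True
    have "(nrm A R)\<^sup>2 \<le> 0"
    proof (rule ccontr)
      assume "\<not> (nrm A R)\<^sup>2 \<le> 0"
      then have "0 < (nrm A R)\<^sup>2" by simp
      moreover have q: "nrm A Q \<ge> 0" using Q nrm_nonneg by blast
      ultimately have "(nrm A R)\<^sup>2 \<le> (nrm A R)\<^sup>2 / (nrm A Q + 1) * nrm A Q"
        using main[of "(nrm A R)\<^sup>2 / (nrm A Q + 1)"] True by simp
      also have "\<dots> < (nrm A R)\<^sup>2" using \<open>0 < (nrm A R)\<^sup>2\<close> q by (simp add: field_simps)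
      finally show False by simp
    qed
    then show ?thesis using True by simp
  qed
qed

end

section \<open>Averages of powers, and subalgebras\<close>

text \<open>The additive inverse is a description over the carrier, so shrinking the carrier changes
  the term though not its value.\<close>

lemma (in ring) a_inv_subring:
  assumes "ring (R\<lparr>carrier := S, one := e\<rparr>)" "S \<subseteq> carrier R" "x \<in> S"
  shows "\<ominus>\<^bsub>R\<lparr>carrier := S, one := e\<rparr>\<^esub> x = \<ominus> x"
proof -
  interpret S: ring "R\<lparr>carrier := S, one := e\<rparr>" by (rule assms)
  let ?y = "\<ominus>\<^bsub>R\<lparr>carrier := S, one := e\<rparr>\<^esub> x"
  have "?y \<in> S" using S.a_inv_closed assms(3) by simp
  moreover have "?y \<oplus> x = \<zero>" using S.l_neg[of x] assms(3) by simp
  ultimately show ?thesis using minus_equality[of ?y x] assms(2,3) by (metis subsetD)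
qed

context unital_cstar_algebra
begin

lemma psum_one_minus:
  assumes "\<And>k. f k \<in> carrier A"
  shows "psum A (\<lambda>k. \<one> \<ominus> f k) n = real_elt A (real n) \<ominus> psum A f n"
proof (induction n)
  case (Suc n)
  have "real_elt A (real (Suc n)) = real_elt A (real n) \<oplus> \<one>"
    using real_elt_add[of "real n" 1] by (simp add: scal_one add.commute)
  moreover have "psum A f n \<in> carrier A" using psum_closed assms by blast
  ultimately show ?case using assms[of n] real_elt_closed[of "real n"] Suc
    by simp algebra
qed (simp add: scal_zero_left)

lemma pow_telescope:
  assumes "w \<in> carrier A"
  shows "(\<one> \<ominus> w) \<otimes> psum A (\<lambda>k. w [^] k) n = \<one> \<ominus> w [^] (n::nat)"
proof (induction n)
  case (Suc n)
  have "w [^] n \<otimes> w = w \<otimes> w [^] n" using assms by (metis nat_pow_Suc nat_pow_Suc2)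
  moreover have "psum A (\<lambda>k. w [^] k) n \<in> carrier A" using assms by (intro psum_closed) auto
  moreover have "w [^] n \<in> carrier A" using assms by simp
  ultimately show ?case
    using Suc assms by (simp only: psum.simps nat_pow_Suc r_distr minus_closed one_closed) algebra
qed (use assms in simp)

lemma nrm_pow_le: "w \<in> carrier A \<Longrightarrow> nrm A w \<le> 1 \<Longrightarrow> nrm A (w [^] (k::nat)) \<le> 1"
proof (induction k)
  case (Suc k)
  then show ?case using nrm_mult_le[of "w [^] k" w 1 1] by simp
qed (simp add: nrm_one_le)

lemma star_pow: "w \<in> carrier A \<Longrightarrow> star A (w [^] (k::nat)) = star A w [^] k"
proof (induction k)
  case (Suc k)
  then show ?case using nat_pow_Suc2[of "star A w" k] by (simp add: star_mult star_closed)
qed simp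

lemma nrm_psum_le: "(\<And>k. f k \<in> carrier A \<and> nrm A (f k) \<le> 1) \<Longrightarrow> nrm A (psum A f n) \<le> n"
proof (induction n)
  case (Suc n)
  then have "nrm A (psum A f (Suc n)) \<le> nrm A (psum A f n) + nrm A (f n)"
    by (simp add: nrm_add psum_closed)
  also have "\<dots> \<le> real n + 1" using Suc by (intro add_mono) auto
  finally show ?case by simp
qed simp

lemma cstar_subalgebraD:
  assumes "cstar_subalgebra A S"
  shows "S \<subseteq> carrier A" "\<zero> \<in> S" "\<And>a b. a \<in> S \<Longrightarrow> b \<in> S \<Longrightarrow> a \<oplus> b \<in> S"
    "\<And>a b. a \<in> S \<Longrightarrow> b \<in> S \<Longrightarrow> a \<otimes> b \<in> S" "\<And>a. a \<in> S \<Longrightarrow> star A a \<in> S"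
    "\<And>a c. a \<in> S \<Longrightarrow> scal A c a \<in> S" "nrm_closed A S"
  using assms by (auto simp: cstar_subalgebra_def)

lemma cstar_subalgebra_minus:
  assumes "cstar_subalgebra A S" "a \<in> S"
  shows "\<ominus> a \<in> S"
  using cstar_subalgebraD(6)[OF assms, of "-1"] cstar_subalgebraD(1)[OF assms(1)] assms(2)
  by (auto simp: scal_minus_one)

text \<open>The unit \<open>e\<close> of the subalgebra may differ from that of \<open>A\<close>:
  this covers the corner at a projection as well as the Toeplitz algebra.\<close>

lemma cstar_subalgebra_unital:
  assumes S: "cstar_subalgebra A S" and e: "e \<in> S" "\<And>a. a \<in> S \<Longrightarrow> e \<otimes> a = a \<and> a \<otimes> e = a"
  shows "unital_cstar_algebra (A\<lparr>carrier := S, one := e\<rparr>)" (is "unital_cstar_algebra ?S")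
    and "\<And>a b. a \<in> S \<Longrightarrow> b \<in> S \<Longrightarrow> a \<ominus>\<^bsub>A\<lparr>carrier := S, one := e\<rparr>\<^esub> b = a \<ominus> b"
    and "\<And>s l. (\<And>n. s n \<in> S) \<Longrightarrow> nrm_lim (A\<lparr>carrier := S, one := e\<rparr>) s l \<longleftrightarrow> nrm_lim A s l \<and> l \<in> S"
proof -
  note SD = cstar_subalgebraD[OF S]
  have c: "a \<in> carrier A" if "a \<in> S" for a using that SD(1) by blast
  have ring: "ring ?S"
  proof (rule ringI)
    show "abelian_group ?S"
    proof (rule abelian_groupI)
      fix x assume "x \<in> carrier ?S"
      then show "\<exists>y\<in>carrier ?S. y \<oplus>\<^bsub>?S\<^esub> x = \<zero>\<^bsub>?S\<^esub>"
        using c[of x] cstar_subalgebra_minus[OF S] l_neg by (intro bexI[of _ "\<ominus> x"]) auto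
    qed (use SD(2,3) c in \<open>simp_all add: a_ac\<close>)
    show "Group.monoid ?S" using SD c e by (intro monoidI) (auto simp: m_assoc)
  qed (use c in \<open>auto simp: l_distr r_distr\<close>)
  show minus: "a \<ominus>\<^bsub>?S\<^esub> b = a \<ominus> b" if "a \<in> S" "b \<in> S" for a b
    using that a_inv_subring[OF ring SD(1)] by (simp add: a_minus_def)
  show lim: "nrm_lim ?S s l \<longleftrightarrow> nrm_lim A s l \<and> l \<in> S" if "\<And>n. s n \<in> S" for s l
    using that c minus by (auto simp: nrm_lim_def)
  have complete: "\<exists>l. nrm_lim ?S s l"
    if s: "\<And>n. s n \<in> carrier ?S" "\<forall>e>0. \<exists>N. \<forall>m\<ge>N. \<forall>n\<ge>N. nrm ?S (s m \<ominus>\<^bsub>?S\<^esub> s n) < e" for s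
  proof -
    have sS: "s n \<in> S" for n using s(1) by simp
    have "nrm ?S (s m \<ominus>\<^bsub>?S\<^esub> s n) = nrm A (s m \<ominus> s n)" for m n using minus sS by simp
    then obtain l where l: "nrm_lim A s l" using complete[of s] s(2) c sS by auto
    then have "l \<in> S" using nrm_closedD[OF SD(7), of s l] sS by blast
    with l show ?thesis using lim sS by blast
  qed
  show "unital_cstar_algebra ?S"
  proof (intro unital_cstar_algebra.intro[OF ring] unital_cstar_algebra_axioms.intro)
    fix s :: "nat \<Rightarrow> 'a" assume "\<And>n. s n \<in> carrier ?S"
      "\<forall>e>0. \<exists>N. \<forall>m\<ge>N. \<forall>n\<ge>N. nrm ?S (s m \<ominus>\<^bsub>?S\<^esub> s n) < e"
    then show "\<exists>l. nrm_lim ?S s l" by (rule complete)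
  qed (use SD c in \<open>auto simp: scal_add_right scal_add_left scal_scal scal_one scal_mult_left
      scal_mult_right star_star star_add star_scal star_mult nrm_nonneg nrm_eq_zero nrm_scal nrm_add
      nrm_mult cstar_identity\<close>)
qed

lemma cstar_subalgebra_carrier: "cstar_subalgebra A (carrier A)"
  by (auto simp: cstar_subalgebra_def scal_closed star_closed nrm_closed_def nrm_limD)

lemma cstar_gen_least: "cstar_subalgebra A S \<Longrightarrow> G \<subseteq> S \<Longrightarrow> cstar_gen A G \<subseteq> S"
  by (auto simp: cstar_gen_def)

lemma cstar_gen_superset: "G \<subseteq> cstar_gen A G"
  by (auto simp: cstar_gen_def)

lemma cstar_gen_subalgebra:
  assumes "G \<subseteq> carrier A"
  shows "cstar_subalgebra A (cstar_gen A G)"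
proof -
  have sub: "cstar_gen A G \<subseteq> carrier A" by (rule cstar_gen_least[OF cstar_subalgebra_carrier assms])
  have gen: "x \<in> cstar_gen A G \<longleftrightarrow> (\<forall>S. cstar_subalgebra A S \<longrightarrow> G \<subseteq> S \<longrightarrow> x \<in> S)" for x
    by (auto simp: cstar_gen_def)
  have "nrm_closed A (cstar_gen A G)"
    unfolding nrm_closed_def
  proof (intro allI impI, elim conjE)
    fix s l assume s: "\<forall>n. s n \<in> cstar_gen A G" and l: "nrm_lim A s l"
    show "l \<in> cstar_gen A G"
      unfolding gen using s l cstar_subalgebraD(7) nrm_closedD gen by metis
  qed
  then show ?thesis
    unfolding cstar_subalgebra_def using sub cstar_subalgebraD(2-6) by (simp add: gen)
qed

end

section \<open>Homomorphisms and ideals\<close>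

locale cstar_hom = A: unital_cstar_algebra A + B: unital_cstar_algebra B
  for A :: "('a, 'm) cstar_algebra_scheme" (structure)
    and B :: "('b, 'n) cstar_algebra_scheme" (structure) +
  fixes f :: "'a \<Rightarrow> 'b"
  assumes star_hom: "star_hom A B f"
begin

lemma closed: "a \<in> carrier A \<Longrightarrow> f a \<in> carrier B"
  and add: "\<lbrakk>a \<in> carrier A; b \<in> carrier A\<rbrakk> \<Longrightarrow> f (a \<oplus> b) = f a \<oplus>\<^bsub>B\<^esub> f b"
  and mult: "\<lbrakk>a \<in> carrier A; b \<in> carrier A\<rbrakk> \<Longrightarrow> f (a \<otimes> b) = f a \<otimes>\<^bsub>B\<^esub> f b"
  and scal: "a \<in> carrier A \<Longrightarrow> f (scal A c a) = scal B c (f a)"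
  and star: "a \<in> carrier A \<Longrightarrow> f (star A a) = star B (f a)"
  using star_hom by (auto simp: star_hom_def)

lemma zero: "f \<zero> = \<zero>\<^bsub>B\<^esub>"
  using scal[of \<zero> 0] closed[of \<zero>] by (simp add: A.scal_zero_left B.scal_zero_left)

lemma minus: "a \<in> carrier A \<Longrightarrow> f (\<ominus> a) = \<ominus>\<^bsub>B\<^esub> f a"
  using scal[of a "-1"] by (simp add: A.scal_minus_one B.scal_minus_one closed)

lemma diff: "\<lbrakk>a \<in> carrier A; b \<in> carrier A\<rbrakk> \<Longrightarrow> f (a \<ominus> b) = f a \<ominus>\<^bsub>B\<^esub> f b"
  by (simp add: A.minus_eq B.minus_eq add minus)

lemma self_adj: "self_adj A h \<Longrightarrow> self_adj B (f h)"
  by (metis closed self_adj_def star)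

lemma pos: "pos A p \<Longrightarrow> pos B (f p)"
  using A.pos_sqrt B.pos_square self_adj mult A.posD by metis

lemma psum: "(\<And>n. g n \<in> carrier A) \<Longrightarrow> f (psum A g n) = psum B (\<lambda>n. f (g n)) n"
  by (induction n) (auto simp: zero add A.psum_closed)

end

locale unital_cstar_hom = cstar_hom +
  assumes one: "f \<one> = \<one>\<^bsub>B\<^esub>"
begin

text \<open>With \<open>r\<close> a root of 1 - h^2 commuting with \<open>h\<close>, the relation
  h^2 + r^2 = 1 is purely algebraic and survives under \<open>f\<close>, where it bounds the norm
  again.\<close>

lemma nrm_self_adj_le:
  assumes h: "self_adj A h" "nrm A h \<le> 1"
  shows "nrm B (f h) \<le> 1"
proof -
  note hc = A.self_adjD[OF h(1)]
  define k where "k = \<one> \<ominus> h \<otimes> h"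
  have k: "k \<in> carrier A" "star A k = k" using hc by (auto simp: k_def A.star_diff A.star_mult)
  have 1: "\<one> \<ominus> k = h \<otimes> h" unfolding k_def using hc by algebra
  have n: "nrm A (\<one> \<ominus> k) \<le> 1"
    unfolding 1 using h hc A.nrm_nonneg by (simp add: A.nrm_square power_le_one)
  define r where "r = alg_sqrt A k"
  have r: "self_adj A r" "r \<otimes> r = k" "r \<in> carrier A"
    using k n A.alg_sqrt_closed A.alg_sqrt_self_adj A.alg_sqrt_square
    by (auto simp: r_def self_adj_def)
  have "h \<otimes> k = k \<otimes> h" unfolding k_def using hc by algebra
  then have hr: "h \<otimes> r = r \<otimes> h" using A.alg_sqrt_intertwine k n hc by (simp add: r_def)
  have "h \<otimes> h \<oplus> r \<otimes> r = \<one>" unfolding r k_def using hc by algebra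
  then have "f (h \<otimes> h \<oplus> r \<otimes> r) = \<one>\<^bsub>B\<^esub>" using one by simp
  then have "f h \<otimes>\<^bsub>B\<^esub> f h \<oplus>\<^bsub>B\<^esub> f r \<otimes>\<^bsub>B\<^esub> f r = real_elt B 1"
    using hc(1) r(3) by (simp add: B.scal_one add mult)
  moreover have "f h \<otimes>\<^bsub>B\<^esub> f r = f r \<otimes>\<^bsub>B\<^esub> f h" using hc r hr by (simp flip: mult)
  ultimately show ?thesis using B.nrm_le_sum_squares[of "f h" "f r" 1] self_adj h r by simp
qed

text \<open>The C*-identity reduces the claim to the self-adjoint product of \<open>a\<close> with
  its adjoint, scaled to norm 1.\<close>

lemma nrm_le':
  assumes a: "a \<in> carrier A"
  shows "nrm B (f a) \<le> nrm A a"
proof (cases "a = \<zero>")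
  case False
  then have n: "nrm A a > 0" using a A.nrm_nonneg[OF a] A.nrm_eq_zero[OF a] by linarith
  let ?h = "scal A (complex_of_real (1 / (nrm A a)\<^sup>2)) (star A a \<otimes> a)"
  have aa: "star A a \<otimes> a \<in> carrier A" using a A.star_closed by blast
  have "nrm A ?h \<le> 1" using n a A.nrm_scal_real[OF aa, of "1 / (nrm A a)\<^sup>2"] by (simp add: A.cstar_identity)
  then have "nrm B (f ?h) \<le> 1"
    using nrm_self_adj_le[of ?h] A.self_adj_scal A.self_adj_star_mult a by blast
  moreover have "nrm B (f ?h) = 1 / (nrm A a)\<^sup>2 * (nrm B (f a))\<^sup>2"
    using a aa B.nrm_scal_real[OF closed[OF aa], of "1 / (nrm A a)\<^sup>2"] closed
    by (simp add: scal mult star A.star_closed B.cstar_identity)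
  ultimately have "1 / (nrm A a)\<^sup>2 * (nrm B (f a))\<^sup>2 \<le> 1" by simp
  then have "(nrm B (f a))\<^sup>2 \<le> (nrm A a)\<^sup>2" using n by (simp add: field_simps)
  then show ?thesis using n power2_le_imp_le[of _ "nrm A a"] by simp
qed (simp add: zero)

end

context cstar_hom
begin

text \<open>A homomorphism such as \<delta> may fail to be unital. Into the corner cut out by the
  projection \<open>f \<one>\<close> it is unital, and the corner has the norm of
  \<open>B\<close>.\<close>

lemma corner:
  defines "e \<equiv> f \<one>"
  defines "S \<equiv> {b \<in> carrier B. e \<otimes>\<^bsub>B\<^esub> b = b \<and> b \<otimes>\<^bsub>B\<^esub> e = b}"
  shows "unital_cstar_hom A (B\<lparr>carrier := S, one := e\<rparr>) f" "cstar_subalgebra B S"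
    "unital_cstar_algebra (B\<lparr>carrier := S, one := e\<rparr>)" "e \<in> S"
    "\<And>a. a \<in> carrier A \<Longrightarrow> f a \<in> S" "\<And>a. a \<in> S \<Longrightarrow> e \<otimes>\<^bsub>B\<^esub> a = a \<and> a \<otimes>\<^bsub>B\<^esub> e = a"
proof -
  have e: "e \<in> carrier B" "e \<otimes>\<^bsub>B\<^esub> e = e" "star B e = e"
    using mult[of \<one> \<one>] star[of \<one>] closed by (auto simp: e_def)
  show S: "cstar_subalgebra B S"
    unfolding cstar_subalgebra_def
  proof (intro conjI ballI allI)
    show "nrm_closed B S"
      unfolding nrm_closed_def
    proof (intro allI impI, elim conjE)
      fix s l assume s: "\<forall>n. s n \<in> S" and l: "nrm_lim B s l"
      have sc: "s n \<in> carrier B" for n using s by (simp add: S_def)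
      have "nrm_lim B (\<lambda>n. e \<otimes>\<^bsub>B\<^esub> s n) (e \<otimes>\<^bsub>B\<^esub> l)" "nrm_lim B (\<lambda>n. s n \<otimes>\<^bsub>B\<^esub> e) (l \<otimes>\<^bsub>B\<^esub> e)"
        using e sc by (auto intro!: B.nrm_lim_mult B.nrm_lim_const l)
      then have "nrm_lim B s (e \<otimes>\<^bsub>B\<^esub> l)" "nrm_lim B s (l \<otimes>\<^bsub>B\<^esub> e)"
        using s by (simp_all add: S_def)
      then have "e \<otimes>\<^bsub>B\<^esub> l = l" "l \<otimes>\<^bsub>B\<^esub> e = l" by (auto intro: B.nrm_lim_unique l sc)
      then show "l \<in> S" using B.nrm_limD(1)[OF l] by (simp add: S_def)
    qed
    fix a assume a: "a \<in> S"
    then show "star B a \<in> S"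
      using e B.star_mult[of a e] B.star_mult[of e a] by (simp add: S_def B.star_closed)
    show "scal B c a \<in> S" for c
      using a e by (simp add: S_def B.scal_closed B.scal_mult_left B.scal_mult_right)
    fix b assume b: "b \<in> S"
    show "a \<oplus>\<^bsub>B\<^esub> b \<in> S" using a b e by (simp add: S_def B.l_distr B.r_distr)
    have "e \<otimes>\<^bsub>B\<^esub> (a \<otimes>\<^bsub>B\<^esub> b) = a \<otimes>\<^bsub>B\<^esub> b" using a b e by (simp add: S_def B.m_assoc[symmetric])
    moreover have "(a \<otimes>\<^bsub>B\<^esub> b) \<otimes>\<^bsub>B\<^esub> e = a \<otimes>\<^bsub>B\<^esub> b" using a b e by (simp add: S_def B.m_assoc)
    ultimately show "a \<otimes>\<^bsub>B\<^esub> b \<in> S" using a b by (simp add: S_def)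
  qed (auto simp: S_def e)
  show eS: "e \<in> S" by (simp add: S_def e)
  show Se: "e \<otimes>\<^bsub>B\<^esub> a = a \<and> a \<otimes>\<^bsub>B\<^esub> e = a" if "a \<in> S" for a using that by (simp add: S_def)
  note sub = B.cstar_subalgebra_unital[OF S eS Se]
  show un: "unital_cstar_algebra (B\<lparr>carrier := S, one := e\<rparr>)" by (rule sub(1))
  show fS: "f a \<in> S" if "a \<in> carrier A" for a
    using that closed by (simp add: S_def e_def flip: mult)
  show "unital_cstar_hom A (B\<lparr>carrier := S, one := e\<rparr>) f"
    using un fS A.unital_cstar_algebra_axioms add mult scal star
    by (intro unital_cstar_hom.intro cstar_hom.intro cstar_hom_axioms.intro
        unital_cstar_hom_axioms.intro) (auto simp: star_hom_def e_def)
qed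

lemma nrm_le: "a \<in> carrier A \<Longrightarrow> nrm B (f a) \<le> nrm A a"
  using unital_cstar_hom.nrm_le'[OF corner(1)] by simp

lemma lim:
  assumes "nrm_lim A s l" "\<And>n. s n \<in> carrier A"
  shows "nrm_lim B (\<lambda>n. f (s n)) (f l)"
  using A.nrm_limD[OF assms(1)] assms(2) closed nrm_le
  by (intro B.nrm_limI_bound[where c = "\<lambda>n. nrm A (s n \<ominus> l)"]) (auto simp flip: diff)

end

text \<open>The elements on which \<open>f\<close> and \<open>g\<close> agree form a closed
  subalgebra, so no dense set of polynomials has to be described.\<close>

lemma (in cstar_hom) eq_on_gen:
  assumes g: "star_hom A B g" and eq: "\<And>a. a \<in> G \<Longrightarrow> f a = g a" and G: "G \<subseteq> carrier A"
    and a: "a \<in> cstar_gen A G"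
  shows "f a = g a"
proof -
  interpret g: cstar_hom A B g by unfold_locales (rule g)
  let ?S = "{a \<in> carrier A. f a = g a}"
  have "nrm_closed A ?S"
    unfolding nrm_closed_def
  proof (intro allI impI, elim conjE)
    fix s l assume s: "\<forall>n. s n \<in> ?S" and l: "nrm_lim A s l"
    then have sc: "s n \<in> carrier A" for n by blast
    have "nrm_lim B (\<lambda>n. f (s n)) (g l)" using s g.lim[OF l sc] by simp
    then show "l \<in> ?S"
      using B.nrm_lim_unique[OF lim[OF l sc]] closed sc A.nrm_limD(1)[OF l] by blast
  qed
  then have "cstar_subalgebra A ?S"
    by (auto simp: cstar_subalgebra_def zero g.zero add g.add mult g.mult scal g.scal star g.star
        A.scal_closed A.star_closed)
  then show ?thesis using A.cstar_gen_least[of ?S G] a eq G by blast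
qed

section \<open>Closed ideals and approximate units\<close>

locale cstar_ideal = unital_cstar_algebra +
  fixes I
  assumes closed_ideal: "closed_ideal A I"

sublocale cstar_ideal \<subseteq> ideal I A
  using closed_ideal by (simp add: closed_ideal_def)

context cstar_ideal
begin

lemma scal_in: "a \<in> I \<Longrightarrow> scal A c a \<in> I"
  using I_l_closed[of a "scal A c \<one>"] Icarr[of a] by (simp add: scal_closed scal_mult_left)

lemma minus_in: "a \<in> I \<Longrightarrow> \<ominus> a \<in> I"
  using scal_in[of a "-1"] Icarr[of a] by (simp add: scal_minus_one)

lemma diff_in: "a \<in> I \<Longrightarrow> b \<in> I \<Longrightarrow> a \<ominus> b \<in> I"
  by (simp add: minus_eq minus_in)

lemma lim_in: "(\<And>n. s n \<in> I) \<Longrightarrow> nrm_lim A s l \<Longrightarrow> l \<in> I"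
  using closed_ideal nrm_closedD by (auto simp: closed_ideal_def)

lemma psum_in: "(\<And>n. f n \<in> I) \<Longrightarrow> psum A f n \<in> I"
  by (induction n) auto

lemma one_minus_pow_in:
  assumes "w \<in> carrier A" "\<one> \<ominus> w \<in> I"
  shows "\<one> \<ominus> w [^] (k::nat) \<in> I"
proof (induction k)
  case (Suc k)
  have "\<one> \<ominus> w [^] Suc k = (\<one> \<ominus> w [^] k) \<otimes> w \<oplus> (\<one> \<ominus> w)"
    using assms nat_pow_closed[of w k] by (simp only: nat_pow_Suc) algebra
  then show ?case using Suc assms by (auto intro: I_r_closed)
qed simp

text \<open>For self-adjoint \<open>b \<in> I\<close> with \<open>\<parallel>b\<parallel> \<le> 1\<close>, the unitary
  $w = \sqrt{1 - b^2} + \<i>b$ satisfies \<open>1 - w \<in> I\<close> and \<open>2\<i>b = w - w\<^sup>* = - (1 + w\<^sup>*)(1 - w)\<close>, and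
  the averages of its powers are almost killed by \<open>1 - w\<close>.\<close>

lemma approx_unit_unitary:
  assumes b: "self_adj A b" "b \<in> I" "nrm A b \<le> 1"
  obtains w where "w \<in> carrier A" "nrm A w \<le> 1" "\<one> \<ominus> w \<in> I" "\<one> \<ominus> star A w \<in> I"
    "scal A \<i> b \<oplus> scal A \<i> b = \<ominus> ((\<one> \<oplus> star A w) \<otimes> (\<one> \<ominus> w))"
proof -
  note bc = self_adjD[OF b(1)]
  define k where "k = \<one> \<ominus> b \<otimes> b"
  have k: "k \<in> carrier A" "star A k = k" using bc by (auto simp: k_def star_diff star_mult)
  have 1: "\<one> \<ominus> k = b \<otimes> b" unfolding k_def using bc by algebra
  have n: "nrm A (\<one> \<ominus> k) \<le> 1"
    unfolding 1 using b bc nrm_nonneg by (simp add: nrm_square power_le_one)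
  define y where "y = alg_sqrt A k"
  have y: "y \<in> carrier A" "star A y = y" "y \<otimes> y = k"
    using k n alg_sqrt_closed alg_sqrt_self_adj alg_sqrt_square by (auto simp: y_def)
  \<comment> \<open>1 - k = b^2 lies in the ideal, so the root of k also differs from 1 by an
    element of the ideal.\<close>
  have yI: "\<one> \<ominus> y \<in> I" using alg_sqrt_ideal[OF k(1) n closed_ideal] b bc by (simp add: y_def 1 I_l_closed)
  have "b \<otimes> k = k \<otimes> b" unfolding k_def using bc by algebra
  then have byc: "b \<otimes> y = y \<otimes> b" using alg_sqrt_intertwine k n bc by (simp add: y_def)
  define d where "d = scal A \<i> b"
  have d: "d \<in> carrier A" "star A d = \<ominus> d" "d \<otimes> d = \<ominus> (b \<otimes> b)" "d \<otimes> y = y \<otimes> d" "d \<in> I"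
    using bc y byc b scal_in scal_minus_left[of b \<i>] scal_minus_one
    by (auto simp: d_def scal_closed star_scal scal_mult_left scal_mult_right scal_scal)
  define w where "w = y \<oplus> d"
  define v where "v = y \<ominus> d"
  have wv: "w \<in> carrier A" "star A w = v" "v \<in> carrier A"
    using y d by (auto simp: w_def v_def star_add minus_eq)
  have "v \<otimes> w = y \<otimes> y \<ominus> d \<otimes> d \<oplus> (y \<otimes> d \<ominus> d \<otimes> y)" unfolding v_def w_def using y(1) d(1) by algebra
  also have "\<dots> = \<one>" unfolding d(3,4) y(3) k_def using y(1) d(1) bc by algebra
  finally have vw: "v \<otimes> w = \<one>" .
  then have "(nrm A w)\<^sup>2 = nrm A \<one>" using cstar_identity[OF wv(1)] wv(2) by simp
  then have nw: "nrm A w \<le> 1" using nrm_one_le power2_le_imp_le[of "nrm A w" 1] by simp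
  have "\<one> \<ominus> w = (\<one> \<ominus> y) \<ominus> d" "\<one> \<ominus> v = (\<one> \<ominus> y) \<oplus> d" unfolding w_def v_def using y(1) d(1) by algebra+
  then have wI: "\<one> \<ominus> w \<in> I" "\<one> \<ominus> v \<in> I" using yI d(5) diff_in by simp_all
  have "\<ominus> ((\<one> \<oplus> v) \<otimes> (\<one> \<ominus> w)) = \<ominus> (\<one> \<ominus> w \<oplus> v \<ominus> v \<otimes> w)" using wv by algebra
  also have "\<dots> = d \<oplus> d" unfolding vw unfolding w_def v_def using y(1) d(1) by algebra
  finally show thesis using that[OF wv(1) nw] wI wv(2) by (simp add: d_def)
qed

text \<open>Here \<open>e\<close> is the average of 1 - w^k over k < N. That the adjoint of
  \<open>e\<close> lies in \<open>I\<close> is stated separately, since an ideal is not self-adjoint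
  by definition; \<open>star_in\<close> is deduced from this clause.\<close>

lemma approx_unit_self_adj:
  assumes b: "self_adj A b" "b \<in> I" "nrm A b \<le> 1" and N: "N > 0"
  obtains e where "e \<in> I" "star A e \<in> I" "nrm A (\<one> \<ominus> e) \<le> 1" "nrm A (b \<otimes> (\<one> \<ominus> e)) \<le> 2 / real N"
proof -
  obtain w where w: "w \<in> carrier A" "nrm A w \<le> 1" "\<one> \<ominus> w \<in> I" "\<one> \<ominus> star A w \<in> I"
    and bw: "scal A \<i> b \<oplus> scal A \<i> b = \<ominus> ((\<one> \<oplus> star A w) \<otimes> (\<one> \<ominus> w))"
    using approx_unit_unitary[OF b] by blast
  let ?c = "complex_of_real (1 / real N)"
  define p where "p = psum A (\<lambda>k. w [^] k) N"
  define e where "e = scal A ?c (psum A (\<lambda>k. \<one> \<ominus> w [^] k) N)"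
  define g where "g = scal A ?c p"
  have wk: "w [^] k \<in> carrier A" for k :: nat using w by simp
  have p: "p \<in> carrier A" unfolding p_def using psum_closed[OF wk] .
  have g: "g \<in> carrier A" using p by (simp add: g_def scal_closed)
  have "e = scal A ?c (real_elt A (real N) \<ominus> p)" by (simp only: e_def p_def psum_one_minus[OF wk])
  also have "\<dots> = \<one> \<ominus> g"
    using p N by (simp add: scal_diff g_def scal_closed scal_scal scal_one)
  finally have e: "e = \<one> \<ominus> g" .
  have 1: "\<one> \<ominus> e = g" unfolding e using g by algebra
  show thesis
  proof
    show "e \<in> I" unfolding e_def using w one_minus_pow_in by (intro scal_in psum_in) auto
    have "star A (psum A (\<lambda>k. \<one> \<ominus> w [^] k) n) = psum A (\<lambda>k. \<one> \<ominus> star A w [^] k) n" for n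
      using w by (induction n) (auto simp: star_add star_diff star_pow psum_closed)
    then have "star A e = scal A ?c (psum A (\<lambda>k. \<one> \<ominus> star A w [^] k) N)"
      using w by (simp add: e_def star_scal psum_closed)
    then show "star A e \<in> I"
      using w one_minus_pow_in[of "star A w"] star_closed by (auto intro!: scal_in psum_in)
    have "nrm A p \<le> N" unfolding p_def using w nrm_pow_le by (intro nrm_psum_le) auto
    then show "nrm A (\<one> \<ominus> e) \<le> 1"
      unfolding 1 g_def nrm_scal_real[OF p] using N by (simp add: field_simps)
    have bc: "b \<in> carrier A" using b Icarr by blast
    have sw: "star A w \<in> carrier A" using w star_closed by blast
    have "(\<one> \<ominus> w) \<otimes> g = scal A ?c (\<one> \<ominus> w [^] N)"
      using w p pow_telescope[OF w(1), of N] by (simp add: g_def p_def scal_mult_right)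
    moreover have "nrm A (\<one> \<ominus> w [^] N) \<le> 2"
      using nrm_diff[of \<one> "w [^] N"] nrm_one_le nrm_pow_le[OF w(1,2), of N] w by simp
    ultimately have wg: "nrm A ((\<one> \<ominus> w) \<otimes> g) \<le> 2 / N"
      using N nrm_scal_real[of "\<one> \<ominus> w [^] N" "1 / real N"] w by (simp add: divide_right_mono)
    have dd: "scal A \<i> b \<oplus> scal A \<i> b = scal A (2 * \<i>) b"
      using bc by (simp flip: scal_add_left)
    have "nrm A (\<one> \<oplus> star A w) \<le> 2"
      using nrm_add[of \<one> "star A w"] nrm_one_le w nrm_star sw by simp
    \<comment> \<open>A factor 2 from 1 + star w, 2/N from the telescoped average, and 2 i b instead
      of b on the other side: together 2/N.\<close>
    then have "nrm A ((\<one> \<oplus> star A w) \<otimes> ((\<one> \<ominus> w) \<otimes> g)) \<le> 2 * (2 / N)"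
      using wg w g sw by (intro nrm_mult_le) auto
    also have "(\<one> \<oplus> star A w) \<otimes> ((\<one> \<ominus> w) \<otimes> g) = \<ominus> (scal A (2 * \<i>) b \<otimes> g)"
      unfolding bw[symmetric, unfolded dd, symmetric] using sw w g by (simp add: bw l_minus m_assoc flip: dd)
    finally show "nrm A (b \<otimes> (\<one> \<ominus> e)) \<le> 2 / real N"
      unfolding 1 using bc g by (simp add: nrm_minus scal_closed scal_mult_left nrm_scal norm_mult)
  qed
qed

text \<open>By the C*-identity it suffices to treat c = star x x: for the contraction g = 1 - e, the
  squared norm of x g is at most the norm of c g.\<close>

lemma approx_unit:
  assumes x: "x \<in> I" and eps: "\<epsilon> > 0"
  obtains e where "e \<in> I" "star A e \<in> I" "nrm A (\<one> \<ominus> e) \<le> 1" "nrm A (x \<otimes> (\<one> \<ominus> e)) < \<epsilon>"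
proof -
  have xc: "x \<in> carrier A" "star A x \<in> carrier A" using x Icarr star_closed by auto
  define c where "c = star A x \<otimes> x"
  have c: "self_adj A c" "c \<in> carrier A" "c \<in> I"
    using xc x self_adj_star_mult I_l_closed by (auto simp: c_def)
  obtain s where s: "s > 0" "nrm A (scal A (complex_of_real s) c) \<le> 1"
    using nrm_scale_le_one[OF c(2) c(2)] by blast
  obtain N :: nat where N: "N > 0" "2 / real N < s * \<epsilon>\<^sup>2"
  proof -
    obtain N where "2 / (s * \<epsilon>\<^sup>2) < real N" using reals_Archimedean2 by blast
    moreover from this have "real N > 0" using s eps by (smt (verit) divide_pos_pos mult_pos_pos zero_less_power)
    ultimately show thesis using that[of N] s eps by (simp add: field_simps)
  qed
  obtain e where e: "e \<in> I" "star A e \<in> I" "nrm A (\<one> \<ominus> e) \<le> 1"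
    "nrm A (scal A (complex_of_real s) c \<otimes> (\<one> \<ominus> e)) \<le> 2 / real N"
    using approx_unit_self_adj[OF self_adj_scal[OF c(1)] scal_in[OF c(3)] s(2) N(1)] by blast
  have ec: "\<one> \<ominus> e \<in> carrier A" using e Icarr by simp
  have ce: "c \<otimes> (\<one> \<ominus> e) \<in> carrier A" using c ec by simp
  have "(nrm A (x \<otimes> (\<one> \<ominus> e)))\<^sup>2 = nrm A (star A (\<one> \<ominus> e) \<otimes> (c \<otimes> (\<one> \<ominus> e)))"
    using xc ec star_closed[OF ec] by (simp add: star_mult c_def m_assoc flip: cstar_identity)
  also have "\<dots> \<le> 1 * nrm A (c \<otimes> (\<one> \<ominus> e))"
    using ec ce e nrm_star[OF ec] star_closed[OF ec] by (intro nrm_mult_le) auto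
  also have "\<dots> < \<epsilon>\<^sup>2"
  proof -
    have "s * nrm A (c \<otimes> (\<one> \<ominus> e)) \<le> 2 / real N"
      using e(4) s c ec nrm_scal_real[OF ce, of s] by (simp add: scal_mult_left)
    also have "\<dots> < s * \<epsilon>\<^sup>2" by (rule N(2))
    finally show ?thesis using s(1) by simp
  qed
  finally have "nrm A (x \<otimes> (\<one> \<ominus> e)) < \<epsilon>" using eps by (simp add: power2_less_imp_less)
  with e that show thesis by blast
qed

text \<open>As x (1 - e_n) tends to 0, taking adjoints shows that star e_n star x tends to star x;
  these products lie in the ideal because star e_n does.\<close>

lemma star_in:
  assumes x: "x \<in> I"
  shows "star A x \<in> I"
proof -
  have xc: "x \<in> carrier A" "star A x \<in> carrier A" using x Icarr star_closed by auto
  have "\<exists>e. e \<in> I \<and> star A e \<in> I \<and> nrm A (x \<otimes> (\<one> \<ominus> e)) < inverse (Suc n)" for n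
    using approx_unit[OF x, of "inverse (Suc n)"] by (metis inverse_positive_iff_positive of_nat_0_less_iff zero_less_Suc)
  then obtain e where e: "\<And>n. e n \<in> I" "\<And>n. star A (e n) \<in> I"
    "\<And>n. nrm A (x \<otimes> (\<one> \<ominus> e n)) < inverse (Suc n)" by metis
  have "nrm_lim A (\<lambda>n. star A (e n) \<otimes> star A x) (star A x)"
  proof (rule nrm_limI_bound[OF xc(2) _ _ LIMSEQ_inverse_real_of_nat])
    show "\<forall>\<^sub>F n in sequentially. nrm A (star A (e n) \<otimes> star A x \<ominus> star A x) \<le> inverse (Suc n)"
    proof (intro always_eventually allI)
      fix n
      have ec: "e n \<in> carrier A" using e Icarr by blast
      have "star A (e n) \<otimes> star A x \<ominus> star A x = \<ominus> star A (x \<otimes> (\<one> \<ominus> e n))"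
        using ec xc(1) by algebra
      then show "nrm A (star A (e n) \<otimes> star A x \<ominus> star A x) \<le> inverse (Suc n)"
        using e(3)[of n] ec xc by (simp add: nrm_minus star_closed nrm_star)
    qed
  qed (use e Icarr xc in auto)
  then show ?thesis using lim_in[of "\<lambda>n. star A (e n) \<otimes> star A x"] e xc I_r_closed by blast
qed

end

section \<open>Quotients\<close>

context cstar_ideal
begin

abbreviation coset :: "'a \<Rightarrow> 'a set" where "coset a \<equiv> I +> a"

abbreviation Q :: "'a set cstar_algebra" where "Q \<equiv> cstar_quotient A I"

lemma mem_coset: "b \<in> coset a \<longleftrightarrow> (\<exists>i\<in>I. b = i \<oplus> a)"
  by (auto simp: a_r_coset_def')

lemma coset_eq_iff:
  assumes "a \<in> carrier A" "b \<in> carrier A"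
  shows "coset a = coset b \<longleftrightarrow> a \<ominus> b \<in> I"
  using quotient_eq_iff_same_a_r_cos[OF is_ideal assms] by simp

lemma Q_simps:
  "mult Q = rcoset_mult A I" "one Q = coset \<one>" "zero Q = I" "add Q = set_add A"
  "carrier Q = coset ` carrier A"
  "scal Q = (\<lambda>c X. \<Union>a\<in>X. coset (scal A c a))" "star Q = (\<lambda>X. \<Union>a\<in>X. coset (star A a))"
  "nrm Q = (\<lambda>X. INF a\<in>X. nrm A a)"
  by (auto simp: cstar_quotient_def ring.extend_def cstar_algebra.fields_def FactRing_simps)

lemma coset_closed: "a \<in> carrier A \<Longrightarrow> coset a \<in> carrier Q"
  by (simp add: Q_simps)

lemma coset_add: "\<lbrakk>a \<in> carrier A; b \<in> carrier A\<rbrakk> \<Longrightarrow> coset a \<oplus>\<^bsub>Q\<^esub> coset b = coset (a \<oplus> b)"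
  by (simp add: Q_simps a_rcos_sum)

lemma coset_mult: "\<lbrakk>a \<in> carrier A; b \<in> carrier A\<rbrakk> \<Longrightarrow> coset a \<otimes>\<^bsub>Q\<^esub> coset b = coset (a \<otimes> b)"
  by (simp add: Q_simps rcoset_mult_add)

lemma coset_zero: "coset \<zero> = \<zero>\<^bsub>Q\<^esub>"
  using a_coset_add_zero a_subset by (simp add: Q_simps)

text \<open>The operations of \<open>cstar_quotient\<close> are unions over representatives, which
  collapse when all the cosets agree.\<close>

lemma coset_UN:
  assumes "a \<in> carrier A" "\<And>b. b \<in> coset a \<Longrightarrow> coset (g b) = coset (g a)"
  shows "(\<Union>b\<in>coset a. coset (g b)) = coset (g a)"
  using assms a_rcos_self by blast

lemma coset_carrier: "a \<in> carrier A \<Longrightarrow> b \<in> coset a \<Longrightarrow> b \<in> carrier A"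
  by (auto simp: mem_coset Icarr)

lemma coset_diff_in: "a \<in> carrier A \<Longrightarrow> b \<in> coset a \<Longrightarrow> b \<ominus> a \<in> I"
proof -
  assume a: "a \<in> carrier A" "b \<in> coset a"
  then obtain i where i: "i \<in> I" "b = i \<oplus> a" by (auto simp: mem_coset)
  moreover have "i \<oplus> a \<ominus> a = i" using i Icarr a by algebra
  ultimately show ?thesis by simp
qed

lemma coset_scal: "a \<in> carrier A \<Longrightarrow> scal Q c (coset a) = coset (scal A c a)"
  unfolding Q_simps
proof (rule coset_UN)
  fix b assume "a \<in> carrier A" "b \<in> coset a"
  then show "coset (scal A c b) = coset (scal A c a)"
    using coset_carrier coset_diff_in scal_in by (simp add: coset_eq_iff scal_closed flip: scal_diff)
qed

lemma coset_star: "a \<in> carrier A \<Longrightarrow> star Q (coset a) = coset (star A a)"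
  unfolding Q_simps
proof (rule coset_UN)
  fix b assume "a \<in> carrier A" "b \<in> coset a"
  then show "coset (star A b) = coset (star A a)"
    using coset_carrier coset_diff_in star_in by (simp add: coset_eq_iff star_closed flip: star_diff)
qed

lemma ring_Q: "ring Q"
proof -
  interpret R: ring "A Quot I" by (rule quotient_is_ring)
  have eq: "carrier Q = carrier (A Quot I)" "mult Q = mult (A Quot I)" "one Q = one (A Quot I)"
    "zero Q = zero (A Quot I)" "add Q = add (A Quot I)"
    by (auto simp: cstar_quotient_def ring.extend_def)
  show ?thesis
  proof (rule ringI)
    show "abelian_group Q"
    proof (rule abelian_groupI)
      fix x assume "x \<in> carrier Q"
      then show "\<exists>y\<in>carrier Q. y \<oplus>\<^bsub>Q\<^esub> x = \<zero>\<^bsub>Q\<^esub>"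
        unfolding eq using R.l_neg by blast
    qed (simp_all add: eq R.a_ac)
    show "Group.monoid Q" by (rule monoidI) (simp_all add: eq R.m_assoc)
  qed (simp_all add: eq R.l_distr R.r_distr)
qed

lemma coset_minus: "a \<in> carrier A \<Longrightarrow> \<ominus>\<^bsub>Q\<^esub> coset a = coset (\<ominus> a)"
proof -
  interpret Q: ring Q by (rule ring_Q)
  assume a: "a \<in> carrier A"
  then have "coset (\<ominus> a) \<oplus>\<^bsub>Q\<^esub> coset a = \<zero>\<^bsub>Q\<^esub>" by (simp add: coset_add l_neg coset_zero)
  then show ?thesis using Q.minus_equality a coset_closed by simp
qed

lemma coset_diff: "\<lbrakk>a \<in> carrier A; b \<in> carrier A\<rbrakk> \<Longrightarrow> coset a \<ominus>\<^bsub>Q\<^esub> coset b = coset (a \<ominus> b)"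
  by (simp add: a_minus_def[of Q] coset_minus coset_add minus_eq)

lemma bdd_below_coset: "a \<in> carrier A \<Longrightarrow> bdd_below (nrm A ` coset a)"
  using coset_carrier nrm_nonneg by (intro bdd_belowI2[of _ 0]) blast

lemma coset_nonempty: "a \<in> carrier A \<Longrightarrow> coset a \<noteq> {}"
  using a_rcos_self by blast

lemma nrm_coset_le:
  assumes "a \<in> carrier A" "b \<in> coset a"
  shows "nrm Q (coset a) \<le> nrm A b"
  unfolding Q_simps
  using assms by (intro cINF_lower bdd_below_coset)

lemma nrm_coset_le_self: "a \<in> carrier A \<Longrightarrow> nrm Q (coset a) \<le> nrm A a"
  using nrm_coset_le a_rcos_self by blast

lemma nrm_coset_approx:
  assumes "a \<in> carrier A" "nrm Q (coset a) < t"
  obtains b where "b \<in> coset a" "b \<in> carrier A" "coset b = coset a" "nrm A b < t"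
proof -
  have "\<exists>b\<in>coset a. nrm A b < t"
    using assms cINF_less_iff[OF coset_nonempty[OF assms(1)] bdd_below_coset[OF assms(1)], of t]
    by (simp add: Q_simps)
  then obtain b where b: "b \<in> coset a" "nrm A b < t" by blast
  then show thesis
    using that[of b] assms coset_carrier coset_diff_in coset_eq_iff by blast
qed

lemma nrm_coset_nonneg: "a \<in> carrier A \<Longrightarrow> 0 \<le> nrm Q (coset a)"
  unfolding Q_simps
  using coset_nonempty coset_carrier nrm_nonneg by (intro cINF_greatest) blast+

lemma nrm_coset_greatest:
  assumes "a \<in> carrier A" "\<And>b. b \<in> carrier A \<Longrightarrow> coset b = coset a \<Longrightarrow> c \<le> nrm A b"
  shows "c \<le> nrm Q (coset a)"
proof (rule ccontr)
  assume "\<not> c \<le> nrm Q (coset a)"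
  then obtain b where "b \<in> carrier A" "coset b = coset a" "nrm A b < c"
    using nrm_coset_approx[OF assms(1), of c] by auto
  then show False using assms(2)[of b] by simp
qed

lemma nrm_coset_eq_zero:
  assumes a: "a \<in> carrier A" "nrm Q (coset a) = 0"
  shows "a \<in> I"
proof -
  have "\<exists>b. b \<in> coset a \<and> nrm A b < inverse (Suc n)" for n
    using nrm_coset_approx[OF a(1), of "inverse (Suc n)"] a(2)
    by (metis inverse_positive_iff_positive of_nat_0_less_iff zero_less_Suc)
  then obtain b where b: "\<And>n. b n \<in> coset a" "\<And>n. nrm A (b n) < inverse (Suc n)" by metis
  have bc: "b n \<in> carrier A" for n using b a coset_carrier by blast
  have "nrm_lim A (\<lambda>n. b n \<ominus> a) (\<ominus> a)"
  proof (rule nrm_limI_bound[OF _ _ _ LIMSEQ_inverse_real_of_nat])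
    have "b n \<ominus> a \<ominus> \<ominus> a = b n" for n using bc[of n] a by algebra
    then show "\<forall>\<^sub>F n in sequentially. nrm A (b n \<ominus> a \<ominus> \<ominus> a) \<le> inverse (Suc n)"
      using b(2) by (simp add: less_imp_le)
  qed (use a bc in auto)
  then have "\<ominus> a \<in> I" using lim_in[of "\<lambda>n. b n \<ominus> a"] coset_diff_in a b by blast
  then show ?thesis using minus_in[of "\<ominus> a"] a by simp
qed

text \<open>For a representative \<open>b\<close> of the coset of star a a, choose \<open>e\<close>
  as an approximate unit for x = star a a - b. Then a (1 - e) represents the coset of
  \<open>a\<close>, and its squared norm exceeds the norm of \<open>b\<close> by at most
  \<epsilon>.\<close>

lemma nrm_coset_cstar:
  assumes a: "a \<in> carrier A"
  shows "(nrm Q (coset a))\<^sup>2 \<le> nrm Q (coset (star A a \<otimes> a))"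
proof (rule nrm_coset_greatest)
  fix b assume b: "b \<in> carrier A" "coset b = coset (star A a \<otimes> a)"
  have aa: "star A a \<otimes> a \<in> carrier A" using a star_closed by blast
  define x where "x = star A a \<otimes> a \<ominus> b"
  have x: "x \<in> I" "x \<in> carrier A"
    using b aa coset_eq_iff[OF aa b(1)] by (simp_all add: x_def)
  show "(nrm Q (coset a))\<^sup>2 \<le> nrm A b"
  proof (rule field_le_epsilon)
    fix \<epsilon> :: real assume "\<epsilon> > 0"
    then obtain e where e: "e \<in> I" "nrm A (\<one> \<ominus> e) \<le> 1" "nrm A (x \<otimes> (\<one> \<ominus> e)) < \<epsilon>"
      using approx_unit[OF x(1)] by metis
    define g where "g = \<one> \<ominus> e"
    have g: "g \<in> carrier A" "nrm A g \<le> 1" using e Icarr by (auto simp: g_def)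
    have "a \<otimes> g = \<ominus> (a \<otimes> e) \<oplus> a" unfolding g_def using a e Icarr by algebra
    then have "a \<otimes> g \<in> coset a" using e a I_l_closed minus_in by (auto simp: mem_coset)
    then have "(nrm Q (coset a))\<^sup>2 \<le> (nrm A (a \<otimes> g))\<^sup>2"
      using a nrm_coset_le nrm_coset_nonneg by (intro power_mono) auto
    also have "\<dots> = nrm A (star A g \<otimes> (star A a \<otimes> a \<otimes> g))"
      using a g star_closed by (simp add: star_mult m_assoc flip: cstar_identity)
    also have "\<dots> \<le> 1 * nrm A (star A a \<otimes> a \<otimes> g)"
      using a g star_closed nrm_star by (intro nrm_mult_le) auto
    also have "star A a \<otimes> a \<otimes> g = b \<otimes> g \<oplus> x \<otimes> g"
      unfolding x_def using b aa g(1) by algebra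
    also have "1 * nrm A (b \<otimes> g \<oplus> x \<otimes> g) \<le> nrm A (b \<otimes> g) + nrm A (x \<otimes> g)"
      using b x g by (simp add: nrm_add)
    also have "\<dots> \<le> nrm A b * 1 + \<epsilon>"
      using b x g e by (intro add_mono nrm_mult_le) (auto simp: g_def)
    finally show "(nrm Q (coset a))\<^sup>2 \<le> nrm A b + \<epsilon>" by simp
  qed
qed (use a star_closed in auto)

lemma nrm_coset_add:
  assumes a: "a \<in> carrier A" and b: "b \<in> carrier A"
  shows "nrm Q (coset (a \<oplus> b)) \<le> nrm Q (coset a) + nrm Q (coset b)"
proof (rule field_le_epsilon)
  fix \<epsilon> :: real assume "\<epsilon> > 0"
  then have "nrm Q (coset a) < nrm Q (coset a) + \<epsilon> / 2" "nrm Q (coset b) < nrm Q (coset b) + \<epsilon> / 2"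
    by simp_all
  then obtain a' b' where
    a': "a' \<in> carrier A" "coset a' = coset a" "nrm A a' < nrm Q (coset a) + \<epsilon> / 2" and
    b': "b' \<in> carrier A" "coset b' = coset b" "nrm A b' < nrm Q (coset b) + \<epsilon> / 2"
    by (metis nrm_coset_approx a b)
  have "nrm Q (coset (a' \<oplus> b')) \<le> nrm A a' + nrm A b'"
    using nrm_coset_le_self[of "a' \<oplus> b'"] nrm_add[of a' b'] a' b' by simp
  also have "coset (a' \<oplus> b') = coset (a \<oplus> b)" using a a' b b' by (metis coset_add)
  finally show "nrm Q (coset (a \<oplus> b)) \<le> nrm Q (coset a) + nrm Q (coset b) + \<epsilon>"
    using a' b' by linarith
qed

text \<open>The infimum is taken in one factor at a time; a factor of norm 0 cannot be divided out
  and is treated separately.\<close>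

lemma nrm_coset_mult:
  assumes a: "a \<in> carrier A" and b: "b \<in> carrier A"
  shows "nrm Q (coset (a \<otimes> b)) \<le> nrm Q (coset a) * nrm Q (coset b)"
proof -
  have step: "nrm Q (coset (a \<otimes> b)) \<le> nrm A a' * nrm A b'"
    if "a' \<in> carrier A" "coset a' = coset a" "b' \<in> carrier A" "coset b' = coset b" for a' b'
  proof -
    have "coset (a' \<otimes> b') = coset (a \<otimes> b)" using a b that by (metis coset_mult)
    then show ?thesis using nrm_coset_le_self[of "a' \<otimes> b'"] nrm_mult[of a' b'] that by simp
  qed
  have *: "nrm Q (coset (a \<otimes> b)) \<le> nrm A a' * nrm Q (coset b)"
    if a': "a' \<in> carrier A" "coset a' = coset a" for a'
  proof (cases "nrm A a' = 0")
    case True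
    then show ?thesis using step[OF a' b] by simp
  next
    case False
    then have p: "nrm A a' > 0" using a' nrm_nonneg[of a'] by simp
    have "nrm Q (coset (a \<otimes> b)) / nrm A a' \<le> nrm Q (coset b)"
      using step[OF a'] p b by (intro nrm_coset_greatest) (auto simp: field_simps)
    then show ?thesis using p by (simp add: field_simps)
  qed
  show ?thesis
  proof (cases "nrm Q (coset b) = 0")
    case True
    then show ?thesis using *[OF a] by simp
  next
    case False
    then have p: "nrm Q (coset b) > 0" using b nrm_coset_nonneg[of b] by simp
    have "nrm Q (coset (a \<otimes> b)) / nrm Q (coset b) \<le> nrm Q (coset a)"
      using * p a by (intro nrm_coset_greatest) (auto simp: field_simps)
    then show ?thesis using p by (simp add: field_simps)
  qed
qed

lemma nrm_coset_scal:
  assumes a: "a \<in> carrier A"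
  shows "nrm Q (coset (scal A c a)) = cmod c * nrm Q (coset a)"
proof -
  have le: "nrm Q (coset (scal A d b)) \<le> cmod d * nrm Q (coset b)" if b: "b \<in> carrier A" for d b
  proof (cases "d = 0")
    case True
    then show ?thesis using b nrm_coset_le_self[of \<zero>] by (simp add: scal_zero_left)
  next
    case False
    then have p: "cmod d > 0" by simp
    have "nrm Q (coset (scal A d b)) / cmod d \<le> nrm Q (coset b)"
    proof (rule nrm_coset_greatest[OF b])
      fix b' assume b': "b' \<in> carrier A" "coset b' = coset b"
      then have "nrm Q (coset (scal A d b)) \<le> cmod d * nrm A b'"
        using b nrm_coset_le_self[of "scal A d b'"] by (metis coset_scal nrm_scal scal_closed)
      then show "nrm Q (coset (scal A d b)) / cmod d \<le> nrm A b'" using p by (simp add: field_simps)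
    qed
    then show ?thesis using p by (simp add: field_simps)
  qed
  show ?thesis
  proof (cases "c = 0")
    case True
    then show ?thesis using le[OF a, of 0] nrm_coset_nonneg[OF scal_closed[OF a], of 0] by simp
  next
    case False
    have "nrm Q (coset a) \<le> cmod (1 / c) * nrm Q (coset (scal A c a))"
      using le[OF scal_closed[OF a], of "1/c" c] a False by (simp add: scal_scal scal_one)
    then have "cmod c * nrm Q (coset a) \<le> nrm Q (coset (scal A c a))"
      using False by (simp add: norm_divide field_simps)
    then show ?thesis using le[OF a, of c] by simp
  qed
qed

lemma nrm_coset_star: "a \<in> carrier A \<Longrightarrow> nrm Q (coset (star A a)) = nrm Q (coset a)"
proof -
  have le: "nrm Q (coset (star A b)) \<le> nrm Q (coset b)" if b: "b \<in> carrier A" for b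
  proof (rule nrm_coset_greatest[OF b])
    fix b' assume b': "b' \<in> carrier A" "coset b' = coset b"
    then show "nrm Q (coset (star A b)) \<le> nrm A b'"
      using b nrm_coset_le_self[of "star A b'"] by (metis coset_star nrm_star star_closed)
  qed
  assume "a \<in> carrier A"
  then show ?thesis using le[of a] le[of "star A a"] by (simp add: star_closed star_star)
qed

text \<open>Along a fast subsequence the cosets are lifted one after the other, each lift being the
  previous one plus a small representative of the difference; such lifts converge in
  \<open>A\<close>.\<close>

lemma Q_complete:
  assumes s: "\<And>n. s n \<in> carrier Q" and cauchy: "\<forall>e>0. \<exists>N. \<forall>m\<ge>N. \<forall>n\<ge>N. nrm Q (s m \<ominus>\<^bsub>Q\<^esub> s n) < e"
  shows "\<exists>l. nrm_lim Q s l"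
proof -
  have "\<exists>N. \<forall>m\<ge>N. \<forall>n\<ge>N. nrm Q (s m \<ominus>\<^bsub>Q\<^esub> s n) < (1/2) ^ k" for k :: nat using cauchy by simp
  then obtain M where M: "\<And>k m n. m \<ge> M k \<Longrightarrow> n \<ge> M k \<Longrightarrow> nrm Q (s m \<ominus>\<^bsub>Q\<^esub> s n) < (1/2) ^ k"
    by metis
  \<comment> \<open>Partial sums of \<open>M\<close> are nondecreasing and dominate
    \<open>M\<close>, so both r n and r (n + 1) lie beyond M n.\<close>
  define r where "r k = (\<Sum>j\<le>k. M j)" for k
  have r: "M k \<le> r k" "r k \<le> r (Suc k)" for k
    unfolding r_def by (auto intro: member_le_sum)
  let ?P = "\<lambda>n b. b \<in> carrier A \<and> coset b = s (r n)"
  have ex: "\<exists>y. ?P (Suc n) y \<and> nrm A (y \<ominus> x) < (1/2) ^ n" if x: "?P n x" for n x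
  proof -
    obtain z where z: "z \<in> carrier A" "coset z = s (r (Suc n))" using s[of "r (Suc n)"] by (auto simp: Q_simps)
    have "nrm Q (coset (z \<ominus> x)) < (1/2) ^ n"
      using M[of n "r (Suc n)" "r n"] r[of n] z x coset_diff[of z x] by simp
    with z x obtain w where w: "w \<in> carrier A" "coset w = coset (z \<ominus> x)" "nrm A w < (1/2) ^ n"
      by (meson nrm_coset_approx minus_closed)
    have "coset (w \<oplus> x) = coset w \<oplus>\<^bsub>Q\<^esub> coset x" using w(1) x coset_add[of w x] by simp
    also have "\<dots> = coset ((z \<ominus> x) \<oplus> x)"
      using x z(1) coset_add[of "z \<ominus> x" x] unfolding w(2) by simp
    also have "(z \<ominus> x) \<oplus> x = z" using x z by algebra
    finally have "?P (Suc n) (w \<oplus> x)" using w x z by simp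
    moreover have "w \<oplus> x \<ominus> x = w" using w x by algebra
    ultimately show ?thesis using w by auto
  qed
  obtain b0 where b0: "?P 0 b0" using s[of "r 0"] by (auto simp: Q_simps)
  have "\<exists>b. \<forall>n. ?P n (b n) \<and> nrm A (b (Suc n) \<ominus> b n) < (1/2) ^ n"
  proof (rule dependent_nat_choice[of ?P "\<lambda>n x y. nrm A (y \<ominus> x) < (1/2) ^ n"])
    show "\<exists>x. ?P 0 x" using b0 by (rule exI)
  qed (rule ex)
  then obtain b where b: "\<And>n. ?P n (b n)" "\<And>n. nrm A (b (Suc n) \<ominus> b n) < (1/2) ^ n" by blast
  have "\<exists>l. nrm_lim A b l"
  proof (rule convergent_if_increments_le)
    \<comment> \<open>The increments of - 2 / 2^n are exactly 1 / 2^n.\<close>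
    show "nrm A (b (Suc n) \<ominus> b n) \<le> (- 2 * (1/2) ^ Suc n) - (- 2 * (1/2) ^ n)" for n
      using b(2)[of n] by simp
    have "(\<lambda>n. - 2 * (1/2::real) ^ n) \<longlonglongrightarrow> - 2 * 0" by (intro tendsto_intros) auto
    then show "convergent (\<lambda>n. - 2 * (1/2::real) ^ n)" by (rule convergentI)
  qed (use b in blast)
  then obtain l where l: "nrm_lim A b l" by blast
  have lc: "l \<in> carrier A" using nrm_limD(1)[OF l] .
  have "(\<lambda>n. nrm Q (s n \<ominus>\<^bsub>Q\<^esub> coset l)) \<longlonglongrightarrow> 0"
  proof (rule LIMSEQ_I)
    fix e :: real assume e: "e > 0"
    obtain k where k: "(1/2) ^ k < e / 2" using real_arch_pow_inv[of "e/2" "1/2"] e by auto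
    obtain K where K0: "\<And>n. n \<ge> K \<Longrightarrow> norm (nrm A (b n \<ominus> l) - 0) < e / 2"
      using LIMSEQ_D[OF nrm_limD(2)[OF l], of "e / 2"] e by auto
    have K: "nrm A (b n \<ominus> l) < e / 2" if "n \<ge> K" for n
      using K0[OF that] abs_ge_self[of "nrm A (b n \<ominus> l)"] unfolding diff_zero real_norm_def by linarith
    define j where "j = max k K"
    have "norm (nrm Q (s n \<ominus>\<^bsub>Q\<^esub> coset l) - 0) < e" if n: "n \<ge> r j" for n
    proof -
      obtain z where z: "z \<in> carrier A" "coset z = s n" using s[of n] by (auto simp: Q_simps)
      have "nrm Q (s n \<ominus>\<^bsub>Q\<^esub> s (r j)) < (1/2) ^ j" using M[of j n "r j"] r(1)[of j] n by linarith
      also have "(1/2::real) ^ j \<le> (1/2) ^ k" by (rule power_decreasing) (auto simp: j_def)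
      finally have 1: "nrm Q (coset (z \<ominus> b j)) < e / 2"
        using k z b(1)[of j] by (simp flip: coset_diff)
      have 2: "nrm Q (coset (b j \<ominus> l)) < e / 2"
        using nrm_coset_le_self[of "b j \<ominus> l"] K[of j] b(1)[of j] lc by (simp add: j_def)
      have "z \<ominus> l = (z \<ominus> b j) \<oplus> (b j \<ominus> l)" using z b(1)[of j] lc by algebra
      then have "nrm Q (coset (z \<ominus> l)) < e"
        using nrm_coset_add[of "z \<ominus> b j" "b j \<ominus> l"] 1 2 z b(1)[of j] lc by simp
      then show ?thesis using z lc nrm_coset_nonneg[of "z \<ominus> l"] by (simp flip: z(2) add: coset_diff)
    qed
    then show "\<exists>no. \<forall>n\<ge>no. norm (nrm Q (s n \<ominus>\<^bsub>Q\<^esub> coset l) - 0) < e" by blast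
  qed
  then show ?thesis using lc coset_closed unfolding nrm_lim_def by blast
qed

theorem quotient_cstar: "unital_cstar_algebra Q"
proof (intro unital_cstar_algebra.intro[OF ring_Q] unital_cstar_algebra_axioms.intro)
  fix a b c d assume a: "a \<in> carrier Q"
  then obtain a' where a': "a' \<in> carrier A" "a = coset a'" by (auto simp: Q_simps)
  note cs = a' star_closed scal_closed coset_closed coset_add coset_mult coset_scal coset_star
  show "scal Q c a \<in> carrier Q" "scal Q (c + d) a = scal Q c a \<oplus>\<^bsub>Q\<^esub> scal Q d a"
    "scal Q c (scal Q d a) = scal Q (c * d) a" "scal Q 1 a = a" "star Q a \<in> carrier Q"
    "star Q (star Q a) = a" "star Q (scal Q c a) = scal Q (cnj c) (star Q a)" "0 \<le> nrm Q a"
    "nrm Q (scal Q c a) = cmod c * nrm Q a"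
    by (simp_all add: cs scal_add_left scal_scal scal_one star_star star_scal nrm_coset_nonneg
        nrm_coset_scal)
  show "nrm Q a = 0 \<longleftrightarrow> a = \<zero>\<^bsub>Q\<^esub>"
  proof
    assume "nrm Q a = 0"
    then have "a' \<in> I" using nrm_coset_eq_zero a' by simp
    then have "a' \<ominus> \<zero> \<in> I" using a' by (simp add: minus_eq)
    then show "a = \<zero>\<^bsub>Q\<^esub>" using coset_eq_iff[of a' \<zero>] coset_zero a' by simp
  next
    assume "a = \<zero>\<^bsub>Q\<^esub>"
    then show "nrm Q a = 0"
      using nrm_coset_le_self[of \<zero>] nrm_coset_nonneg[of \<zero>] by (simp add: coset_zero)
  qed
  have "nrm Q (star Q a \<otimes>\<^bsub>Q\<^esub> a) \<le> nrm Q a * nrm Q a"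
    using nrm_coset_mult[of "star A a'" a'] by (simp add: cs nrm_coset_star)
  moreover have "(nrm Q a)\<^sup>2 \<le> nrm Q (star Q a \<otimes>\<^bsub>Q\<^esub> a)" using nrm_coset_cstar by (simp add: cs)
  ultimately show "nrm Q (star Q a \<otimes>\<^bsub>Q\<^esub> a) = (nrm Q a)\<^sup>2" by (simp add: power2_eq_square)
  assume b: "b \<in> carrier Q"
  then obtain b' where b': "b' \<in> carrier A" "b = coset b'" by (auto simp: Q_simps)
  show "scal Q c (a \<oplus>\<^bsub>Q\<^esub> b) = scal Q c a \<oplus>\<^bsub>Q\<^esub> scal Q c b"
    "scal Q c a \<otimes>\<^bsub>Q\<^esub> b = scal Q c (a \<otimes>\<^bsub>Q\<^esub> b)" "a \<otimes>\<^bsub>Q\<^esub> scal Q c b = scal Q c (a \<otimes>\<^bsub>Q\<^esub> b)"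
    "star Q (a \<oplus>\<^bsub>Q\<^esub> b) = star Q a \<oplus>\<^bsub>Q\<^esub> star Q b" "star Q (a \<otimes>\<^bsub>Q\<^esub> b) = star Q b \<otimes>\<^bsub>Q\<^esub> star Q a"
    "nrm Q (a \<oplus>\<^bsub>Q\<^esub> b) \<le> nrm Q a + nrm Q b" "nrm Q (a \<otimes>\<^bsub>Q\<^esub> b) \<le> nrm Q a * nrm Q b"
    by (simp_all add: cs b' scal_add_right scal_mult_left scal_mult_right star_add star_mult
        nrm_coset_add nrm_coset_mult)
qed (rule Q_complete)

lemma coset_hom: "unital_cstar_hom A Q coset"
proof -
  interpret Q: unital_cstar_algebra Q by (rule quotient_cstar)
  show ?thesis
    by unfold_locales
      (auto simp: star_hom_def coset_closed coset_add coset_mult coset_scal coset_star Q_simps(2))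
qed

end

text \<open>Functional calculus with $t \<mapsto> \<bar>t - r\<bar> + (t - r)$, which vanishes on $[0, r]$: the element
  obtained from \<open>c\<close> lies in \<open>I\<close> and in the kernel of \<open>f\<close>.\<close>

lemma (in cstar_hom) nrm_pos_le_if_inj_on_ideal:
  assumes I: "closed_ideal A I" and inj: "\<And>a. a \<in> I \<Longrightarrow> f a = \<zero>\<^bsub>B\<^esub> \<Longrightarrow> a = \<zero>"
    and c: "pos A c" "c \<in> I" and r: "nrm B (f c) \<le> r"
  shows "nrm A c \<le> r"
proof -
  interpret I: cstar_ideal A I by unfold_locales (rule I)
  interpret Q: unital_cstar_hom A "cstar_quotient A I" I.coset by (rule I.coset_hom)
  note cc = A.posD[OF c(1)]
  have r0: "0 \<le> r" using r B.nrm_nonneg[OF closed[OF cc(2)]] by simp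
  define s where "s = c \<ominus> real_elt A r"
  have s: "self_adj A s" "s \<in> carrier A"
    using A.self_adj_diff[OF cc(1) A.self_adj_real_elt] cc A.real_elt_closed by (auto simp: s_def)
  obtain m where m: "pos A m" "m \<otimes> m = s \<otimes> s"
    and mc: "\<And>z. z \<in> carrier A \<Longrightarrow> z \<otimes> (s \<otimes> s) = s \<otimes> s \<otimes> z \<Longrightarrow> z \<otimes> m = m \<otimes> z"
    using A.pos_sqrt[OF A.pos_square[OF s(1)]] by metis
  note mcl = A.posD[OF m(1)]
  have sm: "s \<otimes> m = m \<otimes> s" using mc s A.m_assoc by simp
  define k where "k = m \<oplus> s"
  have k: "k \<in> carrier A" using mcl s by (simp add: k_def)
  \<comment> \<open>Wherever - s becomes positive, the root m of s^2 becomes - s by uniqueness, so k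
    = m + s goes to 0. This is used in the quotient by \<open>I\<close>, where - s becomes r, and in
    the corner of \<open>B\<close>.\<close>
  have root: "g m = \<ominus>\<^bsub>D\<^esub> g s" if D: "cstar_hom A D g" and neg: "pos D (\<ominus>\<^bsub>D\<^esub> g s)" for D g
  proof -
    interpret D: cstar_hom A D g by (rule D)
    note cl = D.closed[OF mcl(2)] D.closed[OF s(2)]
    have ms: "g m \<otimes>\<^bsub>D\<^esub> g s = g s \<otimes>\<^bsub>D\<^esub> g m" "g m \<otimes>\<^bsub>D\<^esub> g m = g s \<otimes>\<^bsub>D\<^esub> g s"
      using mcl s sm m(2) by (simp_all flip: D.mult)
    show ?thesis
      using cl ms by (intro D.B.pos_sqrt_unique[OF D.pos[OF m(1)] neg])
        (simp_all add: D.B.l_minus D.B.r_minus)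
  qed
  have "k \<in> I"
  proof -
    have "I.coset c = \<zero>\<^bsub>cstar_quotient A I\<^esub>"
      using c(2) cc I.coset_eq_iff[of c \<zero>] by (simp add: A.minus_eq flip: I.coset_zero)
    then have "\<ominus>\<^bsub>cstar_quotient A I\<^esub> I.coset s = real_elt (cstar_quotient A I) r"
      using cc Q.B.real_elt_closed[of r]
      by (simp add: s_def Q.diff A.real_elt_closed Q.scal Q.one Q.B.minus_eq)
    then have "pos (cstar_quotient A I) (\<ominus>\<^bsub>cstar_quotient A I\<^esub> I.coset s)"
      using Q.B.pos_scal[OF Q.B.pos_one r0] by simp
    then have "I.coset m = \<ominus>\<^bsub>cstar_quotient A I\<^esub> I.coset s"
      using root[of "cstar_quotient A I" I.coset] Q.cstar_hom_axioms by blast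
    then have "I.coset k = I.coset \<zero>"
      using mcl s Q.closed[OF s(2)] by (simp add: k_def Q.add Q.B.l_neg I.coset_zero)
    then show ?thesis using I.coset_eq_iff[of k \<zero>] k by (simp add: A.minus_eq)
  qed
  moreover have "f k = \<zero>\<^bsub>B\<^esub>"
  proof -
    \<comment> \<open>If \<open>f\<close> is not unital, it does not send the scalar r to r; in the
      corner it does.\<close>
    define S where "S = {b \<in> carrier B. f \<one> \<otimes>\<^bsub>B\<^esub> b = b \<and> b \<otimes>\<^bsub>B\<^esub> f \<one> = b}"
    note corner = corner[folded S_def]
    let ?D = "B\<lparr>carrier := S, one := f \<one>\<rparr>"
    interpret D: unital_cstar_hom A ?D f by (rule corner(1))
    have "pos ?D (real_elt ?D r \<ominus>\<^bsub>?D\<^esub> f c)"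
      using D.B.pos_real_elt_diff[OF D.self_adj[OF cc(1)]] r by simp
    also have "real_elt ?D r \<ominus>\<^bsub>?D\<^esub> f c = \<ominus>\<^bsub>?D\<^esub> f s"
    proof -
      have "real_elt ?D r = f (real_elt A r)" by (simp add: D.scal)
      then have "real_elt ?D r \<ominus>\<^bsub>?D\<^esub> f c = f (real_elt A r \<ominus> c)"
        using D.diff cc A.real_elt_closed by simp
      also have "real_elt A r \<ominus> c = \<ominus> s" unfolding s_def using cc A.real_elt_closed by algebra
      finally show ?thesis using D.minus s by simp
    qed
    finally have "f m = \<ominus>\<^bsub>?D\<^esub> f s" using root[of ?D f] D.cstar_hom_axioms by blast
    then have "f k = \<zero>\<^bsub>?D\<^esub>"
      unfolding k_def using D.B.l_neg[OF D.closed[OF s(2)]] mcl s by (simp add: D.add[OF mcl(2) s(2)])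
    then show ?thesis by simp
  qed
  ultimately have "k = \<zero>" using inj by blast
  then have "m = \<ominus> s" using mcl s A.minus_equality[of m s] by (simp add: k_def)
  \<comment> \<open>So the positive element m is r - c, which bounds c.\<close>
  also have "\<ominus> s = real_elt A r \<ominus> c" unfolding s_def using cc A.real_elt_closed by algebra
  finally show ?thesis using A.nrm_le_if_pos_diff[OF c(1) _ r0] m(1) by simp
qed

text \<open>An ideal has in general no unit of its own, so the estimate for positive elements passes
  through the quotient instead of restricting \<open>f\<close>. It is applied to \<delta> on
  J.\<close>

lemma (in cstar_hom) nrm_eq_if_inj_on_ideal:
  assumes I: "closed_ideal A I" and inj: "\<And>a. a \<in> I \<Longrightarrow> f a = \<zero>\<^bsub>B\<^esub> \<Longrightarrow> a = \<zero>"
    and a: "a \<in> I"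
  shows "nrm B (f a) = nrm A a"
proof -
  interpret I: cstar_ideal A I by unfold_locales (rule I)
  have ac: "a \<in> carrier A" "star A a \<in> carrier A" using a I.Icarr A.star_closed by auto
  have "nrm A (star A a \<otimes> a) \<le> nrm B (f (star A a \<otimes> a))"
    using nrm_pos_le_if_inj_on_ideal[OF I inj A.pos_star_mult[OF ac(1)]] a ac I.I_l_closed by blast
  then have "(nrm A a)\<^sup>2 \<le> (nrm B (f a))\<^sup>2"
    using ac closed by (simp add: mult star A.cstar_identity B.cstar_identity)
  then have "nrm A a \<le> nrm B (f a)" using B.nrm_nonneg closed ac by (meson power2_le_imp_le)
  then show ?thesis using nrm_le[OF ac(1)] by simp
qed

section \<open>Hilbert modules\<close>

text \<open>Equality of vectors is tested by inner products (\<open>ip_ext\<close>); in this way the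
  laws of a module are inherited from \<open>A\<close> instead of being axioms.\<close>

locale hilbert_module = unital_cstar_algebra A
  for A :: "'a cstar_algebra" (structure) +
  fixes X :: "('a, 'x) hilbert_bimodule"
  assumes hadd_closed: "\<lbrakk>x \<in> carrier X; y \<in> carrier X\<rbrakk> \<Longrightarrow> hadd X x y \<in> carrier X"
    and hzero_closed: "hzero X \<in> carrier X"
    and ract_closed: "\<lbrakk>x \<in> carrier X; a \<in> carrier A\<rbrakk> \<Longrightarrow> ract X x a \<in> carrier X"
    and ip_closed: "\<lbrakk>x \<in> carrier X; y \<in> carrier X\<rbrakk> \<Longrightarrow> ip X x y \<in> carrier A"
    and ip_add: "\<lbrakk>x \<in> carrier X; y \<in> carrier X; z \<in> carrier X\<rbrakk>
      \<Longrightarrow> ip X x (hadd X y z) = ip X x y \<oplus> ip X x z"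
    and ip_ract: "\<lbrakk>x \<in> carrier X; y \<in> carrier X; a \<in> carrier A\<rbrakk>
      \<Longrightarrow> ip X x (ract X y a) = ip X x y \<otimes> a"
    and ip_zero: "x \<in> carrier X \<Longrightarrow> ip X x (hzero X) = \<zero>"
    and ip_star: "\<lbrakk>x \<in> carrier X; y \<in> carrier X\<rbrakk> \<Longrightarrow> star A (ip X x y) = ip X y x"
    and ip_pos: "x \<in> carrier X \<Longrightarrow> pos A (ip X x x)"
    and ip_ext: "\<lbrakk>x \<in> carrier X; y \<in> carrier X; \<And>z. z \<in> carrier X \<Longrightarrow> ip X z x = ip X z y\<rbrakk> \<Longrightarrow> x = y"
    and hcomplete: "\<lbrakk>\<And>n. s n \<in> carrier X; \<forall>e>0. \<exists>N. \<forall>m\<ge>N. \<forall>n\<ge>N. hdist A X (s m) (s n) < e\<rbrakk>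
      \<Longrightarrow> \<exists>l\<in>carrier X. (\<lambda>n. hdist A X (s n) l) \<longlonglongrightarrow> 0"
begin

abbreviation hdiff :: "'x \<Rightarrow> 'x \<Rightarrow> 'x" where "hdiff x y \<equiv> hadd X x (hscal A X (- 1) y)"

abbreviation hn :: "'x \<Rightarrow> real" where "hn \<equiv> hnorm A X"

lemma hscal_closed: "x \<in> carrier X \<Longrightarrow> hscal A X c x \<in> carrier X"
  by (simp add: hscal_def ract_closed scal_closed)

lemma ip_hscal: "\<lbrakk>x \<in> carrier X; y \<in> carrier X\<rbrakk> \<Longrightarrow> ip X x (hscal A X c y) = scal A c (ip X x y)"
  by (simp add: hscal_def ip_ract scal_closed ip_closed scal_mult_right)

lemma ip_add_left: "\<lbrakk>x \<in> carrier X; y \<in> carrier X; z \<in> carrier X\<rbrakk>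
    \<Longrightarrow> ip X (hadd X x y) z = ip X x z \<oplus> ip X y z"
  by (metis ip_star ip_add star_add ip_closed hadd_closed)

lemma ip_ract_left: "\<lbrakk>x \<in> carrier X; y \<in> carrier X; a \<in> carrier A\<rbrakk>
    \<Longrightarrow> ip X (ract X x a) y = star A a \<otimes> ip X x y"
  by (metis ip_star ip_ract star_mult ip_closed ract_closed)

lemma ip_hscal_left: "\<lbrakk>x \<in> carrier X; y \<in> carrier X\<rbrakk>
    \<Longrightarrow> ip X (hscal A X c x) y = scal A (cnj c) (ip X x y)"
  by (metis ip_star ip_hscal star_scal ip_closed hscal_closed)

lemma ip_zero_left: "x \<in> carrier X \<Longrightarrow> ip X (hzero X) x = \<zero>"
  by (metis ip_star ip_zero star_zero hzero_closed)

lemma ip_hdiff: "\<lbrakk>x \<in> carrier X; y \<in> carrier X; z \<in> carrier X\<rbrakk>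
    \<Longrightarrow> ip X x (hdiff y z) = ip X x y \<ominus> ip X x z"
  by (simp add: ip_add hscal_closed ip_hscal scal_minus_one ip_closed minus_eq)

lemma ip_hdiff_left: "\<lbrakk>x \<in> carrier X; y \<in> carrier X; z \<in> carrier X\<rbrakk>
    \<Longrightarrow> ip X (hdiff y z) x = ip X y x \<ominus> ip X z x"
  by (simp add: ip_add_left hscal_closed ip_hscal_left scal_minus_one ip_closed minus_eq)

lemmas hclosed = hadd_closed hzero_closed ract_closed hscal_closed

lemma hn_nonneg: "x \<in> carrier X \<Longrightarrow> 0 \<le> hn x"
  by (simp add: hnorm_def ip_closed nrm_nonneg)

lemma hn_square: "x \<in> carrier X \<Longrightarrow> (hn x)\<^sup>2 = nrm A (ip X x x)"
  by (simp add: hnorm_def ip_closed nrm_nonneg)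

lemma nrm_ip_le: "\<lbrakk>x \<in> carrier X; y \<in> carrier X\<rbrakk> \<Longrightarrow> nrm A (ip X x y) \<le> hn x * hn y"
proof -
  assume xy: "x \<in> carrier X" "y \<in> carrier X"
  have "(nrm A (ip X x y))\<^sup>2 \<le> nrm A (ip X x x) * nrm A (ip X y y)"
  proof (rule cauchy_schwarz)
    fix c assume c: "c \<in> carrier A"
    let ?z = "hadd X y (ract X x c)"
    have "ip X ?z ?z = (ip X y y \<oplus> star A c \<otimes> ip X x y) \<oplus> (ip X y x \<oplus> star A c \<otimes> ip X x x) \<otimes> c"
      using xy c by (simp add: ip_add ip_add_left ip_ract ip_ract_left hclosed)
    also have "\<dots> = ip X y y \<oplus> star A c \<otimes> ip X x y \<oplus> star A (ip X x y) \<otimes> c \<oplus> star A c \<otimes> ip X x x \<otimes> c"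
      unfolding ip_star[OF xy] using ip_closed xy c star_closed[OF c]
      by (simp add: l_distr r_distr m_assoc a_assoc)
    finally show "pos A (ip X y y \<oplus> star A c \<otimes> ip X x y \<oplus> star A (ip X x y) \<otimes> c \<oplus> star A c \<otimes> ip X x x \<otimes> c)"
      using ip_pos[of ?z] xy c by (simp add: hclosed)
  qed (use xy ip_pos ip_closed in auto)
  then have "(nrm A (ip X x y))\<^sup>2 \<le> (hn x * hn y)\<^sup>2" using xy by (simp add: power_mult_distrib hn_square)
  then show ?thesis by (rule power2_le_imp_le) (use xy hn_nonneg in auto)
qed

lemma hn_add: "\<lbrakk>x \<in> carrier X; y \<in> carrier X\<rbrakk> \<Longrightarrow> hn (hadd X x y) \<le> hn x + hn y"
proof -
  assume xy: "x \<in> carrier X" "y \<in> carrier X"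
  have "(hn (hadd X x y))\<^sup>2 = nrm A ((ip X x x \<oplus> ip X y x) \<oplus> (ip X x y \<oplus> ip X y y))"
    using xy by (simp add: hn_square hclosed ip_add ip_add_left)
  also have "\<dots> \<le> (nrm A (ip X x x) + nrm A (ip X y x)) + (nrm A (ip X x y) + nrm A (ip X y y))"
    using xy ip_closed by (intro order_trans[OF nrm_add] add_mono nrm_add) auto
  also have "\<dots> \<le> ((hn x)\<^sup>2 + hn y * hn x) + (hn x * hn y + (hn y)\<^sup>2)"
    using xy nrm_ip_le by (intro add_mono) (auto simp: hn_square)
  also have "\<dots> = (hn x + hn y)\<^sup>2" by (simp add: power2_eq_square algebra_simps)
  finally show ?thesis by (rule power2_le_imp_le) (use xy hn_nonneg in auto)
qed

lemma hn_hscal: "x \<in> carrier X \<Longrightarrow> hn (hscal A X c x) = cmod c * hn x"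
proof -
  assume x: "x \<in> carrier X"
  then have "(hn (hscal A X c x))\<^sup>2 = cmod c * (cmod c * nrm A (ip X x x))"
    by (simp add: hn_square hclosed ip_hscal ip_hscal_left nrm_scal ip_closed scal_closed)
  also have "\<dots> = (cmod c * hn x)\<^sup>2"
    unfolding power_mult_distrib hn_square[OF x] by (simp add: power2_eq_square)
  finally have "(hn (hscal A X c x))\<^sup>2 = (cmod c * hn x)\<^sup>2" .
  then show ?thesis by (rule power2_eq_imp_eq) (use x hn_nonneg hclosed in auto)
qed

lemma hn_eq_zero: "x \<in> carrier X \<Longrightarrow> hn x = 0 \<Longrightarrow> x = hzero X"
proof (rule ip_ext)
  fix z assume x: "x \<in> carrier X" "hn x = 0" and z: "z \<in> carrier X"
  then have "nrm A (ip X z x) = 0" using nrm_ip_le[of z x] nrm_nonneg[OF ip_closed, of z x] by simp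
  then show "ip X z x = ip X z (hzero X)" using x z nrm_eq_zero ip_closed by (simp add: ip_zero)
qed (auto simp: hclosed)

lemma hdist_eq: "hdist A X x y = hn (hdiff x y)"
  by (simp add: hdist_def)

lemma hdiff_commute: "\<lbrakk>x \<in> carrier X; y \<in> carrier X\<rbrakk> \<Longrightarrow> hn (hdiff x y) = hn (hdiff y x)"
proof -
  assume xy: "x \<in> carrier X" "y \<in> carrier X"
  have "hdiff x y = hscal A X (- 1) (hdiff y x)"
  proof (rule ip_ext)
    fix z assume z: "z \<in> carrier X"
    have "ip X z x \<ominus> ip X z y = \<ominus> (ip X z y \<ominus> ip X z x)" using ip_closed xy z by algebra
    then show "ip X z (hdiff x y) = ip X z (hscal A X (- 1) (hdiff y x))"
      using xy z by (simp add: ip_hdiff ip_hscal[of z "hdiff y x"] hclosed scal_minus_one ip_closed)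
  qed (use xy in \<open>simp_all add: hclosed\<close>)
  then show ?thesis using xy hn_hscal[of "hdiff y x" "-1"] by (simp add: hclosed)
qed

lemma hdiff_triangle:
  assumes "x \<in> carrier X" "y \<in> carrier X" "z \<in> carrier X"
  shows "hn (hdiff x z) \<le> hn (hdiff x y) + hn (hdiff y z)"
proof -
  have "hdiff x z = hadd X (hdiff x y) (hdiff y z)"
  proof (rule ip_ext)
    fix w assume w: "w \<in> carrier X"
    have "ip X w x \<ominus> ip X w z = (ip X w x \<ominus> ip X w y) \<oplus> (ip X w y \<ominus> ip X w z)"
      using ip_closed assms w by algebra
    then show "ip X w (hdiff x z) = ip X w (hadd X (hdiff x y) (hdiff y z))"
      using assms w by (simp add: ip_hdiff ip_add[of w "hdiff x y"] hclosed)
  qed (use assms in \<open>simp_all add: hclosed\<close>)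
  then show ?thesis using hn_add[of "hdiff x y" "hdiff y z"] assms by (simp add: hclosed)
qed

lemma nrm_ip_hdiff_le:
  "\<lbrakk>x \<in> carrier X; y \<in> carrier X; z \<in> carrier X\<rbrakk>
    \<Longrightarrow> nrm A (ip X z x \<ominus> ip X z y) \<le> hn z * hn (hdiff x y)"
  "\<lbrakk>x \<in> carrier X; y \<in> carrier X; z \<in> carrier X\<rbrakk>
    \<Longrightarrow> nrm A (ip X x z \<ominus> ip X y z) \<le> hn (hdiff x y) * hn z"
  using nrm_ip_le[of z "hdiff x y"] nrm_ip_le[of "hdiff x y" z]
  by (simp_all add: ip_hdiff ip_hdiff_left hclosed)

section \<open>Adjointable operators\<close>

abbreviation L :: "('x \<Rightarrow> 'x) cstar_algebra" where "L \<equiv> adjointable A X"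

lemma L_simps:
  "carrier L = {T. \<exists>S. is_adjoint X T S}" "mult L = compose (carrier X)"
  "one L = (\<lambda>x\<in>carrier X. x)" "zero L = (\<lambda>x\<in>carrier X. hzero X)"
  "add L = (\<lambda>S T. \<lambda>x\<in>carrier X. hadd X (S x) (T x))"
  "scal L = (\<lambda>c T. \<lambda>x\<in>carrier X. hscal A X c (T x))"
  "star L = (\<lambda>T. THE S. is_adjoint X T S)"
  "nrm L = (\<lambda>T. SUP x\<in>{x \<in> carrier X. hnorm A X x \<le> 1}. hnorm A X (T x))"
  by (simp_all add: adjointable_def)

lemma is_adjointD:
  assumes "is_adjoint X T S"
  shows "x \<in> carrier X \<Longrightarrow> T x \<in> carrier X" "x \<in> carrier X \<Longrightarrow> S x \<in> carrier X"
    "\<lbrakk>x \<in> carrier X; y \<in> carrier X\<rbrakk> \<Longrightarrow> ip X (T x) y = ip X x (S y)"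
    "\<lbrakk>x \<in> carrier X; y \<in> carrier X\<rbrakk> \<Longrightarrow> ip X x (T y) = ip X (S x) y"
    "T \<in> extensional (carrier X)" "S \<in> extensional (carrier X)"
proof -
  show cl: "x \<in> carrier X \<Longrightarrow> T x \<in> carrier X" "x \<in> carrier X \<Longrightarrow> S x \<in> carrier X" for x
    using assms by (auto simp: is_adjoint_def)
  show ip: "ip X (T x) y = ip X x (S y)" if "x \<in> carrier X" "y \<in> carrier X" for x y
    using assms that by (auto simp: is_adjoint_def)
  show "ip X x (T y) = ip X (S x) y" if "x \<in> carrier X" "y \<in> carrier X"
    using ip[OF that(2,1)] ip_star[of "T y" x] ip_star[of y "S x"] cl that by metis
  show "T \<in> extensional (carrier X)" "S \<in> extensional (carrier X)"
    using assms by (auto simp: is_adjoint_def PiE_def)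
qed

lemma is_adjointI:
  assumes "\<And>x. x \<in> carrier X \<Longrightarrow> T x \<in> carrier X" "\<And>x. x \<in> carrier X \<Longrightarrow> S x \<in> carrier X"
    "T \<in> extensional (carrier X)" "S \<in> extensional (carrier X)"
    "\<And>x y. \<lbrakk>x \<in> carrier X; y \<in> carrier X\<rbrakk> \<Longrightarrow> ip X (T x) y = ip X x (S y)"
  shows "is_adjoint X T S"
  using assms by (auto simp: is_adjoint_def PiE_def)

lemma is_adjoint_sym: "is_adjoint X T S \<Longrightarrow> is_adjoint X S T"
  by (rule is_adjointI) (auto simp: is_adjointD)

lemma op_ext:
  assumes "T \<in> extensional (carrier X)" "S \<in> extensional (carrier X)"
    "\<And>x. x \<in> carrier X \<Longrightarrow> T x \<in> carrier X" "\<And>x. x \<in> carrier X \<Longrightarrow> S x \<in> carrier X"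
    "\<And>x z. x \<in> carrier X \<Longrightarrow> z \<in> carrier X \<Longrightarrow> ip X z (T x) = ip X z (S x)"
  shows "T = S"
  using assms by (blast intro: extensionalityI ip_ext)

lemma is_adjoint_unique: "is_adjoint X T S \<Longrightarrow> is_adjoint X T R \<Longrightarrow> S = R"
  by (rule op_ext) (simp_all add: is_adjointD(2,6) flip: is_adjointD(3))

lemma adjointableI:
  assumes "is_adjoint X T S"
  shows "T \<in> carrier L" "star L T = S"
proof -
  show "T \<in> carrier L" using assms by (auto simp: L_simps)
  show "star L T = S"
    unfolding L_simps using assms is_adjoint_unique by (intro the_equality) blast+
qed

lemma adjointableD: "T \<in> carrier L \<Longrightarrow> is_adjoint X T (star L T)"
  using adjointableI(2) by (auto simp: L_simps(1))

lemmas op_closed = is_adjointD(1)[OF adjointableD]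
lemmas star_op_closed = is_adjointD(2)[OF adjointableD]
lemmas ip_op = is_adjointD(4)[OF adjointableD]
lemmas ip_op_left = is_adjointD(3)[OF adjointableD]

lemma op_eqI:
  "\<lbrakk>T \<in> carrier L; S \<in> carrier L; \<And>x z. \<lbrakk>x \<in> carrier X; z \<in> carrier X\<rbrakk> \<Longrightarrow> ip X z (T x) = ip X z (S x)\<rbrakk>
    \<Longrightarrow> T = S"
  by (rule op_ext) (auto simp: op_closed is_adjointD(5)[OF adjointableD])

text \<open>Adjointable maps are not linear by definition. Moving \<open>T\<close> to the other side
  of the inner product makes compatibility with the module operations automatic.\<close>

lemma op_add: "\<lbrakk>T \<in> carrier L; x \<in> carrier X; y \<in> carrier X\<rbrakk> \<Longrightarrow> T (hadd X x y) = hadd X (T x) (T y)"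
  by (rule ip_ext) (simp_all add: ip_op hclosed op_closed star_op_closed ip_add)

lemma op_ract: "\<lbrakk>T \<in> carrier L; x \<in> carrier X; a \<in> carrier A\<rbrakk> \<Longrightarrow> T (ract X x a) = ract X (T x) a"
  by (rule ip_ext) (simp_all add: ip_op hclosed op_closed star_op_closed ip_ract)

lemma op_hscal: "\<lbrakk>T \<in> carrier L; x \<in> carrier X\<rbrakk> \<Longrightarrow> T (hscal A X c x) = hscal A X c (T x)"
  by (simp add: hscal_def op_ract scal_closed)

lemma op_zero: "T \<in> carrier L \<Longrightarrow> T (hzero X) = hzero X"
  by (rule ip_ext) (simp_all add: ip_op hclosed op_closed star_op_closed ip_zero)

lemma L_app:
  assumes "x \<in> carrier X"
  shows "(T \<otimes>\<^bsub>L\<^esub> S) x = T (S x)" "\<one>\<^bsub>L\<^esub> x = x" "\<zero>\<^bsub>L\<^esub> x = hzero X"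
    "(T \<oplus>\<^bsub>L\<^esub> S) x = hadd X (T x) (S x)" "scal L c T x = hscal A X c (T x)"
  using assms by (auto simp: L_simps compose_def)

lemma adj_mult:
  "\<lbrakk>T \<in> carrier L; S \<in> carrier L\<rbrakk> \<Longrightarrow> is_adjoint X (T \<otimes>\<^bsub>L\<^esub> S) (star L S \<otimes>\<^bsub>L\<^esub> star L T)"
  by (rule is_adjointI)
    (auto simp: L_app op_closed star_op_closed ip_op_left, auto simp: L_simps compose_def)

lemma adj_add:
  "\<lbrakk>T \<in> carrier L; S \<in> carrier L\<rbrakk> \<Longrightarrow> is_adjoint X (T \<oplus>\<^bsub>L\<^esub> S) (star L T \<oplus>\<^bsub>L\<^esub> star L S)"
  by (rule is_adjointI)
    (auto simp: L_app op_closed star_op_closed ip_op_left hclosed ip_add ip_add_left,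
      auto simp: L_simps)

lemma adj_scal: "T \<in> carrier L \<Longrightarrow> is_adjoint X (scal L c T) (scal L (cnj c) (star L T))"
  by (rule is_adjointI)
    (auto simp: L_app op_closed star_op_closed ip_op_left hclosed ip_hscal ip_hscal_left,
      auto simp: L_simps)

lemma adj_one: "is_adjoint X \<one>\<^bsub>L\<^esub> \<one>\<^bsub>L\<^esub>"
  by (rule is_adjointI) (auto simp: L_app, auto simp: L_simps)

lemma adj_zero: "is_adjoint X \<zero>\<^bsub>L\<^esub> \<zero>\<^bsub>L\<^esub>"
  by (rule is_adjointI) (auto simp: L_app hclosed ip_zero ip_zero_left, auto simp: L_simps)

lemmas L_closed = adjointableI(1)[OF adj_mult] adjointableI(1)[OF adj_add] adjointableI(1)[OF adj_scal]
  adjointableI(1)[OF adj_one] adjointableI(1)[OF adj_zero] adjointableI(1)[OF is_adjoint_sym[OF adjointableD]]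

lemmas L_star = adjointableI(2)[OF adj_mult] adjointableI(2)[OF adj_add] adjointableI(2)[OF adj_scal]
  adjointableI(2)[OF is_adjoint_sym[OF adjointableD]]

lemma ring_L: "ring L"
proof (rule ringI)
  show "abelian_group L"
  proof (rule abelian_groupI)
    fix T assume T: "T \<in> carrier L"
    then have "scal L (- 1) T \<oplus>\<^bsub>L\<^esub> T = \<zero>\<^bsub>L\<^esub>"
      by (intro op_eqI)
        (auto simp: L_closed L_app hclosed op_closed ip_add ip_hscal ip_zero scal_minus_one ip_closed l_neg)
    then show "\<exists>S\<in>carrier L. S \<oplus>\<^bsub>L\<^esub> T = \<zero>\<^bsub>L\<^esub>" using T L_closed by blast
  next
    fix T S R assume *: "T \<in> carrier L" "S \<in> carrier L" "R \<in> carrier L"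
    then show "(T \<oplus>\<^bsub>L\<^esub> S) \<oplus>\<^bsub>L\<^esub> R = T \<oplus>\<^bsub>L\<^esub> (S \<oplus>\<^bsub>L\<^esub> R)"
      by (intro op_eqI) (auto simp: L_closed L_app hclosed op_closed ip_add ip_closed a_assoc)
  next
    fix T S assume *: "T \<in> carrier L" "S \<in> carrier L"
    then show "T \<oplus>\<^bsub>L\<^esub> S = S \<oplus>\<^bsub>L\<^esub> T"
      by (intro op_eqI) (auto simp: L_closed L_app hclosed op_closed ip_add ip_closed a_comm)
  next
    fix T assume *: "T \<in> carrier L"
    then show "\<zero>\<^bsub>L\<^esub> \<oplus>\<^bsub>L\<^esub> T = T"
      by (intro op_eqI) (auto simp: L_closed L_app hclosed op_closed ip_add ip_closed ip_zero)
  qed (auto simp: L_closed)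
  show "Group.monoid L"
  proof (rule monoidI)
    fix T S R assume *: "T \<in> carrier L" "S \<in> carrier L" "R \<in> carrier L"
    then show "(T \<otimes>\<^bsub>L\<^esub> S) \<otimes>\<^bsub>L\<^esub> R = T \<otimes>\<^bsub>L\<^esub> (S \<otimes>\<^bsub>L\<^esub> R)"
      by (intro op_eqI) (auto simp: L_closed L_app op_closed)
  next
    fix T assume *: "T \<in> carrier L"
    then show "\<one>\<^bsub>L\<^esub> \<otimes>\<^bsub>L\<^esub> T = T" "T \<otimes>\<^bsub>L\<^esub> \<one>\<^bsub>L\<^esub> = T"
      by (intro op_eqI; auto simp: L_closed L_app op_closed)+
  qed (auto simp: L_closed)
next
  fix T S R assume *: "T \<in> carrier L" "S \<in> carrier L" "R \<in> carrier L"
  then show "(T \<oplus>\<^bsub>L\<^esub> S) \<otimes>\<^bsub>L\<^esub> R = T \<otimes>\<^bsub>L\<^esub> R \<oplus>\<^bsub>L\<^esub> S \<otimes>\<^bsub>L\<^esub> R"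
    "R \<otimes>\<^bsub>L\<^esub> (T \<oplus>\<^bsub>L\<^esub> S) = R \<otimes>\<^bsub>L\<^esub> T \<oplus>\<^bsub>L\<^esub> R \<otimes>\<^bsub>L\<^esub> S"
    by (intro op_eqI; auto simp: L_closed L_app op_closed op_add hclosed)+
qed

lemma L_minus: "T \<in> carrier L \<Longrightarrow> \<ominus>\<^bsub>L\<^esub> T = scal L (- 1) T"
proof -
  interpret L: ring L by (rule ring_L)
  assume T: "T \<in> carrier L"
  then have "scal L (- 1) T \<oplus>\<^bsub>L\<^esub> T = \<zero>\<^bsub>L\<^esub>"
    by (intro op_eqI)
      (auto simp: L_closed L_app hclosed op_closed ip_add ip_hscal ip_zero scal_minus_one ip_closed l_neg)
  then show ?thesis using L.minus_equality[of "scal L (- 1) T" T] T L_closed(3) by simp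
qed

lemma L_diff_app: "\<lbrakk>S \<in> carrier L; x \<in> carrier X\<rbrakk> \<Longrightarrow> (T \<ominus>\<^bsub>L\<^esub> S) x = hdiff (T x) (S x)"
  by (simp add: a_minus_def L_minus L_app)

text \<open>A gliding hump: were \<open>\<parallel>S y\<^sub>n\<parallel> > 4\<^sup>n\<close> with \<open>\<parallel>y\<^sub>n\<parallel> \<le> 1\<close>, adding up $\pm 3^{-n} u_n$ with unit
  vectors \<open>u\<^sub>n\<close> in the directions of \<open>S y\<^sub>n\<close> and well-chosen signs would give a vector \<open>l\<close> for which
  \<open>\<langle>S y\<^sub>n, l\<rangle> = \<langle>y\<^sub>n, T l\<rangle>\<close> is unbounded.\<close>

lemma adjoint_bounded_unit_ball:
  assumes TS: "is_adjoint X T S"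
  shows "\<exists>K. \<forall>y\<in>carrier X. hn y \<le> 1 \<longrightarrow> hn (S y) \<le> K"
proof (rule ccontr)
  assume "\<not> ?thesis"
  then have "\<forall>n. \<exists>y. y \<in> carrier X \<and> hn y \<le> 1 \<and> hn (S y) > 4 ^ n" by (meson not_le)
  then obtain y where y: "\<And>n. y n \<in> carrier X" "\<And>n. hn (y n) \<le> 1" "\<And>n. hn (S (y n)) > 4 ^ n"
    by metis
  have Sy: "S (y n) \<in> carrier X" for n using is_adjointD(2)[OF TS] y by blast
  have pos: "hn (S (y n)) > 0" for n using y(3)[of n] by (smt (verit) zero_less_power)
  \<comment> \<open>Ratio 1/3: the corrections after the n-th hump add up to at most 3/2 times the
    next term, half of the n-th one, while 4^n / 3^n still grows.\<close>
  let ?q = "\<lambda>n::nat. (1/3::real) ^ n"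
  let ?Q = "\<lambda>n x x'. hn (hdiff x' x) \<le> ?q n \<and> ?q n * hn (S (y n)) \<le> nrm A (ip X (S (y n)) x')"
  have step: "\<exists>x'. x' \<in> carrier X \<and> ?Q n x x'" if x: "x \<in> carrier X" for n x
  proof -
    define t where "t = ?q n / hn (S (y n))"
    have t: "t > 0" "t * hn (S (y n)) = ?q n" using pos[of n] by (simp_all add: t_def)
    have w: "hscal A X (complex_of_real r) (S (y n)) \<in> carrier X" for r
      using Sy by (simp add: hclosed)
    have ipw: "ip X (S (y n)) (hadd X x (hscal A X (complex_of_real r) (S (y n))))
        = ip X (S (y n)) x \<oplus> scal A (complex_of_real r) (ip X (S (y n)) (S (y n)))" for r
      using x w Sy by (simp add: ip_add ip_hscal)
    have dist: "hn (hdiff (hadd X x (hscal A X (complex_of_real r) (S (y n)))) x) = \<bar>r\<bar> * hn (S (y n))"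
      for r
    proof -
      have "hdiff (hadd X x (hscal A X (complex_of_real r) (S (y n)))) x
          = hscal A X (complex_of_real r) (S (y n))"
      proof (rule ip_ext)
        fix z assume z: "z \<in> carrier X"
        let ?u = "ip X z x" and ?v = "ip X z (hscal A X (complex_of_real r) (S (y n)))"
        have "?u \<oplus> ?v \<ominus> ?u = ?v" using ip_closed[OF z] x w[of r] by algebra
        then show "ip X z (hdiff (hadd X x (hscal A X (complex_of_real r) (S (y n)))) x) = ?v"
          using z x w by (simp add: ip_hdiff hadd_closed ip_add[of z x])
      qed (use x w in \<open>simp_all add: hclosed\<close>)
      then show ?thesis using hn_hscal[OF Sy] by simp
    qed
    let ?u = "ip X (S (y n)) x" and ?v = "ip X (S (y n)) (S (y n))"
    have cl: "?u \<in> carrier A" "scal A (complex_of_real t) ?v \<in> carrier A"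
      using ip_closed x Sy scal_closed by auto
    have nv: "nrm A ?v = (hn (S (y n)))\<^sup>2" using hn_square Sy by simp
    let ?w = "scal A (complex_of_real t) ?v"
    \<comment> \<open>As 2 w is the difference of u + w and u - w, one of the two signs yields a
      norm of at least that of w.\<close>
    have "?w \<oplus> ?w = (?u \<oplus> ?w) \<ominus> (?u \<oplus> \<ominus> ?w)" using cl by algebra
    then have "nrm A (?w \<oplus> ?w) \<le> nrm A (?u \<oplus> ?w) + nrm A (?u \<oplus> \<ominus> ?w)" using cl by (simp add: nrm_diff)
    moreover have "nrm A (?w \<oplus> ?w) = 2 * (?q n * hn (S (y n)))"
    proof -
      have "?w \<oplus> ?w = scal A (complex_of_real (2 * t)) ?v"
        using ip_closed Sy by (simp flip: scal_add_left)
      then have "nrm A (?w \<oplus> ?w) = 2 * t * (hn (S (y n)))\<^sup>2"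
        using nrm_scal_real[of ?v "2 * t"] ip_closed Sy t nv by simp
      then show ?thesis using pos[of n] by (simp add: t_def power2_eq_square)
    qed
    ultimately consider "?q n * hn (S (y n)) \<le> nrm A (?u \<oplus> ?w)" |
      "?q n * hn (S (y n)) \<le> nrm A (?u \<oplus> \<ominus> ?w)" by linarith
    then show ?thesis
    proof cases
      case 1
      then show ?thesis
        using ipw[of t] dist[of t] x w[of t] t
        by (intro exI[of _ "hadd X x (hscal A X (complex_of_real t) (S (y n)))"])
          (simp add: hadd_closed)
    next
      case 2
      then show ?thesis
        using ipw[of "- t"] dist[of "- t"] x w[of "- t"] t scal_minus_left[of ?v t] ip_closed Sy
        by (intro exI[of _ "hadd X x (hscal A X (complex_of_real (- t)) (S (y n)))"])
          (simp add: hadd_closed)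
    qed
  qed
  have "\<exists>x. \<forall>n. x n \<in> carrier X \<and> ?Q n (x n) (x (Suc n))"
    by (rule dependent_nat_choice[of "\<lambda>_ x. x \<in> carrier X" ?Q]) (use hzero_closed step in blast)+
  then obtain x where x: "\<And>n. x n \<in> carrier X" "\<And>n. hn (hdiff (x (Suc n)) (x n)) \<le> ?q n"
    "\<And>n. ?q n * hn (S (y n)) \<le> nrm A (ip X (S (y n)) (x (Suc n)))" by blast
  \<comment> \<open>The bound is the geometric sum of 1 / 3^i over k <= i < k + j.\<close>
  have tail: "hn (hdiff (x (k + j)) (x k)) \<le> 3/2 * ?q k * (1 - ?q j)" for k j
  proof (induction j)
    case 0
    have "hn (hdiff (x k) (x k)) = 0"
      using x(1)[of k] hn_square[of "hdiff (x k) (x k)"] by (simp add: hclosed ip_hdiff ip_closed)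
    then show ?case by simp
  next
    case (Suc j)
    have "hn (hdiff (x (k + Suc j)) (x k)) \<le> ?q (k + j) + 3/2 * ?q k * (1 - ?q j)"
      using hdiff_triangle[of "x (k + Suc j)" "x (k + j)" "x k"] x(1) x(2)[of "k + j"] Suc by simp
    also have "\<dots> = 3/2 * ?q k * (1 - ?q (Suc j))" by (simp add: power_add field_simps)
    finally show ?case .
  qed
  have tail': "hn (hdiff (x m) (x k)) \<le> 3/2 * ?q k" if "m \<ge> k" for m k
  proof -
    have "3/2 * ?q k * (1 - ?q (m - k)) \<le> 3/2 * ?q k * 1" by (intro mult_left_mono) auto
    with tail[of k "m - k"] have "hn (hdiff (x (k + (m - k))) (x k)) \<le> 3/2 * ?q k * 1" by (rule order_trans)
    then show ?thesis using that by simp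
  qed
  have "\<forall>e>0. \<exists>N. \<forall>m\<ge>N. \<forall>n\<ge>N. hdist A X (x m) (x n) < e"
  proof (intro allI impI)
    fix e :: real assume "e > 0"
    then obtain N where N: "?q N < e / 3" using real_arch_pow_inv[of "e/3" "1/3"] by auto
    have "hdist A X (x m) (x n) < e" if "m \<ge> N" "n \<ge> N" for m n
      using hdiff_triangle[of "x m" "x N" "x n"] hdiff_commute[of "x N" "x n"] x(1)
        tail'[OF that(1)] tail'[OF that(2)] N by (simp add: hdist_eq)
    then show "\<exists>N. \<forall>m\<ge>N. \<forall>n\<ge>N. hdist A X (x m) (x n) < e" by blast
  qed
  then obtain l where l: "l \<in> carrier X" "(\<lambda>n. hdist A X (x n) l) \<longlonglongrightarrow> 0" using hcomplete x(1) by blast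
  have ltail: "hn (hdiff (x k) l) \<le> 3/2 * ?q k" for k
  proof -
    have "(\<lambda>m. hn (hdiff (x m) l) + 3/2 * ?q k) \<longlonglongrightarrow> 0 + 3/2 * ?q k"
      using l(2) by (intro tendsto_intros) (simp add: hdist_eq)
    moreover have "hn (hdiff (x k) l) \<le> hn (hdiff (x m) l) + 3/2 * ?q k" if "m \<ge> k" for m
      using hdiff_triangle[of "x k" "x m" l] hdiff_commute[of "x k" "x m"] x(1) l(1) tail'[OF that]
      by simp
    ultimately have "hn (hdiff (x k) l) \<le> 0 + 3/2 * ?q k" by (intro LIMSEQ_le_const) blast+
    then show ?thesis by simp
  qed
  \<comment> \<open>Half of the n-th hump survives the later corrections, so the single vector
    \<open>T l\<close> would have arbitrarily large norm.\<close>
  have "(4/3) ^ n / 2 \<le> hn (T l)" for n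
  proof -
    let ?h = "hn (S (y n))"
    have "?q n * ?h \<le> nrm A (ip X (S (y n)) (x (Suc n)))" by (rule x(3))
    also have "\<dots> \<le> nrm A (ip X (S (y n)) l) + nrm A (ip X (S (y n)) (x (Suc n)) \<ominus> ip X (S (y n)) l)"
      using ip_closed Sy x(1) l(1) by (intro nrm_le_diff) auto
    also have "\<dots> \<le> hn (T l) + ?h * (3/2 * ?q (Suc n))"
    proof (intro add_mono)
      have "nrm A (ip X (S (y n)) l) \<le> hn (y n) * hn (T l)"
        using nrm_ip_le[of "y n" "T l"] y l(1) is_adjointD[OF TS] by simp
      also have "\<dots> \<le> 1 * hn (T l)"
        using y hn_nonneg is_adjointD(1)[OF TS] l(1) by (intro mult_right_mono) auto
      finally show "nrm A (ip X (S (y n)) l) \<le> hn (T l)" by simp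
      show "nrm A (ip X (S (y n)) (x (Suc n)) \<ominus> ip X (S (y n)) l) \<le> ?h * (3/2 * ?q (Suc n))"
        by (rule order_trans[OF nrm_ip_hdiff_le(1)[OF x(1) l(1) Sy] mult_left_mono[OF ltail]])
          (use pos[of n] in simp)
    qed
    finally have "?q n * ?h / 2 \<le> hn (T l)" by (simp add: algebra_simps)
    moreover have "?q n * 4 ^ n \<le> ?q n * ?h" using y(3)[of n] by (intro mult_left_mono) auto
    moreover have "?q n * 4 ^ n = (4/3) ^ n" by (simp flip: power_mult_distrib)
    ultimately show ?thesis by simp
  qed
  moreover obtain n where "2 * hn (T l) < (4/3) ^ n" using real_arch_pow[of "4/3"] by auto
  ultimately show False by (smt (verit) field_sum_of_halves)
qed

lemma adjoint_bounded:
  assumes T: "T \<in> carrier L"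
  obtains K where "K \<ge> 0" "\<And>x. x \<in> carrier X \<Longrightarrow> hn (T x) \<le> K * hn x"
proof -
  obtain K where K: "\<And>x. x \<in> carrier X \<Longrightarrow> hn x \<le> 1 \<Longrightarrow> hn (T x) \<le> K"
    using adjoint_bounded_unit_ball[OF is_adjoint_sym[OF adjointableD[OF T]]] by blast
  show thesis
  proof
    show "\<bar>K\<bar> \<ge> 0" by simp
    fix x assume x: "x \<in> carrier X"
    show "hn (T x) \<le> \<bar>K\<bar> * hn x"
    proof (cases "hn x = 0")
      case True
      then have "x = hzero X" using hn_eq_zero x by blast
      then show ?thesis using True T by (simp add: op_zero)
    next
      case False
      then have p: "hn x > 0" using hn_nonneg[OF x] by simp
      have "hn (T (hscal A X (complex_of_real (1 / hn x)) x)) \<le> K"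
        using K x p hn_hscal[OF x, of "complex_of_real (1 / hn x)"] by (simp add: hclosed norm_divide)
      then have "(1 / hn x) * hn (T x) \<le> K"
        using op_hscal[OF T x] hn_hscal[OF op_closed[OF T x], of "complex_of_real (1 / hn x)"] p
        by (simp add: norm_divide)
      then have "hn (T x) \<le> K * hn x" using p by (simp add: field_simps)
      also have "\<dots> \<le> \<bar>K\<bar> * hn x" using p by (intro mult_right_mono) auto
      finally show ?thesis .
    qed
  qed
qed

lemma hn_zero: "hn (hzero X) = 0"
  using hn_square[OF hzero_closed] by (simp add: ip_zero hzero_closed)

text \<open>The supremum that defines the operator norm is over a bounded set because of the gliding
  hump argument.\<close>

lemma L_nrm_upper:
  assumes T: "T \<in> carrier L" and x: "x \<in> carrier X" "hn x \<le> 1"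
  shows "hn (T x) \<le> nrm L T"
proof -
  obtain K where K: "K \<ge> 0" "\<And>x. x \<in> carrier X \<Longrightarrow> hn (T x) \<le> K * hn x"
    using adjoint_bounded[OF T] by blast
  have "bdd_above ((\<lambda>x. hn (T x)) ` {x \<in> carrier X. hn x \<le> 1})"
    using K by (intro bdd_aboveI2[of _ _ K]) (fastforce intro: order_trans mult_left_le)
  then show ?thesis unfolding L_simps using x by (intro cSUP_upper) auto
qed

lemma L_nrm_nonneg: "T \<in> carrier L \<Longrightarrow> 0 \<le> nrm L T"
  using L_nrm_upper[of T "hzero X"] hn_zero by (simp add: hzero_closed op_zero)

lemma L_nrm_bound:
  assumes T: "T \<in> carrier L" and x: "x \<in> carrier X"
  shows "hn (T x) \<le> nrm L T * hn x"
proof (cases "hn x = 0")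
  case True
  then have "x = hzero X" using hn_eq_zero x by blast
  then show ?thesis using T by (simp add: op_zero hn_zero)
next
  case False
  then have p: "hn x > 0" using hn_nonneg[OF x] by simp
  have "hn (T (hscal A X (complex_of_real (1 / hn x)) x)) \<le> nrm L T"
    using L_nrm_upper[OF T] x p hn_hscal[OF x, of "complex_of_real (1 / hn x)"]
    by (simp add: hclosed norm_divide)
  then have "(1 / hn x) * hn (T x) \<le> nrm L T"
    using op_hscal[OF T x] hn_hscal[OF op_closed[OF T x], of "complex_of_real (1 / hn x)"] p
    by (simp add: norm_divide)
  then show ?thesis using p by (simp add: field_simps)
qed

lemma L_nrm_least:
  assumes "0 \<le> c" "\<And>x. x \<in> carrier X \<Longrightarrow> hn (T x) \<le> c * hn x"
  shows "nrm L T \<le> c"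
  unfolding L_simps
proof (rule cSUP_least)
  show "{x \<in> carrier X. hn x \<le> 1} \<noteq> {}" using hzero_closed hn_zero by force
  fix x assume "x \<in> {x \<in> carrier X. hn x \<le> 1}"
  then show "hn (T x) \<le> c" using assms(2)[of x] mult_left_le[of "hn x" c] assms(1) by simp
qed

lemma L_nrm_mult:
  assumes "T \<in> carrier L" "S \<in> carrier L"
  shows "nrm L (T \<otimes>\<^bsub>L\<^esub> S) \<le> nrm L T * nrm L S"
proof (rule L_nrm_least)
  fix x assume x: "x \<in> carrier X"
  have "hn (T (S x)) \<le> nrm L T * hn (S x)" using assms x op_closed L_nrm_bound by blast
  also have "\<dots> \<le> nrm L T * (nrm L S * hn x)"
    using assms x L_nrm_bound L_nrm_nonneg by (intro mult_left_mono) auto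
  finally show "hn ((T \<otimes>\<^bsub>L\<^esub> S) x) \<le> nrm L T * nrm L S * hn x" using x by (simp add: L_app mult.assoc)
qed (use assms L_nrm_nonneg in simp)

lemma L_nrm_star: "T \<in> carrier L \<Longrightarrow> nrm L (star L T) = nrm L T"
proof -
  have le: "nrm L (star L T) \<le> nrm L T" if T: "T \<in> carrier L" for T
  proof (rule L_nrm_least[OF L_nrm_nonneg[OF T]])
    fix x assume x: "x \<in> carrier X"
    let ?y = "star L T x"
    have y: "?y \<in> carrier X" using star_op_closed T x by blast
    have "(hn ?y)\<^sup>2 = nrm A (ip X (T ?y) x)" using T x y by (simp add: hn_square ip_op_left)
    also have "\<dots> \<le> hn (T ?y) * hn x" using T x y op_closed nrm_ip_le by blast
    also have "\<dots> \<le> nrm L T * hn ?y * hn x"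
      using L_nrm_bound[OF T y] hn_nonneg[OF x] by (intro mult_right_mono) auto
    finally have "hn ?y * hn ?y \<le> nrm L T * hn x * hn ?y" by (simp add: power2_eq_square mult_ac)
    then show "hn ?y \<le> nrm L T * hn x"
      using hn_nonneg[OF y] hn_nonneg[OF x] L_nrm_nonneg[OF T]
      by (cases "hn ?y = 0") (auto dest: mult_right_le_imp_le)
  qed
  assume "T \<in> carrier L"
  then show ?thesis using le[of T] le[of "star L T"] L_closed(6) by (simp add: L_star)
qed

text \<open>A pointwise limit is easy, but it needs an adjoint. Since the involution is isometric,
  the adjoints converge pointwise as well, and the two limits are adjoint to each other.\<close>

lemma L_complete:
  assumes s: "\<And>n. s n \<in> carrier L" and cauchy: "\<forall>e>0. \<exists>N. \<forall>m\<ge>N. \<forall>n\<ge>N. nrm L (s m \<ominus>\<^bsub>L\<^esub> s n) < e"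
  shows "\<exists>l. nrm_lim L s l"
proof -
  interpret L: ring L by (rule ring_L)
  have pw: "\<exists>l\<in>carrier X. (\<lambda>n. hdist A X (t n x) l) \<longlonglongrightarrow> 0"
    if t: "\<And>n. t n \<in> carrier L" and c: "\<forall>e>0. \<exists>N. \<forall>m\<ge>N. \<forall>n\<ge>N. nrm L (t m \<ominus>\<^bsub>L\<^esub> t n) < e"
      and x: "x \<in> carrier X" for t x
  proof (rule hcomplete)
    show "\<forall>e>0. \<exists>N. \<forall>m\<ge>N. \<forall>n\<ge>N. hdist A X (t m x) (t n x) < e"
    proof (intro allI impI)
      fix e :: real assume e: "e > 0"
      have p: "hn x + 1 > 0" using hn_nonneg[OF x] by simp
      then obtain N where N: "\<And>m n. m \<ge> N \<Longrightarrow> n \<ge> N \<Longrightarrow> nrm L (t m \<ominus>\<^bsub>L\<^esub> t n) < e / (hn x + 1)"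
        using c e by (metis divide_pos_pos)
      have "hdist A X (t m x) (t n x) < e" if "m \<ge> N" "n \<ge> N" for m n
      proof -
        have d: "t m \<ominus>\<^bsub>L\<^esub> t n \<in> carrier L" using t by simp
        have "hdist A X (t m x) (t n x) \<le> nrm L (t m \<ominus>\<^bsub>L\<^esub> t n) * hn x"
          using L_nrm_bound[OF d x] t x by (simp add: hdist_eq L_diff_app)
        also have "\<dots> \<le> nrm L (t m \<ominus>\<^bsub>L\<^esub> t n) * (hn x + 1)"
          using L_nrm_nonneg[OF d] by (intro mult_left_mono) auto
        also have "\<dots> < e" using N[OF that] p by (simp add: field_simps)
        finally show ?thesis .
      qed
      then show "\<exists>N. \<forall>m\<ge>N. \<forall>n\<ge>N. hdist A X (t m x) (t n x) < e" by blast
    qed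
  qed (use t x op_closed in blast)
  have diff_star: "star L T \<ominus>\<^bsub>L\<^esub> star L R = star L (T \<ominus>\<^bsub>L\<^esub> R)" if "T \<in> carrier L" "R \<in> carrier L" for T R
    using that by (simp add: a_minus_def L_minus L_closed L_star)
  obtain T where T: "\<And>x. x \<in> carrier X \<Longrightarrow> T x \<in> carrier X \<and> (\<lambda>n. hdist A X (s n x) (T x)) \<longlonglongrightarrow> 0"
    using pw[OF s cauchy] by metis
  have "\<forall>e>0. \<exists>N. \<forall>m\<ge>N. \<forall>n\<ge>N. nrm L (star L (s m) \<ominus>\<^bsub>L\<^esub> star L (s n)) < e"
    using cauchy s L_nrm_star[OF L.minus_closed] by (simp add: diff_star)
  then obtain R where R: "\<And>x. x \<in> carrier X \<Longrightarrow> R x \<in> carrier X \<and> (\<lambda>n. hdist A X (star L (s n) x) (R x)) \<longlonglongrightarrow> 0"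
    using pw[of "\<lambda>n. star L (s n)"] L_closed(6)[OF s] by metis
  define T' where "T' = restrict T (carrier X)"
  define R' where "R' = restrict R (carrier X)"
  have "is_adjoint X T' R'"
  proof (rule is_adjointI)
    fix x y assume xy: "x \<in> carrier X" "y \<in> carrier X"
    have snx: "s n x \<in> carrier X" "star L (s n) y \<in> carrier X" for n
      using s xy op_closed star_op_closed by auto
    have "nrm_lim A (\<lambda>n. ip X (s n x) y) (ip X (T x) y)"
    proof (rule nrm_limI_bound)
      show "\<forall>\<^sub>F n in sequentially. nrm A (ip X (s n x) y \<ominus> ip X (T x) y) \<le> hdist A X (s n x) (T x) * hn y"
        using nrm_ip_hdiff_le(2)[OF snx(1) _ xy(2)] T xy by (simp add: hdist_eq)
      show "(\<lambda>n. hdist A X (s n x) (T x) * hn y) \<longlonglongrightarrow> 0"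
        using T xy by (intro tendsto_mult_left_zero) blast
    qed (use T xy snx ip_closed in auto)
    moreover have "nrm_lim A (\<lambda>n. ip X x (star L (s n) y)) (ip X x (R y))"
    proof (rule nrm_limI_bound)
      show "\<forall>\<^sub>F n in sequentially. nrm A (ip X x (star L (s n) y) \<ominus> ip X x (R y))
          \<le> hn x * hdist A X (star L (s n) y) (R y)"
        using nrm_ip_hdiff_le(1)[OF snx(2) _ xy(1)] R xy by (simp add: hdist_eq)
      show "(\<lambda>n. hn x * hdist A X (star L (s n) y) (R y)) \<longlonglongrightarrow> 0"
        using R xy by (intro tendsto_mult_right_zero) blast
    qed (use R xy snx ip_closed in auto)
    moreover have "(\<lambda>n. ip X (s n x) y) = (\<lambda>n. ip X x (star L (s n) y))"
      using s xy ip_op_left by blast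
    ultimately show "ip X (T' x) y = ip X x (R' y)"
      using nrm_lim_unique[of "\<lambda>n. ip X (s n x) y" "ip X (T x) y" "ip X x (R y)"] xy snx ip_closed
      by (simp add: T'_def R'_def)
  qed (use T R in \<open>auto simp: T'_def R'_def\<close>)
  then have T': "T' \<in> carrier L" by (rule adjointableI)
  have "(\<lambda>n. nrm L (s n \<ominus>\<^bsub>L\<^esub> T')) \<longlonglongrightarrow> 0"
  proof (rule LIMSEQ_I)
    fix e :: real assume e: "e > 0"
    then obtain N where N: "\<And>m n. m \<ge> N \<Longrightarrow> n \<ge> N \<Longrightarrow> nrm L (s m \<ominus>\<^bsub>L\<^esub> s n) < e / 2"
      using cauchy by (metis half_gt_zero)
    have "norm (nrm L (s n \<ominus>\<^bsub>L\<^esub> T') - 0) < e" if n: "n \<ge> N" for n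
    proof -
      have "nrm L (s n \<ominus>\<^bsub>L\<^esub> T') \<le> e / 2"
      proof (rule L_nrm_least)
        fix x assume x: "x \<in> carrier X"
        have snx: "s m x \<in> carrier X" for m using s x op_closed by blast
        have "hn (hdiff (s n x) (T x)) \<le> e / 2 * hn x + hn (hdiff (s m x) (T x))" if m: "m \<ge> N" for m
        proof -
          have "hn (hdiff (s n x) (s m x)) \<le> nrm L (s n \<ominus>\<^bsub>L\<^esub> s m) * hn x"
            using L_nrm_bound[OF L.minus_closed[OF s s] x, of n m] s x by (simp add: L_diff_app)
          also have "\<dots> \<le> e / 2 * hn x"
            using N[OF n m] hn_nonneg[OF x] by (intro mult_right_mono) auto
          finally show ?thesis using hdiff_triangle[OF snx snx, of "T x" n m] T x by simp
        qed
        moreover have "(\<lambda>m. e / 2 * hn x + hn (hdiff (s m x) (T x))) \<longlonglongrightarrow> e / 2 * hn x + 0"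
          using T x by (intro tendsto_intros) (simp add: hdist_eq)
        ultimately have "hn (hdiff (s n x) (T x)) \<le> e / 2 * hn x + 0" by (intro LIMSEQ_le_const) blast+
        then show "hn ((s n \<ominus>\<^bsub>L\<^esub> T') x) \<le> e / 2 * hn x" using x T' by (simp add: L_diff_app) (simp add: T'_def)
      qed (use e in simp)
      then show ?thesis using e L_nrm_nonneg[OF L.minus_closed[OF s T']] by simp
    qed
    then show "\<exists>no. \<forall>n\<ge>no. norm (nrm L (s n \<ominus>\<^bsub>L\<^esub> T') - 0) < e" by blast
  qed
  then show ?thesis using T' unfolding nrm_lim_def by blast
qed

theorem adjointable_cstar: "unital_cstar_algebra L"
proof (intro unital_cstar_algebra.intro[OF ring_L] unital_cstar_algebra_axioms.intro)
  fix T S c d assume T: "T \<in> carrier L"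
  have Tx: "x \<in> carrier X \<Longrightarrow> T x \<in> carrier X" for x using T op_closed by blast
  note app = L_closed L_app T Tx hclosed ip_add ip_hscal ip_closed
  show "scal L c T \<in> carrier L" "star L T \<in> carrier L" "star L (star L T) = T"
    "star L (scal L c T) = scal L (cnj c) (star L T)" "0 \<le> nrm L T"
    using T by (auto simp: L_closed L_star L_nrm_nonneg)
  show "scal L (c + d) T = scal L c T \<oplus>\<^bsub>L\<^esub> scal L d T"
    by (rule op_eqI) (simp_all add: app scal_add_left)
  show "scal L c (scal L d T) = scal L (c * d) T"
    by (rule op_eqI) (simp_all add: app scal_scal)
  show "scal L 1 T = T" by (rule op_eqI) (simp_all add: app scal_one)
  show "nrm L T = 0 \<longleftrightarrow> T = \<zero>\<^bsub>L\<^esub>"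
  proof
    assume 0: "nrm L T = 0"
    show "T = \<zero>\<^bsub>L\<^esub>"
    proof (rule op_eqI)
      fix x z assume x: "x \<in> carrier X"
      then have "hn (T x) = 0" using L_nrm_bound[OF T x] 0 hn_nonneg[OF Tx[OF x]] by simp
      then have "T x = hzero X" using Tx[OF x] hn_eq_zero by blast
      then show "ip X z (T x) = ip X z (\<zero>\<^bsub>L\<^esub> x)" using x by (simp add: L_app)
    qed (simp_all add: app)
  next
    assume "T = \<zero>\<^bsub>L\<^esub>"
    then have "nrm L T \<le> 0" by (intro L_nrm_least) (simp_all add: L_app hn_zero)
    then show "nrm L T = 0" using L_nrm_nonneg[OF T] by simp
  qed
  have le: "nrm L (scal L e R) \<le> cmod e * nrm L R" if R: "R \<in> carrier L" for e R
  proof (rule L_nrm_least)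
    fix x assume x: "x \<in> carrier X"
    then show "hn (scal L e R x) \<le> cmod e * nrm L R * hn x"
      using L_nrm_bound[OF R x] op_closed[OF R x]
      by (simp add: L_app hn_hscal mult.assoc mult_left_mono)
  qed (use R L_nrm_nonneg in simp)
  show "nrm L (scal L c T) = cmod c * nrm L T"
  proof (cases "c = 0")
    case True
    then show ?thesis using le[OF T, of 0] L_nrm_nonneg[OF L_closed(3)[OF T], of 0] by simp
  next
    case False
    have "scal L (1/c) (scal L c T) = T"
      using False by (intro op_eqI) (simp_all add: app scal_scal scal_one)
    then have "nrm L T \<le> cmod (1/c) * nrm L (scal L c T)"
      using le[OF L_closed(3)[OF T], of "1/c" c] by simp
    then have "cmod c * nrm L T \<le> nrm L (scal L c T)" using False by (simp add: norm_divide field_simps)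
    then show ?thesis using le[OF T, of c] by simp
  qed
  have TT: "star L T \<otimes>\<^bsub>L\<^esub> T \<in> carrier L" by (rule L_closed(1)[OF L_closed(6)[OF T] T])
  have "nrm L T \<le> sqrt (nrm L (star L T \<otimes>\<^bsub>L\<^esub> T))"
  proof (rule L_nrm_least)
    fix x assume x: "x \<in> carrier X"
    have "(hn (T x))\<^sup>2 = nrm A (ip X x ((star L T \<otimes>\<^bsub>L\<^esub> T) x))"
      using T x Tx by (simp add: hn_square ip_op_left L_app)
    also have "\<dots> \<le> hn x * hn ((star L T \<otimes>\<^bsub>L\<^esub> T) x)" using x TT op_closed nrm_ip_le by blast
    also have "\<dots> \<le> hn x * (nrm L (star L T \<otimes>\<^bsub>L\<^esub> T) * hn x)"
      using L_nrm_bound[OF TT x] hn_nonneg[OF x] by (intro mult_left_mono) auto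
    also have "\<dots> = (sqrt (nrm L (star L T \<otimes>\<^bsub>L\<^esub> T)) * hn x)\<^sup>2"
      using L_nrm_nonneg[OF TT] by (simp add: power_mult_distrib) (simp add: power2_eq_square)
    finally show "hn (T x) \<le> sqrt (nrm L (star L T \<otimes>\<^bsub>L\<^esub> T)) * hn x"
      by (rule power2_le_imp_le) (use hn_nonneg[OF x] L_nrm_nonneg[OF TT] in simp)
  qed (use L_nrm_nonneg TT in simp)
  then have "(nrm L T)\<^sup>2 \<le> (sqrt (nrm L (star L T \<otimes>\<^bsub>L\<^esub> T)))\<^sup>2"
    using L_nrm_nonneg[OF T] by (intro power_mono)
  then have "(nrm L T)\<^sup>2 \<le> nrm L (star L T \<otimes>\<^bsub>L\<^esub> T)" using L_nrm_nonneg[OF TT] by simp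
  moreover have "nrm L (star L T \<otimes>\<^bsub>L\<^esub> T) \<le> (nrm L T)\<^sup>2"
    using L_nrm_mult[OF L_closed(6)[OF T] T] L_nrm_star[OF T] by (simp add: power2_eq_square)
  ultimately show "nrm L (star L T \<otimes>\<^bsub>L\<^esub> T) = (nrm L T)\<^sup>2" by simp
  assume S: "S \<in> carrier L"
  have Sx: "x \<in> carrier X \<Longrightarrow> S x \<in> carrier X" for x using S op_closed by blast
  show "scal L c (T \<oplus>\<^bsub>L\<^esub> S) = scal L c T \<oplus>\<^bsub>L\<^esub> scal L c S"
    by (rule op_eqI) (simp_all add: app S Sx scal_add_right)
  show "scal L c T \<otimes>\<^bsub>L\<^esub> S = scal L c (T \<otimes>\<^bsub>L\<^esub> S)"
    by (rule op_eqI) (simp_all add: app S Sx)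
  show "T \<otimes>\<^bsub>L\<^esub> scal L c S = scal L c (T \<otimes>\<^bsub>L\<^esub> S)"
    by (rule op_eqI) (simp_all add: app S Sx op_hscal)
  show "star L (T \<oplus>\<^bsub>L\<^esub> S) = star L T \<oplus>\<^bsub>L\<^esub> star L S" "star L (T \<otimes>\<^bsub>L\<^esub> S) = star L S \<otimes>\<^bsub>L\<^esub> star L T"
    using T S by (simp_all add: L_star)
  show "nrm L (T \<oplus>\<^bsub>L\<^esub> S) \<le> nrm L T + nrm L S"
  proof (rule L_nrm_least)
    fix x assume x: "x \<in> carrier X"
    then show "hn ((T \<oplus>\<^bsub>L\<^esub> S) x) \<le> (nrm L T + nrm L S) * hn x"
      using hn_add[OF Tx[OF x] Sx[OF x]] L_nrm_bound[OF T x] L_nrm_bound[OF S x]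
      by (simp add: L_app distrib_right)
  qed (use T S L_nrm_nonneg in simp)
  show "nrm L (T \<otimes>\<^bsub>L\<^esub> S) \<le> nrm L T * nrm L S" using T S L_nrm_mult by blast
qed (rule L_complete)

end

section \<open>Infinite sums and Gram matrices\<close>

definition nsummable :: "('a, 'm) cstar_algebra_scheme \<Rightarrow> (nat \<Rightarrow> 'a) \<Rightarrow> bool" where
  "nsummable A f \<longleftrightarrow> (\<exists>l. nrm_lim A (psum A f) l)"

definition nsum :: "('a, 'm) cstar_algebra_scheme \<Rightarrow> (nat \<Rightarrow> 'a) \<Rightarrow> 'a" where
  "nsum A f = (THE l. nrm_lim A (psum A f) l)"

text \<open>The terms of the inner product of the columns \<open>f\<close> and
  \<open>g\<close>.\<close>

definition gram :: "('a, 'm) cstar_algebra_scheme \<Rightarrow> (nat \<Rightarrow> 'a) \<Rightarrow> (nat \<Rightarrow> 'a) \<Rightarrow> nat \<Rightarrow> 'a" where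
  "gram A f g n = star A (f n) \<otimes>\<^bsub>A\<^esub> g n"

context unital_cstar_algebra
begin

lemma add_diff_cancel: "\<lbrakk>a \<in> carrier A; b \<in> carrier A\<rbrakk> \<Longrightarrow> a \<oplus> b \<ominus> a = b"
  by algebra

lemma nsum_lim:
  assumes "nsummable A f" "\<And>n. f n \<in> carrier A"
  shows "nrm_lim A (psum A f) (nsum A f)"
proof -
  obtain l where l: "nrm_lim A (psum A f) l" using assms nsummable_def by metis
  moreover have "m = l" if "nrm_lim A (psum A f) m" for m
    using nrm_lim_unique[OF that l] psum_closed assms(2) by blast
  ultimately show ?thesis unfolding nsum_def by (metis theI)
qed

lemma nsumI:
  assumes "nrm_lim A (psum A f) l" "\<And>n. f n \<in> carrier A"
  shows "nsummable A f" "nsum A f = l"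
proof -
  show s: "nsummable A f" using assms by (auto simp: nsummable_def)
  show "nsum A f = l" using nrm_lim_unique[OF nsum_lim[OF s assms(2)] assms(1)] psum_closed assms(2) by blast
qed

lemma psum_cong: "(\<And>k. k < n \<Longrightarrow> f k = g k) \<Longrightarrow> psum A f n = psum A g n"
  by (induction n) auto

lemma psum_shift:
  "(\<And>n. f n \<in> carrier A) \<Longrightarrow> psum A f (m + n) = psum A f m \<oplus> psum A (\<lambda>k. f (m + k)) n"
  by (induction n) (auto simp: psum_closed a_assoc)

lemma psum_Suc_left:
  "(\<And>n. f n \<in> carrier A) \<Longrightarrow> psum A f (Suc n) = f 0 \<oplus> psum A (\<lambda>k. f (Suc k)) n"
  using psum_shift[of f 1 n] by simp

lemma psum_add:
  "(\<And>n. f n \<in> carrier A) \<Longrightarrow> (\<And>n. g n \<in> carrier A)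
    \<Longrightarrow> psum A (\<lambda>k. f k \<oplus> g k) n = psum A f n \<oplus> psum A g n"
  by (induction n) (simp_all add: psum_closed a_ac)

lemma psum_mult_left:
  "(\<And>n. f n \<in> carrier A) \<Longrightarrow> c \<in> carrier A \<Longrightarrow> psum A (\<lambda>k. c \<otimes> f k) n = c \<otimes> psum A f n"
  by (induction n) (auto simp: psum_closed r_distr)

lemma psum_mult_right:
  "(\<And>n. f n \<in> carrier A) \<Longrightarrow> c \<in> carrier A \<Longrightarrow> psum A (\<lambda>k. f k \<otimes> c) n = psum A f n \<otimes> c"
  by (induction n) (auto simp: psum_closed l_distr)

lemma psum_star: "(\<And>n. f n \<in> carrier A) \<Longrightarrow> star A (psum A f n) = psum A (\<lambda>k. star A (f k)) n"
  by (induction n) (auto simp: psum_closed star_add)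

lemma psum_scal: "(\<And>n. f n \<in> carrier A) \<Longrightarrow> psum A (\<lambda>k. scal A c (f k)) n = scal A c (psum A f n)"
  by (induction n) (auto simp: psum_closed scal_add_right)

lemma psum_zero: "(\<And>k. k < n \<Longrightarrow> f k = \<zero>) \<Longrightarrow> psum A f n = \<zero>"
  by (induction n) auto

lemma psum_single:
  assumes "\<And>k. f k \<in> carrier A" "\<And>k. k \<noteq> m \<Longrightarrow> f k = \<zero>" "m < n"
  shows "psum A f n = f m"
  using assms(3)
proof (induction n)
  case (Suc n)
  show ?case
  proof (cases "m = n")
    case True
    then show ?thesis using assms(1) psum_zero[of n f] assms(2) by simp
  next
    case False
    then show ?thesis using Suc assms(1,2) by (simp add: less_Suc_eq)
  qed
qed simp

lemma psum_extend:
  assumes "\<And>k. f k \<in> carrier A" "\<And>k. n \<le> k \<Longrightarrow> f k = \<zero>" "n \<le> m"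
  shows "psum A f m = psum A f n"
  using psum_shift[of f n "m - n"] assms psum_zero[of "m - n" "\<lambda>k. f (n + k)"] psum_closed[of f]
  by simp

lemma nsum_finite:
  assumes "\<And>k. f k \<in> carrier A" "\<And>k. n \<le> k \<Longrightarrow> f k = \<zero>"
  shows "nsummable A f" "nsum A f = psum A f n"
proof -
  have "nrm_lim A (psum A f) (psum A f n)"
  proof (rule nrm_lim_cong[OF nrm_lim_const[OF psum_closed[OF assms(1)]]])
    show "\<forall>\<^sub>F k in sequentially. psum A f k = psum A f n"
      using psum_extend[of f n] assms by (intro eventually_sequentiallyI[of n]) blast
  qed
  then show "nsummable A f" "nsum A f = psum A f n" using nsumI assms(1) by auto
qed

lemma nsum_single:
  assumes "\<And>k. f k \<in> carrier A" "\<And>k. k \<noteq> m \<Longrightarrow> f k = \<zero>"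
  shows "nsummable A f" "nsum A f = f m"
  using nsum_finite[of f "Suc m"] psum_single[of f m "Suc m"] assms by auto

lemma nsum_closed: "nsummable A f \<Longrightarrow> (\<And>n. f n \<in> carrier A) \<Longrightarrow> nsum A f \<in> carrier A"
  using nsum_lim nrm_limD by blast

lemma nsum_add:
  assumes "nsummable A f" "nsummable A g" "\<And>n. f n \<in> carrier A" "\<And>n. g n \<in> carrier A"
  shows "nsummable A (\<lambda>k. f k \<oplus> g k)" "nsum A (\<lambda>k. f k \<oplus> g k) = nsum A f \<oplus> nsum A g"
proof -
  have "psum A (\<lambda>k. f k \<oplus> g k) = (\<lambda>n. psum A f n \<oplus> psum A g n)" using psum_add assms by blast
  then have *: "nrm_lim A (psum A (\<lambda>k. f k \<oplus> g k)) (nsum A f \<oplus> nsum A g)"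
    using nrm_lim_add[OF nsum_lim[OF assms(1,3)] nsum_lim[OF assms(2,4)]] psum_closed assms by simp
  show "nsummable A (\<lambda>k. f k \<oplus> g k)" "nsum A (\<lambda>k. f k \<oplus> g k) = nsum A f \<oplus> nsum A g"
    using nsumI[OF *] assms by auto
qed

lemma nsum_mult_right:
  assumes "nsummable A f" "\<And>n. f n \<in> carrier A" "c \<in> carrier A"
  shows "nsummable A (\<lambda>k. f k \<otimes> c)" "nsum A (\<lambda>k. f k \<otimes> c) = nsum A f \<otimes> c"
proof -
  have "psum A (\<lambda>k. f k \<otimes> c) = (\<lambda>n. psum A f n \<otimes> c)" using psum_mult_right assms by blast
  then have *: "nrm_lim A (psum A (\<lambda>k. f k \<otimes> c)) (nsum A f \<otimes> c)"
    using nrm_lim_mult[OF nsum_lim[OF assms(1,2)] nrm_lim_const] psum_closed assms by simp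
  show "nsummable A (\<lambda>k. f k \<otimes> c)" "nsum A (\<lambda>k. f k \<otimes> c) = nsum A f \<otimes> c"
    using nsumI[OF *] assms by auto
qed

lemma nsum_star:
  assumes "nsummable A f" "\<And>n. f n \<in> carrier A"
  shows "nsummable A (\<lambda>k. star A (f k))" "nsum A (\<lambda>k. star A (f k)) = star A (nsum A f)"
proof -
  have "psum A (\<lambda>k. star A (f k)) = (\<lambda>n. star A (psum A f n))" using psum_star assms(2) by fastforce
  then have *: "nrm_lim A (psum A (\<lambda>k. star A (f k))) (star A (nsum A f))"
    using nrm_lim_star[OF nsum_lim[OF assms]] psum_closed assms by simp
  show "nsummable A (\<lambda>k. star A (f k))" "nsum A (\<lambda>k. star A (f k)) = star A (nsum A f)"
    using nsumI[OF *] assms star_closed by auto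
qed

lemma nsum_Suc:
  assumes "\<And>n. f n \<in> carrier A" "f 0 = \<zero>" "nsummable A (\<lambda>k. f (Suc k))"
  shows "nsummable A f" "nsum A f = nsum A (\<lambda>k. f (Suc k))"
proof -
  have eq: "psum A f (Suc n) = psum A (\<lambda>k. f (Suc k)) n" for n
    using psum_Suc_left[of f n] assms psum_closed by simp
  have "(\<lambda>n. nrm A (psum A f (Suc n) \<ominus> nsum A (\<lambda>k. f (Suc k)))) \<longlonglongrightarrow> 0"
    using nsum_lim[OF assms(3)] assms(1) unfolding eq by (simp add: nrm_lim_def)
  then have "nrm_lim A (psum A f) (nsum A (\<lambda>k. f (Suc k)))"
    using nsum_closed[OF assms(3)] assms(1)
      filterlim_sequentially_Suc[of "\<lambda>n. nrm A (psum A f n \<ominus> nsum A (\<lambda>k. f (Suc k)))"]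
    unfolding nrm_lim_def by blast
  then show "nsummable A f" "nsum A f = nsum A (\<lambda>k. f (Suc k))" using nsumI assms(1) by blast+
qed

lemma nsummable_Cauchy:
  assumes f: "\<And>n. f n \<in> carrier A"
  shows "nsummable A f \<longleftrightarrow> (\<forall>e>0. \<exists>N. \<forall>m\<ge>N. \<forall>n. nrm A (psum A (\<lambda>k. f (m + k)) n) < e)"
proof
  have seg: "psum A (\<lambda>k. f (m + k)) n = psum A f (m + n) \<ominus> psum A f m" for m n
  proof -
    have "psum A (\<lambda>k. f (m + k)) n \<in> carrier A" "psum A f m \<in> carrier A" using f psum_closed by auto
    then show ?thesis unfolding psum_shift[of f, OF f] by (simp add: add_diff_cancel)
  qed
  note pc = psum_closed[of f, OF f]
  {
    assume "nsummable A f"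
    then have l: "nrm_lim A (psum A f) (nsum A f)" using nsum_lim f by blast
    show "\<forall>e>0. \<exists>N. \<forall>m\<ge>N. \<forall>n. nrm A (psum A (\<lambda>k. f (m + k)) n) < e"
    proof (intro allI impI)
      fix e :: real assume "e > 0"
      then obtain N where N: "\<And>m. m \<ge> N \<Longrightarrow> \<bar>nrm A (psum A f m \<ominus> nsum A f)\<bar> < e / 2"
        using l nrm_lim_epsilon[OF nrm_limD(1)[OF l]] half_gt_zero by metis
      have "nrm A (psum A (\<lambda>k. f (m + k)) n) < e" if "m \<ge> N" for m n
        using N[of m] N[of "m + n"] that nrm_triangle[OF pc nrm_limD(1)[OF l] pc, of "m + n" m]
          nrm_diff_commute[OF pc nrm_limD(1)[OF l], of m] unfolding seg by linarith
      then show "\<exists>N. \<forall>m\<ge>N. \<forall>n. nrm A (psum A (\<lambda>k. f (m + k)) n) < e" by blast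
    qed
  next
    assume c: "\<forall>e>0. \<exists>N. \<forall>m\<ge>N. \<forall>n. nrm A (psum A (\<lambda>k. f (m + k)) n) < e"
    have "\<exists>l. nrm_lim A (psum A f) l"
    proof (rule complete)
      show "\<forall>e>0. \<exists>N. \<forall>m\<ge>N. \<forall>n\<ge>N. nrm A (psum A f m \<ominus> psum A f n) < e"
      proof (intro allI impI)
        fix e :: real assume "e > 0"
        then obtain N where N: "\<And>m n. m \<ge> N \<Longrightarrow> nrm A (psum A f (m + n) \<ominus> psum A f m) < e"
          using c unfolding seg by blast
        have "nrm A (psum A f m \<ominus> psum A f n) < e" if "m \<ge> N" "n \<ge> N" for m n
        proof (cases "n \<le> m")
          case True
          then show ?thesis using N[OF that(2), of "m - n"] by simp
        next
          case False
          then show ?thesis using N[OF that(1), of "n - m"] nrm_diff_commute[OF pc pc, of m n] by simp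
        qed
        then show "\<exists>N. \<forall>m\<ge>N. \<forall>n\<ge>N. nrm A (psum A f m \<ominus> psum A f n) < e" by blast
      qed
    qed (rule pc)
    then show "nsummable A f" by (simp add: nsummable_def)
  }
qed

lemma gram_closed: "\<lbrakk>\<And>n. f n \<in> carrier A; \<And>n. g n \<in> carrier A\<rbrakk> \<Longrightarrow> gram A f g n \<in> carrier A"
  by (simp add: gram_def star_closed)

lemma gram_pos: "(\<And>n. f n \<in> carrier A) \<Longrightarrow> pos A (gram A f f n)"
  by (simp add: gram_def pos_star_mult)

text \<open>The square of the column g + f c, summed up to \<open>n\<close>, is the form required by
  \<open>cauchy_schwarz\<close>.\<close>

lemma psum_gram_cauchy_schwarz:
  assumes f: "\<And>n. f n \<in> carrier A" and g: "\<And>n. g n \<in> carrier A"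
  shows "(nrm A (psum A (gram A f g) n))\<^sup>2 \<le> nrm A (psum A (gram A f f) n) * nrm A (psum A (gram A g g) n)"
proof (rule cauchy_schwarz)
  fix c assume c: "c \<in> carrier A"
  let ?h = "\<lambda>k. g k \<oplus> f k \<otimes> c"
  have h: "?h k \<in> carrier A" for k using f g c by simp
  have "gram A ?h ?h = (\<lambda>k. gram A g g k \<oplus> star A c \<otimes> gram A f g k \<oplus> star A (gram A f g k) \<otimes> c
      \<oplus> star A c \<otimes> gram A f f k \<otimes> c)"
  proof
    show "gram A ?h ?h k = gram A g g k \<oplus> star A c \<otimes> gram A f g k \<oplus> star A (gram A f g k) \<otimes> c
      \<oplus> star A c \<otimes> gram A f f k \<otimes> c" for k
      unfolding gram_def using f[of k] g[of k] c by algebra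
  qed
  then have eq: "psum A (gram A ?h ?h) n = psum A (gram A g g) n \<oplus> star A c \<otimes> psum A (gram A f g) n
      \<oplus> star A (psum A (gram A f g) n) \<otimes> c \<oplus> star A c \<otimes> psum A (gram A f f) n \<otimes> c"
    using gram_closed f g c star_closed psum_closed
    by (simp add: psum_add psum_mult_left psum_mult_right psum_star m_assoc)
  show "pos A (psum A (gram A g g) n \<oplus> star A c \<otimes> psum A (gram A f g) n
      \<oplus> star A (psum A (gram A f g) n) \<otimes> c \<oplus> star A c \<otimes> psum A (gram A f f) n \<otimes> c)"
    unfolding eq[symmetric] by (rule pos_psum[OF gram_pos[of ?h, OF h]])
qed (use f g in \<open>auto intro!: pos_psum gram_pos psum_closed gram_closed\<close>)

abbreviation col_nrm :: "(nat \<Rightarrow> 'a) \<Rightarrow> nat \<Rightarrow> real" where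
  "col_nrm f n \<equiv> sqrt (nrm A (psum A (gram A f f) n))"

lemma psum_gram_nrm_le:
  assumes f: "\<And>n. f n \<in> carrier A" and g: "\<And>n. g n \<in> carrier A"
  shows "nrm A (psum A (gram A f g) n) \<le> col_nrm f n * col_nrm g n"
  using psum_gram_cauchy_schwarz[OF assms] nrm_nonneg[OF psum_closed[OF gram_closed[OF f g]]]
  by (simp add: real_le_rsqrt flip: real_sqrt_mult)

lemma psum_gram_add:
  assumes f: "\<And>n. f n \<in> carrier A" and g: "\<And>n. g n \<in> carrier A"
  shows "psum A (gram A (\<lambda>k. f k \<oplus> g k) (\<lambda>k. f k \<oplus> g k)) n
    = (psum A (gram A f f) n \<oplus> psum A (gram A f g) n) \<oplus> (psum A (gram A g f) n \<oplus> psum A (gram A g g) n)"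
proof -
  have "gram A (\<lambda>k. f k \<oplus> g k) (\<lambda>k. f k \<oplus> g k)
      = (\<lambda>k. (gram A f f k \<oplus> gram A f g k) \<oplus> (gram A g f k \<oplus> gram A g g k))"
  proof
    show "gram A (\<lambda>k. f k \<oplus> g k) (\<lambda>k. f k \<oplus> g k) k
        = (gram A f f k \<oplus> gram A f g k) \<oplus> (gram A g f k \<oplus> gram A g g k)" for k
      unfolding gram_def using f[of k] g[of k] by algebra
  qed
  then show ?thesis using gram_closed f g by (simp add: psum_add)
qed

lemma col_nrm_add:
  assumes f: "\<And>n. f n \<in> carrier A" and g: "\<And>n. g n \<in> carrier A"
  shows "col_nrm (\<lambda>k. f k \<oplus> g k) n \<le> col_nrm f n + col_nrm g n"
proof -
  note c = psum_closed[OF gram_closed[OF f f]] psum_closed[OF gram_closed[OF f g]]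
    psum_closed[OF gram_closed[OF g f]] psum_closed[OF gram_closed[OF g g]]
  have "nrm A (psum A (gram A (\<lambda>k. f k \<oplus> g k) (\<lambda>k. f k \<oplus> g k)) n)
    \<le> ((col_nrm f n)\<^sup>2 + col_nrm f n * col_nrm g n) + (col_nrm g n * col_nrm f n + (col_nrm g n)\<^sup>2)"
    unfolding psum_gram_add[OF assms]
    using c nrm_nonneg psum_gram_nrm_le[OF f g] psum_gram_nrm_le[OF g f]
    by (intro order_trans[OF nrm_add] add_mono) auto
  also have "\<dots> = (col_nrm f n + col_nrm g n)\<^sup>2" by (simp add: power2_eq_square algebra_simps)
  finally show ?thesis using c nrm_nonneg by (intro real_le_lsqrt) auto
qed

text \<open>The sum need not converge absolutely. Its segments are bounded through the
  Cauchy-Schwarz inequality by those of the two positive sums.\<close>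

lemma nsummable_gram:
  assumes f: "\<And>n. f n \<in> carrier A" "nsummable A (gram A f f)"
    and g: "\<And>n. g n \<in> carrier A" "nsummable A (gram A g g)"
  shows "nsummable A (gram A f g)"
  unfolding nsummable_Cauchy[of "gram A f g", OF gram_closed[of f g, OF f(1) g(1)]]
proof (intro allI impI)
  fix e :: real assume e: "e > 0"
  obtain N where N: "\<And>m n. m \<ge> N \<Longrightarrow> nrm A (psum A (\<lambda>k. gram A f f (m + k)) n) < e"
    using f(2) e nsummable_Cauchy[of "gram A f f", OF gram_closed[of f f, OF f(1) f(1)]] by blast
  obtain M where M: "\<And>m n. m \<ge> M \<Longrightarrow> nrm A (psum A (\<lambda>k. gram A g g (m + k)) n) < e"
    using g(2) e nsummable_Cauchy[of "gram A g g", OF gram_closed[of g g, OF g(1) g(1)]] by blast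
  have "nrm A (psum A (\<lambda>k. gram A f g (m + k)) n) < e" if "m \<ge> max N M" for m n
  proof -
    let ?f = "\<lambda>k. f (m + k)" and ?g = "\<lambda>k. g (m + k)"
    have eq: "(\<lambda>k. gram A f f (m + k)) = gram A ?f ?f" "(\<lambda>k. gram A g g (m + k)) = gram A ?g ?g"
      "(\<lambda>k. gram A f g (m + k)) = gram A ?f ?g" by (auto simp: gram_def)
    have "col_nrm ?f n * col_nrm ?g n < sqrt e * sqrt e"
      using N[of m n] M[of m n] that e nrm_nonneg[OF psum_closed[OF gram_closed]] f(1) g(1)
      unfolding eq by (intro mult_strict_mono') auto
    then show ?thesis unfolding eq using psum_gram_nrm_le[of ?f ?g n] f(1) g(1) e by simp
  qed
  then show "\<exists>N. \<forall>m\<ge>N. \<forall>n. nrm A (psum A (\<lambda>k. gram A f g (m + k)) n) < e" by blast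
qed

lemma nsum_pos:
  assumes "\<And>n. pos A (f n)" "nsummable A f"
  shows "pos A (nsum A f)"
  using pos_lim[OF nsum_lim[OF assms(2)]] pos_psum assms posD by blast

lemma pos_nsum_diff_psum:
  assumes "\<And>n. pos A (f n)" "nsummable A f"
  shows "pos A (nsum A f \<ominus> psum A f m)"
proof -
  have f: "f n \<in> carrier A" for n using assms posD by blast
  have "nrm_lim A (\<lambda>n. psum A f (m + n)) (nsum A f)"
    using nsum_lim[OF assms(2) f] by (rule nrm_lim_subseq) (auto simp: strict_mono_def)
  then have "nrm_lim A (\<lambda>n. psum A f (m + n) \<ominus> psum A f m) (nsum A f \<ominus> psum A f m)"
    using psum_closed f by (intro nrm_lim_diff nrm_lim_const) auto
  moreover have "psum A f (m + n) \<ominus> psum A f m = psum A (\<lambda>k. f (m + k)) n" for n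
  proof -
    have "psum A (\<lambda>k. f (m + k)) n \<in> carrier A" "psum A f m \<in> carrier A" using f psum_closed by auto
    then show ?thesis unfolding psum_shift[of f, OF f] by (simp add: add_diff_cancel)
  qed
  ultimately show ?thesis using pos_lim pos_psum assms(1) by metis
qed

lemma nrm_psum_mono:
  assumes "\<And>n. pos A (f n)" "\<And>n. pos A (g n \<ominus> f n)" "\<And>n. g n \<in> carrier A"
  shows "nrm A (psum A f n) \<le> nrm A (psum A g n)"
proof (rule nrm_mono)
  have f: "f n \<in> carrier A" for n using assms posD by blast
  have "psum A g n \<ominus> psum A f n = psum A (\<lambda>k. g k \<ominus> f k) n"
  proof (induction n)
    case (Suc n)
    have "psum A g n \<in> carrier A" "psum A f n \<in> carrier A" "psum A g (Suc n) \<ominus> psum A f (Suc n)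
        = (psum A g n \<ominus> psum A f n) \<oplus> (g n \<ominus> f n)"
      using f assms(3) psum_closed[of f] psum_closed[of g] f[of n] assms(3)[of n]
      by (simp_all, algebra)
    then show ?case using Suc by simp
  qed simp
  then show "pos A (psum A g n \<ominus> psum A f n)" using pos_psum[OF assms(2)] by simp
qed (use pos_psum assms psum_closed in auto)

text \<open>Domination in the order suffices, since segments of positive sums compare in
  norm.\<close>

lemma nsummable_le:
  assumes "\<And>n. pos A (f n)" "\<And>n. pos A (g n \<ominus> f n)" "\<And>n. g n \<in> carrier A" "nsummable A g"
  shows "nsummable A f"
proof -
  have f: "f n \<in> carrier A" for n using assms posD by blast
  have "nrm A (psum A (\<lambda>k. f (m + k)) n) \<le> nrm A (psum A (\<lambda>k. g (m + k)) n)" for m n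
    by (rule nrm_psum_mono) (rule assms)+
  then show ?thesis
    using assms(4) unfolding nsummable_Cauchy[OF f] nsummable_Cauchy[OF assms(3)]
    by (meson le_less_trans)
qed

lemma nsummable_scal:
  assumes "nsummable A f" "\<And>n. f n \<in> carrier A"
  shows "nsummable A (\<lambda>k. scal A c (f k))"
  using nsum_mult_right(1)[OF assms scal_closed[OF one_closed], of c] assms(2)
  by (simp add: scal_mult_right)

text \<open>The square of c f is at most K^2 times the square of f in the order of
  \<open>A\<close>.\<close>

lemma nsummable_gram_mult:
  assumes f: "\<And>n. f n \<in> carrier A" "nsummable A (gram A f f)"
    and c: "\<And>n. c n \<in> carrier A" "\<And>n. nrm A (c n) \<le> K"
  shows "nsummable A (gram A (\<lambda>n. c n \<otimes> f n) (\<lambda>n. c n \<otimes> f n))"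
proof (rule nsummable_le)
  let ?g = "\<lambda>n. scal A (complex_of_real (K\<^sup>2)) (gram A f f n)"
  show "?g n \<in> carrier A" for n using gram_closed f by (simp add: scal_closed)
  show "nsummable A ?g" using nsummable_scal f gram_closed by blast
  show "pos A (gram A (\<lambda>n. c n \<otimes> f n) (\<lambda>n. c n \<otimes> f n) n)" for n using f c by (intro gram_pos) simp
  show "pos A (?g n \<ominus> gram A (\<lambda>n. c n \<otimes> f n) (\<lambda>n. c n \<otimes> f n) n)" for n
  proof -
    have cc: "star A (c n) \<otimes> c n \<in> carrier A" "star A (f n) \<in> carrier A" using c f star_closed by auto
    have "nrm A (star A (c n) \<otimes> c n) \<le> K\<^sup>2"
      using c nrm_nonneg by (simp add: cstar_identity power_mono)
    then have "pos A (real_elt A (K\<^sup>2) \<ominus> star A (c n) \<otimes> c n)"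
      using pos_real_elt_diff self_adj_star_mult c by blast
    then have "pos A (star A (f n) \<otimes> real_elt A (K\<^sup>2) \<otimes> f n \<ominus> star A (f n) \<otimes> (star A (c n) \<otimes> c n) \<otimes> f n)"
      using pos_conj_diff cc real_elt_closed f by blast
    also have "star A (f n) \<otimes> real_elt A (K\<^sup>2) \<otimes> f n = ?g n"
      using cc f(1)[of n] by (simp add: gram_def real_elt_mult(2) scal_mult_left del: of_real_power)
    also have "star A (f n) \<otimes> (star A (c n) \<otimes> c n) \<otimes> f n = gram A (\<lambda>n. c n \<otimes> f n) (\<lambda>n. c n \<otimes> f n) n"
      using cc c(1)[of n] f(1)[of n] star_closed[OF c(1)[of n]] by (simp add: gram_def star_mult m_assoc)
    finally show ?thesis .
  qed
qed

end

text \<open>The completion of a bimodule whose structure is read off from a map \<open>v\<close> into \<open>A\<close> with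
  closed range \<open>M\<close>: its elements are the fibres of the limits.\<close>

locale valued_bimodule = unital_cstar_algebra A
  for A :: "'a cstar_algebra" (structure) +
  fixes P :: "('a, 'p) hilbert_bimodule" and v :: "'p \<Rightarrow> 'a" and M :: "'a set" and c :: "'a \<Rightarrow> 'a"
  assumes v_range: "v ` carrier P = M" and M_carrier: "M \<subseteq> carrier A" and M_closed: "nrm_closed A M"
    and c_closed: "a \<in> carrier A \<Longrightarrow> c a \<in> carrier A"
    and P_hadd: "\<lbrakk>s \<in> carrier P; t \<in> carrier P\<rbrakk> \<Longrightarrow> hadd P s t \<in> carrier P \<and> v (hadd P s t) = v s \<oplus> v t"
    and P_hzero: "hzero P \<in> carrier P \<and> v (hzero P) = \<zero>"
    and P_ract: "\<lbrakk>s \<in> carrier P; a \<in> carrier A\<rbrakk> \<Longrightarrow> ract P s a \<in> carrier P \<and> v (ract P s a) = v s \<otimes> a"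
    and P_lact: "\<lbrakk>s \<in> carrier P; a \<in> carrier A\<rbrakk> \<Longrightarrow> lact P a s \<in> carrier P \<and> v (lact P a s) = c a \<otimes> v s"
    and P_ip: "\<lbrakk>s \<in> carrier P; t \<in> carrier P\<rbrakk> \<Longrightarrow> ip P s t = star A (v s) \<otimes> v t"
begin

definition fibre :: "'a \<Rightarrow> (nat \<Rightarrow> 'p) set" where
  "fibre l = {s. (\<forall>k. s k \<in> carrier P) \<and> nrm_lim A (\<lambda>k. v (s k)) l}"

lemma v_closed: "s \<in> carrier P \<Longrightarrow> v s \<in> carrier A"
  using v_range M_carrier by blast

lemma P_hdist: "\<lbrakk>s \<in> carrier P; t \<in> carrier P\<rbrakk> \<Longrightarrow> hdist A P s t = nrm A (v s \<ominus> v t)"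
proof -
  assume st: "s \<in> carrier P" "t \<in> carrier P"
  let ?t = "ract P t (scal A (- 1) \<one>)"
  have t: "?t \<in> carrier P" "v ?t = \<ominus> v t"
    using P_ract st v_closed by (auto simp: scal_closed scal_mult_right scal_minus_one r_minus)
  then have "hadd P s ?t \<in> carrier P" "v (hadd P s ?t) = v s \<ominus> v t" using P_hadd st by (auto simp: minus_eq)
  then show ?thesis
    using st v_closed by (simp add: hdist_def hnorm_def hscal_def P_ip cstar_identity nrm_nonneg)
qed

text \<open>Distances in \<open>P\<close> are distances of values and \<open>A\<close> is complete,
  so the Cauchy sequences are those with convergent values.\<close>

lemma hcauchy_eq: "hcauchy A P = {s. \<exists>l. s \<in> fibre l}"
proof (intro equalityI subsetI)
  fix s assume s: "s \<in> hcauchy A P"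
  then have sc: "s k \<in> carrier P" for k by (simp add: hcauchy_def)
  moreover have "\<exists>l. nrm_lim A (\<lambda>k. v (s k)) l"
    using s sc v_closed by (intro complete) (auto simp: hcauchy_def P_hdist)
  ultimately show "s \<in> {s. \<exists>l. s \<in> fibre l}" by (simp add: fibre_def)
next
  fix s assume "s \<in> {s. \<exists>l. s \<in> fibre l}"
  then obtain l where s: "\<And>k. s k \<in> carrier P" "nrm_lim A (\<lambda>k. v (s k)) l" by (auto simp: fibre_def)
  note l = nrm_limD(1)[OF s(2)]
  have "\<exists>N. \<forall>m\<ge>N. \<forall>n\<ge>N. nrm A (v (s m) \<ominus> v (s n)) < e" if e: "e > 0" for e
  proof -
    obtain N where N: "\<And>m. m \<ge> N \<Longrightarrow> \<bar>nrm A (v (s m) \<ominus> l)\<bar> < e / 2"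
      using s(2)[unfolded nrm_lim_epsilon[OF l]] half_gt_zero[OF e] by blast
    have "nrm A (v (s m) \<ominus> v (s n)) < e" if "m \<ge> N" "n \<ge> N" for m n
      using N[OF that(1)] N[OF that(2)] nrm_triangle[of "v (s m)" l "v (s n)"]
        nrm_diff_commute[of "v (s n)" l] v_closed s(1) l by fastforce
    then show ?thesis by blast
  qed
  then show "s \<in> hcauchy A P" using s(1) by (simp add: hcauchy_def P_hdist)
qed

lemma fibre_unique: "s \<in> fibre l \<Longrightarrow> s \<in> fibre m \<Longrightarrow> l = m"
  unfolding fibre_def using nrm_lim_unique v_closed by blast

lemma fibre_in_M: "s \<in> fibre l \<Longrightarrow> l \<in> M"
  unfolding fibre_def using nrm_closedD[OF M_closed, of "\<lambda>k. v (s k)" l] v_range by blast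

text \<open>Convergent sequences of values have a null difference exactly when their limits agree,
  so the classes are the fibres.\<close>

lemma hequiv_eq: "hequiv A P = {(s, t). \<exists>l. s \<in> fibre l \<and> t \<in> fibre l}"
proof -
  have "(\<lambda>k. hdist A P (s k) (t k)) \<longlonglongrightarrow> 0 \<longleftrightarrow> l = m" if s: "s \<in> fibre l" and t: "t \<in> fibre m" for s t l m
  proof -
    have *: "\<And>k. s k \<in> carrier P" "\<And>k. t k \<in> carrier P" "nrm_lim A (\<lambda>k. v (s k)) l" "nrm_lim A (\<lambda>k. v (t k)) m"
      using s t by (auto simp: fibre_def)
    then have "nrm_lim A (\<lambda>k. v (s k) \<ominus> v (t k)) (l \<ominus> m)" using v_closed by (intro nrm_lim_diff) auto
    then have "(\<lambda>k. hdist A P (s k) (t k)) \<longlonglongrightarrow> nrm A (l \<ominus> m)"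
      using nrm_lim_nrm v_closed * by (simp add: P_hdist)
    then show ?thesis
      using nrm_limD(1)[OF *(3)] nrm_limD(1)[OF *(4)] nrm_diff_eq_zero[of l m] LIMSEQ_unique by fastforce
  qed
  then show ?thesis unfolding hequiv_def hcauchy_eq by auto
qed

lemma class_eq_fibre: "s \<in> fibre l \<Longrightarrow> hequiv A P `` {s} = fibre l"
  unfolding hequiv_eq using fibre_unique by blast

lemma fibre_nonempty: "l \<in> M \<Longrightarrow> \<exists>s. s \<in> fibre l"
proof -
  assume "l \<in> M"
  then obtain p where "p \<in> carrier P" "v p = l" using v_range by blast
  then have "(\<lambda>_. p) \<in> fibre l" using nrm_lim_const v_closed by (auto simp: fibre_def)
  then show ?thesis by blast
qed

lemma completion_carrier: "carrier (hcompletion A P) = fibre ` M"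
proof -
  have "hcauchy A P // hequiv A P = fibre ` M"
  proof (intro equalityI subsetI)
    fix x assume "x \<in> hcauchy A P // hequiv A P"
    then obtain s l where "s \<in> fibre l" "x = hequiv A P `` {s}"
      unfolding hcauchy_eq by (elim quotientE) blast
    then show "x \<in> fibre ` M" using class_eq_fibre fibre_in_M by blast
  next
    fix x assume "x \<in> fibre ` M"
    then obtain l s where "x = fibre l" "s \<in> fibre l" using fibre_nonempty by blast
    then have "s \<in> hcauchy A P" using hcauchy_eq by blast
    then have "hequiv A P `` {s} \<in> hcauchy A P // hequiv A P" by (rule quotientI)
    then show "x \<in> hcauchy A P // hequiv A P"
      using class_eq_fibre[OF \<open>s \<in> fibre l\<close>] \<open>x = fibre l\<close> by simp
  qed
  then show ?thesis by (simp add: hcompletion_def)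
qed

lemma fibre_inj: "l \<in> M \<Longrightarrow> m \<in> M \<Longrightarrow> fibre l = fibre m \<Longrightarrow> l = m"
  using fibre_nonempty fibre_unique by blast

lemma UN_class:
  assumes "l \<in> M" "\<And>s. s \<in> fibre l \<Longrightarrow> g s = fibre m"
  shows "(\<Union>s\<in>fibre l. g s) = fibre m"
proof -
  obtain s where "s \<in> fibre l" using fibre_nonempty assms(1) by blast
  then have "fibre l \<noteq> {}" by blast
  then show ?thesis using assms(2) by simp
qed

lemma completion_hadd:
  assumes "l \<in> M" "m \<in> M"
  shows "hadd (hcompletion A P) (fibre l) (fibre m) = fibre (l \<oplus> m)"
proof -
  have "(\<lambda>k. hadd P (s k) (t k)) \<in> fibre (l \<oplus> m)" if "s \<in> fibre l" "t \<in> fibre m" for s t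
    using that v_closed by (auto simp: fibre_def P_hadd intro!: nrm_lim_add)
  then show ?thesis
    using assms by (auto simp: hcompletion_def intro!: UN_class class_eq_fibre)
qed

lemma completion_hzero: "hzero (hcompletion A P) = fibre \<zero>"
  using P_hzero nrm_lim_const by (auto simp: hcompletion_def fibre_def intro!: class_eq_fibre[unfolded fibre_def])

lemma completion_ract:
  assumes "l \<in> M" "a \<in> carrier A"
  shows "ract (hcompletion A P) (fibre l) a = fibre (l \<otimes> a)"
proof -
  have "(\<lambda>k. ract P (s k) a) \<in> fibre (l \<otimes> a)" if "s \<in> fibre l" for s
    using that v_closed assms by (auto simp: fibre_def P_ract intro!: nrm_lim_mult nrm_lim_const)
  then show ?thesis
    using assms by (auto simp: hcompletion_def intro!: UN_class class_eq_fibre)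
qed

lemma completion_lact:
  assumes "l \<in> M" "a \<in> carrier A"
  shows "lact (hcompletion A P) a (fibre l) = fibre (c a \<otimes> l)"
proof -
  have "(\<lambda>k. lact P a (s k)) \<in> fibre (c a \<otimes> l)" if "s \<in> fibre l" for s
    using that v_closed assms c_closed by (auto simp: fibre_def P_lact intro!: nrm_lim_mult nrm_lim_const)
  then show ?thesis
    using assms by (auto simp: hcompletion_def intro!: UN_class class_eq_fibre)
qed

lemma completion_ip:
  assumes "l \<in> M" "m \<in> M"
  shows "ip (hcompletion A P) (fibre l) (fibre m) = star A l \<otimes> m"
proof -
  have lim: "nrm_lim A (\<lambda>k. ip P (s k) (t k)) (star A l \<otimes> m)" if "s \<in> fibre l" "t \<in> fibre m" for s t
    using that v_closed star_closed by (auto simp: fibre_def P_ip intro!: nrm_lim_mult nrm_lim_star)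
  obtain s t where st: "s \<in> fibre l" "t \<in> fibre m" using fibre_nonempty assms by blast
  then have cl: "ip P (s k) (t k) \<in> carrier A" for k using v_closed star_closed by (auto simp: fibre_def P_ip)
  have "(THE r. \<forall>s\<in>fibre l. \<forall>t\<in>fibre m. nrm_lim A (\<lambda>k. ip P (s k) (t k)) r) = star A l \<otimes> m"
    using lim st nrm_lim_unique[of "\<lambda>k. ip P (s k) (t k)" _ "star A l \<otimes> m"] cl
    by (intro the_equality) blast+
  then show ?thesis by (simp add: hcompletion_def)
qed

end

section \<open>The bimodule of a dynamical system\<close>

locale dyn_system = unital_cstar_algebra A
  for A :: "'a cstar_algebra" (structure) +
  fixes \<delta> :: "'a \<Rightarrow> 'a"
  assumes delta_hom: "star_hom A A \<delta>"
begin

lemma dn_hom: "cstar_hom A A (\<delta> ^^ n)"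
proof (unfold_locales, induction n)
  case (Suc n)
  then show ?case using delta_hom by (simp add: star_hom_def Pi_def)
qed (simp add: star_hom_def)

lemmas dn_closed = cstar_hom.closed[OF dn_hom]
lemmas dn_add = cstar_hom.add[OF dn_hom]
lemmas dn_mult = cstar_hom.mult[OF dn_hom]
lemmas dn_star = cstar_hom.star[OF dn_hom]
lemmas dn_scal = cstar_hom.scal[OF dn_hom]
lemmas dn_nrm_le = cstar_hom.nrm_le[OF dn_hom]

lemma d_closed: "a \<in> carrier A \<Longrightarrow> \<delta> a \<in> carrier A"
  and d_mult: "\<lbrakk>a \<in> carrier A; b \<in> carrier A\<rbrakk> \<Longrightarrow> \<delta> (a \<otimes> b) = \<delta> a \<otimes> \<delta> b"
  and d_star: "a \<in> carrier A \<Longrightarrow> \<delta> (star A a) = star A (\<delta> a)"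
  using dn_closed[of a 1] dn_mult[of a b 1] dn_star[of a 1] by simp_all

abbreviation en :: "nat \<Rightarrow> 'a" where "en n \<equiv> (\<delta> ^^ n) \<one>"

lemma en_closed: "en n \<in> carrier A"
  by (simp add: dn_closed)

lemma en_dn: "a \<in> carrier A \<Longrightarrow> en n \<otimes> (\<delta> ^^ n) a = (\<delta> ^^ n) a"
  and dn_en: "a \<in> carrier A \<Longrightarrow> (\<delta> ^^ n) a \<otimes> en n = (\<delta> ^^ n) a"
  by (simp_all flip: dn_mult)

lemma star_en: "star A (en n) = en n"
  by (simp flip: dn_star)

lemma en_le: "m \<le> n \<Longrightarrow> en m \<otimes> en n = en n"
  using en_dn[of "en (n - m)" m] by (simp add: en_closed flip: funpow_add[THEN fun_cong, unfolded o_def])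

lemma en_ge: "m \<le> n \<Longrightarrow> en n \<otimes> en m = en n"
  using star_mult[of "en m" "en n"] en_le[of m n] by (simp add: en_closed star_en)

text \<open>The right ideal \<delta>^n(1)A, written as a fixed point set so that closedness is
  immediate.\<close>

definition M :: "nat \<Rightarrow> 'a set" where "M n = {a \<in> carrier A. en n \<otimes> a = a}"

lemma M_carrier: "a \<in> M n \<Longrightarrow> a \<in> carrier A"
  and M_en: "a \<in> M n \<Longrightarrow> en n \<otimes> a = a"
  by (auto simp: M_def)

text \<open>The projections \<delta>^n(1) decrease with n.\<close>

lemma M_mono: "a \<in> M n \<Longrightarrow> m \<le> n \<Longrightarrow> a \<in> M m"
  unfolding M_def using en_le[of m n] m_assoc[of "en m" "en n" a] en_closed by auto

lemma M_add: "a \<in> M n \<Longrightarrow> b \<in> M n \<Longrightarrow> a \<oplus> b \<in> M n"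
  by (simp add: M_def r_distr en_closed)

lemma M_zero: "\<zero> \<in> M n"
  by (simp add: M_def en_closed)

lemma M_mult: "a \<in> M n \<Longrightarrow> b \<in> carrier A \<Longrightarrow> a \<otimes> b \<in> M n"
  using m_assoc[of "en n" a b] by (simp add: M_def en_closed)

lemma M_dn: "a \<in> carrier A \<Longrightarrow> b \<in> carrier A \<Longrightarrow> (\<delta> ^^ n) a \<otimes> b \<in> M n"
  by (rule M_mult) (simp add: M_def dn_closed en_dn)

lemma M_en_mult: "a \<in> carrier A \<Longrightarrow> en n \<otimes> a \<in> M n"
  by (rule M_dn) auto

lemma en_in_M: "en n \<in> M n"
  using M_en_mult[of \<one> n] by (simp add: en_closed)

lemma M_0: "M 0 = carrier A"
  by (auto simp: M_def)

lemma M_nrm_closed: "nrm_closed A (M n)"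
  unfolding nrm_closed_def
proof (intro allI impI, elim conjE)
  fix s l assume s: "\<forall>k. s k \<in> M n" and l: "nrm_lim A s l"
  have sc: "s k \<in> carrier A" for k using s M_carrier by blast
  have "nrm_lim A (\<lambda>k. en n \<otimes> s k) (en n \<otimes> l)" using l sc en_closed by (intro nrm_lim_mult nrm_lim_const)
  then have "nrm_lim A s (en n \<otimes> l)" using s by (simp add: M_en)
  then have "en n \<otimes> l = l" by (rule nrm_lim_unique[OF _ l sc])
  then show "l \<in> M n" using nrm_limD(1)[OF l] by (simp add: M_def)
qed

abbreviation E :: "('a, 'a) hilbert_bimodule" where "E \<equiv> dyn_bimodule A \<delta>"

lemma E_simps: "hadd E x y = x \<oplus> y" "hzero E = \<zero>" "ract E x a = x \<otimes> a" "lact E a x = \<delta> a \<otimes> x"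
  "ip E x y = star A x \<otimes> y"
  by (auto simp: dyn_bimodule_def)

lemma E_carrier: "carrier E = M 1"
proof
  show "carrier E \<subseteq> M 1" using M_en_mult[of _ 1] by (auto simp: dyn_bimodule_def)
  show "M 1 \<subseteq> carrier E" unfolding M_def dyn_bimodule_def by force
qed

section \<open>Tensor powers\<close>

text \<open>The value of the word $[x_1, \dots, x_n]$ is
  $\delta^{n-1}(x_1) \cdots \delta(x_{n-1})\, x_n$, which identifies $E^{\otimes n}$ with
  $\delta^n(1)A$.\<close>

abbreviation wfold :: "'a \<Rightarrow> 'a list \<Rightarrow> 'a" where "wfold \<equiv> foldl (\<lambda>a x. \<delta> a \<otimes> x)"

definition wval :: "'a list \<Rightarrow> 'a" where "wval w = wfold (hd w) (tl w)"

definition sval :: "'a list list \<Rightarrow> 'a" where "sval s = foldr (\<lambda>w b. wval w \<oplus> b) s \<zero>"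

lemma wfold_closed: "a \<in> carrier A \<Longrightarrow> set w \<subseteq> carrier A \<Longrightarrow> wfold a w \<in> carrier A"
  by (induction w arbitrary: a) (auto simp: d_closed)

text \<open>A factor on the left of the first letter undergoes one application of \<delta> for each
  later letter.\<close>

lemma wfold_mult:
  "\<lbrakk>a \<in> carrier A; b \<in> carrier A; set w \<subseteq> carrier A\<rbrakk>
    \<Longrightarrow> wfold (b \<otimes> a) w = (\<delta> ^^ length w) b \<otimes> wfold a w"
proof (induction w arbitrary: a b)
  case (Cons x w)
  then have "wfold (b \<otimes> a) (x # w) = wfold (\<delta> b \<otimes> (\<delta> a \<otimes> x)) w" by (simp add: d_mult d_closed m_assoc)
  also have "\<dots> = (\<delta> ^^ length w) (\<delta> b) \<otimes> wfold (\<delta> a \<otimes> x) w" using Cons by (intro Cons.IH) (auto simp: d_closed)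
  finally show ?case by (simp add: funpow_swap1)
qed simp

lemma wfold_snoc_mult:
  "\<lbrakk>a \<in> carrier A; b \<in> carrier A; set w \<subseteq> carrier A; w \<noteq> []\<rbrakk>
    \<Longrightarrow> wfold a (butlast w @ [last w \<otimes> b]) = wfold a w \<otimes> b"
proof (induction w rule: rev_induct)
  case (snoc x w)
  then show ?case by (simp add: m_assoc wfold_closed d_closed)
qed simp

text \<open>Multiplicativity of \<delta> turns the nested inner product into a single product of
  values, letter by letter.\<close>

lemma wfold_ip:
  assumes "length v = length w" "set v \<subseteq> carrier A" "set w \<subseteq> carrier A" "a \<in> carrier A" "b \<in> carrier A"
  shows "foldl (\<lambda>a (x, y). ip E x (lact E a y)) (star A a \<otimes> b) (zip v w) = star A (wfold a v) \<otimes> wfold b w"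
  using assms
proof (induction v w arbitrary: a b rule: list_induct2)
  case (Cons x v y w)
  have "star A x \<otimes> (\<delta> (star A a \<otimes> b) \<otimes> y) = star A (\<delta> a \<otimes> x) \<otimes> (\<delta> b \<otimes> y)"
    using Cons.prems star_closed[of x] star_closed[OF d_closed[of a]] d_closed
    by (simp add: d_mult d_star star_mult star_closed m_assoc)
  then show ?case using Cons by (simp add: E_simps d_closed)
qed simp

context
  fixes m :: nat
begin

abbreviation P :: "('a, 'a list list) hilbert_bimodule" where "P \<equiv> alg_tensor_power A E (Suc m)"

lemma P_simps:
  "carrier P = {s. \<forall>w\<in>set s. length w = Suc m \<and> set w \<subseteq> M 1}" "hadd P s t = s @ t" "hzero P = []"
  "ract P s a = map (\<lambda>w. butlast w @ [last w \<otimes> a]) s" "lact P a s = map (\<lambda>w. \<delta> a \<otimes> hd w # tl w) s"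
  "ip P s t = foldr (\<lambda>(v, w) b. word_ip E v w \<oplus> b) (List.product s t) \<zero>"
  by (auto simp: alg_tensor_power_def E_simps E_carrier)

lemma word_carrier:
  assumes "length w = Suc m" "set w \<subseteq> M 1"
  obtains x v where "w = x # v" "length v = m" "x \<in> carrier A" "set v \<subseteq> carrier A" "x \<in> M 1" "set v \<subseteq> M 1"
  using assms M_carrier by (cases w) auto

lemma wval_in_M: "length w = Suc m \<Longrightarrow> set w \<subseteq> M 1 \<Longrightarrow> wval w \<in> M (Suc m)"
proof -
  assume w: "length w = Suc m" "set w \<subseteq> M 1"
  then obtain x v where v: "w = x # v" "length v = m" "x \<in> carrier A" "set v \<subseteq> carrier A" "x \<in> M 1"
    by (rule word_carrier)
  then have "wval w = wfold (\<delta> \<one> \<otimes> x) v" using M_en[of x 1] by (simp add: wval_def)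
  also have "\<dots> = (\<delta> ^^ m) (\<delta> \<one>) \<otimes> wfold x v" using v by (simp add: wfold_mult d_closed)
  also have "(\<delta> ^^ m) (\<delta> \<one>) = en (Suc m)" by (simp add: funpow_swap1)
  finally show ?thesis using M_en_mult[OF wfold_closed[OF v(3,4)], of "Suc m"] by (simp only: v(1))
qed

lemma sval_in_M: "s \<in> carrier P \<Longrightarrow> sval s \<in> M (Suc m)"
  by (induction s) (auto simp: sval_def P_simps M_zero wval_in_M intro: M_add)

lemma sval_closed: "s \<in> carrier P \<Longrightarrow> sval s \<in> carrier A"
  using sval_in_M M_carrier by blast

lemma wval_closed: "length w = Suc m \<Longrightarrow> set w \<subseteq> M 1 \<Longrightarrow> wval w \<in> carrier A"
  using wval_in_M M_carrier by blast

lemma word_ip_eq: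
  assumes "length v = Suc m" "set v \<subseteq> M 1" "length w = Suc m" "set w \<subseteq> M 1"
  shows "word_ip E v w = star A (wval v) \<otimes> wval w"
  using wfold_ip[of "tl v" "tl w" "hd v" "hd w"] word_carrier[OF assms(1,2)] word_carrier[OF assms(3,4)]
  unfolding word_ip_def wval_def E_simps(5) by (metis list.sel(1,3))

lemma sval_append: "s \<in> carrier P \<Longrightarrow> t \<in> carrier P \<Longrightarrow> sval (s @ t) = sval s \<oplus> sval t"
proof (induction s)
  case (Cons w s)
  then have "sval (s @ t) = sval s \<oplus> sval t" "sval s \<in> carrier A" "wval w \<in> carrier A"
    using sval_closed[of s] wval_closed[of w] by (auto simp: P_simps)
  then show ?case using sval_closed[OF Cons(3)] by (simp add: sval_def a_assoc)
qed (use sval_closed in \<open>simp add: sval_def\<close>)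

lemma P_ip_eq: "s \<in> carrier P \<Longrightarrow> t \<in> carrier P \<Longrightarrow> ip P s t = star A (sval s) \<otimes> sval t"
proof (induction s)
  case (Cons v s)
  let ?f = "\<lambda>(v, w) b. word_ip E v w \<oplus> b"
  have v: "length v = Suc m" "set v \<subseteq> M 1" and s: "s \<in> carrier P" using Cons by (auto simp: P_simps)
  have row: "foldr ?f (map (Pair v) t') r = star A (wval v) \<otimes> sval t' \<oplus> r"
    if "t' \<in> carrier P" "r \<in> carrier A" for t' r
    using that
  proof (induction t')
    case (Cons w t')
    then have "t' \<in> carrier P" "length w = Suc m" "set w \<subseteq> M 1" by (auto simp: P_simps)
    then show ?case
      using Cons v wval_closed sval_closed[of t'] star_closed
      by (simp add: word_ip_eq sval_def r_distr a_assoc)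
  qed (use v wval_closed star_closed in \<open>simp add: sval_def\<close>)
  have "ip P s t \<in> carrier A" using Cons s sval_closed star_closed by simp
  then have "ip P (v # s) t = star A (wval v) \<otimes> sval t \<oplus> star A (sval s) \<otimes> sval t"
    using row[OF Cons.prems(2)] Cons s by (simp add: P_simps(6))
  also have "\<dots> = star A (sval (v # s)) \<otimes> sval t"
    using v s Cons.prems(2) wval_closed sval_closed star_closed sval_closed[OF s]
    by (simp add: sval_def star_add l_distr)
  finally show ?case .
qed (use sval_closed in \<open>simp add: P_simps(6) sval_def\<close>)

text \<open>The value of a formal sum determines everything the completion sees, so the tensor power
  becomes the set of fibres over \<delta>^(m+1)(1)A. The index m + 1 is the length of the
  words.\<close>

lemma valued: "valued_bimodule A P sval (M (Suc m)) (\<delta> ^^ Suc m)"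
proof
  show "sval ` carrier P = M (Suc m)"
  proof (intro equalityI subsetI)
    fix a assume a: "a \<in> M (Suc m)"
    \<comment> \<open>The tensor of m factors \<delta>(1) followed by a has value \<delta>^(m+1)(1)
      a = a.\<close>
    define w where "w = replicate m (\<delta> \<one>) @ [a]"
    have rep: "wfold (\<delta> \<one>) (replicate k (\<delta> \<one>)) = en (Suc k)" for k
    proof (induction k)
      case (Suc k)
      have "wfold (\<delta> \<one>) (replicate (Suc k) (\<delta> \<one>)) = wfold (\<delta> \<one>) (replicate k (\<delta> \<one>) @ [\<delta> \<one>])"
        by (simp add: replicate_append_same)
      also have "\<dots> = en (Suc (Suc k)) \<otimes> en 1" by (simp add: Suc.IH)
      also have "\<dots> = en (Suc (Suc k))" by (rule en_ge) simp
      finally show ?case .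
    qed simp
    have "wval w = a"
    proof (cases m)
      case 0
      then show ?thesis by (simp add: w_def wval_def)
    next
      case (Suc k)
      then show ?thesis using rep[of k] M_en[OF a] by (simp add: w_def wval_def)
    qed
    moreover have "[w] \<in> carrier P"
      using M_mono[OF a, of 1] en_in_M[of 1] by (auto simp: P_simps w_def)
    ultimately have "sval [w] = a" using M_carrier[OF a] by (simp add: sval_def)
    then show "a \<in> sval ` carrier P" using \<open>[w] \<in> carrier P\<close> by blast
  qed (use sval_in_M in auto)
  show "M (Suc m) \<subseteq> carrier A" using M_carrier by blast
  show "nrm_closed A (M (Suc m))" by (rule M_nrm_closed)
  show "(\<delta> ^^ Suc m) a \<in> carrier A" if "a \<in> carrier A" for a using that by (rule dn_closed)
  show "hadd P s t \<in> carrier P \<and> sval (hadd P s t) = sval s \<oplus> sval t" if "s \<in> carrier P" "t \<in> carrier P" for s t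
    using that sval_append by (auto simp: P_simps)
  show "hzero P \<in> carrier P \<and> sval (hzero P) = \<zero>" by (simp add: P_simps sval_def)
  show "ip P s t = star A (sval s) \<otimes> sval t" if "s \<in> carrier P" "t \<in> carrier P" for s t
    using that by (rule P_ip_eq)
  fix s a assume s: "s \<in> carrier P" and a: "a \<in> carrier A"
  let ?r = "\<lambda>w. butlast w @ [last w \<otimes> a]" and ?l = "\<lambda>w. \<delta> a \<otimes> hd w # tl w"
  have r: "length (?r w) = Suc m \<and> set (?r w) \<subseteq> M 1 \<and> wval (?r w) = wval w \<otimes> a"
    if w: "length w = Suc m" "set w \<subseteq> M 1" for w
  proof -
    obtain x v where v: "w = x # v" "length v = m" "x \<in> carrier A" "set v \<subseteq> carrier A" "x \<in> M 1" "set v \<subseteq> M 1"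
      by (rule word_carrier[OF w])
    have "last w \<otimes> a \<in> M 1" using w a M_mult[of "last w" 1 a] by (metis last_in_set list.size(3) nat.distinct(1) subsetD)
    moreover have "set (butlast w) \<subseteq> M 1" using w(2) by (auto dest: in_set_butlastD)
    moreover have "wval (?r w) = wval w \<otimes> a"
      using v a wfold_snoc_mult[of x a v] by (cases "v = []") (auto simp: wval_def)
    ultimately show ?thesis using w by simp
  qed
  have l: "length (?l w) = Suc m \<and> set (?l w) \<subseteq> M 1 \<and> wval (?l w) = (\<delta> ^^ Suc m) a \<otimes> wval w"
    if w: "length w = Suc m" "set w \<subseteq> M 1" for w
  proof -
    obtain x v where v: "w = x # v" "length v = m" "x \<in> carrier A" "set v \<subseteq> carrier A" "x \<in> M 1" "set v \<subseteq> M 1"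
      by (rule word_carrier[OF w])
    then show ?thesis
      using a M_dn[of a x 1] wfold_mult[of x "\<delta> a" v] by (simp add: wval_def d_closed funpow_swap1)
  qed
  show "ract P s a \<in> carrier P \<and> sval (ract P s a) = sval s \<otimes> a"
    using s
  proof (induction s)
    case (Cons w s)
    then have w: "length w = Suc m" "set w \<subseteq> M 1" and s: "s \<in> carrier P" by (auto simp: P_simps)
    have "sval (ract P (w # s) a) = wval w \<otimes> a \<oplus> sval s \<otimes> a"
      using r[OF w] Cons s by (simp add: P_simps(4) sval_def)
    also have "\<dots> = sval (w # s) \<otimes> a"
      using wval_closed[OF w] sval_closed[OF s] a by (simp add: sval_def l_distr)
    finally show ?case using r[OF w] Cons s by (simp add: P_simps)
  qed (use a in \<open>simp add: P_simps sval_def\<close>)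
  show "lact P a s \<in> carrier P \<and> sval (lact P a s) = (\<delta> ^^ Suc m) a \<otimes> sval s"
    using s
  proof (induction s)
    case (Cons w s)
    then have w: "length w = Suc m" "set w \<subseteq> M 1" and s: "s \<in> carrier P" by (auto simp: P_simps)
    have "sval (lact P a (w # s)) = (\<delta> ^^ Suc m) a \<otimes> wval w \<oplus> (\<delta> ^^ Suc m) a \<otimes> sval s"
      using l[OF w] Cons s by (simp add: P_simps(5) sval_def)
    also have "\<dots> = (\<delta> ^^ Suc m) a \<otimes> sval (w # s)"
      using wval_closed[OF w] sval_closed[OF s] dn_closed[OF a, of "Suc m"] by (simp add: sval_def r_distr)
    finally show ?case using l[OF w] Cons s by (simp add: P_simps)
  qed (use dn_closed[OF a, of "Suc m"] in \<open>simp add: P_simps sval_def\<close>)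
qed

text \<open>The element of the tensor power of order m + 1 that has the given value.\<close>

abbreviation fib :: "'a \<Rightarrow> 'a tensor" where "fib \<equiv> valued_bimodule.fibre A P sval"

lemma tp_carrier: "carrier (tensor_power A E (Suc m)) = fib ` M (Suc m)"
    and fib_inj: "\<lbrakk>a \<in> M (Suc m); b \<in> M (Suc m); fib a = fib b\<rbrakk> \<Longrightarrow> a = b"
    and tp_hadd: "\<lbrakk>a \<in> M (Suc m); b \<in> M (Suc m)\<rbrakk> \<Longrightarrow> hadd (tensor_power A E (Suc m)) (fib a) (fib b) = fib (a \<oplus> b)"
    and tp_hzero: "hzero (tensor_power A E (Suc m)) = fib \<zero>"
    and tp_ract: "\<lbrakk>a \<in> M (Suc m); b \<in> carrier A\<rbrakk> \<Longrightarrow> ract (tensor_power A E (Suc m)) (fib a) b = fib (a \<otimes> b)"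
    and tp_lact: "\<lbrakk>a \<in> M (Suc m); b \<in> carrier A\<rbrakk>
      \<Longrightarrow> lact (tensor_power A E (Suc m)) b (fib a) = fib ((\<delta> ^^ Suc m) b \<otimes> a)"
    and tp_ip: "\<lbrakk>a \<in> M (Suc m); b \<in> M (Suc m)\<rbrakk> \<Longrightarrow> ip (tensor_power A E (Suc m)) (fib a) (fib b) = star A a \<otimes> b"
  unfolding tensor_power_def
  by (fact valued_bimodule.completion_carrier[OF valued] valued_bimodule.fibre_inj[OF valued]
    valued_bimodule.completion_hadd[OF valued] valued_bimodule.completion_hzero[OF valued]
    valued_bimodule.completion_ract[OF valued] valued_bimodule.completion_lact[OF valued]
    valued_bimodule.completion_ip[OF valued])+

end

lemma tensor_embed_eq: "x \<in> M 1 \<Longrightarrow> tensor_embed A E x = fib 0 x"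
proof -
  assume x: "x \<in> M 1"
  then have "(\<lambda>k. [[x]]) \<in> fib 0 x"
    using M_carrier[OF x] nrm_lim_const[of x] valued_bimodule.fibre_def[OF valued[of 0]]
    by (simp add: P_simps sval_def wval_def)
  then show ?thesis
    using valued_bimodule.class_eq_fibre[OF valued[of 0]] by (simp add: tensor_embed_def)
qed

text \<open>A prepended \<open>x\<close> passes through the m + 1 letters of each word, hence the
  factor \<delta>^(m+1)(x).\<close>

lemma tensor_cons_eq:
  assumes x: "x \<in> M 1" and a: "a \<in> M (Suc m)"
  shows "tensor_cons A E (Suc m) x (fib m a) = fib (Suc m) ((\<delta> ^^ Suc m) x \<otimes> a)"
proof -
  have eq: "hequiv A (P (Suc m)) `` {\<lambda>k. map ((#) x) (s k)} = fib (Suc m) ((\<delta> ^^ Suc m) x \<otimes> a)"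
    if "s \<in> fib m a" for s
  proof -
  from that have s: "\<And>k. s k \<in> carrier (P m)" "nrm_lim A (\<lambda>k. sval (s k)) a"
    by (auto simp: valued_bimodule.fibre_def[OF valued])
  have xc: "x \<in> carrier A" using x M_carrier by blast
  have map: "map ((#) x) t \<in> carrier (P (Suc m)) \<and> sval (map ((#) x) t) = (\<delta> ^^ Suc m) x \<otimes> sval t"
    if t: "t \<in> carrier (P m)" for t
    using t
  proof (induction t)
    case (Cons w t)
    then have w: "length w = Suc m" "set w \<subseteq> M 1" and t: "t \<in> carrier (P m)" by (auto simp: P_simps)
    obtain y v where v: "w = y # v" "length v = m" "y \<in> carrier A" "set v \<subseteq> carrier A"
      by (rule word_carrier[OF w])
    have "wval (x # w) = (\<delta> ^^ Suc m) x \<otimes> wval w"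
      using wfold_mult[of y "\<delta> x" v] v xc by (simp add: wval_def d_closed funpow_swap1)
    then have "sval (map ((#) x) (w # t)) = (\<delta> ^^ Suc m) x \<otimes> wval w \<oplus> (\<delta> ^^ Suc m) x \<otimes> sval t"
      using Cons t by (simp add: sval_def)
    also have "\<dots> = (\<delta> ^^ Suc m) x \<otimes> sval (w # t)"
      using wval_closed[OF w] sval_closed[OF t] dn_closed[OF xc, of "Suc m"] by (simp add: sval_def r_distr)
    finally show ?case using Cons t x w by (simp add: P_simps)
  qed (use dn_closed[OF xc, of "Suc m"] in \<open>simp add: P_simps sval_def\<close>)
  have "nrm_lim A (\<lambda>k. (\<delta> ^^ Suc m) x \<otimes> sval (s k)) ((\<delta> ^^ Suc m) x \<otimes> a)"
    using s sval_closed dn_closed[OF xc, of "Suc m"] by (intro nrm_lim_mult nrm_lim_const) auto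
  then have "(\<lambda>k. map ((#) x) (s k)) \<in> fib (Suc m) ((\<delta> ^^ Suc m) x \<otimes> a)"
    using map[OF s(1)] by (simp add: valued_bimodule.fibre_def[OF valued])
  then show ?thesis by (rule valued_bimodule.class_eq_fibre[OF valued])
  qed
  moreover have "fib m a \<noteq> {}" using valued_bimodule.fibre_nonempty[OF valued a] by blast
  ultimately show ?thesis by (simp add: tensor_cons_def)
qed

section \<open>The Fock module\<close>

definition Sq :: "(nat \<Rightarrow> 'a) set" where "Sq = {f. (\<forall>n. f n \<in> M n) \<and> nsummable A (gram A f f)}"

text \<open>Slot 0 is \<open>A\<close> itself, and the Fock carrier stores the tensor power of order
  n + 1 at n, which causes the shift of the index.\<close>

definition vec :: "(nat \<Rightarrow> 'a) \<Rightarrow> ('a, 'a) fock" where "vec f = (f 0, \<lambda>n. fib n (f (Suc n)))"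

definition co :: "('a, 'a) fock \<Rightarrow> nat \<Rightarrow> 'a" where "co = inv_into Sq vec"

abbreviation F :: "('a, ('a, 'a) fock) hilbert_bimodule" where "F \<equiv> fock_module A E"

lemma SqD: "f \<in> Sq \<Longrightarrow> f n \<in> M n" "f \<in> Sq \<Longrightarrow> f n \<in> carrier A" "f \<in> Sq \<Longrightarrow> nsummable A (gram A f f)"
  using M_carrier by (auto simp: Sq_def)

lemma fock_partial_ip_vec:
  assumes "\<And>n. f n \<in> M n" "\<And>n. g n \<in> M n"
  shows "fock_partial_ip A E (vec f) (vec g) N = psum A (gram A f g) (Suc N)"
proof -
  have c: "gram A f g n \<in> carrier A" for n using gram_closed[of f g] assms M_carrier by blast
  have "(\<lambda>n. ip (tensor_power A E (Suc n)) (snd (vec f) n) (snd (vec g) n)) = (\<lambda>n. gram A f g (Suc n))"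
    using assms by (simp add: vec_def tp_ip gram_def)
  then have "fock_partial_ip A E (vec f) (vec g) N = gram A f g 0 \<oplus> psum A (\<lambda>n. gram A f g (Suc n)) N"
    using psum_eq_finsum[of "\<lambda>n. gram A f g (Suc n)" N] c
    by (simp add: fock_partial_ip_def) (simp add: vec_def gram_def)
  then show ?thesis using psum_Suc_left[of "gram A f g", OF c] by simp
qed

lemma fock_ip_lim:
  assumes "\<And>n. f n \<in> M n" "\<And>n. g n \<in> M n"
  shows "nrm_lim A (fock_partial_ip A E (vec f) (vec g)) l \<longleftrightarrow> nrm_lim A (psum A (gram A f g)) l"
  unfolding nrm_lim_def fock_partial_ip_vec[of f g, OF assms]
  using filterlim_sequentially_Suc[of "\<lambda>n. nrm A (psum A (gram A f g) n \<ominus> l)" "nhds 0"] by blast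

lemma fock_carrier: "carrier F = vec ` Sq"
proof (intro equalityI subsetI)
  fix v assume v: "v \<in> carrier F"
  then have "fst v \<in> carrier A" "\<forall>n. \<exists>a. a \<in> M (Suc n) \<and> snd v n = fib n a"
    by (auto simp: fock_module_def tp_carrier)
  then obtain g where g: "\<And>n. g n \<in> M (Suc n)" "\<And>n. snd v n = fib n (g n)" by metis
  define f where "f n = (case n of 0 \<Rightarrow> fst v | Suc k \<Rightarrow> g k)" for n
  have f: "f n \<in> M n" for n using \<open>fst v \<in> carrier A\<close> g by (cases n) (auto simp: f_def M_0)
  have vf: "v = vec f" using g by (simp add: vec_def f_def prod_eq_iff fun_eq_iff)
  moreover have "nsummable A (gram A f f)"
    using v fock_ip_lim[of f f] f unfolding vf by (auto simp: fock_module_def nsummable_def)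
  ultimately show "v \<in> vec ` Sq" using f by (auto simp: Sq_def)
next
  fix v assume "v \<in> vec ` Sq"
  then obtain f where f: "f \<in> Sq" "v = vec f" by blast
  then have "\<exists>l. nrm_lim A (fock_partial_ip A E v v) l"
    using fock_ip_lim[of f f] SqD by (simp add: nsummable_def)
  then show "v \<in> carrier F" using f SqD by (auto simp: fock_module_def vec_def tp_carrier)
qed

lemma vec_inj: "inj_on vec Sq"
proof (rule inj_onI)
  fix f g assume f: "f \<in> Sq" and g: "g \<in> Sq" and eq: "vec f = vec g"
  have "f n = g n" for n
  proof (cases n)
    case (Suc k)
    have "fib k (f (Suc k)) = fib k (g (Suc k))" using eq by (simp add: vec_def fun_eq_iff)
    then show ?thesis using fib_inj SqD(1)[OF f] SqD(1)[OF g] Suc by blast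
  qed (use eq in \<open>simp add: vec_def\<close>)
  then show "f = g" by blast
qed

lemma co_vec: "f \<in> Sq \<Longrightarrow> co (vec f) = f"
  unfolding co_def by (rule inv_into_f_f[OF vec_inj])

lemma co_Sq: "v \<in> carrier F \<Longrightarrow> co v \<in> Sq"
  unfolding co_def fock_carrier by (rule inv_into_into)

lemma vec_co: "v \<in> carrier F \<Longrightarrow> vec (co v) = v"
  using f_inv_into_f[of v vec Sq] by (simp add: co_def fock_carrier)

lemma vec_closed: "f \<in> Sq \<Longrightarrow> vec f \<in> carrier F"
  by (simp add: fock_carrier)

lemmas co_M = SqD(1)[OF co_Sq]
lemmas co_closed = SqD(2)[OF co_Sq]
lemmas co_summable = SqD(3)[OF co_Sq]

lemma co_eqI: "\<lbrakk>v \<in> carrier F; w \<in> carrier F; \<And>n. co v n = co w n\<rbrakk> \<Longrightarrow> v = w"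
  by (metis ext vec_co)

lemma Sq_add: "f \<in> Sq \<Longrightarrow> g \<in> Sq \<Longrightarrow> (\<lambda>n. f n \<oplus> g n) \<in> Sq"
proof -
  assume fg: "f \<in> Sq" "g \<in> Sq"
  note c = SqD(2)[OF fg(1)] SqD(2)[OF fg(2)]
  have gc: "gram A f f k \<in> carrier A" "gram A f g k \<in> carrier A" "gram A g f k \<in> carrier A"
    "gram A g g k \<in> carrier A" for k by (simp_all add: gram_closed c)
  note s = SqD(3)[OF fg(1)] SqD(3)[OF fg(2)]
  have ns: "nsummable A (gram A f f)" "nsummable A (gram A f g)" "nsummable A (gram A g f)"
    "nsummable A (gram A g g)" by (rule nsummable_gram[OF c(1) s(1) c(1) s(1)], rule nsummable_gram[OF c(1) s(1) c(2) s(2)],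
      rule nsummable_gram[OF c(2) s(2) c(1) s(1)], rule nsummable_gram[OF c(2) s(2) c(2) s(2)])
  have eq: "gram A (\<lambda>n. f n \<oplus> g n) (\<lambda>n. f n \<oplus> g n)
      = (\<lambda>k. (gram A f f k \<oplus> gram A f g k) \<oplus> (gram A g f k \<oplus> gram A g g k))"
  proof
    show "gram A (\<lambda>n. f n \<oplus> g n) (\<lambda>n. f n \<oplus> g n) k
        = (gram A f f k \<oplus> gram A f g k) \<oplus> (gram A g f k \<oplus> gram A g g k)" for k
      unfolding gram_def using c[of k] by algebra
  qed
  have "nsummable A (gram A (\<lambda>n. f n \<oplus> g n) (\<lambda>n. f n \<oplus> g n))"
    unfolding eq using gc
    by (intro nsum_add(1)[OF nsum_add(1)[OF ns(1,2)] nsum_add(1)[OF ns(3,4)]]) auto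
  then show ?thesis using SqD(1)[OF fg(1)] SqD(1)[OF fg(2)] M_add by (simp add: Sq_def)
qed

lemma Sq_mult_right: "f \<in> Sq \<Longrightarrow> a \<in> carrier A \<Longrightarrow> (\<lambda>n. f n \<otimes> a) \<in> Sq"
proof -
  assume fa: "f \<in> Sq" "a \<in> carrier A"
  note c = SqD(2)[OF fa(1)]
  have gc: "gram A f f n \<in> carrier A" for n by (simp add: gram_closed c)
  have eq: "psum A (gram A (\<lambda>n. f n \<otimes> a) (\<lambda>n. f n \<otimes> a)) = (\<lambda>n. star A a \<otimes> (psum A (gram A f f) n \<otimes> a))"
  proof
    fix n
    have "gram A (\<lambda>n. f n \<otimes> a) (\<lambda>n. f n \<otimes> a) = (\<lambda>k. star A a \<otimes> (gram A f f k \<otimes> a))"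
      using c fa star_closed[OF c] star_closed by (simp add: gram_def star_mult m_assoc fun_eq_iff)
    then show "psum A (gram A (\<lambda>n. f n \<otimes> a) (\<lambda>n. f n \<otimes> a)) n = star A a \<otimes> (psum A (gram A f f) n \<otimes> a)"
      using c fa gram_closed[of f f] star_closed by (simp add: psum_mult_left psum_mult_right)
  qed
  have "nrm_lim A (\<lambda>n. star A a \<otimes> (psum A (gram A f f) n \<otimes> a)) (star A a \<otimes> (nsum A (gram A f f) \<otimes> a))"
    using fa star_closed gc psum_closed[of "gram A f f", OF gc]
    by (intro nrm_lim_mult[OF nrm_lim_const nrm_lim_mult[OF nsum_lim[OF SqD(3)[OF fa(1)]] nrm_lim_const]])
      simp_all
  then have "nsummable A (gram A (\<lambda>n. f n \<otimes> a) (\<lambda>n. f n \<otimes> a))"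
    unfolding nsummable_def eq by (rule exI)
  then show ?thesis using SqD(1)[OF fa(1)] fa(2) M_mult by (simp add: Sq_def)
qed

lemma Sq_mult_left:
  assumes f: "f \<in> Sq" and c: "\<And>n. c n \<in> carrier A" "\<And>n. nrm A (c n) \<le> K" "\<And>n. c n \<otimes> f n \<in> M n"
  shows "(\<lambda>n. c n \<otimes> f n) \<in> Sq"
  using nsummable_gram_mult[of f c K] SqD[OF f] c by (simp add: Sq_def)

lemma Sq_finite:
  assumes "\<And>n. f n \<in> M n" "\<And>n. N \<le> n \<Longrightarrow> f n = \<zero>"
  shows "f \<in> Sq"
proof -
  have f: "f n \<in> carrier A" for n using assms(1) M_carrier by blast
  have "gram A f f n \<in> carrier A" for n by (simp add: gram_closed f)
  then have "nsummable A (gram A f f)"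
    by (rule nsum_finite(1)[where n = N]) (simp add: gram_def assms(2))
  then show ?thesis using assms(1) by (simp add: Sq_def)
qed

lemma Sq_zero: "(\<lambda>n. \<zero>) \<in> Sq"
  by (rule Sq_finite) (auto simp: M_zero)

lemma fock_hadd:
  assumes "v \<in> carrier F" "w \<in> carrier F"
  shows "hadd F v w \<in> carrier F" "co (hadd F v w) n = co v n \<oplus> co w n"
proof -
  have "hadd F (vec (co v)) (vec (co w)) = vec (\<lambda>n. co v n \<oplus> co w n)"
    using co_M assms by (simp add: fock_module_def vec_def tp_hadd)
  then have "hadd F v w = vec (\<lambda>n. co v n \<oplus> co w n)" using assms by (simp add: vec_co)
  then show "hadd F v w \<in> carrier F" "co (hadd F v w) n = co v n \<oplus> co w n"
    using Sq_add[OF co_Sq[OF assms(1)] co_Sq[OF assms(2)]] by (simp_all add: vec_closed co_vec)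
qed

lemma fock_hzero: "hzero F \<in> carrier F" "co (hzero F) n = \<zero>"
proof -
  have "hzero F = vec (\<lambda>n. \<zero>)" by (simp add: fock_module_def vec_def tp_hzero)
  then show "hzero F \<in> carrier F" "co (hzero F) n = \<zero>" using Sq_zero by (simp_all add: vec_closed co_vec)
qed

lemma fock_ract:
  assumes "v \<in> carrier F" "a \<in> carrier A"
  shows "ract F v a \<in> carrier F" "co (ract F v a) n = co v n \<otimes> a"
proof -
  have "ract F (vec (co v)) a = vec (\<lambda>n. co v n \<otimes> a)"
    using co_M assms by (simp add: fock_module_def vec_def tp_ract)
  then have "ract F v a = vec (\<lambda>n. co v n \<otimes> a)" using assms by (simp add: vec_co)
  then show "ract F v a \<in> carrier F" "co (ract F v a) n = co v n \<otimes> a"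
    using Sq_mult_right[OF co_Sq[OF assms(1)] assms(2)] by (simp_all add: vec_closed co_vec)
qed

lemma fock_lact:
  assumes "v \<in> carrier F" "a \<in> carrier A"
  shows "lact F a v \<in> carrier F" "co (lact F a v) n = (\<delta> ^^ n) a \<otimes> co v n"
proof -
  have "lact F a (vec (co v)) = vec (\<lambda>n. (\<delta> ^^ n) a \<otimes> co v n)"
    using co_M assms by (simp add: fock_module_def vec_def tp_lact)
  then have "lact F a v = vec (\<lambda>n. (\<delta> ^^ n) a \<otimes> co v n)" using assms by (simp add: vec_co)
  moreover have "(\<lambda>n. (\<delta> ^^ n) a \<otimes> co v n) \<in> Sq"
    using assms co_closed by (intro Sq_mult_left[where K = "nrm A a"] co_Sq dn_closed dn_nrm_le M_dn)
  ultimately show "lact F a v \<in> carrier F" "co (lact F a v) n = (\<delta> ^^ n) a \<otimes> co v n"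
    by (simp_all add: vec_closed co_vec)
qed

lemma fock_ip:
  assumes "v \<in> carrier F" "w \<in> carrier F"
  shows "ip F v w = nsum A (gram A (co v) (co w))"
proof -
  have "nrm_lim A (fock_partial_ip A E (vec (co v)) (vec (co w))) = nrm_lim A (psum A (gram A (co v) (co w)))"
    by (rule ext) (rule fock_ip_lim[OF co_M[OF assms(1)] co_M[OF assms(2)]])
  moreover have "ip F v w = (THE l. nrm_lim A (fock_partial_ip A E v w) l)" by (simp add: fock_module_def)
  ultimately show ?thesis using assms by (simp add: vec_co nsum_def)
qed

lemma co_gram:
  assumes "v \<in> carrier F" "w \<in> carrier F"
  shows "gram A (co v) (co w) n \<in> carrier A" "nsummable A (gram A (co v) (co w))"
  using gram_closed[of "co v" "co w"] nsummable_gram[of "co v" "co w"] co_closed co_summable assms by auto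

end

section \<open>Column norms and completeness of the Fock module\<close>

context unital_cstar_algebra
begin

lemma psum_lim:
  assumes "\<And>n. nrm_lim A (\<lambda>k. f k n) (g n)" "\<And>k n. f k n \<in> carrier A"
  shows "nrm_lim A (\<lambda>k. psum A (f k) j) (psum A g j)"
proof (induction j)
  case (Suc j)
  then show ?case using assms psum_closed by (auto intro: nrm_lim_add)
qed (simp add: nrm_lim_const)

lemma nrm_psum_gram_le:
  assumes "\<And>n. f n \<in> carrier A"
  shows "nrm A (f n) \<le> col_nrm f (Suc n)" "m \<le> n \<Longrightarrow> col_nrm f m \<le> col_nrm f n"
    "col_nrm (\<lambda>k. f (m + k)) j \<le> col_nrm f (m + j)"
proof -
  have g: "gram A f f k \<in> carrier A" "pos A (gram A f f k)" for k
    by (simp_all add: gram_closed gram_pos assms)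
  note pc = psum_closed[of "gram A f f", OF g(1)] and pp = pos_psum[of "gram A f f", OF g(2)]
  have "psum A (gram A f f) (Suc n) \<ominus> gram A f f n = psum A (gram A f f) n"
    using add_diff_cancel[OF g(1) pc] by (simp add: a_comm g pc)
  then have "nrm A (gram A f f n) \<le> nrm A (psum A (gram A f f) (Suc n))"
    using pp[of n] by (intro nrm_mono g pc) simp
  then show "nrm A (f n) \<le> col_nrm f (Suc n)"
    using assms by (simp add: gram_def cstar_identity real_le_rsqrt)
  have seg: "psum A (gram A f f) (m + j) = psum A (gram A f f) m \<oplus> psum A (\<lambda>k. gram A f f (m + k)) j"
    for m j by (rule psum_shift) (rule g)
  have sc: "psum A (\<lambda>k. gram A f f (m + k)) j \<in> carrier A" "pos A (psum A (\<lambda>k. gram A f f (m + k)) j)"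
    for m j by (auto intro: psum_closed pos_psum g)
  have "nrm A (psum A (\<lambda>k. gram A f f (m + k)) j) \<le> nrm A (psum A (gram A f f) (m + j))" for m j
    using add_diff_cancel[OF sc(1) pc, of m j m] pp[of m] sc pc by (intro nrm_mono) (simp_all add: seg a_comm)
  moreover have "gram A (\<lambda>k. f (m + k)) (\<lambda>k. f (m + k)) = (\<lambda>k. gram A f f (m + k))"
    by (simp add: gram_def fun_eq_iff)
  ultimately show "col_nrm (\<lambda>k. f (m + k)) j \<le> col_nrm f (m + j)" by simp
  have "nrm A (psum A (gram A f f) m) \<le> nrm A (psum A (gram A f f) (m + j))" for m j
    using add_diff_cancel[OF pc sc(1), of m m j] pp[of m] sc[of m j] pc by (intro nrm_mono) (simp_all add: seg)
  from this[of m "n - m"] show "col_nrm f m \<le> col_nrm f n" if "m \<le> n" using that by simp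
qed

lemma col_nrm_le_nsum:
  assumes "\<And>n. f n \<in> carrier A" "nsummable A (gram A f f)"
  shows "col_nrm f n \<le> sqrt (nrm A (nsum A (gram A f f)))"
proof -
  have g: "gram A f f k \<in> carrier A" "pos A (gram A f f k)" for k
    by (simp_all add: gram_closed gram_pos assms(1))
  show ?thesis
    using pos_nsum_diff_psum[OF g(2) assms(2)] pos_psum[of "gram A f f", OF g(2)] nsum_closed[OF assms(2) g(1)]
    by (simp add: nrm_mono)
qed

lemma nsum_gram_le:
  assumes "\<And>n. f n \<in> carrier A" "nsummable A (gram A f f)" "\<And>n. col_nrm f n \<le> e" "0 \<le> e"
  shows "sqrt (nrm A (nsum A (gram A f f))) \<le> e"
proof -
  have g: "gram A f f k \<in> carrier A" for k by (simp add: gram_closed assms(1))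
  have "nrm A (nsum A (gram A f f)) \<le> e\<^sup>2"
    using nrm_lim_le[OF nsum_lim[OF assms(2) g] psum_closed[of "gram A f f", OF g]] assms(3)
      sqrt_le_D by blast
  then show ?thesis using assms(4) by (simp add: real_le_lsqrt)
qed

end

context dyn_system
begin

text \<open>The generator \<delta>^n(1) of the n-th summand; pairing with it reads off the n-th
  coordinate, see \<open>ip_ket\<close>.\<close>

definition ket :: "nat \<Rightarrow> ('a, 'a) fock" where "ket n = vec (\<lambda>k. if k = n then en n else \<zero>)"

lemma ket_Sq: "(\<lambda>k. if k = n then en n else \<zero>) \<in> Sq"
  by (rule Sq_finite[of _ "Suc n"]) (auto simp: M_zero en_in_M)

lemma ket_closed: "ket n \<in> carrier F"
  by (simp add: ket_def vec_closed ket_Sq)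

lemma co_ket: "co (ket n) k = (if k = n then en n else \<zero>)"
  by (simp add: ket_def co_vec ket_Sq)

lemma ip_ket: "v \<in> carrier F \<Longrightarrow> ip F (ket n) v = co v n"
proof -
  assume v: "v \<in> carrier F"
  have "gram A (co (ket n)) (co v) k = (if k = n then co v n else \<zero>)" for k
    using co_closed[OF v] M_en[OF co_M[OF v]] by (simp add: gram_def co_ket star_en)
  then show ?thesis
    using nsum_single(2)[of "gram A (co (ket n)) (co v)" n] co_closed[OF v] v ket_closed
    by (simp add: fock_ip)
qed

text \<open>As for square summable scalar sequences: the coordinates converge, the column norms of
  the differences are small uniformly in their length, and the limit is square summable because it
  is close to a column that is.\<close>

lemma fock_hcomplete:
  assumes s: "\<And>k. s k \<in> carrier F" and cauchy: "\<forall>e>0. \<exists>N. \<forall>m\<ge>N. \<forall>n\<ge>N. hdist A F (s m) (s n) < e"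
  shows "\<exists>l\<in>carrier F. (\<lambda>n. hdist A F (s n) l) \<longlonglongrightarrow> 0"
proof -
  have hd: "hadd F v (hscal A F (- 1) w) \<in> carrier F"
    "co (hadd F v (hscal A F (- 1) w)) = (\<lambda>n. co v n \<ominus> co w n)"
    if "v \<in> carrier F" "w \<in> carrier F" for v w
    using that fock_ract[OF that(2), of "scal A (- 1) \<one>"] co_closed[OF that(2)]
    by (auto simp: hscal_def scal_closed fock_hadd scal_mult_right scal_minus_one minus_eq r_minus)
  have dist: "hdist A F v w = sqrt (nrm A (nsum A (gram A (\<lambda>n. co v n \<ominus> co w n) (\<lambda>n. co v n \<ominus> co w n))))"
    if "v \<in> carrier F" "w \<in> carrier F" for v w
    using hd[OF that] fock_ip by (simp add: hdist_def hnorm_def)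
  have c: "co (s k) n \<in> carrier A" for k n using co_closed s by blast
  have dc: "co (s k) n \<ominus> co (s l) n \<in> carrier A" for k l n using c by simp
  have col: "col_nrm (\<lambda>n. co (s k) n \<ominus> co (s l) n) j \<le> hdist A F (s k) (s l)" for k l j
    unfolding dist[OF s s] using co_summable[OF hd(1)[OF s s]] hd(2)[OF s s]
    by (intro col_nrm_le_nsum dc) simp
  have "\<exists>g. g \<in> M n \<and> nrm_lim A (\<lambda>k. co (s k) n) g" for n
  proof -
    have "\<exists>g. nrm_lim A (\<lambda>k. co (s k) n) g"
    proof (rule complete)
      show "\<forall>e>0. \<exists>N. \<forall>k\<ge>N. \<forall>l\<ge>N. nrm A (co (s k) n \<ominus> co (s l) n) < e"
        using cauchy nrm_psum_gram_le(1)[of "\<lambda>n. co (s _) n \<ominus> co (s _) n", OF dc] col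
        by (meson le_less_trans)
    qed (rule c)
    then show ?thesis using nrm_closedD[OF M_nrm_closed, of "\<lambda>k. co (s k) n"] co_M[OF s] by blast
  qed
  then obtain g where g: "\<And>n. g n \<in> M n" "\<And>n. nrm_lim A (\<lambda>k. co (s k) n) (g n)" by metis
  have gc: "g n \<in> carrier A" for n using g(1) M_carrier by blast
  have cgc: "co (s k) n \<ominus> g n \<in> carrier A" for k n using c gc by simp
  have tail: "\<exists>K. \<forall>k\<ge>K. \<forall>j. col_nrm (\<lambda>n. co (s k) n \<ominus> g n) j \<le> e" if e: "e > 0" for e
  proof -
    obtain K where K: "\<And>k l. k \<ge> K \<Longrightarrow> l \<ge> K \<Longrightarrow> hdist A F (s k) (s l) < e" using cauchy e by blast
    have "col_nrm (\<lambda>n. co (s k) n \<ominus> g n) j \<le> e" if k: "k \<ge> K" for k j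
    proof -
      let ?d = "\<lambda>l n. co (s k) n \<ominus> co (s l) n" and ?g = "\<lambda>n. co (s k) n \<ominus> g n"
      have "nrm_lim A (\<lambda>l. gram A (?d l) (?d l) n) (gram A ?g ?g n)" for n
        unfolding gram_def using g(2) c dc gc cgc star_closed
        by (intro nrm_lim_mult nrm_lim_star nrm_lim_diff nrm_lim_const) auto
      then have lim: "nrm_lim A (\<lambda>l. psum A (gram A (?d l) (?d l)) j) (psum A (gram A ?g ?g) j)"
        by (rule psum_lim) (simp add: gram_closed c)
      have "nrm A (psum A (gram A ?g ?g) j) \<le> e\<^sup>2"
      proof (rule nrm_lim_le[OF lim])
        show "psum A (gram A (?d l) (?d l)) j \<in> carrier A" for l by (intro psum_closed gram_closed dc)
        show "nrm A (psum A (gram A (?d l) (?d l)) j) \<le> e\<^sup>2" if "l \<ge> K" for l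
          using col[of k l j] K[OF k that] sqrt_le_D by fastforce
      qed
      then show ?thesis using e by (simp add: real_le_lsqrt)
    qed
    then show ?thesis by blast
  qed
  have "nsummable A (gram A g g)"
  proof -
    have gg: "gram A g g n \<in> carrier A" for n by (simp add: gram_closed gc)
    show ?thesis
      unfolding nsummable_Cauchy[of "gram A g g", OF gg]
    proof (intro allI impI)
      fix e :: real assume e: "e > 0"
      \<comment> \<open>Two errors of size r, the distance to \<open>s K\<close> and the tail of
        \<open>s K\<close>, have to stay below \<open>sqrt e\<close> together.\<close>
      define r where "r = sqrt e / 3"
      have r: "r > 0" using e by (simp add: r_def)
      obtain K where K: "\<And>j. col_nrm (\<lambda>n. co (s K) n \<ominus> g n) j \<le> r" using tail[OF r] by blast
      have sg: "gram A (co (s K)) (co (s K)) n \<in> carrier A" for n by (simp add: gram_closed c)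
      have "nsummable A (gram A (co (s K)) (co (s K)))" by (rule co_summable[OF s])
      then obtain N where N: "\<And>m n. m \<ge> N \<Longrightarrow> nrm A (psum A (\<lambda>k. gram A (co (s K)) (co (s K)) (m + k)) n) < r\<^sup>2"
        unfolding nsummable_Cauchy[of "gram A (co (s K)) (co (s K))", OF sg] using r by (metis zero_less_power)
      have "nrm A (psum A (\<lambda>k. gram A g g (m + k)) n) < e" if m: "m \<ge> N" for m n
      proof -
        let ?h = "\<lambda>k. \<ominus> (co (s K) (m + k) \<ominus> g (m + k))" and ?f = "\<lambda>k. co (s K) (m + k)"
        have hf: "(\<lambda>k. ?h k \<oplus> ?f k) = (\<lambda>k. g (m + k))"
        proof
          fix k show "?h k \<oplus> ?f k = g (m + k)" using c[of K "m + k"] gc[of "m + k"] by algebra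
        qed
        have "col_nrm (\<lambda>k. g (m + k)) n \<le> col_nrm ?h n + col_nrm ?f n"
          using col_nrm_add[of ?h ?f n] c gc unfolding hf by simp
        moreover have "gram A ?h ?h = gram A (\<lambda>k. co (s K) (m + k) \<ominus> g (m + k)) (\<lambda>k. co (s K) (m + k) \<ominus> g (m + k))"
          using cgc star_closed by (simp add: gram_def fun_eq_iff star_minus l_minus r_minus)
        then have "col_nrm ?h n \<le> r"
          using order_trans[OF nrm_psum_gram_le(3)[of "\<lambda>n. co (s K) n \<ominus> g n" m n, OF cgc] K] by (simp only:)
        moreover have "col_nrm ?f n \<le> r"
        proof -
          have "gram A ?f ?f = (\<lambda>k. gram A (co (s K)) (co (s K)) (m + k))" by (simp add: gram_def fun_eq_iff)
          then show ?thesis using N[OF m, of n] r by (simp add: real_le_lsqrt)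
        qed
        ultimately have "col_nrm (\<lambda>k. g (m + k)) n < sqrt e" using r unfolding r_def by linarith
        moreover have "gram A (\<lambda>k. g (m + k)) (\<lambda>k. g (m + k)) = (\<lambda>k. gram A g g (m + k))"
          by (simp add: gram_def fun_eq_iff)
        ultimately show ?thesis by simp
      qed
      then show "\<exists>N. \<forall>m\<ge>N. \<forall>n. nrm A (psum A (\<lambda>k. gram A g g (m + k)) n) < e" by blast
    qed
  qed
  then have gSq: "g \<in> Sq" using g(1) by (simp add: Sq_def)
  have lF: "vec g \<in> carrier F" and cog: "co (vec g) = g" using gSq by (simp_all add: vec_closed co_vec)
  have "(\<lambda>n. hdist A F (s n) (vec g)) \<longlonglongrightarrow> 0"
  proof (rule LIMSEQ_I)
    fix e :: real assume e: "e > 0"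
    then obtain K where K: "\<And>k j. k \<ge> K \<Longrightarrow> col_nrm (\<lambda>n. co (s k) n \<ominus> g n) j \<le> e / 2"
      using tail half_gt_zero by metis
    have "norm (hdist A F (s k) (vec g) - 0) < e" if k: "k \<ge> K" for k
    proof -
      have "sqrt (nrm A (nsum A (gram A (\<lambda>n. co (s k) n \<ominus> g n) (\<lambda>n. co (s k) n \<ominus> g n)))) \<le> e / 2"
        using co_summable[OF hd(1)[OF s lF, of k]] hd(2)[OF s lF] K[OF k] e
        by (intro nsum_gram_le cgc) (simp_all add: cog)
      then have "hdist A F (s k) (vec g) \<le> e / 2" by (simp add: dist s lF cog)
      moreover have "0 \<le> hdist A F (s k) (vec g)"
        using hd(1)[OF s lF, of k] hd(2)[OF s lF, of k]
          nrm_nonneg[OF nsum_closed[OF co_gram(2) co_gram(1)], of "hadd F (s k) (hscal A F (- 1) (vec g))"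
            "hadd F (s k) (hscal A F (- 1) (vec g))"]
        by (simp add: dist s lF)
      ultimately show ?thesis using e by simp
    qed
    then show "\<exists>K. \<forall>k\<ge>K. norm (hdist A F (s k) (vec g) - 0) < e" by blast
  qed
  then show ?thesis using lF by blast
qed

lemma fock_hilbert: "hilbert_module A F"
proof
  show "ip F x y \<in> carrier A" if "x \<in> carrier F" "y \<in> carrier F" for x y
    unfolding fock_ip[OF that] using co_gram[OF that] by (intro nsum_closed)
  show "ip F x (hadd F y z) = ip F x y \<oplus> ip F x z"
    if "x \<in> carrier F" "y \<in> carrier F" "z \<in> carrier F" for x y z
  proof -
    have "gram A (co x) (co (hadd F y z)) = (\<lambda>n. gram A (co x) (co y) n \<oplus> gram A (co x) (co z) n)"
      using that co_closed star_closed by (simp add: gram_def fun_eq_iff fock_hadd r_distr)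
    then show ?thesis
      using nsum_add(2)[OF co_gram(2)[OF that(1,2)] co_gram(2)[OF that(1,3)] co_gram(1)[OF that(1,2)]
          co_gram(1)[OF that(1,3)]] that by (simp add: fock_ip fock_hadd(1))
  qed
  show "ip F x (ract F y a) = ip F x y \<otimes> a" if "x \<in> carrier F" "y \<in> carrier F" "a \<in> carrier A" for x y a
  proof -
    have "gram A (co x) (co (ract F y a)) = (\<lambda>n. gram A (co x) (co y) n \<otimes> a)"
      using that co_closed star_closed by (simp add: gram_def fun_eq_iff fock_ract m_assoc)
    then show ?thesis
      using nsum_mult_right(2)[OF co_gram(2)[OF that(1,2)] co_gram(1)[OF that(1,2)] that(3)] that
      by (simp add: fock_ip fock_ract(1))
  qed
  show "ip F x (hzero F) = \<zero>" if "x \<in> carrier F" for x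
  proof -
    have "gram A (co x) (co (hzero F)) = (\<lambda>n. \<zero>)"
      using co_closed[OF that] star_closed by (simp add: gram_def fun_eq_iff fock_hzero)
    then show ?thesis using nsum_finite(2)[of "\<lambda>n. \<zero>" 0] that fock_hzero(1) by (simp add: fock_ip)
  qed
  show "star A (ip F x y) = ip F y x" if "x \<in> carrier F" "y \<in> carrier F" for x y
  proof -
    have "gram A (co y) (co x) = (\<lambda>n. star A (gram A (co x) (co y) n))"
      using that co_closed star_closed by (simp add: gram_def fun_eq_iff star_mult star_star)
    then show ?thesis using nsum_star(2)[OF co_gram(2,1)[OF that]] that by (simp add: fock_ip)
  qed
  show "pos A (ip F x x)" if x: "x \<in> carrier F" for x
    unfolding fock_ip[OF x x] by (rule nsum_pos[OF gram_pos[of "co x"] co_gram(2)[OF x x]]) (rule co_closed[OF x])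
  show "x = y" if "x \<in> carrier F" "y \<in> carrier F" "\<And>z. z \<in> carrier F \<Longrightarrow> ip F z x = ip F z y" for x y
    using that ip_ket ket_closed by (intro co_eqI) metis+
  show "\<exists>l\<in>carrier F. (\<lambda>n. hdist A F (s n) l) \<longlonglongrightarrow> 0"
    if "\<And>n. s n \<in> carrier F" "\<forall>e>0. \<exists>N. \<forall>m\<ge>N. \<forall>n\<ge>N. hdist A F (s m) (s n) < e" for s
    using that by (rule fock_hcomplete)
qed (simp_all add: fock_hadd fock_hzero fock_ract)

sublocale F: hilbert_module A F
  by (rule fock_hilbert)

sublocale L: unital_cstar_algebra F.L
  by (rule F.adjointable_cstar)

abbreviation L :: "('a, 'a) fock_op cstar_algebra" where "L \<equiv> F.L"

lemma op_coI:
  "\<lbrakk>T \<in> carrier L; R \<in> carrier L; \<And>x n. x \<in> carrier F \<Longrightarrow> co (T x) n = co (R x) n\<rbrakk> \<Longrightarrow> T = R"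
  by (rule F.op_ext) (auto intro: co_eqI simp: F.op_closed F.is_adjointD(5)[OF F.adjointableD]
      dest: co_eqI[OF F.op_closed F.op_closed])

lemma co_hscal: "v \<in> carrier F \<Longrightarrow> co (hscal A F c v) n = scal A c (co v n)"
  by (simp add: hscal_def fock_ract scal_closed scal_mult_right co_closed)

section \<open>The generating operators on the Fock module\<close>

abbreviation \<phi> :: "'a \<Rightarrow> ('a, 'a) fock_op" where "\<phi> \<equiv> fock_phi A E"

abbreviation S :: "('a, 'a) fock_op" where "S \<equiv> fock_creation A E (\<delta> \<one>)"

text \<open>The adjoint of \<open>S\<close>, which is u. Coordinates may be shifted down without a
  correcting factor, since \<delta>^(n+1)(1)A is contained in \<delta>^n(1)A.\<close>

definition Sd :: "('a, 'a) fock_op" where "Sd = (\<lambda>v\<in>carrier F. vec (\<lambda>n. co v (Suc n)))"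

lemma phi_app:
  assumes "a \<in> carrier A" "v \<in> carrier F"
  shows "\<phi> a v \<in> carrier F" "co (\<phi> a v) n = (\<delta> ^^ n) a \<otimes> co v n"
  using fock_lact assms by (simp_all add: fock_phi_def)

text \<open>In coordinates a creation operator is a weighted shift; the weight \<delta>^n(x) is the
  factor picked up by prepending \<open>x\<close>.\<close>

lemma creation_app:
  assumes x: "x \<in> M 1" and v: "v \<in> carrier F"
  shows "fock_creation A E x v \<in> carrier F" "co (fock_creation A E x v) 0 = \<zero>"
    "co (fock_creation A E x v) (Suc n) = (\<delta> ^^ n) x \<otimes> co v n"
proof -
  define f where "f n = (case n of 0 \<Rightarrow> \<zero> | Suc m \<Rightarrow> (\<delta> ^^ m) x \<otimes> co v m)" for n
  have xc: "x \<in> carrier A" using M_carrier x by blast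
  have cv: "co v n \<in> M n" "co v n \<in> carrier A" for n using co_M co_closed v by auto
  have dx: "(\<delta> ^^ m) x = en (Suc m) \<otimes> (\<delta> ^^ m) x" for m
    using M_en[OF x] dn_mult[of "\<delta> \<one>" x m] xc by (simp add: d_closed funpow_swap1)
  have "(\<delta> ^^ m) x \<in> M (Suc m)" for m
    using dx[of m] dn_closed[OF xc, of m] by (simp add: M_def)
  then have fM: "f n \<in> M n" for n
    using M_mult[OF _ cv(2)] by (cases n) (auto simp: f_def M_zero)
  have fc: "f n \<in> carrier A" for n using fM M_carrier by blast
  have shift: "(\<lambda>k. gram A f f (Suc k)) = gram A (\<lambda>m. (\<delta> ^^ m) x \<otimes> co v m) (\<lambda>m. (\<delta> ^^ m) x \<otimes> co v m)"
    by (simp add: gram_def fun_eq_iff f_def)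
  have "nsummable A (gram A f f)"
  proof (rule nsum_Suc(1))
    show "gram A f f n \<in> carrier A" for n by (simp add: gram_closed fc)
    show "gram A f f 0 = \<zero>" by (simp add: gram_def f_def)
    show "nsummable A (\<lambda>k. gram A f f (Suc k))"
      unfolding shift
      by (rule nsummable_gram_mult[OF cv(2) co_summable[OF v] dn_closed[OF xc] dn_nrm_le[OF xc]])
  qed
  then have f: "f \<in> Sq" using fM by (simp add: Sq_def)
  have "fst v = co v 0" "snd v = (\<lambda>n. fib n (co v (Suc n)))" using vec_co[OF v] by (simp_all add: vec_def prod_eq_iff)
  then have "fock_creation A E x v = (\<zero>, \<lambda>n. case n of 0 \<Rightarrow> tensor_embed A E (x \<otimes> co v 0)
      | Suc m \<Rightarrow> tensor_cons A E (Suc m) x (fib m (co v (Suc m))))"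
    using v by (simp add: fock_creation_def E_simps)
  also have "\<dots> = vec f"
    using tensor_embed_eq[OF M_mult[OF x cv(2)]] tensor_cons_eq[OF x cv(1)]
    by (auto simp: vec_def f_def fun_eq_iff split: nat.splits)
  finally have eq: "fock_creation A E x v = vec f" .
  show "fock_creation A E x v \<in> carrier F" "co (fock_creation A E x v) 0 = \<zero>"
    "co (fock_creation A E x v) (Suc n) = (\<delta> ^^ n) x \<otimes> co v n"
    unfolding eq using f by (simp_all add: vec_closed co_vec) (simp_all add: f_def)
qed

lemma S_app:
  assumes v: "v \<in> carrier F"
  shows "S v \<in> carrier F" "co (S v) 0 = \<zero>" "co (S v) (Suc n) = en (Suc n) \<otimes> co v n"
  using creation_app[OF _ v, of "\<delta> \<one>"] en_in_M[of 1] by (simp_all add: funpow_swap1)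

lemma Sd_app:
  assumes v: "v \<in> carrier F"
  shows "Sd v \<in> carrier F" "co (Sd v) n = co v (Suc n)"
proof -
  have g: "gram A (co v) (co v) n \<in> carrier A" for n by (rule co_gram(1)[OF v v])
  have "nsummable A (gram A (\<lambda>n. co v (Suc n)) (\<lambda>n. co v (Suc n)))"
  proof -
    have "(\<lambda>k. gram A (co v) (co v) (Suc k)) = gram A (\<lambda>n. co v (Suc n)) (\<lambda>n. co v (Suc n))"
      by (simp add: gram_def fun_eq_iff)
    moreover have "nsummable A (\<lambda>k. gram A (co v) (co v) (Suc k))"
      unfolding nsummable_Cauchy[of "\<lambda>k. gram A (co v) (co v) (Suc k)", OF g]
    proof (intro allI impI)
      fix e :: real assume "e > 0"
      then obtain N where N: "\<And>m n. m \<ge> N \<Longrightarrow> nrm A (psum A (\<lambda>k. gram A (co v) (co v) (m + k)) n) < e"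
        using co_summable[OF v] unfolding nsummable_Cauchy[of "gram A (co v) (co v)", OF g] by blast
      show "\<exists>N. \<forall>m\<ge>N. \<forall>n. nrm A (psum A (\<lambda>k. gram A (co v) (co v) (Suc (m + k))) n) < e"
        using N[of "Suc _"] by (intro exI[of _ N]) simp
    qed
    ultimately show ?thesis by simp
  qed
  then have "(\<lambda>n. co v (Suc n)) \<in> Sq" using M_mono[OF co_M[OF v]] by (simp add: Sq_def)
  then show "Sd v \<in> carrier F" "co (Sd v) n = co v (Suc n)" using v by (simp_all add: Sd_def vec_closed co_vec)
qed

text \<open>The weight of \<open>S\<close> is a projection that fixes the coordinate of
  \<open>w\<close> which it meets, so it disappears on the other side.\<close>

lemma is_adjoint_S: "is_adjoint F S Sd"
proof (rule F.is_adjointI)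
  show "S \<in> extensional (carrier F)" "Sd \<in> extensional (carrier F)"
    by (auto simp: fock_creation_def Sd_def)
  fix v w assume v: "v \<in> carrier F" and w: "w \<in> carrier F"
  have Sv: "S v \<in> carrier F" and Sw: "Sd w \<in> carrier F" using v w S_app Sd_app by auto
  have eq: "gram A (co (S v)) (co w) (Suc k) = gram A (co v) (co (Sd w)) k" for k
  proof -
    have "star A (en (Suc k) \<otimes> co v k) \<otimes> co w (Suc k) = star A (co v k) \<otimes> (en (Suc k) \<otimes> co w (Suc k))"
      using co_closed[OF v] co_closed[OF w] en_closed[of "Suc k"] star_closed[OF co_closed[OF v]]
        star_en[of "Suc k"] by (simp add: star_mult m_assoc del: funpow.simps)
    then show ?thesis using M_en[OF co_M[OF w], of "Suc k"] S_app(3)[OF v] by (simp add: gram_def Sd_app[OF w])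
  qed
  have "nsum A (gram A (co (S v)) (co w)) = nsum A (\<lambda>k. gram A (co (S v)) (co w) (Suc k))"
  proof (rule nsum_Suc(2))
    show "gram A (co (S v)) (co w) 0 = \<zero>" using S_app(2)[OF v] co_closed[OF w] by (simp add: gram_def)
    show "nsummable A (\<lambda>k. gram A (co (S v)) (co w) (Suc k))" unfolding eq using co_gram(2)[OF v Sw] by simp
  qed (rule co_gram(1)[OF Sv w])
  then show "ip F (S v) w = ip F v (Sd w)"
    unfolding eq fock_ip[OF Sv w] fock_ip[OF v Sw] by simp
qed (auto simp: S_app Sd_app)

lemma is_adjoint_phi:
  assumes a: "a \<in> carrier A"
  shows "is_adjoint F (\<phi> a) (\<phi> (star A a))"
proof (rule F.is_adjointI)
  show "\<phi> a \<in> extensional (carrier F)" "\<phi> (star A a) \<in> extensional (carrier F)" by (auto simp: fock_phi_def)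
  fix v w assume v: "v \<in> carrier F" and w: "w \<in> carrier F"
  have sa: "star A a \<in> carrier A" using a star_closed by blast
  have "gram A (co (\<phi> a v)) (co w) = gram A (co v) (co (\<phi> (star A a) w))"
    using co_closed[OF v] co_closed[OF w] dn_closed[OF a] star_closed[OF co_closed[OF v]]
      star_closed[OF dn_closed[OF a]] by (simp add: gram_def fun_eq_iff phi_app a sa v w star_mult dn_star m_assoc)
  then show "ip F (\<phi> a v) w = ip F v (\<phi> (star A a) w)" using a sa v w by (simp add: fock_ip phi_app)
qed (use assms star_closed phi_app in auto)

lemma S_closed: "S \<in> carrier L" and star_S: "star L S = Sd"
  and Sd_closed: "Sd \<in> carrier L" and star_Sd: "star L Sd = S"
  using F.adjointableI[OF is_adjoint_S] F.adjointableI[OF F.is_adjoint_sym[OF is_adjoint_S]] by auto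

lemma phi_closed: "a \<in> carrier A \<Longrightarrow> \<phi> a \<in> carrier L"
  and star_phi: "a \<in> carrier A \<Longrightarrow> star L (\<phi> a) = \<phi> (star A a)"
  using F.adjointableI[OF is_adjoint_phi] by auto

lemmas op_simps = F.L_app F.op_closed phi_app S_app Sd_app S_closed Sd_closed phi_closed fock_hadd
  co_hscal F.hclosed co_closed dn_closed L.scal_closed

lemma phi_add: "\<lbrakk>a \<in> carrier A; b \<in> carrier A\<rbrakk> \<Longrightarrow> \<phi> (a \<oplus> b) = \<phi> a \<oplus>\<^bsub>L\<^esub> \<phi> b"
  by (rule op_coI) (auto simp: op_simps dn_add l_distr)

lemma phi_mult: "\<lbrakk>a \<in> carrier A; b \<in> carrier A\<rbrakk> \<Longrightarrow> \<phi> (a \<otimes> b) = \<phi> a \<otimes>\<^bsub>L\<^esub> \<phi> b"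
  by (rule op_coI) (auto simp: op_simps dn_mult m_assoc)

lemma phi_scal: "a \<in> carrier A \<Longrightarrow> \<phi> (scal A c a) = scal L c (\<phi> a)"
  by (rule op_coI) (auto simp: op_simps dn_scal scal_mult_left scal_closed)

lemma phi_one: "\<phi> \<one> = \<one>\<^bsub>L\<^esub>"
  by (rule op_coI) (auto simp: op_simps M_en[OF co_M])

text \<open>The weight \<delta>^(n+1)(1) of \<open>S\<close> is absorbed by
  \<delta>^(n+1)(a).\<close>

lemma S_phi_S: "a \<in> carrier A \<Longrightarrow> Sd \<otimes>\<^bsub>L\<^esub> \<phi> a \<otimes>\<^bsub>L\<^esub> S = \<phi> (\<delta> a)"
proof (rule op_coI)
  fix v n assume a: "a \<in> carrier A" and v: "v \<in> carrier F"
  have "(\<delta> ^^ Suc n) a \<otimes> (en (Suc n) \<otimes> co v n) = (\<delta> ^^ Suc n) a \<otimes> co v n"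
    using dn_en[OF a, of "Suc n"] dn_closed[OF a, of "Suc n"] en_closed[of "Suc n"] co_closed[OF v]
    by (simp add: m_assoc[symmetric] del: funpow.simps)
  then show "co ((Sd \<otimes>\<^bsub>L\<^esub> \<phi> a \<otimes>\<^bsub>L\<^esub> S) v) n = co (\<phi> (\<delta> a) v) n"
    using a v by (simp add: F.L_app Sd_app phi_app S_app d_closed funpow_swap1)
qed (auto simp: phi_closed d_closed S_closed Sd_closed)

lemma S_Sd_app:
  assumes v: "v \<in> carrier F"
  shows "co ((S \<otimes>\<^bsub>L\<^esub> Sd) v) n = (if n = 0 then \<zero> else co v n)"
  using v M_en[OF co_M[OF v]] by (cases n) (simp_all add: F.L_app S_app Sd_app del: funpow.simps)

lemma S_Sd_phi: "a \<in> carrier A \<Longrightarrow> S \<otimes>\<^bsub>L\<^esub> Sd \<otimes>\<^bsub>L\<^esub> \<phi> a = \<phi> a \<otimes>\<^bsub>L\<^esub> (S \<otimes>\<^bsub>L\<^esub> Sd)"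
proof (rule op_coI)
  fix v n assume a: "a \<in> carrier A" and v: "v \<in> carrier F"
  have SSd: "S \<otimes>\<^bsub>L\<^esub> Sd \<in> carrier L" using S_closed Sd_closed by simp
  show "co ((S \<otimes>\<^bsub>L\<^esub> Sd \<otimes>\<^bsub>L\<^esub> \<phi> a) v) n = co ((\<phi> a \<otimes>\<^bsub>L\<^esub> (S \<otimes>\<^bsub>L\<^esub> Sd)) v) n"
    using a v S_Sd_app[OF phi_app(1)[OF a v]] S_Sd_app[OF v] F.op_closed[OF SSd v] dn_closed[OF a]
    by (simp add: F.L_app(1)[of _ "S \<otimes>\<^bsub>L\<^esub> Sd"] F.L_app(1)[of _ "\<phi> a"] phi_app del: funpow.simps)
qed (auto simp: phi_closed S_closed Sd_closed)

lemma creation_eq: "a \<in> carrier A \<Longrightarrow> fock_creation A E (\<delta> \<one> \<otimes> a) = S \<otimes>\<^bsub>L\<^esub> \<phi> a"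
proof (rule F.op_ext)
  assume a: "a \<in> carrier A"
  have x: "\<delta> \<one> \<otimes> a \<in> M 1" using M_en_mult[OF a, of 1] by simp
  have Sa: "S \<otimes>\<^bsub>L\<^esub> \<phi> a \<in> carrier L" using a S_closed phi_closed by simp
  show "fock_creation A E (\<delta> \<one> \<otimes> a) \<in> extensional (carrier F)" by (simp add: fock_creation_def)
  show "S \<otimes>\<^bsub>L\<^esub> \<phi> a \<in> extensional (carrier F)" using F.is_adjointD(5)[OF F.adjointableD[OF Sa]] .
  fix v assume v: "v \<in> carrier F"
  show "fock_creation A E (\<delta> \<one> \<otimes> a) v \<in> carrier F" using creation_app[OF x v] by simp
  show "(S \<otimes>\<^bsub>L\<^esub> \<phi> a) v \<in> carrier F" using F.op_closed[OF Sa v] .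
  have "fock_creation A E (\<delta> \<one> \<otimes> a) v = (S \<otimes>\<^bsub>L\<^esub> \<phi> a) v"
  proof (rule co_eqI)
    fix n
    show "co (fock_creation A E (\<delta> \<one> \<otimes> a) v) n = co ((S \<otimes>\<^bsub>L\<^esub> \<phi> a) v) n"
    proof (cases n)
      case (Suc k)
      have "(\<delta> ^^ k) (\<delta> \<one> \<otimes> a) \<otimes> co v k = en (Suc k) \<otimes> ((\<delta> ^^ k) a \<otimes> co v k)"
        using a v dn_closed[OF a] en_closed[of "Suc k"] co_closed[OF v] dn_mult[of "\<delta> \<one>" a k]
        by (simp add: d_closed funpow_swap1 m_assoc)
      then show ?thesis
        using creation_app(3)[OF x v, of k] S_app(3)[OF phi_app(1)[OF a v], of k] a v Suc
        by (simp add: F.L_app phi_app del: funpow.simps)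
    qed (use creation_app(2)[OF x v] S_app(2)[OF phi_app(1)[OF a v]] v in \<open>simp add: F.L_app\<close>)
  qed (use creation_app(1)[OF x v] F.op_closed[OF Sa v] in auto)
  then show "ip F z (fock_creation A E (\<delta> \<one> \<otimes> a) v) = ip F z ((S \<otimes>\<^bsub>L\<^esub> \<phi> a) v)" for z by simp
qed

lemma P0_app:
  assumes v: "v \<in> carrier F"
  shows "fock_P0 A E v \<in> carrier F" "co (fock_P0 A E v) n = (if n = 0 then co v 0 else \<zero>)"
proof -
  have "fst v = co v 0" using vec_co[OF v] by (simp add: vec_def prod_eq_iff)
  then have eq: "fock_P0 A E v = vec (\<lambda>n. if n = 0 then co v 0 else \<zero>)"
    using v by (simp add: fock_P0_def vec_def fock_module_def tp_hzero)
  have "(\<lambda>n. if n = 0 then co v 0 else \<zero>) \<in> Sq"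
    using co_M[OF v] by (intro Sq_finite[of _ 1]) (auto simp: M_zero)
  then show "fock_P0 A E v \<in> carrier F" "co (fock_P0 A E v) n = (if n = 0 then co v 0 else \<zero>)"
    by (simp_all add: eq vec_closed co_vec)
qed

lemma P0_eq: "fock_P0 A E = \<one>\<^bsub>L\<^esub> \<ominus>\<^bsub>L\<^esub> S \<otimes>\<^bsub>L\<^esub> Sd"
proof -
  let ?R = "\<one>\<^bsub>L\<^esub> \<ominus>\<^bsub>L\<^esub> S \<otimes>\<^bsub>L\<^esub> Sd"
  have SSd: "S \<otimes>\<^bsub>L\<^esub> Sd \<in> carrier L" using S_closed Sd_closed by simp
  have R: "?R \<in> carrier L" using SSd by simp
  show ?thesis
  proof (rule extensionalityI)
    show "fock_P0 A E \<in> extensional (carrier F)" by (simp add: fock_P0_def)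
    show "?R \<in> extensional (carrier F)" using F.is_adjointD(5)[OF F.adjointableD[OF R]] .
    fix v assume v: "v \<in> carrier F"
    have SSv: "(S \<otimes>\<^bsub>L\<^esub> Sd) v \<in> carrier F" using F.op_closed[OF SSd v] .
    have "co (?R v) n = co v n \<oplus> scal A (- 1) (co ((S \<otimes>\<^bsub>L\<^esub> Sd) v) n)" for n
      using v SSd SSv by (simp only: F.L_diff_app F.L_app(2) fock_hadd F.hscal_closed co_hscal)
    then show "fock_P0 A E v = ?R v"
      using P0_app[OF v] F.op_closed[OF R v] co_closed[OF v]
      by (intro co_eqI) (auto simp: S_Sd_app[OF v] scal_minus_one r_neg)
  qed
qed

section \<open>Matrix entries\<close>

definition ent :: "('a, 'a) fock_op \<Rightarrow> nat \<Rightarrow> nat \<Rightarrow> 'a" where "ent T i j = co (T (ket j)) i"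

lemma ent_closed: "T \<in> carrier L \<Longrightarrow> ent T i j \<in> carrier A"
  by (simp add: ent_def co_closed F.op_closed ket_closed)

lemma ent_ip: "T \<in> carrier L \<Longrightarrow> ent T i j = ip F (ket i) (T (ket j))"
  by (simp add: ent_def ip_ket F.op_closed ket_closed)

lemma ent_star: "T \<in> carrier L \<Longrightarrow> ent (star L T) i j = star A (ent T j i)"
  by (simp add: ent_ip L.star_closed ket_closed F.ip_star F.op_closed flip: F.ip_op_left)

text \<open>Row i of \<open>T\<close> is the adjoint of the column \<open>star L T (ket i)\<close>,
  so the series is an inner product of square summable columns.\<close>

lemma co_op:
  assumes T: "T \<in> carrier L" and v: "v \<in> carrier F"
  shows "nsummable A (\<lambda>j. ent T i j \<otimes> co v j)" "co (T v) i = nsum A (\<lambda>j. ent T i j \<otimes> co v j)"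
proof -
  have w: "star L T (ket i) \<in> carrier F" using F.star_op_closed[OF T ket_closed] .
  have "co (star L T (ket i)) j = star A (ent T i j)" for j
    using ent_star[OF T, of j i] by (simp add: ent_def)
  then have eq: "gram A (co (star L T (ket i))) (co v) = (\<lambda>j. ent T i j \<otimes> co v j)"
    using ent_closed[OF T] by (simp add: gram_def fun_eq_iff star_star)
  show "nsummable A (\<lambda>j. ent T i j \<otimes> co v j)" using co_gram(2)[OF w v] by (simp add: eq)
  have "co (T v) i = ip F (star L T (ket i)) v"
    using T v ip_ket[OF F.op_closed[OF T v]] F.ip_op[OF T ket_closed v] by simp
  then show "co (T v) i = nsum A (\<lambda>j. ent T i j \<otimes> co v j)" using fock_ip[OF w v] by (simp add: eq)
qed

text \<open>Finite support of the column of \<open>R\<close> keeps the matrix product finite, so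
  that a homomorphism can be applied to it term by term.\<close>

lemma ent_mult:
  assumes T: "T \<in> carrier L" and R: "R \<in> carrier L" and m: "\<And>j. m \<le> j \<Longrightarrow> ent R j k = \<zero>"
  shows "ent (T \<otimes>\<^bsub>L\<^esub> R) i k = psum A (\<lambda>j. ent T i j \<otimes> ent R j k) m"
proof -
  have "ent (T \<otimes>\<^bsub>L\<^esub> R) i k = nsum A (\<lambda>j. ent T i j \<otimes> ent R j k)"
    using co_op(2)[OF T F.op_closed[OF R ket_closed], of k i] by (simp add: ent_def F.L_app ket_closed)
  also have "\<dots> = psum A (\<lambda>j. ent T i j \<otimes> ent R j k) m"
    using m ent_closed[OF T] ent_closed[OF R] by (intro nsum_finite) auto
  finally show ?thesis .
qed

lemma ent_add: "\<lbrakk>T \<in> carrier L; R \<in> carrier L\<rbrakk> \<Longrightarrow> ent (T \<oplus>\<^bsub>L\<^esub> R) i j = ent T i j \<oplus> ent R i j"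
  by (simp add: ent_def F.L_app ket_closed fock_hadd F.op_closed)

lemma ent_scal: "T \<in> carrier L \<Longrightarrow> ent (scal L c T) i j = scal A c (ent T i j)"
  by (simp add: ent_def F.L_app ket_closed co_hscal F.op_closed)

lemma ent_phi: "a \<in> carrier A \<Longrightarrow> ent (\<phi> a) i j = (if i = j then (\<delta> ^^ i) a else \<zero>)"
  by (simp add: ent_def phi_app ket_closed co_ket dn_closed dn_en)

lemma ent_S: "ent S i j = (if i = Suc j then en i else \<zero>)"
proof (cases i)
  case (Suc k)
  then show ?thesis
    using S_app(3)[OF ket_closed, of j k] en_ge[of j "Suc j"] en_closed[of "Suc k"]
    by (auto simp: ent_def co_ket simp del: funpow.simps)
qed (use S_app(2)[OF ket_closed] in \<open>simp add: ent_def\<close>)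

lemma ent_Sd: "ent Sd i j = (if j = Suc i then en j else \<zero>)"
  by (auto simp: ent_def Sd_app ket_closed co_ket)

lemma ent_left:
  assumes T: "T \<in> carrier L"
  shows "a \<in> carrier A \<Longrightarrow> ent (\<phi> a \<otimes>\<^bsub>L\<^esub> T) i j = (\<delta> ^^ i) a \<otimes> ent T i j"
    "ent (Sd \<otimes>\<^bsub>L\<^esub> T) i j = ent T (Suc i) j" "ent (S \<otimes>\<^bsub>L\<^esub> T) 0 j = \<zero>"
    "ent (S \<otimes>\<^bsub>L\<^esub> T) (Suc i) j = en (Suc i) \<otimes> ent T i j"
  using F.op_closed[OF T ket_closed] by (simp_all add: ent_def F.L_app ket_closed phi_app Sd_app S_app)

lemma hn_ket: "hnorm A F (ket j) \<le> 1"
proof -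
  have "ip F (ket j) (ket j) = en j" using ip_ket[OF ket_closed] by (simp add: co_ket)
  moreover have "nrm A (en j) \<le> 1" using order_trans[OF dn_nrm_le[OF one_closed] nrm_one_le] by simp
  ultimately show ?thesis by (simp add: hnorm_def)
qed

lemma nrm_ent_le: "T \<in> carrier L \<Longrightarrow> nrm A (ent T i j) \<le> nrm L T"
proof -
  assume T: "T \<in> carrier L"
  have "nrm A (ent T i j) \<le> hnorm A F (ket i) * hnorm A F (T (ket j))"
    unfolding ent_ip[OF T] by (rule F.nrm_ip_le[OF ket_closed F.op_closed[OF T ket_closed]])
  also have "\<dots> \<le> 1 * nrm L T"
    using hn_ket F.L_nrm_upper[OF T ket_closed hn_ket] F.hn_nonneg[OF F.op_closed[OF T ket_closed]]
    by (intro mult_mono) auto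
  finally show ?thesis by simp
qed

end

section \<open>Covariant representations\<close>

locale covariant = dyn_system A \<delta> + B: unital_cstar_algebra B
  for A :: "'a cstar_algebra" (structure) and \<delta> :: "'a \<Rightarrow> 'a" and B :: "'b cstar_algebra" +
  fixes \<pi> :: "'a \<Rightarrow> 'b" and U :: 'b
  assumes cov: "covariant_rep A \<delta> B \<pi> U"

sublocale covariant \<subseteq> p: unital_cstar_hom A B \<pi>
  using cov by unfold_locales (auto simp: covariant_rep_def)

context covariant
begin

abbreviation bmult :: "'b \<Rightarrow> 'b \<Rightarrow> 'b" (infixl "\<cdot>" 70) where "x \<cdot> y \<equiv> x \<otimes>\<^bsub>B\<^esub> y"

abbreviation V :: 'b where "V \<equiv> star B U"

abbreviation Up :: "nat \<Rightarrow> 'b" where "Up n \<equiv> U [^]\<^bsub>B\<^esub> n"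

definition q :: 'b where "q = \<one>\<^bsub>B\<^esub> \<ominus>\<^bsub>B\<^esub> V \<cdot> U"

definition pp :: "nat \<Rightarrow> 'b" where "pp n = star B (Up n) \<cdot> Up n"

lemma U_closed: "U \<in> carrier B" and V_closed: "V \<in> carrier B"
  using cov B.star_closed by (auto simp: covariant_rep_def)

lemma cov_U: "a \<in> carrier A \<Longrightarrow> U \<cdot> \<pi> a \<cdot> V = \<pi> (\<delta> a)"
  and cov_comm: "a \<in> carrier A \<Longrightarrow> V \<cdot> U \<cdot> \<pi> a = \<pi> a \<cdot> (V \<cdot> U)"
  using cov by (auto simp: covariant_rep_def)

lemma UV: "U \<cdot> V = \<pi> (\<delta> \<one>)"
  using cov_U[of \<one>] U_closed V_closed by (simp add: p.one)

text \<open>By covariance \<open>U \<cdot> V\<close> is the projection \<pi>(\<delta>(1)), and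
  therefore the product of U - U V U with its adjoint is 0.\<close>

lemma UVU: "U \<cdot> (V \<cdot> U) = U"
proof -
  have "\<delta> \<one> \<otimes> \<delta> \<one> = \<delta> \<one>" using d_mult[of \<one> \<one>] by simp
  then have e: "U \<cdot> V \<cdot> (U \<cdot> V) = U \<cdot> V" unfolding UV by (simp add: d_closed flip: p.mult)
  let ?x = "U \<ominus>\<^bsub>B\<^esub> U \<cdot> V \<cdot> U"
  have c: "U \<in> carrier B" "V \<in> carrier B" "star B V = U" using U_closed V_closed B.star_star by auto
  have x: "?x \<in> carrier B" using c by simp
  have sx: "star B ?x = V \<ominus>\<^bsub>B\<^esub> V \<cdot> (U \<cdot> V)" using c by (simp add: B.star_diff B.star_mult)
  have "?x \<cdot> star B ?x = U \<cdot> V \<ominus>\<^bsub>B\<^esub> U \<cdot> V \<cdot> (U \<cdot> V) \<ominus>\<^bsub>B\<^esub> (U \<cdot> V \<cdot> (U \<cdot> V) \<ominus>\<^bsub>B\<^esub> U \<cdot> V \<cdot> (U \<cdot> V) \<cdot> (U \<cdot> V))"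
    unfolding sx using c(1,2) by algebra
  also have "\<dots> = \<zero>\<^bsub>B\<^esub>" using c(1,2) by (simp add: e)
  finally have "(nrm B ?x)\<^sup>2 = 0" using B.cstar_identity'[OF x] by simp
  then have "U = U \<cdot> V \<cdot> U" using B.nrm_diff_eq_zero[of U "U \<cdot> V \<cdot> U"] c by simp
  then show ?thesis using c B.m_assoc by simp
qed

text \<open>Insert the initial projection \<open>V \<cdot> U\<close> after \<open>U\<close>, commute
  it with \<open>\<pi> a\<close>, and apply covariance.\<close>

lemma U_pi: "a \<in> carrier A \<Longrightarrow> U \<cdot> \<pi> a = \<pi> (\<delta> a) \<cdot> U"
proof -
  assume a: "a \<in> carrier A"
  have c: "U \<in> carrier B" "V \<in> carrier B" "\<pi> a \<in> carrier B" using U_closed V_closed p.closed a by auto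
  have "U \<cdot> \<pi> a = U \<cdot> (V \<cdot> U \<cdot> \<pi> a)" using UVU c by (simp flip: B.m_assoc)
  also have "\<dots> = U \<cdot> \<pi> a \<cdot> V \<cdot> U" unfolding cov_comm[OF a] using c by (simp add: B.m_assoc)
  finally show ?thesis by (simp add: cov_U a)
qed

lemma Up_closed: "Up n \<in> carrier B" and Up_star_closed: "star B (Up n) \<in> carrier B"
  using U_closed B.star_closed by auto

lemma Up_Suc: "Up (Suc n) = U \<cdot> Up n"
  using B.nat_pow_Suc2[OF U_closed] .

lemma Up_pi: "a \<in> carrier A \<Longrightarrow> Up n \<cdot> \<pi> a = \<pi> ((\<delta> ^^ n) a) \<cdot> Up n"
proof (induction n)
  case (Suc n)
  have c: "U \<in> carrier B" "Up n \<in> carrier B" "\<pi> a \<in> carrier B" "\<pi> ((\<delta> ^^ n) a) \<in> carrier B"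
    "\<pi> (\<delta> ((\<delta> ^^ n) a)) \<in> carrier B"
    using U_closed Up_closed p.closed dn_closed d_closed Suc(2) by auto
  have "Up (Suc n) \<cdot> \<pi> a = U \<cdot> \<pi> ((\<delta> ^^ n) a) \<cdot> Up n" unfolding Up_Suc using c Suc by (simp add: B.m_assoc)
  also have "\<dots> = \<pi> ((\<delta> ^^ Suc n) a) \<cdot> Up (Suc n)"
    unfolding U_pi[OF dn_closed[OF Suc(2)]] Up_Suc using c by (simp add: B.m_assoc)
  finally show ?case .
qed (simp add: p.closed)

lemma en_Up: "\<pi> (en n) \<cdot> Up n = Up n"
  using Up_pi[of \<one> n] Up_closed by (simp add: p.one)

lemma q_closed: "q \<in> carrier B" and q_star: "star B q = q" and q_idem: "q \<cdot> q = q" and qV: "q \<cdot> V = \<zero>\<^bsub>B\<^esub>"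
proof -
  have c: "U \<in> carrier B" "V \<in> carrier B" "star B V = U" using U_closed V_closed B.star_star by auto
  show qc: "q \<in> carrier B" using c by (simp add: q_def)
  show qs: "star B q = q" using c by (simp add: q_def B.star_diff B.star_mult)
  have "U \<cdot> q = U \<ominus>\<^bsub>B\<^esub> U \<cdot> (V \<cdot> U)" unfolding q_def using c(1,2) by algebra
  then have Uq: "U \<cdot> q = \<zero>\<^bsub>B\<^esub>" using c by (simp add: UVU)
  have "q \<cdot> V = star B (U \<cdot> q)" using c qc by (simp add: B.star_mult qs)
  then show "q \<cdot> V = \<zero>\<^bsub>B\<^esub>" by (simp add: Uq)
  have "q \<cdot> q = q \<ominus>\<^bsub>B\<^esub> V \<cdot> (U \<cdot> q)"
  proof -
    have "(\<one>\<^bsub>B\<^esub> \<ominus>\<^bsub>B\<^esub> V \<cdot> U) \<cdot> q = q \<ominus>\<^bsub>B\<^esub> V \<cdot> (U \<cdot> q)" using c(1,2) qc by algebra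
    then show ?thesis by (simp add: q_def)
  qed
  then show "q \<cdot> q = q" using c qc by (simp add: Uq B.minus_eq)
qed

lemma q_pi: "a \<in> carrier A \<Longrightarrow> q \<cdot> \<pi> a = \<pi> a \<cdot> q"
  using cov_comm[of a] p.closed[of a] U_closed V_closed
  by (simp add: q_def B.minus_eq B.l_distr B.r_distr B.l_minus B.r_minus)

lemma pp_closed: "pp n \<in> carrier B" and pp_pos: "pos B (pp n)" and pp_nrm: "nrm B (pp n) \<le> 1"
proof -
  show "pp n \<in> carrier B" "pos B (pp n)" using Up_closed Up_star_closed B.pos_star_mult by (auto simp: pp_def)
  have "nrm B (U \<cdot> V) \<le> 1"
    unfolding UV using p.nrm_le'[of "\<delta> \<one>"] dn_nrm_le[of \<one> 1] nrm_one_le d_closed[of \<one>] by simp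
  then have "nrm B U \<le> 1" using B.cstar_identity'[OF U_closed] B.nrm_nonneg[OF U_closed] power2_le_imp_le[of "nrm B U" 1] by simp
  then have "nrm B (Up n) \<le> 1" using B.nrm_pow_le U_closed by blast
  then show "nrm B (pp n) \<le> 1"
    using Up_closed by (simp add: pp_def B.cstar_identity B.nrm_nonneg power_le_one)
qed

lemma pp_0: "pp 0 = \<one>\<^bsub>B\<^esub>"
  by (simp add: pp_def)

lemma pp_step: "star B (q \<cdot> Up n) \<cdot> (q \<cdot> Up n) = pp n \<ominus>\<^bsub>B\<^esub> pp (Suc n)"
proof -
  have c: "U \<in> carrier B" "V \<in> carrier B" "Up n \<in> carrier B" "star B (Up n) \<in> carrier B"
    using U_closed V_closed Up_closed Up_star_closed by auto
  have "star B (q \<cdot> Up n) \<cdot> (q \<cdot> Up n) = star B (Up n) \<cdot> ((q \<cdot> q) \<cdot> Up n)"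
    using c q_closed by (simp add: B.star_mult q_star B.m_assoc)
  also have "\<dots> = star B (Up n) \<cdot> Up n \<ominus>\<^bsub>B\<^esub> star B (Up n) \<cdot> V \<cdot> (U \<cdot> Up n)"
    unfolding q_idem unfolding q_def using c by algebra
  also have "star B (Up n) \<cdot> V = star B (U \<cdot> Up n)" using c by (simp add: B.star_mult)
  finally show ?thesis by (simp add: pp_def flip: Up_Suc)
qed

text \<open>\<open>X\<close> is the image of the banded operator \<open>T\<close>: the column $(q U^j)_j$ plays the role of the
  standard basis of the Fock module. The column $(U^j)_j$ behaves in the same way except in the first
  \<open>d\<close> rows.\<close>

definition Rel :: "nat \<Rightarrow> ('a, 'a) fock_op \<Rightarrow> 'b \<Rightarrow> bool" where
  "Rel d T X \<longleftrightarrow> T \<in> carrier L \<and> X \<in> carrier B \<and>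
     (\<forall>i j. j + d < i \<or> i + d < j \<longrightarrow> ent T i j = \<zero>) \<and>
     (\<forall>r i m. r = q \<or> r = \<one>\<^bsub>B\<^esub> \<and> d \<le> i \<longrightarrow> i + d < m \<longrightarrow>
        psum B (\<lambda>j. \<pi> (ent T i j) \<cdot> (r \<cdot> Up j)) m = r \<cdot> (Up i \<cdot> X))"

lemma RelD:
  assumes "Rel d T X"
  shows "T \<in> carrier L" "X \<in> carrier B" "\<And>i j. j + d < i \<or> i + d < j \<Longrightarrow> ent T i j = \<zero>"
    "\<And>r i m. r = q \<or> r = \<one>\<^bsub>B\<^esub> \<and> d \<le> i \<Longrightarrow> i + d < m \<Longrightarrow>
       psum B (\<lambda>j. \<pi> (ent T i j) \<cdot> (r \<cdot> Up j)) m = r \<cdot> (Up i \<cdot> X)"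
  using assms unfolding Rel_def by blast+

lemma Rel_mono: "Rel d T X \<Longrightarrow> d \<le> d' \<Longrightarrow> Rel d' T X"
  unfolding Rel_def by force

lemma r_closed: "r = q \<or> r = \<one>\<^bsub>B\<^esub> \<and> c \<Longrightarrow> r \<in> carrier B"
  using q_closed by auto

lemma r_pi: "r = q \<or> r = \<one>\<^bsub>B\<^esub> \<and> c \<Longrightarrow> a \<in> carrier A \<Longrightarrow> r \<cdot> \<pi> a = \<pi> a \<cdot> r"
  using q_pi p.closed by auto

lemma Rel_add:
  assumes "Rel d T X" "Rel d R Y"
  shows "Rel d (T \<oplus>\<^bsub>L\<^esub> R) (X \<oplus>\<^bsub>B\<^esub> Y)"
  unfolding Rel_def
proof (intro conjI allI impI)
  note T = RelD[OF assms(1)] and R = RelD[OF assms(2)]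
  show "T \<oplus>\<^bsub>L\<^esub> R \<in> carrier L" "X \<oplus>\<^bsub>B\<^esub> Y \<in> carrier B" using T R by auto
  fix i j assume "j + d < i \<or> i + d < j"
  then show "ent (T \<oplus>\<^bsub>L\<^esub> R) i j = \<zero>" using T R by (simp add: ent_add)
next
  note T = RelD[OF assms(1)] and R = RelD[OF assms(2)]
  fix r and i m :: nat assume r: "r = q \<or> r = \<one>\<^bsub>B\<^esub> \<and> d \<le> i" and m: "i + d < m"
  note rc = r_closed[OF r]
  have c: "\<pi> (ent T i j) \<in> carrier B" "\<pi> (ent R i j) \<in> carrier B" "r \<cdot> Up j \<in> carrier B" for j
    using ent_closed T(1) R(1) p.closed rc Up_closed by auto
  have "psum B (\<lambda>j. \<pi> (ent (T \<oplus>\<^bsub>L\<^esub> R) i j) \<cdot> (r \<cdot> Up j)) m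
      = psum B (\<lambda>j. \<pi> (ent T i j) \<cdot> (r \<cdot> Up j) \<oplus>\<^bsub>B\<^esub> \<pi> (ent R i j) \<cdot> (r \<cdot> Up j)) m"
    using T(1) R(1) ent_closed c by (simp add: ent_add p.add B.l_distr)
  also have "\<dots> = r \<cdot> (Up i \<cdot> X) \<oplus>\<^bsub>B\<^esub> r \<cdot> (Up i \<cdot> Y)"
    using T(4)[OF r m] R(4)[OF r m] c by (simp add: B.psum_add)
  also have "\<dots> = r \<cdot> (Up i \<cdot> (X \<oplus>\<^bsub>B\<^esub> Y))" using T(2) R(2) rc Up_closed by (simp add: B.r_distr)
  finally show "psum B (\<lambda>j. \<pi> (ent (T \<oplus>\<^bsub>L\<^esub> R) i j) \<cdot> (r \<cdot> Up j)) m = r \<cdot> (Up i \<cdot> (X \<oplus>\<^bsub>B\<^esub> Y))" .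
qed

lemma Rel_scal:
  assumes "Rel d T X"
  shows "Rel d (scal L c T) (scal B c X)"
  unfolding Rel_def
proof (intro conjI allI impI)
  note T = RelD[OF assms(1)]
  show "scal L c T \<in> carrier L" "scal B c X \<in> carrier B" using T L.scal_closed B.scal_closed by auto
  fix i j assume "j + d < i \<or> i + d < j"
  then show "ent (scal L c T) i j = \<zero>" using T by (simp add: ent_scal)
next
  note T = RelD[OF assms(1)]
  fix r and i m :: nat assume r: "r = q \<or> r = \<one>\<^bsub>B\<^esub> \<and> d \<le> i" and m: "i + d < m"
  note rc = r_closed[OF r]
  have c: "\<pi> (ent T i j) \<in> carrier B" "r \<cdot> Up j \<in> carrier B" for j
    using ent_closed T(1) p.closed rc Up_closed by auto
  have "psum B (\<lambda>j. \<pi> (ent (scal L c T) i j) \<cdot> (r \<cdot> Up j)) m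
      = psum B (\<lambda>j. scal B c (\<pi> (ent T i j) \<cdot> (r \<cdot> Up j))) m"
    using T(1) ent_closed c by (simp add: ent_scal p.scal B.scal_mult_left)
  also have "\<dots> = scal B c (r \<cdot> (Up i \<cdot> X))" using T(4)[OF r m] c by (simp add: B.psum_scal)
  finally show "psum B (\<lambda>j. \<pi> (ent (scal L c T) i j) \<cdot> (r \<cdot> Up j)) m = r \<cdot> (Up i \<cdot> scal B c X)"
    using T(2) rc Up_closed by (simp add: B.scal_mult_right)
qed

lemma psum_swap:
  assumes "\<And>i j. f i j \<in> carrier B"
  shows "psum B (\<lambda>i. psum B (\<lambda>j. f i j) m) n = psum B (\<lambda>j. psum B (\<lambda>i. f i j) n) m"
proof (induction n)
  case (Suc n)
  then show ?case using assms B.psum_closed by (simp add: B.psum_add)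
qed (simp add: B.psum_zero)

text \<open>Widths and lost rows both add. A nonzero entry in row i of \<open>T\<close> sits in a
  column j >= i - d, so giving up d + d' rows of the product leaves only rows j >= d' of
  \<open>R\<close>.\<close>

lemma Rel_mult:
  assumes "Rel d T X" "Rel d' R Y"
  shows "Rel (d + d') (T \<otimes>\<^bsub>L\<^esub> R) (X \<cdot> Y)"
  unfolding Rel_def
proof (intro conjI allI impI)
  note T = RelD[OF assms(1)] and R = RelD[OF assms(2)]
  show "T \<otimes>\<^bsub>L\<^esub> R \<in> carrier L" "X \<cdot> Y \<in> carrier B" using T R by auto
  fix i k assume ik: "k + (d + d') < i \<or> i + (d + d') < k"
  have "ent (T \<otimes>\<^bsub>L\<^esub> R) i k = psum A (\<lambda>j. ent T i j \<otimes> ent R j k) (k + d' + 1)"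
    using R(3) by (intro ent_mult[OF T(1) R(1)]) auto
  also have "\<dots> = \<zero>"
  proof (rule psum_zero)
    fix j
    have "ent T i j = \<zero> \<or> ent R j k = \<zero>" using T(3)[of j i] R(3)[of k j] ik by linarith
    then show "ent T i j \<otimes> ent R j k = \<zero>" using ent_closed T(1) R(1) by auto
  qed
  finally show "ent (T \<otimes>\<^bsub>L\<^esub> R) i k = \<zero>" .
next
  note T = RelD[OF assms(1)] and R = RelD[OF assms(2)]
  fix r and i m :: nat assume r: "r = q \<or> r = \<one>\<^bsub>B\<^esub> \<and> d + d' \<le> i" and m: "i + (d + d') < m"
  note rc = r_closed[OF r]
  have c: "\<pi> (ent T i j) \<in> carrier B" "\<pi> (ent R i j) \<in> carrier B" "r \<cdot> Up j \<in> carrier B" for i j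
    using ent_closed T(1) R(1) p.closed rc Up_closed by auto
  \<comment> \<open>The columns k < m of \<open>R\<close> are supported in rows below m +
    d'.\<close>
  have ent: "ent (T \<otimes>\<^bsub>L\<^esub> R) i k = psum A (\<lambda>j. ent T i j \<otimes> ent R j k) (m + d')" if "k < m" for k
    using R(3) that by (intro ent_mult[OF T(1) R(1)]) auto
  have "psum B (\<lambda>k. \<pi> (ent (T \<otimes>\<^bsub>L\<^esub> R) i k) \<cdot> (r \<cdot> Up k)) m
      = psum B (\<lambda>k. psum B (\<lambda>j. \<pi> (ent T i j) \<cdot> (\<pi> (ent R j k) \<cdot> (r \<cdot> Up k))) (m + d')) m"
  proof (rule B.psum_cong)
    fix k assume k: "k < m"
    have "\<pi> (ent (T \<otimes>\<^bsub>L\<^esub> R) i k) \<cdot> (r \<cdot> Up k)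
        = psum B (\<lambda>j. \<pi> (ent T i j) \<cdot> \<pi> (ent R j k)) (m + d') \<cdot> (r \<cdot> Up k)"
      using ent[OF k] ent_closed T(1) R(1) by (simp add: p.psum p.mult)
    also have "\<dots> = psum B (\<lambda>j. \<pi> (ent T i j) \<cdot> (\<pi> (ent R j k) \<cdot> (r \<cdot> Up k))) (m + d')"
      using c by (simp add: B.m_assoc flip: B.psum_mult_right)
    finally show "\<pi> (ent (T \<otimes>\<^bsub>L\<^esub> R) i k) \<cdot> (r \<cdot> Up k)
        = psum B (\<lambda>j. \<pi> (ent T i j) \<cdot> (\<pi> (ent R j k) \<cdot> (r \<cdot> Up k))) (m + d')" .
  qed
  also have "\<dots> = psum B (\<lambda>j. psum B (\<lambda>k. \<pi> (ent T i j) \<cdot> (\<pi> (ent R j k) \<cdot> (r \<cdot> Up k))) m) (m + d')"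
    using c by (intro psum_swap) auto
  also have "\<dots> = psum B (\<lambda>j. \<pi> (ent T i j) \<cdot> (r \<cdot> Up j) \<cdot> Y) (m + d')"
  proof (rule B.psum_cong)
    fix j
    have "psum B (\<lambda>k. \<pi> (ent T i j) \<cdot> (\<pi> (ent R j k) \<cdot> (r \<cdot> Up k))) m
        = \<pi> (ent T i j) \<cdot> psum B (\<lambda>k. \<pi> (ent R j k) \<cdot> (r \<cdot> Up k)) m"
      using c by (intro B.psum_mult_left) auto
    also have "\<dots> = \<pi> (ent T i j) \<cdot> (r \<cdot> (Up j \<cdot> Y))"
    proof (cases "ent T i j = \<zero>")
      case True
      then show ?thesis using R(2) rc Up_closed c B.psum_closed[of "\<lambda>k. \<pi> (ent R j k) \<cdot> (r \<cdot> Up k)"]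
        by (simp add: p.zero)
    next
      case False
      \<comment> \<open>Where the entry of \<open>T\<close> is nonzero, its band keeps j in the
        range in which the relation for \<open>R\<close> holds.\<close>
      then have "\<not> (j + d < i)" "\<not> (i + d < j)" using T(3) by blast+
      then have "r = q \<or> r = \<one>\<^bsub>B\<^esub> \<and> d' \<le> j" "j + d' < m" using r m by auto
      then show ?thesis using R(4) by simp
    qed
    finally show "psum B (\<lambda>k. \<pi> (ent T i j) \<cdot> (\<pi> (ent R j k) \<cdot> (r \<cdot> Up k))) m
        = \<pi> (ent T i j) \<cdot> (r \<cdot> Up j) \<cdot> Y"
      using c rc Up_closed R(2) by (simp add: B.m_assoc)
  qed
  also have "\<dots> = r \<cdot> (Up i \<cdot> X) \<cdot> Y"
  proof -
    have "r = q \<or> r = \<one>\<^bsub>B\<^esub> \<and> d \<le> i" using r by auto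
    then show ?thesis using T(4)[of r i "m + d'"] m c R(2) by (simp add: B.psum_mult_right)
  qed
  finally show "psum B (\<lambda>k. \<pi> (ent (T \<otimes>\<^bsub>L\<^esub> R) i k) \<cdot> (r \<cdot> Up k)) m = r \<cdot> (Up i \<cdot> (X \<cdot> Y))"
    using rc Up_closed T(2) R(2) by (simp add: B.m_assoc)
qed

lemma Rel_phi: "a \<in> carrier A \<Longrightarrow> Rel 0 (\<phi> a) (\<pi> a)"
  unfolding Rel_def
proof (intro conjI allI impI)
  assume a: "a \<in> carrier A"
  fix r and i m :: nat assume r: "r = q \<or> r = \<one>\<^bsub>B\<^esub> \<and> 0 \<le> i" and m: "i + 0 < m"
  note rc = r_closed[OF r]
  have da: "(\<delta> ^^ i) a \<in> carrier A" "\<pi> ((\<delta> ^^ i) a) \<in> carrier B" using a dn_closed p.closed by auto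
  have c: "\<pi> (ent (\<phi> a) i j) \<cdot> (r \<cdot> Up j) \<in> carrier B" for j
    using ent_closed[OF phi_closed[OF a]] p.closed rc Up_closed by simp
  have "psum B (\<lambda>j. \<pi> (ent (\<phi> a) i j) \<cdot> (r \<cdot> Up j)) m = \<pi> ((\<delta> ^^ i) a) \<cdot> (r \<cdot> Up i)"
    using B.psum_single[of "\<lambda>j. \<pi> (ent (\<phi> a) i j) \<cdot> (r \<cdot> Up j)" i m, OF c] a m rc Up_closed
    by (simp add: ent_phi p.zero)
  also have "\<dots> = r \<cdot> (\<pi> ((\<delta> ^^ i) a) \<cdot> Up i)"
    using r_pi[OF r da(1)] da rc Up_closed by (simp flip: B.m_assoc)
  finally show "psum B (\<lambda>j. \<pi> (ent (\<phi> a) i j) \<cdot> (r \<cdot> Up j)) m = r \<cdot> (Up i \<cdot> \<pi> a)" using Up_pi[OF a] by simp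
qed (auto simp: ent_phi phi_closed p.closed)

text \<open>Row 0 of \<open>S\<close> is zero. The column with \<open>q\<close> matches this by q V
  = 0, whereas the column of powers would require V = 0: this is where rows are lost.\<close>

lemma Rel_S: "Rel 1 S V"
  unfolding Rel_def
proof (intro conjI allI impI)
  fix r and i m :: nat assume r: "r = q \<or> r = \<one>\<^bsub>B\<^esub> \<and> 1 \<le> i" and m: "i + 1 < m"
  note rc = r_closed[OF r]
  have ec: "\<pi> (en k) \<in> carrier B" for k using en_closed p.closed by blast
  show "psum B (\<lambda>j. \<pi> (ent S i j) \<cdot> (r \<cdot> Up j)) m = r \<cdot> (Up i \<cdot> V)"
  proof (cases i)
    case 0
    then show ?thesis
      using r qV V_closed rc Up_closed by (auto simp: ent_S p.zero intro!: B.psum_zero)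
  next
    case (Suc k)
    have "psum B (\<lambda>j. \<pi> (ent S i j) \<cdot> (r \<cdot> Up j)) m = \<pi> (en i) \<cdot> (r \<cdot> Up k)"
      using B.psum_single[of "\<lambda>j. \<pi> (ent S i j) \<cdot> (r \<cdot> Up j)" k m] m ec rc Up_closed Suc
      by (simp add: ent_S p.zero del: funpow.simps)
    also have "\<dots> = r \<cdot> (\<pi> (en i) \<cdot> Up k)"
      using r_pi[OF r en_closed] ec rc Up_closed by (simp flip: B.m_assoc)
    also have "\<pi> (en i) \<cdot> Up k = Up k \<cdot> (U \<cdot> V)"
      using Up_pi[OF d_closed[OF one_closed], of k] Suc by (simp add: UV funpow_swap1)
    also have "\<dots> = Up i \<cdot> V" using Suc U_closed V_closed Up_closed by (simp add: B.m_assoc)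
    finally show ?thesis .
  qed
qed (auto simp: ent_S S_closed V_closed)

lemma Rel_Sd: "Rel 1 Sd U"
  unfolding Rel_def
proof (intro conjI allI impI)
  fix r and i m :: nat assume r: "r = q \<or> r = \<one>\<^bsub>B\<^esub> \<and> 1 \<le> i" and m: "i + 1 < m"
  note rc = r_closed[OF r]
  have ec: "\<pi> (en k) \<in> carrier B" for k using en_closed p.closed by blast
  have "psum B (\<lambda>j. \<pi> (ent Sd i j) \<cdot> (r \<cdot> Up j)) m = \<pi> (en (Suc i)) \<cdot> (r \<cdot> Up (Suc i))"
    using B.psum_single[of "\<lambda>j. \<pi> (ent Sd i j) \<cdot> (r \<cdot> Up j)" "Suc i" m] m ec rc Up_closed
    by (simp add: ent_Sd p.zero del: funpow.simps B.nat_pow_Suc)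
  also have "\<dots> = r \<cdot> (\<pi> (en (Suc i)) \<cdot> Up (Suc i))"
    using r_pi[OF r en_closed] ec rc Up_closed[of "Suc i"]
    by (simp del: funpow.simps B.nat_pow_Suc flip: B.m_assoc)
  also have "\<dots> = r \<cdot> (Up i \<cdot> U)" unfolding en_Up by simp
  finally show "psum B (\<lambda>j. \<pi> (ent Sd i j) \<cdot> (r \<cdot> Up j)) m = r \<cdot> (Up i \<cdot> U)" .
qed (auto simp: ent_Sd Sd_closed U_closed)

section \<open>The norm estimate\<close>

context
  fixes y :: "nat \<Rightarrow> 'b" and K :: nat
  assumes y: "\<And>j. y j \<in> carrier B" "\<And>j. \<pi> (en j) \<cdot> y j = y j"
begin

definition img :: "('a, 'a) fock_op \<Rightarrow> nat \<Rightarrow> 'b" where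
  "img T i = psum B (\<lambda>j. \<pi> (ent T i j) \<cdot> y j) K"

text \<open>The sesquilinear form of the matrix \<pi>(g), evaluated at the column \<open>y\<close>
  cut off at \<open>K\<close>.\<close>

definition form :: "(nat \<Rightarrow> nat \<Rightarrow> 'a) \<Rightarrow> 'b" where
  "form g = psum B (\<lambda>j. psum B (\<lambda>k. star B (y j) \<cdot> (\<pi> (g j k) \<cdot> y k)) K) K"

lemma img_closed: "T \<in> carrier L \<Longrightarrow> img T i \<in> carrier B"
  unfolding img_def using y ent_closed p.closed by (intro B.psum_closed) simp

lemma form_term_closed:
  "(\<And>j k. g j k \<in> carrier A) \<Longrightarrow> star B (y j) \<cdot> (\<pi> (g j k) \<cdot> y k) \<in> carrier B"
  by (simp add: y p.closed B.star_closed)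

lemma form_add:
  assumes "\<And>j k. g j k \<in> carrier A" "\<And>j k. h j k \<in> carrier A"
  shows "form (\<lambda>j k. g j k \<oplus> h j k) = form g \<oplus>\<^bsub>B\<^esub> form h"
proof -
  have "star B (y j) \<cdot> (\<pi> (g j k \<oplus> h j k) \<cdot> y k)
      = star B (y j) \<cdot> (\<pi> (g j k) \<cdot> y k) \<oplus>\<^bsub>B\<^esub> star B (y j) \<cdot> (\<pi> (h j k) \<cdot> y k)" for j k
    using assms y p.closed B.star_closed by (simp add: p.add B.l_distr B.r_distr)
  then show ?thesis
    using form_term_closed[of g] form_term_closed[of h] assms B.psum_closed
    by (simp add: form_def B.psum_add)
qed

text \<open>Moves the sum over the rows from \<open>B\<close> into \<open>A\<close>, where it is a
  partial sum of an inner product in the Fock module and converges.\<close>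

lemma gram_img:
  assumes T: "T \<in> carrier L"
  shows "psum B (gram B (img T) (img T)) n = form (\<lambda>j k. psum A (\<lambda>i. star A (ent T i j) \<otimes> ent T i k) n)"
proof (induction n)
  case 0
  show ?case using y B.star_closed by (simp add: form_def p.zero B.psum_zero)
next
  case (Suc n)
  have e: "ent T i j \<in> carrier A" "star A (ent T i j) \<in> carrier A" for i j using ent_closed[OF T] star_closed by auto
  let ?x = "\<lambda>j. \<pi> (ent T n j) \<cdot> y j"
  have xc: "?x j \<in> carrier B" "star B (?x j) \<in> carrier B" for j using y p.closed e B.star_closed by auto
  have "gram B (img T) (img T) n = psum B (\<lambda>j. star B (?x j)) K \<cdot> psum B ?x K"
    using xc by (simp add: gram_def img_def B.psum_star)
  also have "\<dots> = psum B (\<lambda>j. psum B (\<lambda>k. star B (?x j) \<cdot> ?x k) K) K"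
    using xc B.psum_closed[of ?x, OF xc(1)] by (simp add: B.psum_mult_left flip: B.psum_mult_right)
  also have "\<dots> = form (\<lambda>j k. star A (ent T n j) \<otimes> ent T n k)"
    unfolding form_def using y e p.closed B.star_closed
    by (simp add: B.star_mult B.m_assoc p.mult p.star)
  finally have "gram B (img T) (img T) n = form (\<lambda>j k. star A (ent T n j) \<otimes> ent T n k)" .
  then show ?case
    using Suc e form_add[of "\<lambda>j k. psum A (\<lambda>i. star A (ent T i j) \<otimes> ent T i k) n"
        "\<lambda>j k. star A (ent T n j) \<otimes> ent T n k"] psum_closed by simp
qed

lemma form_lim:
  assumes "\<And>j k. nrm_lim A (\<lambda>n. g n j k) (h j k)" "\<And>n j k. g n j k \<in> carrier A"
  shows "nrm_lim B (\<lambda>n. form (g n)) (form h)"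
  unfolding form_def
proof (rule B.psum_lim)
  show "nrm_lim B (\<lambda>n. psum B (\<lambda>k. star B (y j) \<cdot> (\<pi> (g n j k) \<cdot> y k)) K)
      (psum B (\<lambda>k. star B (y j) \<cdot> (\<pi> (h j k) \<cdot> y k)) K)" for j
  proof (rule B.psum_lim)
    show "nrm_lim B (\<lambda>n. star B (y j) \<cdot> (\<pi> (g n j k) \<cdot> y k)) (star B (y j) \<cdot> (\<pi> (h j k) \<cdot> y k))" for k
      using p.lim[OF assms(1)[of j k] assms(2)] assms(2) p.closed y B.star_closed
      by (intro B.nrm_lim_mult B.nrm_lim_const) auto
    show "star B (y j) \<cdot> (\<pi> (g n j k) \<cdot> y k) \<in> carrier B" for n k using form_term_closed[of "g n"] assms(2) .
  qed
  show "psum B (\<lambda>k. star B (y j) \<cdot> (\<pi> (g n j k) \<cdot> y k)) K \<in> carrier B" for n j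
    using form_term_closed[of "g n", OF assms(2)] by (rule B.psum_closed)
qed

lemma gram_img_lim:
  assumes T: "T \<in> carrier L"
  shows "nrm_lim B (psum B (gram B (img T) (img T))) (form (\<lambda>j k. ip F (T (ket j)) (T (ket k))))"
proof -
  have v: "T (ket j) \<in> carrier F" for j using F.op_closed[OF T ket_closed] .
  have "nrm_lim A (psum A (\<lambda>i. star A (ent T i j) \<otimes> ent T i k)) (ip F (T (ket j)) (T (ket k)))" for j k
  proof -
    have "gram A (co (T (ket j))) (co (T (ket k))) = (\<lambda>i. star A (ent T i j) \<otimes> ent T i k)"
      by (simp add: gram_def ent_def fun_eq_iff)
    then show ?thesis using nsum_lim[OF co_gram(2)[OF v v] co_gram(1)[OF v v], of j k] fock_ip[OF v v, of j k] by simp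
  qed
  then have "nrm_lim B (\<lambda>n. form (\<lambda>j k. psum A (\<lambda>i. star A (ent T i j) \<otimes> ent T i k) n))
      (form (\<lambda>j k. ip F (T (ket j)) (T (ket k))))"
    using ent_closed[OF T] star_closed by (intro form_lim psum_closed) auto
  then show ?thesis using gram_img[OF T] by (metis (no_types, lifting) ext)
qed

text \<open>With \<open>R\<close> the square root of \<open>\<parallel>T\<parallel>\<^sup>2 - T\<^sup>*T\<close>, the squares of the matrices of \<open>T\<close> and \<open>R\<close>
  add up to \<open>\<parallel>T\<parallel>\<^sup>2\<close>, and this persists under \<open>\<pi>\<close>.\<close>

lemma gram_img_le:
  assumes T: "T \<in> carrier L"
  shows "pos B (scal B (complex_of_real ((nrm L T)\<^sup>2)) (psum B (gram B y y) K) \<ominus>\<^bsub>B\<^esub> psum B (gram B (img T) (img T)) n)"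
proof -
  let ?t = "(nrm L T)\<^sup>2"
  have TT: "star L T \<otimes>\<^bsub>L\<^esub> T \<in> carrier L" using T L.star_closed by simp
  have "pos L (real_elt L ?t \<ominus>\<^bsub>L\<^esub> star L T \<otimes>\<^bsub>L\<^esub> T)"
    using T L.cstar_identity[OF T] by (intro L.pos_real_elt_diff L.self_adj_star_mult) auto
  then obtain R where R0: "pos L R" "R \<otimes>\<^bsub>L\<^esub> R = real_elt L ?t \<ominus>\<^bsub>L\<^esub> star L T \<otimes>\<^bsub>L\<^esub> T"
    using L.pos_sqrt by metis
  have R: "R \<in> carrier L" "star L R = R" using L.posD[OF R0(1)] by auto
  have sum: "ip F (R v) (R w) \<oplus> ip F (T v) (T w) = scal A (complex_of_real ?t) (ip F v w)"
    if v: "v \<in> carrier F" and w: "w \<in> carrier F" for v w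
  proof -
    have Tv: "T v \<in> carrier F" "T w \<in> carrier F" "(star L T \<otimes>\<^bsub>L\<^esub> T) w \<in> carrier F" "R w \<in> carrier F"
      using F.op_closed T TT R v w by auto
    have "ip F (R v) (R w) = ip F v ((R \<otimes>\<^bsub>L\<^esub> R) w)"
      using F.ip_op_left[OF R(1) v Tv(4)] R(2) w by (simp add: F.L_app)
    also have "\<dots> = scal A (complex_of_real ?t) (ip F v w) \<ominus> ip F v ((star L T \<otimes>\<^bsub>L\<^esub> T) w)"
      unfolding R0(2) using v w Tv TT by (simp add: F.L_diff_app F.L_app(2,5) F.ip_hdiff F.hscal_closed F.ip_hscal del: of_real_power)
    also have "ip F v ((star L T \<otimes>\<^bsub>L\<^esub> T) w) = ip F (T v) (T w)"
      using F.ip_op_left[OF T v Tv(2)] w by (simp add: F.L_app)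
    finally have "ip F (R v) (R w) = scal A (complex_of_real ?t) (ip F v w) \<ominus> ip F (T v) (T w)" .
    moreover have "scal A (complex_of_real ?t) (ip F v w) \<in> carrier A" "ip F (T v) (T w) \<in> carrier A"
      using F.ip_closed v w Tv scal_closed by auto
    ultimately show ?thesis by (simp only:) algebra
  qed
  have ipc: "ip F (Q (ket j)) (Q (ket k)) \<in> carrier A" if "Q \<in> carrier L" for Q j k
    using that by (intro F.ip_closed F.op_closed[OF that] ket_closed)
  have "form (\<lambda>j k. ip F (R (ket j)) (R (ket k))) \<oplus>\<^bsub>B\<^esub> form (\<lambda>j k. ip F (T (ket j)) (T (ket k)))
      = form (\<lambda>j k. scal A (complex_of_real ?t) (ip F (ket j) (ket k)))"
    using form_add[of "\<lambda>j k. ip F (R (ket j)) (R (ket k))" "\<lambda>j k. ip F (T (ket j)) (T (ket k))"] ipc R T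
    by (simp add: sum ket_closed del: of_real_power)
  also have "\<dots> = psum B (\<lambda>j. scal B (complex_of_real ?t) (gram B y y j)) K"
    unfolding form_def
  proof (rule B.psum_cong)
    fix j assume j: "j < K"
    \<comment> \<open>Distinct basis vectors are orthogonal, and the square of \<open>ket j\<close>
      is \<open>en j\<close>, which acts trivially on \<open>y j\<close>; this is the reason for the
      condition on \<open>y\<close>.\<close>
    have t: "star B (y j) \<cdot> (\<pi> (scal A (complex_of_real ?t) (ip F (ket j) (ket k))) \<cdot> y k)
        = (if k = j then scal B (complex_of_real ?t) (gram B y y j) else \<zero>\<^bsub>B\<^esub>)" for k
      using y en_closed p.closed[OF en_closed] B.star_closed
      by (auto simp: ip_ket ket_closed co_ket gram_def p.scal p.zero B.scal_mult_left B.scal_mult_right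
          simp del: of_real_power)
    show "psum B (\<lambda>k. star B (y j) \<cdot> (\<pi> (scal A (complex_of_real ?t) (ip F (ket j) (ket k))) \<cdot> y k)) K
        = scal B (complex_of_real ?t) (gram B y y j)"
      unfolding t using B.psum_single[of "\<lambda>k. if k = j then scal B (complex_of_real ?t) (gram B y y j) else \<zero>\<^bsub>B\<^esub>" j K] j
        B.gram_closed[of y y j, OF y(1) y(1)] B.scal_closed by simp
  qed
  also have "\<dots> = scal B (complex_of_real ?t) (psum B (gram B y y) K)"
    by (rule B.psum_scal) (rule B.gram_closed[OF y(1) y(1)])
  finally have form: "form (\<lambda>j k. ip F (R (ket j)) (R (ket k))) \<oplus>\<^bsub>B\<^esub> form (\<lambda>j k. ip F (T (ket j)) (T (ket k)))
      = scal B (complex_of_real ?t) (psum B (gram B y y) K)" .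
  let ?w = "gram B (img R) (img R)" and ?z = "gram B (img T) (img T)"
  have wz: "?w i \<in> carrier B" "?z i \<in> carrier B" "pos B (?w i)" "pos B (?z i)" for i
    using B.gram_closed[of "img R" "img R"] B.gram_closed[of "img T" "img T"] B.gram_pos[of "img R"]
      B.gram_pos[of "img T"] img_closed[OF R(1)] img_closed[OF T] by auto
  note pc = B.psum_closed[of ?w, OF wz(1)] B.psum_closed[of ?z, OF wz(2)]
  \<comment> \<open>Only positive terms are discarded: all rows of R, and the rows of T from n
    on.\<close>
  have "nrm_lim B (\<lambda>N. psum B ?w (n + N) \<oplus>\<^bsub>B\<^esub> psum B ?z (n + N) \<ominus>\<^bsub>B\<^esub> psum B ?z n)
      (scal B (complex_of_real ?t) (psum B (gram B y y) K) \<ominus>\<^bsub>B\<^esub> psum B ?z n)"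
    unfolding form[symmetric]
  proof (intro B.nrm_lim_diff B.nrm_lim_add B.nrm_lim_const)
    show "nrm_lim B (\<lambda>N. psum B ?w (n + N)) (form (\<lambda>j k. ip F (R (ket j)) (R (ket k))))"
      by (rule B.nrm_lim_subseq[OF gram_img_lim[OF R(1)]]) (simp add: strict_mono_def)
    show "nrm_lim B (\<lambda>N. psum B ?z (n + N)) (form (\<lambda>j k. ip F (T (ket j)) (T (ket k))))"
      by (rule B.nrm_lim_subseq[OF gram_img_lim[OF T]]) (simp add: strict_mono_def)
  qed (use pc in auto)
  moreover have "pos B (psum B ?w (n + N) \<oplus>\<^bsub>B\<^esub> psum B ?z (n + N) \<ominus>\<^bsub>B\<^esub> psum B ?z n)" for N
  proof -
    have s: "psum B (\<lambda>k. ?z (n + k)) N \<in> carrier B" by (rule B.psum_closed[of "\<lambda>k. ?z (n + k)"]) (rule wz)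
    have "psum B ?w (n + N) \<oplus>\<^bsub>B\<^esub> psum B ?z (n + N) \<ominus>\<^bsub>B\<^esub> psum B ?z n
        = psum B ?w (n + N) \<oplus>\<^bsub>B\<^esub> psum B (\<lambda>k. ?z (n + k)) N"
    proof -
      have "b \<oplus>\<^bsub>B\<^esub> (a \<oplus>\<^bsub>B\<^esub> c) \<ominus>\<^bsub>B\<^esub> a = b \<oplus>\<^bsub>B\<^esub> c"
        if "a \<in> carrier B" "b \<in> carrier B" "c \<in> carrier B" for a b c using that by algebra
      from this[OF pc(2) pc(1) s] show ?thesis unfolding B.psum_shift[of ?z, OF wz(2)] .
    qed
    then show ?thesis using B.pos_psum wz by (simp add: B.pos_add)
  qed
  ultimately show ?thesis by (rule B.pos_lim)
qed

end

text \<open>Apply \<open>gram_img_le\<close> to the columns $(U^j)_{j < K}$ and $(q U^j)_{j < K}$, which \<open>T\<close> maps,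
  away from the boundary, to $(U^i X)_i$ and $(q U^i X)_i$. As \<open>q U\<^sup>j\<close> has the square
  $p_j - p_{j+1}$, where $p_j = U^{*j}U^j$, adding one estimate of the first kind and estimates of the
  second kind for many values of \<open>K\<close> gives $m\,X^*X \le (m + 2d)\,\|T\|^2$.\<close>

lemma Rel_nrm_estimate:
  assumes "Rel d T X"
  shows "real m * (nrm B X)\<^sup>2 \<le> (nrm L T)\<^sup>2 * real (2 * d + m)"
proof -
  note T = RelD[OF assms]
  let ?t = "complex_of_real ((nrm L T)\<^sup>2)"
  have X: "X \<in> carrier B" "star B X \<in> carrier B" using T(2) B.star_closed by auto
  \<comment> \<open>\<open>Pl l\<close> is the square of U^(d+l) X, and \<open>Rl l\<close> is the
    telescoped sum of the squares of q U^i X over i < d + l. Together they give star X X, whatever l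
    is.\<close>
  define Pl where "Pl l = star B X \<cdot> pp (d + l) \<cdot> X" for l
  define Rl where "Rl l = star B X \<cdot> (\<one>\<^bsub>B\<^esub> \<ominus>\<^bsub>B\<^esub> pp (d + l)) \<cdot> X" for l
  have PR: "Pl l \<in> carrier B" "Rl l \<in> carrier B" "Pl l \<oplus>\<^bsub>B\<^esub> Rl l = star B X \<cdot> X" for l
  proof -
    show "Pl l \<in> carrier B" "Rl l \<in> carrier B" using X pp_closed by (auto simp: Pl_def Rl_def)
    show "Pl l \<oplus>\<^bsub>B\<^esub> Rl l = star B X \<cdot> X" unfolding Pl_def Rl_def using X pp_closed[of "d + l"] by algebra
  qed
  define a where "a = scal B ?t (psum B pp (2 * d))"
  define b where "b = scal B ?t (psum B (\<lambda>l. pp (2 * d + l)) m)"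
  define e where "e = scal B ?t (real_elt B (real m))"
  define P' where "P' = psum B Pl m"
  define R' where "R' = psum B Rl m"
  have cl: "a \<in> carrier B" "b \<in> carrier B" "e \<in> carrier B" "P' \<in> carrier B" "R' \<in> carrier B"
    using PR pp_closed by (auto simp: a_def b_def e_def P'_def R'_def intro!: B.scal_closed B.psum_closed)
  have first: "pos B (a \<oplus>\<^bsub>B\<^esub> b \<ominus>\<^bsub>B\<^esub> P')"
  proof -
    \<comment> \<open>Length 2 d + m lets the bands of the rows d <= i < d + m fit; the first d rows
      are dropped by positivity.\<close>
    let ?z = "img Up (2 * d + m) T"
    have zc: "?z i \<in> carrier B" for i using img_closed[of Up, OF Up_closed en_Up T(1)] .
    have gz: "gram B ?z ?z i \<in> carrier B" "pos B (gram B ?z ?z i)" for i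
      by (simp_all add: B.gram_closed B.gram_pos zc)
    have "?z (d + l) = Up (d + l) \<cdot> X" if "l < m" for l
      using T(4)[of "\<one>\<^bsub>B\<^esub>" "d + l" "2 * d + m"] that X Up_closed
      by (simp add: img_def[of Up, OF Up_closed en_Up])
    then have "gram B ?z ?z (d + l) = Pl l" if "l < m" for l
      using that X Up_closed Up_star_closed by (simp add: gram_def Pl_def pp_def B.star_mult B.m_assoc)
    then have "psum B (\<lambda>l. gram B ?z ?z (d + l)) m = P'" unfolding P'_def by (intro B.psum_cong)
    then have sz: "psum B (gram B ?z ?z) (d + m) = psum B (gram B ?z ?z) d \<oplus>\<^bsub>B\<^esub> P'"
      using B.psum_shift[of "gram B ?z ?z" d m] gz by simp
    have "gram B Up Up = pp" by (simp add: gram_def pp_def fun_eq_iff)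
    then have "scal B ?t (psum B (gram B Up Up) (2 * d + m)) = a \<oplus>\<^bsub>B\<^esub> b"
      using B.psum_shift[of pp "2 * d" m, OF pp_closed] B.psum_closed[of pp] B.psum_closed[of "\<lambda>l. pp (2 * d + l)"] pp_closed
      by (simp add: a_def b_def B.scal_add_right)
    then have "pos B (a \<oplus>\<^bsub>B\<^esub> b \<ominus>\<^bsub>B\<^esub> (psum B (gram B ?z ?z) d \<oplus>\<^bsub>B\<^esub> P'))"
      using gram_img_le[where y = Up and K = "2 * d + m" and T = T and n = "d + m", OF Up_closed en_Up T(1)] sz by simp
    moreover have "pos B (psum B (gram B ?z ?z) d)" using gz(2) by (rule B.pos_psum)
    ultimately have "pos B ((a \<oplus>\<^bsub>B\<^esub> b \<ominus>\<^bsub>B\<^esub> (psum B (gram B ?z ?z) d \<oplus>\<^bsub>B\<^esub> P')) \<oplus>\<^bsub>B\<^esub> psum B (gram B ?z ?z) d)"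
      by (rule B.pos_add)
    moreover have "(x \<ominus>\<^bsub>B\<^esub> (y \<oplus>\<^bsub>B\<^esub> z)) \<oplus>\<^bsub>B\<^esub> y = x \<ominus>\<^bsub>B\<^esub> z"
      if "x \<in> carrier B" "y \<in> carrier B" "z \<in> carrier B" for x y z using that by algebra
    ultimately show ?thesis using cl B.psum_closed[of "gram B ?z ?z", OF gz(1)] by simp
  qed
  have second: "pos B (scal B ?t (\<one>\<^bsub>B\<^esub> \<ominus>\<^bsub>B\<^esub> pp (2 * d + l)) \<ominus>\<^bsub>B\<^esub> Rl l)" for l
  proof -
    let ?y = "\<lambda>j. q \<cdot> Up j"
    \<comment> \<open>The column with \<open>q\<close> loses no rows at the top, so length 2 d + l
      serves all rows i < d + l and produces the same indices of \<open>pp\<close> as in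
      \<open>b\<close>.\<close>
    let ?z = "img ?y (2 * d + l) T"
    have y: "?y j \<in> carrier B" "\<pi> (en j) \<cdot> ?y j = ?y j" for j
    proof -
      show "?y j \<in> carrier B" using q_closed Up_closed by simp
      have "\<pi> (en j) \<cdot> ?y j = q \<cdot> (\<pi> (en j) \<cdot> Up j)"
        using q_pi[OF en_closed, of j] q_closed Up_closed p.closed[OF en_closed] by (simp flip: B.m_assoc)
      then show "\<pi> (en j) \<cdot> ?y j = ?y j" by (simp add: en_Up)
    qed
    have tele: "psum B (\<lambda>i. pp i \<ominus>\<^bsub>B\<^esub> pp (Suc i)) n = \<one>\<^bsub>B\<^esub> \<ominus>\<^bsub>B\<^esub> pp n" for n
    proof (induction n)
      case (Suc n)
      have "(\<one>\<^bsub>B\<^esub> \<ominus>\<^bsub>B\<^esub> pp n) \<oplus>\<^bsub>B\<^esub> (pp n \<ominus>\<^bsub>B\<^esub> pp (Suc n)) = \<one>\<^bsub>B\<^esub> \<ominus>\<^bsub>B\<^esub> pp (Suc n)"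
        using pp_closed[of n] pp_closed[of "Suc n"] by algebra
      then show ?case using Suc by simp
    qed (simp add: pp_0)
    have "gram B ?z ?z i = star B X \<cdot> (pp i \<ominus>\<^bsub>B\<^esub> pp (Suc i)) \<cdot> X" if i: "i < d + l" for i
    proof -
      have "?z i = ?y i \<cdot> X"
        using T(4)[of q i "2 * d + l"] i X Up_closed q_closed
        by (simp add: img_def[of ?y, OF y] B.m_assoc)
      then show ?thesis
        using X y(1)[of i] B.star_closed[OF y(1)[of i]]
        by (simp add: gram_def B.star_mult B.m_assoc flip: pp_step)
    qed
    then have "psum B (gram B ?z ?z) (d + l) = psum B (\<lambda>i. star B X \<cdot> (pp i \<ominus>\<^bsub>B\<^esub> pp (Suc i)) \<cdot> X) (d + l)"
      by (rule B.psum_cong)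
    also have "\<dots> = Rl l"
      using X pp_closed by (simp add: B.psum_mult_right B.psum_mult_left tele Rl_def)
    finally have "psum B (gram B ?z ?z) (d + l) = Rl l" .
    moreover have "gram B ?y ?y = (\<lambda>i. pp i \<ominus>\<^bsub>B\<^esub> pp (Suc i))"
      unfolding gram_def using pp_step by blast
    ultimately show ?thesis
      using gram_img_le[where y = ?y and K = "2 * d + l" and T = T and n = "d + l", OF y T(1)] by (simp add: tele)
  qed
  have "pos B (psum B (\<lambda>l. scal B ?t (\<one>\<^bsub>B\<^esub> \<ominus>\<^bsub>B\<^esub> pp (2 * d + l)) \<ominus>\<^bsub>B\<^esub> Rl l) m)" by (rule B.pos_psum[OF second])
  also have "psum B (\<lambda>l. scal B ?t (\<one>\<^bsub>B\<^esub> \<ominus>\<^bsub>B\<^esub> pp (2 * d + l)) \<ominus>\<^bsub>B\<^esub> Rl l) m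
      = scal B ?t (psum B (\<lambda>l. \<one>\<^bsub>B\<^esub> \<ominus>\<^bsub>B\<^esub> pp (2 * d + l)) m) \<ominus>\<^bsub>B\<^esub> R'"
  proof -
    have "psum B (\<lambda>l. \<ominus>\<^bsub>B\<^esub> Rl l) m = \<ominus>\<^bsub>B\<^esub> R'"
      using B.psum_scal[of Rl "-1" m] PR cl by (simp add: B.scal_minus_one R'_def)
    then show ?thesis
      using PR pp_closed by (simp add: B.minus_eq[of "scal B _ _"] B.psum_add B.scal_closed B.psum_scal)
  qed
  also have "psum B (\<lambda>l. \<one>\<^bsub>B\<^esub> \<ominus>\<^bsub>B\<^esub> pp (2 * d + l)) m = real_elt B (real m) \<ominus>\<^bsub>B\<^esub> psum B (\<lambda>l. pp (2 * d + l)) m"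
    by (rule B.psum_one_minus) (rule pp_closed)
  also have "scal B ?t \<dots> = e \<ominus>\<^bsub>B\<^esub> b"
    unfolding e_def b_def using pp_closed by (intro B.scal_diff B.real_elt_closed B.psum_closed) auto
  finally have "pos B (e \<ominus>\<^bsub>B\<^esub> b \<ominus>\<^bsub>B\<^esub> R')" .
  then have "pos B ((a \<oplus>\<^bsub>B\<^esub> b \<ominus>\<^bsub>B\<^esub> P') \<oplus>\<^bsub>B\<^esub> (e \<ominus>\<^bsub>B\<^esub> b \<ominus>\<^bsub>B\<^esub> R'))" using first B.pos_add by blast
  \<comment> \<open>The long sums \<open>b\<close> cancel; of the first estimate only the 2 d
    boundary terms in \<open>a\<close> remain beside \<open>e\<close>.\<close>
  also have "(a \<oplus>\<^bsub>B\<^esub> b \<ominus>\<^bsub>B\<^esub> P') \<oplus>\<^bsub>B\<^esub> (e \<ominus>\<^bsub>B\<^esub> b \<ominus>\<^bsub>B\<^esub> R') = (a \<oplus>\<^bsub>B\<^esub> e) \<ominus>\<^bsub>B\<^esub> (P' \<oplus>\<^bsub>B\<^esub> R')" using cl by algebra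
  also have "P' \<oplus>\<^bsub>B\<^esub> R' = scal B (complex_of_real (real m)) (star B X \<cdot> X)"
  proof -
    have "P' \<oplus>\<^bsub>B\<^esub> R' = psum B (\<lambda>l. Pl l \<oplus>\<^bsub>B\<^esub> Rl l) m" using B.psum_add[of Pl Rl m] PR(1,2) by (simp add: P'_def R'_def)
    also have "\<dots> = scal B (complex_of_real (real m)) (star B X \<cdot> X)"
      unfolding PR(3) using X
      by (induction m) (simp_all add: B.scal_zero_left B.scal_add_left B.scal_one B.a_comm B.scal_closed)
    finally show ?thesis .
  qed
  finally have "nrm B (scal B (complex_of_real (real m)) (star B X \<cdot> X)) \<le> nrm B (a \<oplus>\<^bsub>B\<^esub> e)"
    using B.pos_scal[OF B.pos_star_mult[OF X(1)], of "real m"] cl by (intro B.nrm_mono) auto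
  also have "\<dots> \<le> nrm B a + nrm B e" using cl by (simp add: B.nrm_add)
  also have "\<dots> \<le> (nrm L T)\<^sup>2 * real (2 * d) + (nrm L T)\<^sup>2 * real m"
  proof (rule add_mono)
    have "nrm B (psum B pp (2 * d)) \<le> real (2 * d)" using pp_closed pp_nrm by (intro B.nrm_psum_le) auto
    then show "nrm B a \<le> (nrm L T)\<^sup>2 * real (2 * d)"
      unfolding a_def using B.nrm_scal_real[OF B.psum_closed[of pp, OF pp_closed]] by (simp add: mult_left_mono del: of_real_power)
    show "nrm B e \<le> (nrm L T)\<^sup>2 * real m"
      unfolding e_def B.nrm_scal_real[OF B.real_elt_closed] abs_power2
      using B.nrm_real_elt_le[of "real m"] by (intro mult_left_mono) auto
  qed
  finally show ?thesis
    using B.nrm_scal_real[of "star B X \<cdot> X" "real m"] X by (simp add: B.cstar_identity algebra_simps)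
qed

text \<open>The boundary terms contribute a fixed amount, which becomes negligible against
  m.\<close>

lemma Rel_nrm_le:
  assumes "Rel d T X"
  shows "nrm B X \<le> nrm L T"
proof (rule power2_le_imp_le)
  show "0 \<le> nrm L T" using RelD(1)[OF assms] L.nrm_nonneg by blast
  show "(nrm B X)\<^sup>2 \<le> (nrm L T)\<^sup>2"
  proof (rule ccontr)
    assume "\<not> (nrm B X)\<^sup>2 \<le> (nrm L T)\<^sup>2"
    then have p: "(nrm B X)\<^sup>2 - (nrm L T)\<^sup>2 > 0" by simp
    then obtain m :: nat where "real (2 * d) * (nrm L T)\<^sup>2 < real m * ((nrm B X)\<^sup>2 - (nrm L T)\<^sup>2)"
      using reals_Archimedean3 by blast
    then show False using Rel_nrm_estimate[OF assms, of m] by (simp add: algebra_simps)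
  qed
qed

end

section \<open>The Toeplitz algebra and its universal property\<close>

context unital_cstar_algebra
begin

lemma closed_ideal_closed_ideal_gen:
  assumes "G \<subseteq> carrier A"
  shows "closed_ideal A (closed_ideal_gen A G)"
proof -
  let ?S = "{I. closed_ideal A I \<and> G \<subseteq> I}"
  have "carrier A \<in> ?S"
    using assms oneideal by (auto simp: closed_ideal_def nrm_closed_def nrm_limD)
  then have "ideal (\<Inter>?S) A" by (intro i_Intersect) (auto simp: closed_ideal_def)
  moreover have "nrm_closed A (\<Inter>?S)"
    unfolding nrm_closed_def
  proof (intro allI impI, elim conjE)
    fix s l assume "\<forall>n. s n \<in> \<Inter>?S" "nrm_lim A s l"
    then show "l \<in> \<Inter>?S" unfolding closed_ideal_def nrm_closed_def by blast
  qed
  ultimately show ?thesis by (simp add: closed_ideal_def closed_ideal_gen_def)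
qed

end

lemma (in cstar_ideal) factor_hom:
  assumes "unital_cstar_algebra B" "star_hom A B f" "\<And>x. x \<in> I \<Longrightarrow> f x = \<zero>\<^bsub>B\<^esub>"
  obtains g where "star_hom Q B g" "\<And>a. a \<in> carrier A \<Longrightarrow> g (coset a) = f a"
proof -
  interpret f: cstar_hom A B f
    using assms by (intro cstar_hom.intro cstar_hom_axioms.intro unital_cstar_algebra_axioms)
  define g where "g X = f (SOME a. a \<in> carrier A \<and> coset a = X)" for X
  have g: "g (coset a) = f a" if a: "a \<in> carrier A" for a
  proof -
    define b where "b = (SOME b. b \<in> carrier A \<and> coset b = coset a)"
    have b: "b \<in> carrier A" "coset b = coset a"
      using someI[of "\<lambda>b. b \<in> carrier A \<and> coset b = coset a" a] a by (auto simp: b_def)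
    then have "f (b \<ominus> a) = \<zero>\<^bsub>B\<^esub>" using coset_eq_iff a assms(3) by blast
    then show ?thesis
      using f.B.diff_eq_zeroD[of "f b" "f a"] f.closed a b by (simp add: g_def f.diff flip: b_def)
  qed
  have "star_hom Q B g"
    unfolding star_hom_def Q_simps(5)
    by (auto simp: g coset_add coset_mult coset_scal coset_star f.add f.mult f.scal f.star f.closed
        scal_closed star_closed)
  then show thesis using that g by blast
qed

context dyn_system
begin

abbreviation TA :: "('a, 'a) fock_op cstar_algebra" where "TA \<equiv> toeplitz_algebra A E"

text \<open>Writing out the unit puts the algebra into the form treated by
  \<open>cstar_subalgebra_unital\<close>.\<close>

lemma TA_eq: "TA = L\<lparr>carrier := carrier TA, one := \<one>\<^bsub>L\<^esub>\<rparr>"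
  by (simp add: toeplitz_algebra_def)

lemma TA_simps: "mult TA = mult L" "add TA = add L" "zero TA = zero L" "one TA = one L" "scal TA = scal L"
  "star TA = star L" "nrm TA = nrm L"
  by (simp_all add: toeplitz_algebra_def)

lemma delta_one_E: "\<delta> \<one> \<in> carrier E"
  using en_in_M[of 1] by (simp add: E_carrier)

lemma E_elt: "x \<in> carrier E \<Longrightarrow> \<exists>a\<in>carrier A. x = \<delta> \<one> \<otimes> a"
  by (auto simp: dyn_bimodule_def)

lemma creation_closed: "x \<in> carrier E \<Longrightarrow> fock_creation A E x \<in> carrier L"
  using E_elt[of x] S_closed phi_closed by (auto simp: creation_eq)

lemma TA_subalgebra: "cstar_subalgebra L (carrier TA)"
  unfolding toeplitz_algebra_def
  using creation_closed phi_closed by (simp, intro L.cstar_gen_subalgebra) auto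

text \<open>Every creation operator is \<open>S\<close> times some \<open>\<phi> a\<close>, so
  \<open>S\<close> and the image of \<phi> suffice as generators.\<close>

lemma TA_least:
  assumes "cstar_subalgebra L D" "\<And>a. a \<in> carrier A \<Longrightarrow> \<phi> a \<in> D" "S \<in> D"
  shows "carrier TA \<subseteq> D"
proof -
  have "fock_creation A E x \<in> D" if x: "x \<in> carrier E" for x
  proof -
    obtain a where "a \<in> carrier A" "x = \<delta> \<one> \<otimes> a" using E_elt[OF x] by blast
    then show ?thesis using creation_eq L.cstar_subalgebraD(4)[OF assms(1)] assms(2,3) by simp
  qed
  then have "fock_creation A E ` carrier E \<union> \<phi> ` carrier A \<subseteq> D" using assms(2) by blast
  then show ?thesis using L.cstar_gen_least[OF assms(1)] by (simp add: toeplitz_algebra_def)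
qed

lemma phi_TA: "a \<in> carrier A \<Longrightarrow> \<phi> a \<in> carrier TA"
  and S_TA: "S \<in> carrier TA" and Sd_TA: "Sd \<in> carrier TA"
proof -
  have gen: "fock_creation A E ` carrier E \<union> \<phi> ` carrier A \<subseteq> carrier TA"
    unfolding toeplitz_algebra_def using L.cstar_gen_superset by simp
  then show "a \<in> carrier A \<Longrightarrow> \<phi> a \<in> carrier TA" by blast
  show S: "S \<in> carrier TA" using gen delta_one_E by blast
  show "Sd \<in> carrier TA" using L.cstar_subalgebraD(5)[OF TA_subalgebra S] by (simp add: star_S)
qed

lemma TA_carrier: "T \<in> carrier TA \<Longrightarrow> T \<in> carrier L"
  using L.cstar_subalgebraD(1)[OF TA_subalgebra] by blast

lemma one_TA: "\<one>\<^bsub>L\<^esub> \<in> carrier TA"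
  using phi_TA[OF one_closed] by (simp add: phi_one)

lemma TA_cstar: "unital_cstar_algebra TA"
  and TA_minus: "\<And>T R. T \<in> carrier TA \<Longrightarrow> R \<in> carrier TA \<Longrightarrow> T \<ominus>\<^bsub>TA\<^esub> R = T \<ominus>\<^bsub>L\<^esub> R"
  and TA_lim: "\<And>s l. (\<And>n. s n \<in> carrier TA) \<Longrightarrow> nrm_lim TA s l \<longleftrightarrow> nrm_lim L s l \<and> l \<in> carrier TA"
  using L.cstar_subalgebra_unital[OF TA_subalgebra one_TA] TA_carrier unfolding TA_eq[symmetric]
  by simp_all

end

context covariant
begin

text \<open>\<open>Rel\<close> treats rows and columns differently, so compatibility with the
  involution is built in by demanding the relation for the adjoint pair as well.\<close>

definition Rels :: "('a, 'a) fock_op \<Rightarrow> 'b \<Rightarrow> bool" where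
  "Rels T X \<longleftrightarrow> (\<exists>d. Rel d T X \<and> Rel d (star L T) (star B X))"

lemma RelsI: "Rel d T X \<Longrightarrow> Rel d' (star L T) (star B X) \<Longrightarrow> Rels T X"
  unfolding Rels_def using Rel_mono max.cobounded1 max.cobounded2 by blast

lemma RelsD: "Rels T X \<Longrightarrow> T \<in> carrier L" "Rels T X \<Longrightarrow> X \<in> carrier B"
  using RelD unfolding Rels_def by blast+

lemma Rels_nrm_le: "Rels T X \<Longrightarrow> nrm B X \<le> nrm L T"
  using Rel_nrm_le by (auto simp: Rels_def)

lemma Rels_add: "Rels T X \<Longrightarrow> Rels R Y \<Longrightarrow> Rels (T \<oplus>\<^bsub>L\<^esub> R) (X \<oplus>\<^bsub>B\<^esub> Y)"
proof -
  assume TR: "Rels T X" "Rels R Y"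
  then obtain d d' where "Rel d T X" "Rel d (star L T) (star B X)" "Rel d' R Y" "Rel d' (star L R) (star B Y)"
    by (auto simp: Rels_def)
  then have "Rel (max d d') T X" "Rel (max d d') (star L T) (star B X)"
    "Rel (max d d') R Y" "Rel (max d d') (star L R) (star B Y)"
    by (auto elim: Rel_mono)
  then show ?thesis
    using Rel_add RelsD TR by (intro RelsI[of "max d d'" _ _ "max d d'"]) (simp_all add: L.star_add B.star_add)
qed

lemma Rels_mult: "Rels T X \<Longrightarrow> Rels R Y \<Longrightarrow> Rels (T \<otimes>\<^bsub>L\<^esub> R) (X \<cdot> Y)"
proof -
  assume TR: "Rels T X" "Rels R Y"
  then obtain d d' where "Rel d T X" "Rel d (star L T) (star B X)" "Rel d' R Y" "Rel d' (star L R) (star B Y)"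
    by (auto simp: Rels_def)
  then have "Rel (d + d') (T \<otimes>\<^bsub>L\<^esub> R) (X \<cdot> Y)" "Rel (d' + d) (star L R \<otimes>\<^bsub>L\<^esub> star L T) (star B Y \<cdot> star B X)"
    by (auto intro: Rel_mult)
  then show ?thesis using RelsD TR by (intro RelsI) (simp_all add: L.star_mult B.star_mult)
qed

lemma Rels_scal: "Rels T X \<Longrightarrow> Rels (scal L c T) (scal B c X)"
proof -
  assume T: "Rels T X"
  then obtain d where "Rel d T X" "Rel d (star L T) (star B X)" by (auto simp: Rels_def)
  then show ?thesis
    using Rel_scal RelsD[OF T] by (intro RelsI) (simp_all add: L.star_scal B.star_scal)
qed

lemma Rels_star: "Rels T X \<Longrightarrow> Rels (star L T) (star B X)"
  using RelsD[of T X] by (auto simp: Rels_def L.star_star B.star_star)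

lemma Rels_phi: "a \<in> carrier A \<Longrightarrow> Rels (\<phi> a) (\<pi> a)"
  using RelsI[of 0 "\<phi> a" "\<pi> a" 0] Rel_phi[of a] Rel_phi[of "star A a"]
  by (simp add: star_phi star_closed p.star)

lemma Rels_S: "Rels S V" and Rels_Sd: "Rels Sd U"
  using RelsI[of 1 S V 1] RelsI[of 1 Sd U 1] Rel_S Rel_Sd U_closed
  by (simp_all add: star_S star_Sd B.star_star)

text \<open>The closure of the graph of T to X. Working with the graph avoids the choice of a
  polynomial representing T; that it is the graph of a contraction comes from the norm
  estimate.\<close>

definition CRel :: "('a, 'a) fock_op \<Rightarrow> 'b \<Rightarrow> bool" where
  "CRel T X \<longleftrightarrow> (\<exists>s t. (\<forall>n. Rels (s n) (t n)) \<and> nrm_lim L s T \<and> nrm_lim B t X)"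

lemma CRelE:
  assumes "CRel T X"
  obtains s t where "\<And>n. Rels (s n) (t n)" "\<And>n. s n \<in> carrier L" "\<And>n. t n \<in> carrier B"
    "nrm_lim L s T" "nrm_lim B t X"
  using assms RelsD unfolding CRel_def by metis

lemma CRelI: "(\<And>n. Rels (s n) (t n)) \<Longrightarrow> nrm_lim L s T \<Longrightarrow> nrm_lim B t X \<Longrightarrow> CRel T X"
  unfolding CRel_def by blast

lemma CRel_Rels: "Rels T X \<Longrightarrow> CRel T X"
  using RelsD[of T X] by (intro CRelI[of "\<lambda>_. T" "\<lambda>_. X"] L.nrm_lim_const B.nrm_lim_const)

lemma CRelD: "CRel T X \<Longrightarrow> T \<in> carrier L" "CRel T X \<Longrightarrow> X \<in> carrier B"
  by (auto elim!: CRelE dest: L.nrm_limD B.nrm_limD)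

lemma CRel_nrm_le:
  assumes "CRel T X"
  shows "nrm B X \<le> nrm L T"
proof -
  obtain s t where st: "\<And>n. Rels (s n) (t n)" "\<And>n. s n \<in> carrier L" "\<And>n. t n \<in> carrier B"
    "nrm_lim L s T" "nrm_lim B t X" by (rule CRelE[OF assms]) blast
  show ?thesis
    using L.nrm_lim_nrm[OF st(4,2)] B.nrm_lim_nrm[OF st(5,3)] Rels_nrm_le[OF st(1)] by (intro LIMSEQ_le) auto
qed

lemma CRel_add:
  assumes "CRel T X" "CRel R Y"
  shows "CRel (T \<oplus>\<^bsub>L\<^esub> R) (X \<oplus>\<^bsub>B\<^esub> Y)"
proof -
  obtain s t where s: "\<And>n. Rels (s n) (t n)" "\<And>n. s n \<in> carrier L" "\<And>n. t n \<in> carrier B"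
    "nrm_lim L s T" "nrm_lim B t X" by (rule CRelE[OF assms(1)]) blast
  obtain s' t' where s': "\<And>n. Rels (s' n) (t' n)" "\<And>n. s' n \<in> carrier L" "\<And>n. t' n \<in> carrier B"
    "nrm_lim L s' R" "nrm_lim B t' Y" by (rule CRelE[OF assms(2)]) blast
  show ?thesis
    by (rule CRelI[OF Rels_add[OF s(1) s'(1)] L.nrm_lim_add[OF s(4) s'(4) s(2) s'(2)]
          B.nrm_lim_add[OF s(5) s'(5) s(3) s'(3)]])
qed

lemma CRel_mult:
  assumes "CRel T X" "CRel R Y"
  shows "CRel (T \<otimes>\<^bsub>L\<^esub> R) (X \<cdot> Y)"
proof -
  obtain s t where s: "\<And>n. Rels (s n) (t n)" "\<And>n. s n \<in> carrier L" "\<And>n. t n \<in> carrier B"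
    "nrm_lim L s T" "nrm_lim B t X" by (rule CRelE[OF assms(1)]) blast
  obtain s' t' where s': "\<And>n. Rels (s' n) (t' n)" "\<And>n. s' n \<in> carrier L" "\<And>n. t' n \<in> carrier B"
    "nrm_lim L s' R" "nrm_lim B t' Y" by (rule CRelE[OF assms(2)]) blast
  show ?thesis
    by (rule CRelI[OF Rels_mult[OF s(1) s'(1)] L.nrm_lim_mult[OF s(4) s'(4) s(2) s'(2)]
          B.nrm_lim_mult[OF s(5) s'(5) s(3) s'(3)]])
qed

lemma CRel_scal:
  assumes "CRel T X"
  shows "CRel (scal L c T) (scal B c X)"
proof -
  obtain s t where s: "\<And>n. Rels (s n) (t n)" "\<And>n. s n \<in> carrier L" "\<And>n. t n \<in> carrier B"
    "nrm_lim L s T" "nrm_lim B t X" by (rule CRelE[OF assms]) blast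
  show ?thesis
    by (rule CRelI[OF Rels_scal[OF s(1)] L.nrm_lim_scal[OF s(4,2)] B.nrm_lim_scal[OF s(5,3)]])
qed

lemma CRel_star:
  assumes "CRel T X"
  shows "CRel (star L T) (star B X)"
proof -
  obtain s t where s: "\<And>n. Rels (s n) (t n)" "\<And>n. s n \<in> carrier L" "\<And>n. t n \<in> carrier B"
    "nrm_lim L s T" "nrm_lim B t X" by (rule CRelE[OF assms]) blast
  show ?thesis
    by (rule CRelI[OF Rels_star[OF s(1)] L.nrm_lim_star[OF s(4,2)] B.nrm_lim_star[OF s(5,3)]])
qed

lemma CRel_diff: "CRel T X \<Longrightarrow> CRel R Y \<Longrightarrow> CRel (T \<ominus>\<^bsub>L\<^esub> R) (X \<ominus>\<^bsub>B\<^esub> Y)"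
  using CRel_add[of T X "scal L (- 1) R" "scal B (- 1) Y"] CRel_scal[of R Y "-1"] CRelD[of R Y]
  by (simp add: L.minus_eq B.minus_eq L.scal_minus_one B.scal_minus_one)

lemma CRel_unique:
  assumes "CRel T X" "CRel T Y"
  shows "X = Y"
proof -
  have "nrm B (X \<ominus>\<^bsub>B\<^esub> Y) \<le> 0" using CRel_nrm_le[OF CRel_diff[OF assms]] CRelD(1)[OF assms(1)] by simp
  then show ?thesis
    using CRelD(2)[OF assms(1)] CRelD(2)[OF assms(2)] B.nrm_nonneg[of "X \<ominus>\<^bsub>B\<^esub> Y"] B.nrm_diff_eq_zero[of X Y]
    by simp
qed

lemma CRel_approx:
  assumes "CRel T X" "e > 0"
  obtains T' X' where "Rels T' X'" "nrm L (T' \<ominus>\<^bsub>L\<^esub> T) < e" "nrm B (X' \<ominus>\<^bsub>B\<^esub> X) < e"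
proof -
  obtain s t where s: "\<And>n. Rels (s n) (t n)" "nrm_lim L s T" "nrm_lim B t X" by (rule CRelE[OF assms(1)]) blast
  obtain N M where "\<And>n. n \<ge> N \<Longrightarrow> \<bar>nrm L (s n \<ominus>\<^bsub>L\<^esub> T)\<bar> < e" "\<And>n. n \<ge> M \<Longrightarrow> \<bar>nrm B (t n \<ominus>\<^bsub>B\<^esub> X)\<bar> < e"
    using s(2)[unfolded L.nrm_lim_epsilon[OF CRelD(1)[OF assms(1)]]]
      s(3)[unfolded B.nrm_lim_epsilon[OF CRelD(2)[OF assms(1)]]] assms(2) by blast
  from this(1)[of "max N M"] this(2)[of "max N M"]
  have "nrm L (s (max N M) \<ominus>\<^bsub>L\<^esub> T) < e" "nrm B (t (max N M) \<ominus>\<^bsub>B\<^esub> X) < e"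
    by (simp_all add: abs_less_iff)
  then show thesis by (rule that[OF s(1)])
qed

text \<open>For closedness: the estimate turns a convergent sequence in the domain into a Cauchy
  sequence of images, and approximants with errors below 1/(n + 1) bring both limits back into the
  closure.\<close>

lemma CRel_domain: "cstar_subalgebra L {T. \<exists>X. CRel T X}"
  unfolding cstar_subalgebra_def
proof (intro conjI ballI allI)
  show "{T. \<exists>X. CRel T X} \<subseteq> carrier L" using CRelD by blast
  show "\<zero>\<^bsub>L\<^esub> \<in> {T. \<exists>X. CRel T X}"
    using CRel_scal[OF CRel_Rels[OF Rels_S], of 0] S_closed L.scal_zero_left by force
  show "nrm_closed L {T. \<exists>X. CRel T X}"
    unfolding nrm_closed_def
  proof (intro allI impI, elim conjE)
    fix s T assume "\<forall>n. s n \<in> {T. \<exists>X. CRel T X}" and T: "nrm_lim L s T"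
    then obtain t where t: "\<And>n. CRel (s n) (t n)" by (auto dest!: choice)
    note cl = CRelD(1)[OF t] CRelD(2)[OF t] L.nrm_limD(1)[OF T]
    have "\<exists>X. nrm_lim B t X"
    proof (rule B.complete)
      show "\<forall>e>0. \<exists>N. \<forall>m\<ge>N. \<forall>n\<ge>N. nrm B (t m \<ominus>\<^bsub>B\<^esub> t n) < e"
      proof (intro allI impI)
        fix e :: real assume e: "e > 0"
        obtain N where N: "\<And>n. n \<ge> N \<Longrightarrow> \<bar>nrm L (s n \<ominus>\<^bsub>L\<^esub> T)\<bar> < e / 2"
          using T[unfolded L.nrm_lim_epsilon[OF cl(3)]] half_gt_zero[OF e] by blast
        have "nrm B (t m \<ominus>\<^bsub>B\<^esub> t n) < e" if "m \<ge> N" "n \<ge> N" for m n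
          using CRel_nrm_le[OF CRel_diff[OF t t], of m n] L.nrm_triangle[OF cl(1) cl(3) cl(1), of m n]
            L.nrm_diff_commute[OF cl(1) cl(3), of n] N[OF that(1)] N[OF that(2)] by linarith
        then show "\<exists>N. \<forall>m\<ge>N. \<forall>n\<ge>N. nrm B (t m \<ominus>\<^bsub>B\<^esub> t n) < e" by blast
      qed
    qed (rule cl)
    then obtain X where X: "nrm_lim B t X" by blast
    have "\<exists>T' X'. Rels T' X' \<and> nrm L (T' \<ominus>\<^bsub>L\<^esub> s n) < inverse (Suc n) \<and> nrm B (X' \<ominus>\<^bsub>B\<^esub> t n) < inverse (Suc n)" for n
    proof -
      have "inverse (real (Suc n)) > 0" by simp
      then show ?thesis using CRel_approx[OF t[of n]] by blast
    qed
    then obtain s' t' where st: "\<And>n. Rels (s' n) (t' n)" "\<And>n. nrm L (s' n \<ominus>\<^bsub>L\<^esub> s n) < inverse (Suc n)"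
      "\<And>n. nrm B (t' n \<ominus>\<^bsub>B\<^esub> t n) < inverse (Suc n)" by metis
    note cl' = RelsD(1)[OF st(1)] RelsD(2)[OF st(1)]
    have "nrm_lim L s' T"
    proof (rule L.nrm_limI_bound[OF cl(3) cl'(1)])
      show "\<forall>\<^sub>F n in sequentially. nrm L (s' n \<ominus>\<^bsub>L\<^esub> T) \<le> inverse (Suc n) + nrm L (s n \<ominus>\<^bsub>L\<^esub> T)"
        using L.nrm_triangle[OF cl'(1) cl(1) cl(3)] st(2) by (intro always_eventually allI) (smt (verit))
      show "(\<lambda>n. inverse (Suc n) + nrm L (s n \<ominus>\<^bsub>L\<^esub> T)) \<longlonglongrightarrow> 0"
        using tendsto_add[OF LIMSEQ_inverse_real_of_nat L.nrm_limD(2)[OF T]] by simp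
    qed
    moreover have "nrm_lim B t' X"
    proof (rule B.nrm_limI_bound[OF B.nrm_limD(1)[OF X] cl'(2)])
      show "\<forall>\<^sub>F n in sequentially. nrm B (t' n \<ominus>\<^bsub>B\<^esub> X) \<le> inverse (Suc n) + nrm B (t n \<ominus>\<^bsub>B\<^esub> X)"
        using B.nrm_triangle[OF cl'(2) cl(2) B.nrm_limD(1)[OF X]] st(3) by (intro always_eventually allI) (smt (verit))
      show "(\<lambda>n. inverse (Suc n) + nrm B (t n \<ominus>\<^bsub>B\<^esub> X)) \<longlonglongrightarrow> 0"
        using tendsto_add[OF LIMSEQ_inverse_real_of_nat B.nrm_limD(2)[OF X]] by simp
    qed
    ultimately show "T \<in> {T. \<exists>X. CRel T X}" using CRelI[where s = s' and t = t' and T = T and X = X, OF st(1)] by blast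
  qed
qed (use CRel_add CRel_mult CRel_scal CRel_star in blast)+

text \<open>The domain of the closed graph is a closed subalgebra that contains the generators,
  hence the whole Toeplitz algebra.\<close>

theorem toeplitz_universal:
  obtains \<Psi> where "star_hom TA B \<Psi>" "\<And>a. a \<in> carrier A \<Longrightarrow> \<Psi> (\<phi> a) = \<pi> a" "\<Psi> Sd = U"
proof -
  define \<Psi> where "\<Psi> T = (THE X. CRel T X)" for T
  have \<Psi>: "\<Psi> T = X" if "CRel T X" for T X
    unfolding \<Psi>_def using that CRel_unique by (intro the_equality) blast+
  have dom: "CRel T (\<Psi> T)" if T: "T \<in> carrier TA" for T
  proof -
    have "carrier TA \<subseteq> {T. \<exists>X. CRel T X}"
      using CRel_Rels Rels_phi Rels_S by (intro TA_least[OF CRel_domain]) blast+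
    then obtain X where "CRel T X" using T by blast
    then show ?thesis using \<Psi> by simp
  qed
  have "star_hom TA B \<Psi>"
    unfolding star_hom_def TA_simps
    using dom CRelD(2)[OF dom] CRel_add CRel_mult CRel_scal CRel_star by (auto intro!: \<Psi>)
  then show thesis using that \<Psi> CRel_Rels Rels_phi Rels_Sd by blast
qed

end

section \<open>The relative Cuntz-Pimsner algebra\<close>

locale cuntz_pimsner_algebra = dyn_system A \<delta>
  for A :: "'a cstar_algebra" (structure) and \<delta> :: "'a \<Rightarrow> 'a" +
  fixes J :: "'a set"
  assumes J_ideal: "closed_ideal A J"
    and J_ker: "{a \<in> carrier A. \<delta> a = \<zero>} \<inter> J = {\<zero>}"

sublocale cuntz_pimsner_algebra \<subseteq> J: cstar_ideal A J
  by unfold_locales (rule J_ideal)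

context cuntz_pimsner_algebra
begin

text \<open>An upper bound for the relative ideal that can be read off from matrix entries.\<close>

definition K :: "('a, 'a) fock_op set" where
  "K = {T \<in> carrier L. (\<forall>i j. ent T i j \<in> J) \<and>
     (\<forall>d e. e > 0 \<longrightarrow> (\<exists>N. \<forall>i j. N \<le> i \<longrightarrow> i \<le> j + d \<longrightarrow> j \<le> i + d \<longrightarrow> nrm A (ent T i j) < e))}"

lemma KD:
  assumes "T \<in> K"
  shows "T \<in> carrier L" "ent T i j \<in> J"
    "e > 0 \<Longrightarrow> \<exists>N. \<forall>i j. N \<le> i \<longrightarrow> i \<le> j + d \<longrightarrow> j \<le> i + d \<longrightarrow> nrm A (ent T i j) < e"
  using assms by (auto simp: K_def)

lemma KI:
  assumes "T \<in> carrier L" "\<And>i j. ent T i j \<in> J"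
    "\<And>d e. e > 0 \<Longrightarrow> \<exists>N. \<forall>i j. N \<le> i \<longrightarrow> i \<le> j + d \<longrightarrow> j \<le> i + d \<longrightarrow> nrm A (ent T i j) < e"
  shows "T \<in> K"
  using assms by (auto simp: K_def)

lemma K_add: "T \<in> K \<Longrightarrow> R \<in> K \<Longrightarrow> T \<oplus>\<^bsub>L\<^esub> R \<in> K"
proof (rule KI)
  assume T: "T \<in> K" and R: "R \<in> K"
  note cl = KD(1)[OF T] KD(1)[OF R]
  show "T \<oplus>\<^bsub>L\<^esub> R \<in> carrier L" using cl by simp
  show "ent (T \<oplus>\<^bsub>L\<^esub> R) i j \<in> J" for i j using cl KD(2)[OF T] KD(2)[OF R] by (simp add: ent_add)
  fix d :: nat and e :: real assume e: "e > 0"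
  obtain N M where N: "\<And>i j. N \<le> i \<Longrightarrow> i \<le> j + d \<Longrightarrow> j \<le> i + d \<Longrightarrow> nrm A (ent T i j) < e / 2"
    and M: "\<And>i j. M \<le> i \<Longrightarrow> i \<le> j + d \<Longrightarrow> j \<le> i + d \<Longrightarrow> nrm A (ent R i j) < e / 2"
    using KD(3)[OF T half_gt_zero[OF e]] KD(3)[OF R half_gt_zero[OF e]] by blast
  have "nrm A (ent (T \<oplus>\<^bsub>L\<^esub> R) i j) < e" if "max N M \<le> i" "i \<le> j + d" "j \<le> i + d" for i j
    using nrm_add[OF ent_closed[OF cl(1)] ent_closed[OF cl(2)], of i j i j] N[of i j] M[of i j] that cl
    by (simp add: ent_add)
  then show "\<exists>N. \<forall>i j. N \<le> i \<longrightarrow> i \<le> j + d \<longrightarrow> j \<le> i + d \<longrightarrow> nrm A (ent (T \<oplus>\<^bsub>L\<^esub> R) i j) < e" by blast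
qed

text \<open>Multiplication by a shift moves an entry to a neighbouring place. Comparison with
  entries at distance at most 1 covers the shifts and the diagonal operators at once.\<close>

lemma K_dominated:
  assumes T: "T \<in> K" and R: "R \<in> carrier L" and J: "\<And>i j. ent R i j \<in> J" and c: "c \<ge> 0"
    and le: "\<And>i j. ent R i j = \<zero> \<or> (\<exists>i' j'. i \<le> i' + 1 \<and> i' \<le> i + 1 \<and> j \<le> j' + 1 \<and> j' \<le> j + 1 \<and>
      nrm A (ent R i j) \<le> c * nrm A (ent T i' j'))"
  shows "R \<in> K"
proof (rule KI[OF R J])
  fix d :: nat and e :: real assume e: "e > 0"
  \<comment> \<open>\<open>c + 1\<close> avoids a division by 0. Below, both indices may move by 1,
    which widens the band by 2 and raises the threshold by 1.\<close>
  have p: "e / (c + 1) > 0" using c e by simp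
  obtain N where N: "\<And>i j. N \<le> i \<Longrightarrow> i \<le> j + (d + 2) \<Longrightarrow> j \<le> i + (d + 2) \<Longrightarrow> nrm A (ent T i j) < e / (c + 1)"
    using KD(3)[OF T p, of "d + 2"] by blast
  have "nrm A (ent R i j) < e" if i: "N + 1 \<le> i" "i \<le> j + d" "j \<le> i + d" for i j
  proof (cases "ent R i j = \<zero>")
    case False
    then obtain i' j' where i': "i \<le> i' + 1" "i' \<le> i + 1" "j \<le> j' + 1" "j' \<le> j + 1"
      "nrm A (ent R i j) \<le> c * nrm A (ent T i' j')" using le by blast
    have t: "0 \<le> nrm A (ent T i' j')" using nrm_nonneg ent_closed KD(1)[OF T] by blast
    have "nrm A (ent T i' j') < e / (c + 1)" using i i' by (intro N) auto
    then have "(c + 1) * nrm A (ent T i' j') < e" using c by (simp add: field_simps)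
    then show ?thesis using i'(5) t by (simp add: algebra_simps)
  qed (use e in simp)
  then show "\<exists>N. \<forall>i j. N \<le> i \<longrightarrow> i \<le> j + d \<longrightarrow> j \<le> i + d \<longrightarrow> nrm A (ent R i j) < e" by blast
qed

lemma K_dominated_entrywise:
  assumes "T \<in> K" "R \<in> carrier L" "\<And>i j. ent R i j \<in> J" "c \<ge> 0"
    and le: "\<And>i j. nrm A (ent R i j) \<le> c * nrm A (ent T i j)"
  shows "R \<in> K"
proof (rule K_dominated[OF assms(1-4)])
  fix i j show "ent R i j = \<zero> \<or> (\<exists>i' j'. i \<le> i' + 1 \<and> i' \<le> i + 1 \<and> j \<le> j' + 1 \<and> j' \<le> j + 1 \<and>
      nrm A (ent R i j) \<le> c * nrm A (ent T i' j'))"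
    using le[of i j] by (intro disjI2 exI[of _ i] exI[of _ j]) simp
qed

lemma K_scal: "T \<in> K \<Longrightarrow> scal L c T \<in> K"
proof -
  assume T: "T \<in> K"
  note cl = KD(1)[OF T]
  have "nrm A (ent (scal L c T) i j) \<le> cmod c * nrm A (ent T i j)" for i j
    using cl ent_closed[OF cl] by (simp add: ent_scal nrm_scal)
  then show ?thesis
    using cl KD(2)[OF T]
    by (intro K_dominated_entrywise[OF T, where c = "cmod c"]) (auto simp: ent_scal J.scal_in L.scal_closed)
qed

lemma K_star: "T \<in> K \<Longrightarrow> star L T \<in> K"
proof (rule KI)
  assume T: "T \<in> K"
  note cl = KD(1)[OF T]
  show "star L T \<in> carrier L" using cl L.star_closed by blast
  show "ent (star L T) i j \<in> J" for i j using KD(2)[OF T] J.star_in by (simp add: ent_star[OF cl])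
  fix d :: nat and e :: real assume e: "e > 0"
  obtain N where N: "\<And>i j. N \<le> i \<Longrightarrow> i \<le> j + d \<Longrightarrow> j \<le> i + d \<Longrightarrow> nrm A (ent T i j) < e"
    using KD(3)[OF T e] by blast
  have "nrm A (ent (star L T) i j) < e" if "N + d \<le> i" "i \<le> j + d" "j \<le> i + d" for i j
    using that N[of j i] by (simp add: ent_star[OF cl] nrm_star ent_closed[OF cl])
  then show "\<exists>N. \<forall>i j. N \<le> i \<longrightarrow> i \<le> j + d \<longrightarrow> j \<le> i + d \<longrightarrow> nrm A (ent (star L T) i j) < e" by blast
qed

text \<open>Entries are bounded by the operator norm uniformly in their position, so one member of
  the sequence close to \<open>T\<close> controls all entries of \<open>T\<close>.\<close>

lemma K_closed: "nrm_closed L K"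
  unfolding nrm_closed_def
proof (intro allI impI, elim conjE)
  fix s T assume s: "\<forall>n. s n \<in> K" and l: "nrm_lim L s T"
  have sc: "s n \<in> carrier L" for n using s KD(1) by blast
  have T: "T \<in> carrier L" using L.nrm_limD(1)[OF l] .
  have diff: "nrm A (ent (s n) i j \<ominus> ent T i j) \<le> nrm L (s n \<ominus>\<^bsub>L\<^esub> T)" for n i j
  proof -
    have "ent (s n \<ominus>\<^bsub>L\<^esub> T) i j = ent (s n) i j \<ominus> ent T i j"
      using sc[of n] T ent_closed[OF T]
      by (simp add: L.minus_eq minus_eq F.L_minus ent_add ent_scal scal_minus_one L.scal_closed)
    then show ?thesis using nrm_ent_le[of "s n \<ominus>\<^bsub>L\<^esub> T" i j] sc[of n] T by simp
  qed
  show "T \<in> K"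
  proof (rule KI[OF T])
    fix i j
    have "nrm_lim A (\<lambda>n. ent (s n) i j) (ent T i j)"
      using diff ent_closed[OF sc] ent_closed[OF T] L.nrm_limD(2)[OF l] by (intro nrm_limI_bound) auto
    moreover have "ent (s n) i j \<in> J" for n using KD(2)[OF s[rule_format]] .
    ultimately show "ent T i j \<in> J" by (rule J.lim_in[rotated])
  next
    fix d :: nat and e :: real assume e: "e > 0"
    obtain n where n: "\<bar>nrm L (s n \<ominus>\<^bsub>L\<^esub> T)\<bar> < e / 2"
      using l[unfolded L.nrm_lim_epsilon[OF T]] half_gt_zero[OF e] by blast
    obtain N where N: "\<And>i j. N \<le> i \<Longrightarrow> i \<le> j + d \<Longrightarrow> j \<le> i + d \<Longrightarrow> nrm A (ent (s n) i j) < e / 2"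
      using KD(3)[OF s[rule_format] half_gt_zero[OF e]] by blast
    have "nrm A (ent T i j) < e" if "N \<le> i" "i \<le> j + d" "j \<le> i + d" for i j
      using N[OF that] n diff[of n i j] nrm_le_diff[OF ent_closed[OF T] ent_closed[OF sc], of i j n i j]
        nrm_diff_commute[OF ent_closed[OF T] ent_closed[OF sc], of i j n i j] by linarith
    then show "\<exists>N. \<forall>i j. N \<le> i \<longrightarrow> i \<le> j + d \<longrightarrow> j \<le> i + d \<longrightarrow> nrm A (ent T i j) < e" by blast
  qed
qed

lemma K_phi: "a \<in> carrier A \<Longrightarrow> T \<in> K \<Longrightarrow> \<phi> a \<otimes>\<^bsub>L\<^esub> T \<in> K"
proof -
  assume a: "a \<in> carrier A" and T: "T \<in> K"
  note cl = KD(1)[OF T]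
  have "nrm A (ent (\<phi> a \<otimes>\<^bsub>L\<^esub> T) i j) \<le> nrm A a * nrm A (ent T i j)" for i j
    unfolding ent_left(1)[OF cl a] using a dn_closed dn_nrm_le ent_closed[OF cl] by (intro nrm_mult_le) auto
  then show ?thesis
    using a cl KD(2)[OF T] dn_closed nrm_nonneg
    by (intro K_dominated_entrywise[OF T, where c = "nrm A a"])
      (auto simp: phi_closed ent_left(1)[OF cl a] J.I_l_closed)
qed

lemma K_Sd: "T \<in> K \<Longrightarrow> Sd \<otimes>\<^bsub>L\<^esub> T \<in> K"
proof -
  assume T: "T \<in> K"
  note cl = KD(1)[OF T]
  have "\<exists>i' j'. i \<le> i' + 1 \<and> i' \<le> i + 1 \<and> j \<le> j' + 1 \<and> j' \<le> j + 1 \<and>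
      nrm A (ent (Sd \<otimes>\<^bsub>L\<^esub> T) i j) \<le> 1 * nrm A (ent T i' j')" for i j
    by (rule exI[of _ "Suc i"], rule exI[of _ j]) (simp add: ent_left(2)[OF cl])
  then show ?thesis
    using cl KD(2)[OF T] Sd_closed
    by (intro K_dominated[OF T, where c = 1] disjI2) (simp_all only: ent_left(2)[OF cl] L.m_closed zero_le_one)
qed

lemma K_S: "T \<in> K \<Longrightarrow> S \<otimes>\<^bsub>L\<^esub> T \<in> K"
proof -
  assume T: "T \<in> K"
  note cl = KD(1)[OF T]
  have "ent (S \<otimes>\<^bsub>L\<^esub> T) i j = \<zero> \<or> (\<exists>i' j'. i \<le> i' + 1 \<and> i' \<le> i + 1 \<and> j \<le> j' + 1 \<and> j' \<le> j + 1 \<and>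
      nrm A (ent (S \<otimes>\<^bsub>L\<^esub> T) i j) \<le> 1 * nrm A (ent T i' j'))" for i j
  proof (cases i)
    case (Suc k)
    have "nrm A (en (Suc k)) \<le> 1" using order_trans[OF dn_nrm_le[OF one_closed] nrm_one_le] .
    then have "nrm A (ent (S \<otimes>\<^bsub>L\<^esub> T) i j) \<le> 1 * nrm A (ent T k j)"
      unfolding Suc ent_left(4)[OF cl] using en_closed[of "Suc k"] ent_closed[OF cl] by (intro nrm_mult_le) simp_all
    then show ?thesis using Suc by (intro disjI2 exI[of _ k] exI[of _ j]) simp
  qed (simp add: ent_left(3)[OF cl])
  moreover have "ent (S \<otimes>\<^bsub>L\<^esub> T) i j \<in> J" for i j
    using KD(2)[OF T] J.I_l_closed[OF _ en_closed, of _ i] by (cases i) (simp_all add: ent_left[OF cl] del: funpow.simps)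
  ultimately show ?thesis using cl by (intro K_dominated[OF T, where c = 1]) (auto simp: S_closed)
qed

text \<open>The operators that, together with their adjoints, map \<open>K\<close> into itself from
  the left form a closed subalgebra, so generators suffice; multiplication from the right follows
  because \<open>K\<close> is self-adjoint.\<close>

lemma K_multiplier: "R \<in> carrier TA \<Longrightarrow> T \<in> K \<Longrightarrow> R \<otimes>\<^bsub>L\<^esub> T \<in> K \<and> T \<otimes>\<^bsub>L\<^esub> R \<in> K"
proof -
  let ?D = "{R \<in> carrier L. \<forall>T\<in>K. R \<otimes>\<^bsub>L\<^esub> T \<in> K \<and> star L R \<otimes>\<^bsub>L\<^esub> T \<in> K}"
  have Kc: "T \<in> K \<Longrightarrow> T \<in> carrier L" for T by (rule KD)
  have sub: "cstar_subalgebra L ?D"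
    unfolding cstar_subalgebra_def
  proof (intro conjI ballI allI)
    have "\<zero>\<^bsub>L\<^esub> \<in> K" if "T \<in> K" for T using K_scal[OF that, of 0] Kc[OF that] by (simp add: L.scal_zero_left)
    then show "\<zero>\<^bsub>L\<^esub> \<in> ?D" using Kc by auto
    fix R assume R: "R \<in> ?D"
    then show "star L R \<in> ?D" by (simp add: L.star_closed L.star_star)
    show "scal L c R \<in> ?D" for c
      using R K_scal Kc by (auto simp: L.scal_closed L.star_scal L.star_closed L.scal_mult_left)
    fix Q assume Q: "Q \<in> ?D"
    show "R \<oplus>\<^bsub>L\<^esub> Q \<in> ?D"
      using R Q K_add Kc by (auto simp: L.star_closed L.star_add L.l_distr)
    show "R \<otimes>\<^bsub>L\<^esub> Q \<in> ?D"
      using R Q Kc by (auto simp: L.star_closed L.star_mult L.m_assoc)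
  next
    show "nrm_closed L ?D"
      unfolding nrm_closed_def
    proof (intro allI impI, elim conjE)
      fix s R assume s: "\<forall>n. s n \<in> ?D" and l: "nrm_lim L s R"
      have sc: "s n \<in> carrier L" for n using s by blast
      have "R \<otimes>\<^bsub>L\<^esub> T \<in> K \<and> star L R \<otimes>\<^bsub>L\<^esub> T \<in> K" if T: "T \<in> K" for T
      proof -
        have "nrm_lim L (\<lambda>n. s n \<otimes>\<^bsub>L\<^esub> T) (R \<otimes>\<^bsub>L\<^esub> T)"
          using Kc[OF T] by (intro L.nrm_lim_mult l L.nrm_lim_const sc)
        moreover have "nrm_lim L (\<lambda>n. star L (s n) \<otimes>\<^bsub>L\<^esub> T) (star L R \<otimes>\<^bsub>L\<^esub> T)"
          using Kc[OF T] L.star_closed[OF sc] by (intro L.nrm_lim_mult L.nrm_lim_star l L.nrm_lim_const sc) auto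
        ultimately show ?thesis
          using L.nrm_closedD[OF K_closed, of "\<lambda>n. s n \<otimes>\<^bsub>L\<^esub> T"]
            L.nrm_closedD[OF K_closed, of "\<lambda>n. star L (s n) \<otimes>\<^bsub>L\<^esub> T"] s T by blast
      qed
      then show "R \<in> ?D" using L.nrm_limD(1)[OF l] by simp
    qed
  qed auto
  have D: "carrier TA \<subseteq> ?D"
    using K_phi K_S K_Sd S_closed phi_closed star_closed by (intro TA_least[OF sub]) (auto simp: star_phi star_S)
  assume R: "R \<in> carrier TA" and T: "T \<in> K"
  then have RD: "R \<in> ?D" using D by blast
  then have "star L R \<otimes>\<^bsub>L\<^esub> star L T \<in> K" using K_star[OF T] by blast
  then have "star L (star L R \<otimes>\<^bsub>L\<^esub> star L T) \<in> K" by (rule K_star)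
  then show ?thesis using RD T Kc[OF T] by (simp add: L.star_mult L.star_star L.star_closed)
qed

end

section \<open>Kernels, and relations in the Toeplitz algebra\<close>

lemma (in unital_cstar_algebra) closed_idealI:
  assumes "I \<subseteq> carrier A" "\<zero> \<in> I" "\<And>x y. x \<in> I \<Longrightarrow> y \<in> I \<Longrightarrow> x \<oplus> y \<in> I"
    and mult: "\<And>x a. x \<in> I \<Longrightarrow> a \<in> carrier A \<Longrightarrow> a \<otimes> x \<in> I" "\<And>x a. x \<in> I \<Longrightarrow> a \<in> carrier A \<Longrightarrow> x \<otimes> a \<in> I"
    and "nrm_closed A I"
  shows "closed_ideal A I"
proof -
  have "\<ominus> x \<in> I" if x: "x \<in> I" for x
  proof -
    have xc: "x \<in> carrier A" using x assms(1) by blast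
    have "\<ominus> \<one> \<otimes> x = \<ominus> x" using xc by algebra
    then show ?thesis using mult(1)[OF x, of "\<ominus> \<one>"] by simp
  qed
  then have "subgroup I (add_monoid A)" using assms(1-3) by (intro add.subgroupI) auto
  then have "ideal I A" using mult by (intro idealI local.ring_axioms) auto
  then show ?thesis using assms(6) by (simp add: closed_ideal_def)
qed

lemma (in cstar_hom) kernel_closed_ideal: "closed_ideal A {a \<in> carrier A. f a = \<zero>\<^bsub>B\<^esub>}"
proof (rule A.closed_idealI)
  show "nrm_closed A {a \<in> carrier A. f a = \<zero>\<^bsub>B\<^esub>}"
    unfolding nrm_closed_def
  proof (intro allI impI, elim conjE)
    fix s l assume s: "\<forall>n. s n \<in> {a \<in> carrier A. f a = \<zero>\<^bsub>B\<^esub>}" and l: "nrm_lim A s l"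
    then have sc: "s n \<in> carrier A" for n by blast
    have "nrm_lim B (\<lambda>n. \<zero>\<^bsub>B\<^esub>) (f l)" using s lim[OF l sc] by simp
    then show "l \<in> {a \<in> carrier A. f a = \<zero>\<^bsub>B\<^esub>}"
      using B.nrm_lim_unique[OF _ B.nrm_lim_const[of "\<zero>\<^bsub>B\<^esub>"]] A.nrm_limD(1)[OF l] by simp
  qed
qed (auto simp: zero add mult closed)

context dyn_system
begin

lemma TA_closed:
  assumes "T \<in> carrier TA" "R \<in> carrier TA"
  shows "T \<oplus>\<^bsub>L\<^esub> R \<in> carrier TA" "T \<otimes>\<^bsub>L\<^esub> R \<in> carrier TA" "T \<ominus>\<^bsub>L\<^esub> R \<in> carrier TA"
proof -
  interpret TA: unital_cstar_algebra TA by (rule TA_cstar)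
  show "T \<oplus>\<^bsub>L\<^esub> R \<in> carrier TA" "T \<otimes>\<^bsub>L\<^esub> R \<in> carrier TA"
    using TA.a_closed[OF assms] TA.m_closed[OF assms] by (simp_all add: TA_simps)
  show "T \<ominus>\<^bsub>L\<^esub> R \<in> carrier TA" using TA.minus_closed[OF assms] TA_minus[OF assms] by simp
qed

lemma P0_TA: "fock_P0 A E \<in> carrier TA"
  using TA_closed one_TA S_TA Sd_TA by (simp add: P0_eq)

lemma Sd_S_Sd: "Sd \<otimes>\<^bsub>L\<^esub> S \<otimes>\<^bsub>L\<^esub> Sd = Sd"
proof (rule op_coI)
  fix v n assume v: "v \<in> carrier F"
  have SSd: "S \<otimes>\<^bsub>L\<^esub> Sd \<in> carrier L" using S_closed Sd_closed by simp
  show "co ((Sd \<otimes>\<^bsub>L\<^esub> S \<otimes>\<^bsub>L\<^esub> Sd) v) n = co (Sd v) n"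
    using v S_Sd_app[OF v, of "Suc n"] Sd_app F.op_closed[OF SSd v]
    by (simp add: L.m_assoc[OF Sd_closed S_closed Sd_closed] F.L_app)
qed (use S_closed Sd_closed in auto)

lemma ent_phi_P0: "a \<in> carrier A \<Longrightarrow> ent (\<phi> a \<otimes>\<^bsub>L\<^esub> fock_P0 A E) i j = (if i = 0 \<and> j = 0 then a else \<zero>)"
  using ent_left(1)[OF TA_carrier[OF P0_TA]] dn_closed[of a i]
  by (auto simp: ent_def P0_app ket_closed co_ket)

end

section \<open>The relative ideal and the quotient by it\<close>

context cuntz_pimsner_algebra
begin

abbreviation RI :: "('a, 'a) fock_op set" where "RI \<equiv> rel_ideal A J E"

lemma rel_gens: "{\<phi> a \<otimes>\<^bsub>TA\<^esub> fock_P0 A E | a. a \<in> J} \<subseteq> carrier TA"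
  using TA_closed(2)[OF phi_TA P0_TA] J.Icarr by (auto simp: TA_simps)

lemma RI_least:
  assumes "closed_ideal TA I" "\<And>a. a \<in> J \<Longrightarrow> \<phi> a \<otimes>\<^bsub>L\<^esub> fock_P0 A E \<in> I"
  shows "RI \<subseteq> I"
  using assms unfolding rel_ideal_def closed_ideal_gen_def by (auto simp: TA_simps)

end

sublocale cuntz_pimsner_algebra \<subseteq> T: cstar_ideal TA RI
  unfolding cstar_ideal_def cstar_ideal_axioms_def rel_ideal_def
  using TA_cstar unital_cstar_algebra.closed_ideal_closed_ideal_gen[OF TA_cstar rel_gens] by blast

context cuntz_pimsner_algebra
begin

abbreviation CP :: "('a, 'a) fock_op set cstar_algebra" where "CP \<equiv> cuntz_pimsner A J E"

abbreviation uCP :: "('a, 'a) fock_op set" where "uCP \<equiv> T.coset Sd"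

abbreviation kA :: "'a \<Rightarrow> ('a, 'a) fock_op set" where "kA \<equiv> cp_kA A J E"

lemma CP_eq: "T.Q = CP" and kA_eq: "kA a = T.coset (\<phi> a)"
  by (simp_all add: cuntz_pimsner_def cp_kA_def)

lemma star_kE: "star CP (cp_kE A J E (\<delta> \<one>)) = uCP"
  using T.coset_star[OF S_TA] by (simp add: CP_eq cp_kE_def TA_simps star_S)

lemmas coset_simps = T.coset_add[unfolded CP_eq TA_simps] T.coset_mult[unfolded CP_eq TA_simps]
  T.coset_scal[unfolded CP_eq TA_simps] T.coset_star[unfolded CP_eq TA_simps]

lemma RI_gen: "a \<in> J \<Longrightarrow> \<phi> a \<otimes>\<^bsub>L\<^esub> fock_P0 A E \<in> RI"
  unfolding rel_ideal_def closed_ideal_gen_def by (auto simp: TA_simps)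

text \<open>A generator has a single nonzero entry at most, namely \<open>a\<close> at (0,0); the
  ideal property is \<open>K_multiplier\<close>.\<close>

lemma RI_le_K: "RI \<subseteq> K"
proof -
  have "closed_ideal TA (K \<inter> carrier TA)"
  proof (rule T.closed_idealI)
    have "\<zero>\<^bsub>L\<^esub> \<in> K"
    proof (rule KI)
      have "ent \<zero>\<^bsub>L\<^esub> i j = \<zero>" for i j
        using ent_scal[OF S_closed, of 0 i j] ent_closed[OF S_closed]
        by (simp add: L.scal_zero_left[OF S_closed] scal_zero_left)
      then show "ent \<zero>\<^bsub>L\<^esub> i j \<in> J" "e > 0 \<Longrightarrow> \<exists>N. \<forall>i j. N \<le> i \<longrightarrow> i \<le> j + d \<longrightarrow> j \<le> i + d \<longrightarrow> nrm A (ent \<zero>\<^bsub>L\<^esub> i j) < e"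
        for i j d e by simp_all
    qed simp
    then show "\<zero>\<^bsub>TA\<^esub> \<in> K \<inter> carrier TA" using T.zero_closed by (simp add: TA_simps)
    show "nrm_closed TA (K \<inter> carrier TA)"
      unfolding nrm_closed_def
    proof (intro allI impI, elim conjE)
      fix s l assume s: "\<forall>n. s n \<in> K \<inter> carrier TA" and l: "nrm_lim TA s l"
      have "nrm_lim L s l \<and> l \<in> carrier TA" using TA_lim[of s l] l s by blast
      then show "l \<in> K \<inter> carrier TA" using L.nrm_closedD[OF K_closed, of s l] s by blast
    qed
  qed (use K_add TA_closed K_multiplier in \<open>auto simp: TA_simps\<close>)
  moreover have "\<phi> a \<otimes>\<^bsub>L\<^esub> fock_P0 A E \<in> K \<inter> carrier TA" if a: "a \<in> J" for a
  proof -
    note ac = J.Icarr[OF a]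
    have "\<phi> a \<otimes>\<^bsub>L\<^esub> fock_P0 A E \<in> K"
    proof (rule KI)
      fix d :: nat and e :: real assume "e > 0"
      then show "\<exists>N. \<forall>i j. N \<le> i \<longrightarrow> i \<le> j + d \<longrightarrow> j \<le> i + d \<longrightarrow> nrm A (ent (\<phi> a \<otimes>\<^bsub>L\<^esub> fock_P0 A E) i j) < e"
        by (intro exI[of _ 1]) (simp add: ent_phi_P0[OF ac])
    qed (use a in \<open>simp_all add: ent_phi_P0[OF ac] TA_carrier[OF TA_closed(2)[OF phi_TA[OF ac] P0_TA]]\<close>)
    then show ?thesis using TA_closed(2)[OF phi_TA[OF ac] P0_TA] by blast
  qed
  ultimately have "RI \<subseteq> K \<inter> carrier TA" by (rule RI_least)
  then show ?thesis by blast
qed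

lemma nrm_delta_J: "a \<in> J \<Longrightarrow> nrm A (\<delta> a) = nrm A a"
proof -
  interpret d: cstar_hom A A \<delta> by unfold_locales (rule delta_hom)
  have "a = \<zero>" if "a \<in> J" "\<delta> a = \<zero>" for a using J_ker that J.Icarr by blast
  then show "a \<in> J \<Longrightarrow> nrm A (\<delta> a) = nrm A a" by (rule d.nrm_eq_if_inj_on_ideal[OF J_ideal])
qed

text \<open>The diagonal entries of \<open>\<phi> c\<close> are the \<delta>^n(c). Membership in
  \<open>K\<close> puts them all into J, where \<delta> preserves norms, and makes them tend to
  0.\<close>

lemma phi_RI_zero:
  assumes c: "c \<in> carrier A" and "\<phi> c \<in> RI"
  shows "c = \<zero>"
proof -
  have K: "\<phi> c \<in> K" using assms(2) RI_le_K by blast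
  have J: "(\<delta> ^^ n) c \<in> J" for n using KD(2)[OF K, of n n] c by (simp add: ent_phi)
  have n: "nrm A ((\<delta> ^^ n) c) = nrm A c" for n
  proof (induction n)
    case (Suc n)
    then show ?case using nrm_delta_J[OF J[of n]] by simp
  qed simp
  have "nrm A c \<le> 0"
  proof (rule ccontr)
    assume "\<not> nrm A c \<le> 0"
    then obtain N where "\<forall>i j. N \<le> i \<longrightarrow> i \<le> j + 0 \<longrightarrow> j \<le> i + 0 \<longrightarrow> nrm A (ent (\<phi> c) i j) < nrm A c"
      using KD(3)[OF K, of "nrm A c" 0] by auto
    then have "nrm A (ent (\<phi> c) N N) < nrm A c" by simp
    then show False using c n by (simp add: ent_phi)
  qed
  then show ?thesis using nrm_eq_zero[OF c] nrm_nonneg[OF c] by simp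
qed

lemma inj_kA: "inj_on kA (carrier A)"
proof (rule inj_onI)
  fix a b assume a: "a \<in> carrier A" and b: "b \<in> carrier A" and eq: "kA a = kA b"
  have "\<phi> (a \<ominus> b) = \<phi> a \<ominus>\<^bsub>L\<^esub> \<phi> b"
    using a b phi_add[of a "scal A (- 1) b"] phi_closed[OF b]
    by (simp add: minus_eq L.minus_eq phi_scal scal_closed flip: scal_minus_one L.scal_minus_one)
  moreover have "\<phi> a \<ominus>\<^bsub>L\<^esub> \<phi> b \<in> RI"
    using T.coset_eq_iff[OF phi_TA[OF a] phi_TA[OF b]] eq TA_minus[OF phi_TA[OF a] phi_TA[OF b]] by (simp add: kA_eq)
  ultimately have "a \<ominus> b = \<zero>" using phi_RI_zero[of "a \<ominus> b"] a b by simp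
  then show "a = b" using a b diff_eq_zeroD by blast
qed

text \<open>Translates the condition that defines the associated ideal into one on the generators of
  the relative ideal.\<close>

lemma phi_minus_S_Sd: "a \<in> carrier A \<Longrightarrow> \<phi> a \<ominus>\<^bsub>L\<^esub> S \<otimes>\<^bsub>L\<^esub> Sd \<otimes>\<^bsub>L\<^esub> \<phi> a = \<phi> a \<otimes>\<^bsub>L\<^esub> fock_P0 A E"
proof -
  assume a: "a \<in> carrier A"
  note cl = phi_closed[OF a] S_closed Sd_closed L.m_closed[OF S_closed Sd_closed]
  have "\<phi> a \<otimes>\<^bsub>L\<^esub> (\<one>\<^bsub>L\<^esub> \<ominus>\<^bsub>L\<^esub> S \<otimes>\<^bsub>L\<^esub> Sd) = \<phi> a \<ominus>\<^bsub>L\<^esub> \<phi> a \<otimes>\<^bsub>L\<^esub> (S \<otimes>\<^bsub>L\<^esub> Sd)"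
    using cl by (simp add: L.minus_eq L.r_distr L.r_minus)
  then show ?thesis using S_Sd_phi[OF a] by (simp add: P0_eq)
qed

lemma kA_closed: "a \<in> carrier A \<Longrightarrow> kA a \<in> carrier CP"
  and uCP_closed: "uCP \<in> carrier CP"
  using T.coset_closed[OF phi_TA] T.coset_closed[OF Sd_TA] by (simp_all add: CP_eq kA_eq)

lemma star_uCP: "star CP uCP = T.coset S"
  by (simp add: coset_simps Sd_TA star_Sd)

lemma covariant_CP: "covariant_rep A \<delta> CP kA uCP"
  unfolding covariant_rep_def
proof (intro conjI ballI)
  show "unital_cstar_algebra CP" using T.quotient_cstar by (simp add: CP_eq)
  show "kA \<one> = \<one>\<^bsub>CP\<^esub>" using T.Q_simps(2) by (simp add: CP_eq kA_eq phi_one TA_simps)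
  show "star_hom A CP kA"
    unfolding star_hom_def
    by (auto simp: kA_closed) (auto simp: kA_eq coset_simps phi_TA phi_add phi_mult phi_scal star_phi)
  fix a assume a: "a \<in> carrier A"
  note c = a phi_TA S_TA Sd_TA TA_closed
  show "uCP \<otimes>\<^bsub>CP\<^esub> kA a \<otimes>\<^bsub>CP\<^esub> star CP uCP = kA (\<delta> a)"
    by (simp add: c star_uCP kA_eq coset_simps S_phi_S)
  show "star CP uCP \<otimes>\<^bsub>CP\<^esub> uCP \<otimes>\<^bsub>CP\<^esub> kA a = kA a \<otimes>\<^bsub>CP\<^esub> (star CP uCP \<otimes>\<^bsub>CP\<^esub> uCP)"
    by (simp add: c star_uCP kA_eq coset_simps S_Sd_phi)
qed (rule uCP_closed)

lemma associated_ideal_CP: "associated_ideal A CP kA uCP = J"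
proof -
  have "star CP uCP \<otimes>\<^bsub>CP\<^esub> uCP \<otimes>\<^bsub>CP\<^esub> kA a = kA a \<longleftrightarrow> a \<in> J" if a: "a \<in> carrier A" for a
  proof -
    note c = phi_TA[OF a] S_TA Sd_TA TA_closed
    have "star CP uCP \<otimes>\<^bsub>CP\<^esub> uCP \<otimes>\<^bsub>CP\<^esub> kA a = kA a \<longleftrightarrow> kA a = T.coset (S \<otimes>\<^bsub>L\<^esub> Sd \<otimes>\<^bsub>L\<^esub> \<phi> a)"
      by (auto simp: c star_uCP kA_eq coset_simps)
    also have "\<dots> \<longleftrightarrow> \<phi> a \<ominus>\<^bsub>TA\<^esub> S \<otimes>\<^bsub>L\<^esub> Sd \<otimes>\<^bsub>L\<^esub> \<phi> a \<in> RI"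
      unfolding kA_eq by (intro T.coset_eq_iff) (simp_all add: c)
    also have "\<dots> \<longleftrightarrow> \<phi> a \<otimes>\<^bsub>L\<^esub> fock_P0 A E \<in> RI" by (simp add: TA_minus c phi_minus_S_Sd a)
    also have "\<dots> \<longleftrightarrow> a \<in> J"
    proof
      assume "\<phi> a \<otimes>\<^bsub>L\<^esub> fock_P0 A E \<in> RI"
      then have "ent (\<phi> a \<otimes>\<^bsub>L\<^esub> fock_P0 A E) 0 0 \<in> J" using RI_le_K KD(2) by blast
      then show "a \<in> J" by (simp add: ent_phi_P0[OF a])
    qed (rule RI_gen)
    finally show ?thesis .
  qed
  then show ?thesis unfolding associated_ideal_def using J.Icarr by blast
qed

text \<open>The preimage of the generated subalgebra in the Toeplitz algebra is closed and contains
  the generators: \<open>S\<close> because its coset is the adjoint of \<open>uCP\<close>.\<close>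

lemma gen_CP: "cstar_gen CP (kA ` carrier A \<union> {uCP}) = carrier CP"
proof -
  interpret CP: unital_cstar_algebra CP using covariant_CP by (simp add: covariant_rep_def)
  interpret h: cstar_hom TA CP T.coset
    using T.coset_hom by (simp add: CP_eq unital_cstar_hom_def)
  let ?G = "cstar_gen CP (kA ` carrier A \<union> {uCP})"
  let ?D = "{T \<in> carrier TA. T.coset T \<in> ?G}"
  have G: "cstar_subalgebra CP ?G" using kA_closed uCP_closed by (intro CP.cstar_gen_subalgebra) auto
  note GD = CP.cstar_subalgebraD[OF G]
  note sup = CP.cstar_gen_superset[of "kA ` carrier A \<union> {uCP}", THEN subsetD]
  have gen: "kA a \<in> ?G" "uCP \<in> ?G" if "a \<in> carrier A" for a
    by (rule sup, simp add: that)+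
  have "cstar_subalgebra L ?D"
    unfolding cstar_subalgebra_def
  proof (intro conjI ballI allI)
    show "?D \<subseteq> carrier L" using TA_carrier by blast
    show "\<zero>\<^bsub>L\<^esub> \<in> ?D" using GD(2) T.zero_closed h.zero by (simp add: TA_simps)
    fix R assume R: "R \<in> ?D"
    show "star L R \<in> ?D" using R GD(5) h.star[of R] T.star_closed[of R] by (simp add: TA_simps)
    show "scal L c R \<in> ?D" for c using R GD(6) h.scal[of R c] T.scal_closed[of R c] by (simp add: TA_simps)
    fix T assume T: "T \<in> ?D"
    show "R \<oplus>\<^bsub>L\<^esub> T \<in> ?D" using R T GD(3) h.add[of R T] TA_closed[of R T] by (simp add: TA_simps)
    show "R \<otimes>\<^bsub>L\<^esub> T \<in> ?D" using R T GD(4) h.mult[of R T] TA_closed[of R T] by (simp add: TA_simps)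
  next
    show "nrm_closed L ?D"
      unfolding nrm_closed_def
    proof (intro allI impI, elim conjE)
      fix s l assume s: "\<forall>n. s n \<in> ?D" and l: "nrm_lim L s l"
      have sc: "s n \<in> carrier TA" for n using s by blast
      have lc: "l \<in> carrier TA"
        using L.nrm_closedD[OF L.cstar_subalgebraD(7)[OF TA_subalgebra], of s l] sc l by blast
      then have "nrm_lim TA s l" using TA_lim[of s l] sc l by simp
      then have "nrm_lim CP (\<lambda>n. T.coset (s n)) (T.coset l)" by (rule h.lim[OF _ sc])
      then have "T.coset l \<in> ?G" using CP.nrm_closedD[OF GD(7), of "\<lambda>n. T.coset (s n)"] s by blast
      then show "l \<in> ?D" using lc by blast
    qed
  qed
  moreover have "S \<in> ?D" using GD(5)[OF gen(2)[OF one_closed]] S_TA by (simp add: star_uCP)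
  ultimately have "carrier TA \<subseteq> ?D" using phi_TA gen(1) by (intro TA_least) (auto simp flip: kA_eq)
  then have "carrier CP \<subseteq> ?G" using T.Q_simps(5) by (auto simp: CP_eq)
  then show ?thesis using GD(1) by blast
qed

text \<open>The target has an arbitrary type, so it may also be a crossed product whose own
  universal property is tested on the type of the quotient only.\<close>

theorem CP_universal:
  assumes cov: "covariant_rep A \<delta> B \<pi> U" and J: "J \<subseteq> associated_ideal A B \<pi> U"
  obtains \<Psi> where "star_hom CP B \<Psi>" "\<And>a. a \<in> carrier A \<Longrightarrow> \<Psi> (kA a) = \<pi> a" "\<Psi> uCP = U"
proof -
  interpret B: unital_cstar_algebra B using cov by (simp add: covariant_rep_def)
  interpret c: covariant A \<delta> B \<pi> U by unfold_locales (rule cov)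
  obtain \<Psi> where \<Psi>: "star_hom TA B \<Psi>" "\<And>a. a \<in> carrier A \<Longrightarrow> \<Psi> (\<phi> a) = \<pi> a" "\<Psi> Sd = U"
    by (rule c.toeplitz_universal) auto
  interpret h: cstar_hom TA B \<Psi> by unfold_locales (rule \<Psi>)
  have S: "\<Psi> S = star B U" using h.star[OF Sd_TA] \<Psi>(3) by (simp add: TA_simps star_Sd)
  have "\<Psi> (\<phi> a \<otimes>\<^bsub>L\<^esub> fock_P0 A E) = \<zero>\<^bsub>B\<^esub>" if a: "a \<in> J" for a
  proof -
    note ac = J.Icarr[OF a]
    note cl = phi_TA[OF ac] TA_closed(2)[OF S_TA Sd_TA] TA_closed(2)[OF TA_closed(2)[OF S_TA Sd_TA] phi_TA[OF ac]]
    have "\<Psi> (\<phi> a \<ominus>\<^bsub>TA\<^esub> S \<otimes>\<^bsub>L\<^esub> Sd \<otimes>\<^bsub>L\<^esub> \<phi> a) = \<pi> a \<ominus>\<^bsub>B\<^esub> star B U \<otimes>\<^bsub>B\<^esub> U \<otimes>\<^bsub>B\<^esub> \<pi> a"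
      using h.diff[OF cl(1,3)] h.mult[OF cl(2,1)] h.mult[OF S_TA Sd_TA] \<Psi>(2)[OF ac] \<Psi>(3) S
      by (simp add: TA_simps)
    also have "\<dots> = \<zero>\<^bsub>B\<^esub>"
      using a J c.p.closed[OF ac] by (auto simp: associated_ideal_def B.minus_eq B.r_neg)
    finally show ?thesis using TA_minus[OF cl(1,3)] phi_minus_S_Sd[OF ac] by simp
  qed
  then have ker: "RI \<subseteq> {T \<in> carrier TA. \<Psi> T = \<zero>\<^bsub>B\<^esub>}"
    using TA_closed(2)[OF phi_TA P0_TA] J.Icarr by (intro RI_least h.kernel_closed_ideal) auto
  obtain g where "star_hom T.Q B g" "\<And>T. T \<in> carrier TA \<Longrightarrow> g (T.coset T) = \<Psi> T"
    by (rule T.factor_hom[OF B.unital_cstar_algebra_axioms \<Psi>(1)]) (use ker in auto)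
  then show thesis using that[of g] \<Psi> phi_TA Sd_TA by (simp add: CP_eq kA_eq)
qed

theorem crossed_product_CP: "crossed_product TYPE('b) A \<delta> J CP kA uCP"
  unfolding crossed_product_def
proof (intro conjI allI impI covariant_CP inj_kA associated_ideal_CP gen_CP)
  show "uCP \<otimes>\<^bsub>CP\<^esub> star CP uCP \<otimes>\<^bsub>CP\<^esub> uCP = uCP"
    by (simp add: star_uCP coset_simps S_TA Sd_TA TA_closed Sd_S_Sd)
  fix B :: "'b cstar_algebra" and \<pi> U
  assume B: "covariant_rep A \<delta> B \<pi> U \<and> associated_ideal A B \<pi> U = J"
  obtain \<Psi> where "star_hom CP B \<Psi>" "\<And>a. a \<in> carrier A \<Longrightarrow> \<Psi> (kA a) = \<pi> a" "\<Psi> uCP = U"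
    by (rule CP_universal[of B \<pi> U]) (use B in simp_all)
  then show "\<exists>\<Psi>. star_hom CP B \<Psi> \<and> (\<forall>a\<in>carrier A. \<Psi> (kA a) = \<pi> a) \<and> \<Psi> uCP = U" by auto
qed

end

section \<open>The isomorphism\<close>

text \<open>Both composites agree with the identity on generators, hence everywhere by
  \<open>eq_on_gen\<close>.\<close>

lemma star_iso_if_inverse_on_gen:
  assumes A: "unital_cstar_algebra A" and B: "unital_cstar_algebra B"
    and f: "star_hom A B f" and g: "star_hom B A g"
    and G: "G \<subseteq> carrier A" "cstar_gen A G = carrier A" "\<And>a. a \<in> G \<Longrightarrow> g (f a) = a"
    and H: "H \<subseteq> carrier B" "cstar_gen B H = carrier B" "\<And>b. b \<in> H \<Longrightarrow> f (g b) = b"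
  shows "star_iso A B f"
proof -
  interpret f: cstar_hom A B f using A B f by (simp add: cstar_hom_def cstar_hom_axioms_def)
  interpret g: cstar_hom B A g using A B g by (simp add: cstar_hom_def cstar_hom_axioms_def)
  interpret ia: cstar_hom A A "\<lambda>a. a" by unfold_locales (simp add: star_hom_def)
  interpret ib: cstar_hom B B "\<lambda>b. b" by unfold_locales (simp add: star_hom_def)
  have gf: "star_hom A A (\<lambda>a. g (f a))"
    by (auto simp: star_hom_def f.closed g.closed f.add g.add f.mult g.mult f.scal g.scal f.star g.star)
  have fg: "star_hom B B (\<lambda>b. f (g b))"
    by (auto simp: star_hom_def f.closed g.closed f.add g.add f.mult g.mult f.scal g.scal f.star g.star)
  have 1: "g (f a) = a" if "a \<in> carrier A" for a
    using ia.eq_on_gen[OF gf, of G a] G that by simp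
  have 2: "f (g b) = b" if "b \<in> carrier B" for b
    using ib.eq_on_gen[OF fg, of H b] H that by simp
  have "bij_betw f (carrier A) (carrier B)"
    using 1 2 f.closed g.closed by (intro bij_betw_byWitness[where f' = g]) auto
  then show ?thesis using f by (simp add: star_iso_def)
qed

text \<open>Existence is claimed for any test type, while the isomorphism asks for the universal
  property on the type of the quotient; the first half keeps the second from being vacuous.\<close>

theorem corollary3p5:
  fixes A :: "'a cstar_algebra" and \<delta> :: "'a \<Rightarrow> 'a" and J :: "'a set"
    and E :: "('a, 'a) hilbert_bimodule"
  assumes "unital_cstar_algebra A"
    and "star_hom A A \<delta>"
    and "E = dyn_bimodule A \<delta>"
    and "closed_ideal A J"
    and "{a \<in> carrier A. \<delta> a = \<zero>\<^bsub>A\<^esub>} \<inter> J = {\<zero>\<^bsub>A\<^esub>}"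
  shows "(\<exists>(C :: ('a, 'a) fock_op set cstar_algebra) \<iota> u. crossed_product TYPE('b) A \<delta> J C \<iota> u) \<and>
    (\<forall>(C :: 'c cstar_algebra) \<iota> u.
       crossed_product TYPE(('a, 'a) fock_op set) A \<delta> J C \<iota> u \<longrightarrow>
       (\<exists>\<Phi>. star_iso (cuntz_pimsner A J E) C \<Phi> \<and>
          (\<forall>a\<in>carrier A. \<Phi> (cp_kA A J E a) = \<iota> a) \<and>
          \<Phi> (star (cuntz_pimsner A J E) (cp_kE A J E (\<delta> \<one>\<^bsub>A\<^esub>))) = u))"
proof -
  interpret cuntz_pimsner_algebra A \<delta> J
    using assms(1,2,4,5)
    by (simp add: cuntz_pimsner_algebra_def cuntz_pimsner_algebra_axioms_def dyn_system_def dyn_system_axioms_def)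
  show ?thesis
    unfolding assms(3) star_kE
  proof (intro conjI allI impI)
    show "\<exists>(C :: ('a, 'a) fock_op set cstar_algebra) \<iota> u. crossed_product TYPE('b) A \<delta> J C \<iota> u"
      using crossed_product_CP by blast
    fix C :: "'c cstar_algebra" and \<iota> u
    assume "crossed_product TYPE(('a, 'a) fock_op set) A \<delta> J C \<iota> u"
    then have C: "covariant_rep A \<delta> C \<iota> u" "associated_ideal A C \<iota> u = J"
      "cstar_gen C (\<iota> ` carrier A \<union> {u}) = carrier C"
      and univ: "\<exists>\<Psi>. star_hom C CP \<Psi> \<and> (\<forall>a\<in>carrier A. \<Psi> (\<iota> a) = kA a) \<and> \<Psi> u = uCP"
      using covariant_CP associated_ideal_CP by (simp_all add: crossed_product_def)
    obtain \<Psi> where \<Psi>: "star_hom C CP \<Psi>" "\<And>a. a \<in> carrier A \<Longrightarrow> \<Psi> (\<iota> a) = kA a" "\<Psi> u = uCP"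
      using univ by blast
    obtain \<Phi> where \<Phi>: "star_hom CP C \<Phi>" "\<And>a. a \<in> carrier A \<Longrightarrow> \<Phi> (kA a) = \<iota> a" "\<Phi> uCP = u"
      by (rule CP_universal[OF C(1)]) (use C(2) in simp_all)
    have "star_iso CP C \<Phi>"
    proof (rule star_iso_if_inverse_on_gen[OF _ _ \<Phi>(1) \<Psi>(1) _ gen_CP _ _ C(3)])
      show "unital_cstar_algebra CP" "unital_cstar_algebra C"
        using C(1) covariant_CP by (simp_all add: covariant_rep_def)
      show "kA ` carrier A \<union> {uCP} \<subseteq> carrier CP" using kA_closed uCP_closed by blast
      show "\<iota> ` carrier A \<union> {u} \<subseteq> carrier C" using C(1) by (auto simp: covariant_rep_def star_hom_def)
    qed (use \<Phi> \<Psi> in auto)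
    then show "\<exists>\<Phi>. star_iso CP C \<Phi> \<and> (\<forall>a\<in>carrier A. \<Phi> (kA a) = \<iota> a) \<and> \<Phi> uCP = u"
      using \<Phi> by blast
  qed
qed

end
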